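(* Let $\mathfrak g$ be of affine type $G^{(1)}_2$ with Cartan matrix $A=(a_{ij})_{i,j\in I}$, $I=\{0,1,2\}$, and let $\mathcal V_1=\{v_1(x)\mid x\in(\mathbb C^\times)^6\}\subset W(\varpi_1)$ be as in the context. Define rational maps $e_i:\mathbb C^\times\times\mathcal V_1\to\mathcal V_1$, $(c,v)\mapsto e_i^c(v)$, and rational functions $\gamma_i,\varepsilon_i$ on $\mathcal V_1$ ($i=0,1,2$) as follows. For $i=1,2$: $$e_1^c(v_1(x))=v_1(x_0,\mathcal C_1x_1,x_2,\mathcal C_3x_3,x_4,\mathcal C_5x_5),\qquad e_2^c(v_1(x))=v_1(x_0,x_1,\mathcal C_2x_2,x_3,\mathcal C_4x_4,x_5),$$ where $$\mathcal C_1=\frac{\frac{c x_0}{x_1}+\frac{x_0x_2^3}{x_1^2x_3}+\frac{x_0x_2^3x_4^3}{x_1^2x_3^2x_5}}{\frac{x_0}{x_1}+\frac{x_0x_2^3}{x_1^2x_3}+\frac{x_0x_2^3x_4^3}{x_1^2x_3^2x_5}},\quad \mathcal C_3=\frac{\frac{c x_0}{x_1}+\frac{c x_0x_2^3}{x_1^2x_3}+\frac{x_0x_2^3x_4^3}{x_1^2x_3^2x_5}}{\frac{c x_0}{x_1}+\frac{x_0x_2^3}{x_1^2x_3}+\frac{x_0x_2^3x_4^3}{x_1^2x_3^2x_5}},\quad \mathcal C_5=\frac{c\left(\frac{x_0}{x_1}+\frac{x_0x_2^3}{x_1^2x_3}+\frac{x_0x_2^3x_4^3}{x_1^2x_3^2x_5}\right)}{\frac{c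 x_0}{x_1}+\frac{c x_0x_2^3}{x_1^2x_3}+\frac{x_0x_2^3x_4^3}{x_1^2x_3^2x_5}},$$ $$\mathcal C_2=\frac{\frac{c x_1}{x_2}+\frac{x_1x_3}{x_2^2x_4}}{\frac{x_1}{x_2}+\frac{x_1x_3}{x_2^2x_4}},\qquad \mathcal C_4=\frac{c\left(\frac{x_1}{x_2}+\frac{x_1x_3}{x_2^2x_4}\right)}{\frac{c x_1}{x_2}+\frac{x_1x_3}{x_2^2x_4}},$$ $$\varepsilon_1(v_1(x))=\frac{x_0}{x_1}+\frac{x_0x_2^3}{x_1^2x_3}+\frac{x_0x_2^3x_4^3}{x_1^2x_3^2x_5},\qquad \varepsilon_2(v_1(x))=\frac{x_1}{x_2}+\frac{x_1x_3}{x_2^2x_4},$$ $$\gamma_1(v_1(x))=\frac{x_1^2x_3^2x_5^2}{x_0x_2^3x_4^3},\qquad \gamma_2(v_1(x))=\frac{x_2^2x_4^2}{x_1x_3x_5}.$$ For $i=0$: $e_0^c:=\overline\sigma^{-1}\circ e_0^c\circ\overline\sigma$, $\gamma_0:=\gamma_0\circ\overline\sigma$, $\varepsilon_0:=\varepsilon_0\circ\overline\sigma$, where $\overline\sigma:\mathcal V_1\to\mathcal V_2$ is the birational isomorphism and $e_0^c,\gamma_0,\varepsilon_0$ on the right-hand sides are the structures on $\mathcal V_2$ given in the context. Then $\chi=(\mathcal V_1,\{e_i\}_{i\in I},\{\gamma_i\}_{i\in I},\{\varepsilon_i\}_{i\in I})$ is a $\mathfrak g$-geometric crystal, and the parametrization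 $(\mathbb C^\times)^6\to\mathcal V_1$, $x\mapsto v_1(x)$, is a positive structure on it. Moreover $e_0^c$, $\varepsilon_0$, $\gamma_0$ are given explicitly by $$e_0^c(v_1(x))=v_1\Big(\frac{D}{cE}x_0,\ \frac{F}{cE}x_1,\ \frac{G}{cE}x_2,\ \frac{DH}{c^2EF}x_3,\ \frac{D}{cG}x_4,\ \frac{D}{cH}x_5\Big),$$ $$\varepsilon_0(v_1(x))=\frac{E}{x_0^3x_2^3x_3},\qquad \gamma_0(v_1(x))=\frac{x_0^2}{x_1x_3x_5},$$ where \begin{align*} D&=c^2x_0^2x_2^3x_3+x_1x_2^3x_3^2x_5+c\,x_0\big(x_1x_3^3+3x_1x_2x_3^2x_4+3x_1x_2^2x_3x_4^2+x_2^3(x_3^2+x_1x_4^3+x_1x_3x_5)\big),\\ E&=x_0^2x_2^3x_3+x_1x_2^3x_3^2x_5+x_0\big(x_1x_3^3+3x_1x_2x_3^2x_4+3x_1x_2^2x_3x_4^2+x_2^3(x_3^2+x_1x_4^3+x_1x_3x_5)\big),\\ F&=c\,x_0^2x_2^3x_3+x_1x_2^3x_3^2x_5+x_0\big(c\,x_1x_3^3+3c\,x_1x_2x_3^2x_4+3c\,x_1x_2^2x_3x_4^2+x_2^3(x_3^2+c\,x_1x_4^3+c\,x_1x_3x_5)\big),\\ G&=c\,x_0^2x_2^3x_3+x_1x_2^3x_3^2x_5+x_0\big(x_1x_3^3+(2+c)x_1x_2x_3^2x_4+(1+2c)x_1x_2^2x_3x_4^2+x_2^3(x_3^2+c\,x_1x_4^3+c\,x_1x_3x_5)\big),\\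 H&=c\,x_0^2x_2^3x_3+x_1x_2^3x_3^2x_5+x_0\big(x_1x_3^3+3x_1x_2x_3^2x_4+3x_1x_2^2x_3x_4^2+x_2^3(x_3^2+x_1x_4^3+c\,x_1x_3x_5)\big). \end{align*}
   Context: **Cartan matrix.** Type $G^{(1)}_2$, $I=\{0,1,2\}$, $a_{ij}=\alpha_j(\alpha_i^\vee)$: $$A=\begin{pmatrix}2&-1&0\\-1&2&-1\\0&-3&2\end{pmatrix}\quad(\text{rows and columns indexed }0,1,2).$$ **Geometric crystal.** A $\mathfrak g$-geometric crystal is a quadruple $(X,\{e_i\},\{\gamma_i\},\{\varepsilon_i\})$, where $X$ is a variety, $e_i:\mathbb C^\times\times X\to X$, $(c,x)\mapsto e_i^c(x)$, are rational $\mathbb C^\times$-actions and $\gamma_i,\varepsilon_i:X\to\mathbb C$ are rational functions, such that (as identities of rational maps/functions) (i) $(\{1\}\times X)\cap \mathrm{dom}(e_i)$ is open dense in $\{1\}\times X$ for all $i$; (ii) $\gamma_j(e_i^c(x))=c^{a_{ij}}\gamma_j(x)$; (iii) the Verma relations hold: $e_i^{c_1}e_j^{c_2}=e_j^{c_2}e_i^{c_1}$ if $a_{ij}=a_{ji}=0$; $e_i^{c_1}e_j^{c_1c_2}e_i^{c_2}=e_j^{c_2}e_i^{c_1c_2}e_j^{c_1}$ if $a_{ij}=a_{ji}=-1$; and $$e_i^{c_1}e_j^{c_1^3c_2}e_i^{c_1^2c_2}e_j^{c_1^3c_2^2}e_i^{c_1c_2}e_j^{c_2}=e_j^{c_2}e_i^{c_1c_2}e_j^{c_1^3c_2^2}e_i^{c_1^2c_2}e_j^{c_1^3c_2}e_i^{c_1}\quad\text{if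 }a_{ij}=-3,\ a_{ji}=-1;$$ (iv) $\varepsilon_i(e_i^c(x))=c^{-1}\varepsilon_i(x)$. **Positivity.** A nonzero rational function on an algebraic torus is positive if it equals $g/h$ with $g,h$ linear combinations of characters with positive coefficients. A rational map $f:T\to T'$ of tori is positive if $\chi\circ f$ is positive for every character $\chi$ of $T'$. A positive structure on a geometric crystal is a birational isomorphism $\theta:T'\to X$ from a torus $T'$ such that all $\gamma_i\circ\theta$, $\varepsilon_i\circ\theta$ are positive and all maps $\mathbb C^\times\times T'\to T'$, $(c,t)\mapsto\theta^{-1}(e_i^c(\theta(t)))$, are positive. **The module $W(\varpi_1)$.** It is the 15-dimensional $\mathfrak g$-module over $\mathbb C$ with basis $[1],\dots,[6],[\bar1],\dots,[\bar6],[0_1],[0_2],\emptyset$. The weights, written as $(\lambda(\alpha_0^\vee),\lambda(\alpha_1^\vee),\lambda(\alpha_2^\vee))$, are: $[1]:(-2,1,0)$, $[2]:(-1,-1,3)$, $[3]:(-1,0,1)$, $[4]:(-1,1,-1)$, $[5]:(0,-1,2)$, $[6]:(-1,2,-3)$; $[\bar i]$ has the negative of the weight of $[i]$; $[0_1],[0_2],\emptyset$ have weight $0$. The nonzero actions of the Chevalley generators $f_i$ on basis vectors are: - $f_0$: $[0_2]\mapsto[1]$, $[\bar6]\mapsto[2]$, $[\bar4]\mapsto[3]$, $[\bar3]\mapsto[4]$, $[\bar2]\mapsto[6]$, $[\bar1]\mapsto\emptyset$, $\emptyset\mapsto2[1]$; - $f_1$: $[1]\mapsto[2]$, $[4]\mapsto[5]$,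 $[6]\mapsto[0_2]$, $[0_1]\mapsto3[\bar6]$, $[0_2]\mapsto2[\bar6]$, $[\bar5]\mapsto[\bar4]$, $[\bar2]\mapsto[\bar1]$, $\emptyset\mapsto[\bar6]$; - $f_2$: $[2]\mapsto[3]$, $[3]\mapsto2[4]$, $[4]\mapsto3[6]$, $[5]\mapsto[0_1]$, $[0_1]\mapsto2[\bar5]$, $[0_2]\mapsto[\bar5]$, $[\bar6]\mapsto[\bar4]$, $[\bar4]\mapsto2[\bar3]$, $[\bar3]\mapsto3[\bar2]$. For $c\in\mathbb C^\times$, $\alpha_i^\vee(c)$ acts on a vector of weight $\lambda$ by $c^{\lambda(\alpha_i^\vee)}$, and $Y_i(c):=\exp(f_i/c)\,\alpha_i^\vee(c)$. **The varieties.** For $x=(x_0,\dots,x_5)$ and $y=(y_0,\dots,y_5)$ in $(\mathbb C^\times)^6$ put $$v_1(x)=Y_0(x_0)Y_1(x_1)Y_2(x_2)Y_1(x_3)Y_2(x_4)Y_1(x_5)[1],\qquad v_2(y)=Y_2(y_2)Y_1(y_1)Y_2(y_4)Y_1(y_3)Y_0(y_0)Y_1(y_5)[\bar2],$$ and $\mathcal V_1=\{v_1(x)\}$, $\mathcal V_2=\{v_2(y)\}\subset W(\varpi_1)$, with coordinates $x$ and $y$ respectively. **The map $\overline\sigma$.** $\overline\sigma:\mathcal V_1\to\mathcal V_2$, $v_1(x)\mapsto v_2(y)$, is the birational isomorphism determined by the condition $v_2(y)=a(x)v_1(x)$ for a (unique) nonzero rational function $a(x)$; such $y=y(x)$ and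 $a(x)$ exist and are unique. **The $0$-structure on $\mathcal V_2$** (inherited from the standard geometric crystal structure on the set of products $Y_2(y_2)Y_1(y_1)Y_2(y_4)Y_1(y_3)Y_0(y_0)Y_1(y_5)$): $$e_0^c(v_2(y_0,y_1,\dots,y_5))=v_2(c\,y_0,y_1,\dots,y_5),\qquad \gamma_0(v_2(y))=\frac{y_0^2}{y_1y_3y_5},\qquad \varepsilon_0(v_2(y))=\frac{y_1y_3}{y_0}.$$ *)

theory Defs
  imports "HOL-Analysis.Analysis"
begin

section \<open>Quasi-affine varieties over the complex numbers and their rational maps\<close>

text \<open>The class supplies the standard linear coordinate functions of the spaces
  \<open>\<complex>\<close>, \<open>\<complex>\<^sup>n\<close> and finite products of these.\<close>

class affine_space =
  fixes coord_funs :: "('a \<Rightarrow> complex) set"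
  assumes finite_coord_funs: "finite coord_funs"
    and coord_funs_separate: "(\<And>\<phi>. \<phi> \<in> coord_funs \<Longrightarrow> \<phi> x = \<phi> y) \<Longrightarrow> x = y"

instantiation complex :: affine_space
begin
definition "coord_funs = {\<lambda>z::complex. z}"
instance by standard (auto simp: coord_funs_complex_def)
end

instantiation prod :: (affine_space, affine_space) affine_space
begin
definition "coord_funs = (\<lambda>\<phi> (p::'a \<times> 'b). \<phi> (fst p)) ` coord_funs
  \<union> (\<lambda>\<phi> (p::'a \<times> 'b). \<phi> (snd p)) ` coord_funs"
instance
proof
  show "finite (coord_funs :: ('a \<times> 'b \<Rightarrow> complex) set)"
    by (simp add: coord_funs_prod_def finite_coord_funs)
next
  fix x y :: "'a \<times> 'b"
  assume *: "\<And>\<phi>. \<phi> \<in> coord_funs \<Longrightarrow> \<phi> x = \<phi> y"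
  have "\<phi> (fst x) = \<phi> (fst y)" if "\<phi> \<in> coord_funs" for \<phi>
    using *[of "\<lambda>p. \<phi> (fst p)"] that unfolding coord_funs_prod_def by blast
  moreover have "\<phi> (snd x) = \<phi> (snd y)" if "\<phi> \<in> coord_funs" for \<phi>
    using *[of "\<lambda>p. \<phi> (snd p)"] that unfolding coord_funs_prod_def by blast
  ultimately show "x = y"
    by (meson coord_funs_separate prod_eqI)
qed
end

instantiation vec :: (affine_space, finite) affine_space
begin
definition "coord_funs = (\<lambda>(\<phi>, i) (v :: ('a, 'b) vec). \<phi> (v $ i)) ` (coord_funs \<times> UNIV)"
instance
proof
  show "finite (coord_funs :: (('a, 'b) vec \<Rightarrow> complex) set)"
    by (simp add: coord_funs_vec_def finite_coord_funs)
next
  fix x y :: "('a, 'b) vec"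
  assume *: "\<And>\<phi>. \<phi> \<in> coord_funs \<Longrightarrow> \<phi> x = \<phi> y"
  have "\<phi> (x $ i) = \<phi> (y $ i)" if "\<phi> \<in> coord_funs" for \<phi> i
    using *[of "\<lambda>v. \<phi> (v $ i)"] that unfolding coord_funs_vec_def by force
  then show "x = y"
    by (meson coord_funs_separate vec_eq_iff)
qed
end

inductive poly_fun :: "('a::affine_space \<Rightarrow> complex) \<Rightarrow> bool" where
  coord: "\<phi> \<in> coord_funs \<Longrightarrow> poly_fun \<phi>"
| const: "poly_fun (\<lambda>_. c)"
| add: "poly_fun f \<Longrightarrow> poly_fun g \<Longrightarrow> poly_fun (\<lambda>x. f x + g x)"
| mult: "poly_fun f \<Longrightarrow> poly_fun g \<Longrightarrow> poly_fun (\<lambda>x. f x * g x)"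

definition zariski :: "'a::affine_space topology" where
  "zariski = topology_generated_by {{x. p x \<noteq> 0} | p. poly_fun p}"

definition dense_open_in :: "'a::affine_space set \<Rightarrow> 'a set \<Rightarrow> bool" where
  "dense_open_in X U \<longleftrightarrow> openin (subtopology zariski X) U
     \<and> subtopology zariski X closure_of U = X"

definition quasi_affine_variety :: "'a::affine_space set \<Rightarrow> bool" where
  "quasi_affine_variety X \<longleftrightarrow>
     (\<exists>U C. openin zariski U \<and> closedin zariski C \<and> X = U \<inter> C) \<and>
     X \<noteq> {} \<and>
     (\<forall>U V. openin (subtopology zariski X) U \<and> openin (subtopology zariski X) V \<and>
        U \<noteq> {} \<and> V \<noteq> {} \<longrightarrow> U \<inter> V \<noteq> {})"

definition regular_fun :: "'a::affine_space set \<Rightarrow> ('a \<Rightarrow> complex) \<Rightarrow> bool" where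
  "regular_fun U f \<longleftrightarrow> (\<forall>p\<in>U. \<exists>V g h. openin (subtopology zariski U) V \<and> p \<in> V \<and>
     poly_fun g \<and> poly_fun h \<and> (\<forall>x\<in>V. h x \<noteq> 0 \<and> f x = g x / h x))"

definition regular_map ::
    "'a::affine_space set \<Rightarrow> 'b::affine_space set \<Rightarrow> ('a \<Rightarrow> 'b) \<Rightarrow> bool" where
  "regular_map U Y f \<longleftrightarrow> f ` U \<subseteq> Y \<and> (\<forall>\<phi>\<in>coord_funs. regular_fun U (\<lambda>x. \<phi> (f x)))"

text \<open>A rational map is represented by a partial function that is regular on a dense open set.
  Two representatives give the same rational map iff \<open>rat_eq\<close> holds. Composition of rational maps
  is \<open>\<circ>\<^sub>m\<close>; since \<open>rat_eq\<close> demands that both sides be defined on a dense open set, an identity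
  between composites also asserts that the composites exist.\<close>

definition rational_map ::
    "'a::affine_space set \<Rightarrow> 'b::affine_space set \<Rightarrow> ('a \<rightharpoonup> 'b) \<Rightarrow> bool" where
  "rational_map X Y f \<longleftrightarrow> dense_open_in X (dom f) \<and> regular_map (dom f) Y (\<lambda>x. the (f x))"

definition rat_eq :: "'a::affine_space set \<Rightarrow> ('a \<rightharpoonup> 'b) \<Rightarrow> ('a \<rightharpoonup> 'b) \<Rightarrow> bool" where
  "rat_eq X f g \<longleftrightarrow> (\<exists>U. dense_open_in X U \<and> (\<forall>x\<in>U. x \<in> dom f \<and> f x = g x))"

text \<open>The extension of a rational map to its domain of definition, that is, to the union of the
  domains of all its representatives. For a variety \<open>X\<close> all representatives defined at a point
  agree there.\<close>

definition rat_ext ::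
    "'a::affine_space set \<Rightarrow> 'b::affine_space set \<Rightarrow> ('a \<rightharpoonup> 'b) \<Rightarrow> ('a \<rightharpoonup> 'b)" where
  "rat_ext X Y f x = (if \<exists>g. rational_map X Y g \<and> rat_eq X g f \<and> x \<in> dom g
     then (SOME g. rational_map X Y g \<and> rat_eq X g f \<and> x \<in> dom g) x else None)"

definition birational_pair ::
    "'a::affine_space set \<Rightarrow> 'b::affine_space set \<Rightarrow> ('a \<rightharpoonup> 'b) \<Rightarrow> ('b \<rightharpoonup> 'a) \<Rightarrow> bool" where
  "birational_pair X Y f g \<longleftrightarrow> rational_map X Y f \<and> rational_map Y X g \<and>
     rat_eq X (g \<circ>\<^sub>m f) Some \<and> rat_eq Y (f \<circ>\<^sub>m g) Some"

abbreviation nonzero_rational_fun :: "'a::affine_space set \<Rightarrow> ('a \<rightharpoonup> complex) \<Rightarrow> bool" where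
  "nonzero_rational_fun X f \<equiv> rational_map X UNIV f \<and> \<not> rat_eq X f (\<lambda>_. Some 0)"


section \<open>Geometric crystals\<close>

abbreviation Cstar :: "complex set" where "Cstar \<equiv> - {0}"

text \<open>Here \<open>e i c\<close> is \<open>e\<^sub>i\<^sup>c\<close>, and \<open>a i j = \<alpha>\<^sub>j(\<alpha>\<^sub>i\<^sup>\<or>)\<close>.\<close>

definition rational_Cstar_action ::
    "'x::affine_space set \<Rightarrow> (complex \<Rightarrow> 'x \<rightharpoonup> 'x) \<Rightarrow> bool" where
  "rational_Cstar_action X e \<longleftrightarrow>
     rational_map (Cstar \<times> X) X (\<lambda>(c, x). e c x) \<and>
     rat_eq X (\<lambda>x. rat_ext (Cstar \<times> X) X (\<lambda>(c, x). e c x) (1, x)) Some \<and>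
     rat_eq (Cstar \<times> Cstar \<times> X) (\<lambda>(c, d, x). (e c \<circ>\<^sub>m e d) x) (\<lambda>(c, d, x). e (c * d) x)"

definition verma_relations ::
    "(complex \<Rightarrow> 'x \<rightharpoonup> 'x) \<Rightarrow> (complex \<Rightarrow> 'x \<rightharpoonup> 'x) \<Rightarrow> int \<Rightarrow> int \<Rightarrow> 'x::affine_space set \<Rightarrow> bool" where
  "verma_relations ei ej aij aji X \<longleftrightarrow>
     (aij = 0 \<and> aji = 0 \<longrightarrow>
        rat_eq (Cstar \<times> Cstar \<times> X)
          (\<lambda>(c1, c2, x). (ei c1 \<circ>\<^sub>m ej c2) x)
          (\<lambda>(c1, c2, x). (ej c2 \<circ>\<^sub>m ei c1) x)) \<and>
     (aij = -1 \<and> aji = -1 \<longrightarrow>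
        rat_eq (Cstar \<times> Cstar \<times> X)
          (\<lambda>(c1, c2, x). (ei c1 \<circ>\<^sub>m ej (c1 * c2) \<circ>\<^sub>m ei c2) x)
          (\<lambda>(c1, c2, x). (ej c2 \<circ>\<^sub>m ei (c1 * c2) \<circ>\<^sub>m ej c1) x)) \<and>
     (aij = -3 \<and> aji = -1 \<longrightarrow>
        rat_eq (Cstar \<times> Cstar \<times> X)
          (\<lambda>(c1, c2, x). (ei c1 \<circ>\<^sub>m ej (c1^3 * c2) \<circ>\<^sub>m ei (c1^2 * c2) \<circ>\<^sub>m
             ej (c1^3 * c2^2) \<circ>\<^sub>m ei (c1 * c2) \<circ>\<^sub>m ej c2) x)
          (\<lambda>(c1, c2, x). (ej c2 \<circ>\<^sub>m ei (c1 * c2) \<circ>\<^sub>m ej (c1^3 * c2^2) \<circ>\<^sub>m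
             ei (c1^2 * c2) \<circ>\<^sub>m ej (c1^3 * c2) \<circ>\<^sub>m ei c1) x))"

definition geometric_crystal ::
    "'i set \<Rightarrow> ('i \<Rightarrow> 'i \<Rightarrow> int) \<Rightarrow> 'x::affine_space set \<Rightarrow> ('i \<Rightarrow> complex \<Rightarrow> 'x \<rightharpoonup> 'x) \<Rightarrow>
     ('i \<Rightarrow> 'x \<rightharpoonup> complex) \<Rightarrow> ('i \<Rightarrow> 'x \<rightharpoonup> complex) \<Rightarrow> bool" where
  "geometric_crystal I a X e \<gamma> \<epsilon> \<longleftrightarrow>
     quasi_affine_variety X \<and>
     (\<forall>i\<in>I. rational_Cstar_action X (e i) \<and>
        rational_map X UNIV (\<gamma> i) \<and> rational_map X UNIV (\<epsilon> i)) \<and>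
     (\<forall>i\<in>I. dense_open_in ({1} \<times> X)
        (({1} \<times> X) \<inter> dom (rat_ext (Cstar \<times> X) X (\<lambda>(c, x). e i c x)))) \<and>
     (\<forall>i\<in>I. \<forall>j\<in>I. rat_eq (Cstar \<times> X) (\<lambda>(c, x). (\<gamma> j \<circ>\<^sub>m e i c) x)
        (\<lambda>(c, x). map_option (\<lambda>t. c powi a i j * t) (\<gamma> j x))) \<and>
     (\<forall>i\<in>I. \<forall>j\<in>I. verma_relations (e i) (e j) (a i j) (a j i) X) \<and>
     (\<forall>i\<in>I. rat_eq (Cstar \<times> X) (\<lambda>(c, x). (\<epsilon> i \<circ>\<^sub>m e i c) x)
        (\<lambda>(c, x). map_option (\<lambda>t. inverse c * t) (\<epsilon> i x)))"


section \<open>Positivity\<close>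

definition torus :: "'a::affine_space set" where
  "torus = {x. \<forall>\<phi>\<in>coord_funs. \<phi> x \<noteq> 0}"

definition characters :: "('a::affine_space \<Rightarrow> complex) set" where
  "characters = range (\<lambda>m x. \<Prod>\<phi>\<in>coord_funs. \<phi> x powi m \<phi>)"

definition positive_combination :: "('a::affine_space \<Rightarrow> complex) \<Rightarrow> bool" where
  "positive_combination g \<longleftrightarrow> (\<exists>S (a :: ('a \<Rightarrow> complex) \<Rightarrow> real).
     finite S \<and> S \<noteq> {} \<and> S \<subseteq> characters \<and> (\<forall>\<kappa>\<in>S. a \<kappa> > 0) \<and>
     g = (\<lambda>x. \<Sum>\<kappa>\<in>S. of_real (a \<kappa>) * \<kappa> x))"

definition positive_fun :: "('a::affine_space \<rightharpoonup> complex) \<Rightarrow> bool" where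
  "positive_fun f \<longleftrightarrow> nonzero_rational_fun torus f \<and>
     (\<exists>g h. positive_combination g \<and> positive_combination h \<and>
        rat_eq torus f (\<lambda>x. Some (g x / h x)))"

definition positive_map :: "('a::affine_space \<rightharpoonup> 'b::affine_space) \<Rightarrow> bool" where
  "positive_map f \<longleftrightarrow> rational_map torus torus f \<and>
     (\<forall>\<kappa>\<in>characters. positive_fun (\<lambda>x. map_option \<kappa> (f x)))"

definition positive_structure ::
    "'i set \<Rightarrow> 'x::affine_space set \<Rightarrow> ('i \<Rightarrow> complex \<Rightarrow> 'x \<rightharpoonup> 'x) \<Rightarrow>
     ('i \<Rightarrow> 'x \<rightharpoonup> complex) \<Rightarrow> ('i \<Rightarrow> 'x \<rightharpoonup> complex) \<Rightarrow> ('t::affine_space \<rightharpoonup> 'x) \<Rightarrow> bool" where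
  "positive_structure I X e \<gamma> \<epsilon> \<theta> \<longleftrightarrow>
     (\<exists>\<psi>. birational_pair torus X \<theta> \<psi> \<and>
       (\<forall>i\<in>I. positive_fun (\<gamma> i \<circ>\<^sub>m \<theta>) \<and> positive_fun (\<epsilon> i \<circ>\<^sub>m \<theta>) \<and>
          positive_map (\<lambda>(c, t). (\<psi> \<circ>\<^sub>m e i c \<circ>\<^sub>m \<theta>) t)))"


section \<open>The module $W(\varpi_1)$\<close>

definition cartan :: "nat \<Rightarrow> nat \<Rightarrow> int" where
  "cartan i j = [[2, -1, 0], [-1, 2, -1], [0, -3, 2]] ! i ! j"

text \<open>\<open>N\<^sub>i = [i]\<close>, \<open>B\<^sub>i = [\<bar>i]\<close>, \<open>Z\<^sub>i = [0\<^sub>i]\<close>.\<close>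

datatype wbasis = N1 | N2 | N3 | N4 | N5 | N6 | B1 | B2 | B3 | B4 | B5 | B6 | Z1 | Z2 | Emp

instance wbasis :: finite
proof
  have "(UNIV :: wbasis set) \<subseteq> {N1, N2, N3, N4, N5, N6, B1, B2, B3, B4, B5, B6, Z1, Z2, Emp}"
    using wbasis.exhaust by blast
  then show "finite (UNIV :: wbasis set)"
    by (rule finite_subset) simp
qed

type_synonym wmod = "complex ^ wbasis"

primrec weight :: "wbasis \<Rightarrow> int list" where
  "weight N1 = [-2, 1, 0]"
| "weight N2 = [-1, -1, 3]"
| "weight N3 = [-1, 0, 1]"
| "weight N4 = [-1, 1, -1]"
| "weight N5 = [0, -1, 2]"
| "weight N6 = [-1, 2, -3]"
| "weight B1 = [2, -1, 0]"
| "weight B2 = [1, 1, -3]"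
| "weight B3 = [1, 0, -1]"
| "weight B4 = [1, -1, 1]"
| "weight B5 = [0, 1, -2]"
| "weight B6 = [1, -2, 3]"
| "weight Z1 = [0, 0, 0]"
| "weight Z2 = [0, 0, 0]"
| "weight Emp = [0, 0, 0]"

text \<open>An entry \<open>(b, m, b')\<close> of the \<open>i\<close>-th list stands for a summand \<open>m b'\<close> of \<open>f\<^sub>i b\<close>.\<close>

definition f_action :: "nat \<Rightarrow> (wbasis \<times> nat \<times> wbasis) list" where
  "f_action i =
    [[(Z2, 1, N1), (B6, 1, N2), (B4, 1, N3), (B3, 1, N4), (B2, 1, N6), (B1, 1, Emp), (Emp, 2, N1)],
     [(N1, 1, N2), (N4, 1, N5), (N6, 1, Z2), (Z1, 3, B6), (Z2, 2, B6), (B5, 1, B4), (B2, 1, B1),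
      (Emp, 1, B6)],
     [(N2, 1, N3), (N3, 2, N4), (N4, 3, N6), (N5, 1, Z1), (Z1, 2, B5), (Z2, 1, B5), (B6, 1, B4),
      (B4, 2, B3), (B3, 3, B2)]] ! i"

definition f_op :: "nat \<Rightarrow> wmod \<Rightarrow> wmod" where
  "f_op i v = sum_list (map (\<lambda>(b, m, b'). axis b' (of_nat m * v $ b)) (f_action i))"

definition coroot_op :: "nat \<Rightarrow> complex \<Rightarrow> wmod \<Rightarrow> wmod" where
  "coroot_op i c v = (\<chi> b. c powi (weight b ! i) * v $ b)"

definition exp_op :: "(wmod \<Rightarrow> wmod) \<Rightarrow> wmod \<Rightarrow> wmod" where
  "exp_op T v = (\<Sum>n. (1 / fact n) *s (T ^^ n) v)"

definition Y :: "nat \<Rightarrow> complex \<Rightarrow> wmod \<Rightarrow> wmod" where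
  "Y i c v = exp_op (\<lambda>w. (1 / c) *s f_op i w) (coroot_op i c v)"


section \<open>The varieties and their structures\<close>

text \<open>The coordinates of a point of \<open>\<complex>\<^sup>6\<close> are \<open>x $ 0, \<dots>, x $ 5\<close>.\<close>

definition tup6 ::
    "complex \<Rightarrow> complex \<Rightarrow> complex \<Rightarrow> complex \<Rightarrow> complex \<Rightarrow> complex \<Rightarrow> complex ^ 6" where
  "tup6 x0 x1 x2 x3 x4 x5 = (\<chi> i. if i = 0 then x0 else if i = 1 then x1 else if i = 2 then x2
     else if i = 3 then x3 else if i = 4 then x4 else x5)"

definition app6 ::
    "(complex \<Rightarrow> complex \<Rightarrow> complex \<Rightarrow> complex \<Rightarrow> complex \<Rightarrow> complex \<Rightarrow> 'r) \<Rightarrow> complex ^ 6 \<Rightarrow> 'r" where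
  "app6 f x = f (x $ 0) (x $ 1) (x $ 2) (x $ 3) (x $ 4) (x $ 5)"

definition v1 :: "complex ^ 6 \<Rightarrow> wmod" where
  "v1 x = Y 0 (x $ 0) (Y 1 (x $ 1) (Y 2 (x $ 2) (Y 1 (x $ 3) (Y 2 (x $ 4) (Y 1 (x $ 5)
     (axis N1 1))))))"

definition v2 :: "complex ^ 6 \<Rightarrow> wmod" where
  "v2 y = Y 2 (y $ 2) (Y 1 (y $ 1) (Y 2 (y $ 4) (Y 1 (y $ 3) (Y 0 (y $ 0) (Y 1 (y $ 5)
     (axis B2 1))))))"

definition V1 :: "wmod set" where "V1 = v1 ` torus"

definition V2 :: "wmod set" where "V2 = v2 ` torus"

text \<open>The partial map \<open>v(x) \<mapsto> v(\<phi>(x))\<close> and the function \<open>v(x) \<mapsto> g(x)\<close> on \<open>v ` torus\<close>; both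
  \<open>v1\<close> and \<open>v2\<close> are injective on the torus. In all uses below a vanishing denominator (or \<open>c = 0\<close>)
  makes some coordinate of \<open>\<phi>(x)\<close> equal to \<open>0\<close>, because \<open>z / 0 = 0\<close>, so that the map is undefined
  there.\<close>

definition map_in_coords ::
    "(complex ^ 6 \<Rightarrow> wmod) \<Rightarrow> (complex ^ 6 \<Rightarrow> complex ^ 6) \<Rightarrow> wmod \<rightharpoonup> wmod" where
  "map_in_coords v \<phi> w = (let x = inv_into torus v w in
     if w \<in> v ` torus \<and> \<phi> x \<in> torus then Some (v (\<phi> x)) else None)"

definition fun_in_coords ::
    "(complex ^ 6 \<Rightarrow> wmod) \<Rightarrow> (complex ^ 6 \<Rightarrow> complex) \<Rightarrow> wmod \<rightharpoonup> complex" where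
  "fun_in_coords v g w = (if w \<in> v ` torus then Some (g (inv_into torus v w)) else None)"

definition param1 :: "complex ^ 6 \<rightharpoonup> wmod" where
  "param1 x = (if x \<in> torus then Some (v1 x) else None)"

definition is_sigma_bar :: "(wmod \<rightharpoonup> wmod) \<Rightarrow> bool" where
  "is_sigma_bar \<sigma> \<longleftrightarrow> (\<exists>\<tau>. birational_pair V1 V2 \<sigma> \<tau>) \<and>
     (\<exists>a. nonzero_rational_fun V1 a \<and> rat_eq V1 \<sigma> (\<lambda>v. map_option (\<lambda>t. t *s v) (a v)))"

definition e0_V2 :: "complex \<Rightarrow> wmod \<rightharpoonup> wmod" where
  "e0_V2 c = map_in_coords v2 (app6 (\<lambda>y0 y1 y2 y3 y4 y5. tup6 (c * y0) y1 y2 y3 y4 y5))"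

definition gamma0_V2 :: "wmod \<rightharpoonup> complex" where
  "gamma0_V2 = fun_in_coords v2 (app6 (\<lambda>y0 y1 y2 y3 y4 y5. y0^2 / (y1 * y3 * y5)))"

definition eps0_V2 :: "wmod \<rightharpoonup> complex" where
  "eps0_V2 = fun_in_coords v2 (app6 (\<lambda>y0 y1 y2 y3 y4 y5. y1 * y3 / y0))"

definition e1_V1 :: "complex \<Rightarrow> wmod \<rightharpoonup> wmod" where
  "e1_V1 c = map_in_coords v1 (app6 (\<lambda>x0 x1 x2 x3 x4 x5.
     let C1 = (c * x0 / x1 + x0 * x2^3 / (x1^2 * x3) + x0 * x2^3 * x4^3 / (x1^2 * x3^2 * x5)) /
              (x0 / x1 + x0 * x2^3 / (x1^2 * x3) + x0 * x2^3 * x4^3 / (x1^2 * x3^2 * x5));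
         C3 = (c * x0 / x1 + c * x0 * x2^3 / (x1^2 * x3) + x0 * x2^3 * x4^3 / (x1^2 * x3^2 * x5)) /
              (c * x0 / x1 + x0 * x2^3 / (x1^2 * x3) + x0 * x2^3 * x4^3 / (x1^2 * x3^2 * x5));
         C5 = c * (x0 / x1 + x0 * x2^3 / (x1^2 * x3) + x0 * x2^3 * x4^3 / (x1^2 * x3^2 * x5)) /
              (c * x0 / x1 + c * x0 * x2^3 / (x1^2 * x3) + x0 * x2^3 * x4^3 / (x1^2 * x3^2 * x5))
     in tup6 x0 (C1 * x1) x2 (C3 * x3) x4 (C5 * x5)))"

definition e2_V1 :: "complex \<Rightarrow> wmod \<rightharpoonup> wmod" where
  "e2_V1 c = map_in_coords v1 (app6 (\<lambda>x0 x1 x2 x3 x4 x5.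
     let C2 = (c * x1 / x2 + x1 * x3 / (x2^2 * x4)) / (x1 / x2 + x1 * x3 / (x2^2 * x4));
         C4 = c * (x1 / x2 + x1 * x3 / (x2^2 * x4)) / (c * x1 / x2 + x1 * x3 / (x2^2 * x4))
     in tup6 x0 x1 (C2 * x2) x3 (C4 * x4) x5))"

definition eps1_V1 :: "wmod \<rightharpoonup> complex" where
  "eps1_V1 = fun_in_coords v1 (app6 (\<lambda>x0 x1 x2 x3 x4 x5.
     x0 / x1 + x0 * x2^3 / (x1^2 * x3) + x0 * x2^3 * x4^3 / (x1^2 * x3^2 * x5)))"

definition eps2_V1 :: "wmod \<rightharpoonup> complex" where
  "eps2_V1 = fun_in_coords v1 (app6 (\<lambda>x0 x1 x2 x3 x4 x5. x1 / x2 + x1 * x3 / (x2^2 * x4)))"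

definition gamma1_V1 :: "wmod \<rightharpoonup> complex" where
  "gamma1_V1 = fun_in_coords v1 (app6 (\<lambda>x0 x1 x2 x3 x4 x5.
     x1^2 * x3^2 * x5^2 / (x0 * x2^3 * x4^3)))"

definition gamma2_V1 :: "wmod \<rightharpoonup> complex" where
  "gamma2_V1 = fun_in_coords v1 (app6 (\<lambda>x0 x1 x2 x3 x4 x5. x2^2 * x4^2 / (x1 * x3 * x5)))"

text \<open>In the following three families \<open>\<tau>\<close> is an inverse of \<open>\<sigma>\<close>, and the list positions
  \<open>0, 1, 2\<close> are the elements of \<open>I\<close>.\<close>

definition e_chi :: "(wmod \<rightharpoonup> wmod) \<Rightarrow> (wmod \<rightharpoonup> wmod) \<Rightarrow> nat \<Rightarrow> complex \<Rightarrow> wmod \<rightharpoonup> wmod" where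
  "e_chi \<sigma> \<tau> i c = [\<tau> \<circ>\<^sub>m e0_V2 c \<circ>\<^sub>m \<sigma>, e1_V1 c, e2_V1 c] ! i"

definition gamma_chi :: "(wmod \<rightharpoonup> wmod) \<Rightarrow> nat \<Rightarrow> wmod \<rightharpoonup> complex" where
  "gamma_chi \<sigma> i = [gamma0_V2 \<circ>\<^sub>m \<sigma>, gamma1_V1, gamma2_V1] ! i"

definition eps_chi :: "(wmod \<rightharpoonup> wmod) \<Rightarrow> nat \<Rightarrow> wmod \<rightharpoonup> complex" where
  "eps_chi \<sigma> i = [eps0_V2 \<circ>\<^sub>m \<sigma>, eps1_V1, eps2_V1] ! i"


section \<open>The explicit $0$-structure\<close>

definition polD :: "complex \<Rightarrow> complex \<Rightarrow> complex \<Rightarrow> complex \<Rightarrow> complex \<Rightarrow> complex \<Rightarrow> complex \<Rightarrow> complex"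
  where "polD c x0 x1 x2 x3 x4 x5 =
    c^2 * x0^2 * x2^3 * x3 + x1 * x2^3 * x3^2 * x5
    + c * x0 * (x1 * x3^3 + 3 * x1 * x2 * x3^2 * x4 + 3 * x1 * x2^2 * x3 * x4^2
        + x2^3 * (x3^2 + x1 * x4^3 + x1 * x3 * x5))"

definition polE :: "complex \<Rightarrow> complex \<Rightarrow> complex \<Rightarrow> complex \<Rightarrow> complex \<Rightarrow> complex \<Rightarrow> complex"
  where "polE x0 x1 x2 x3 x4 x5 =
    x0^2 * x2^3 * x3 + x1 * x2^3 * x3^2 * x5
    + x0 * (x1 * x3^3 + 3 * x1 * x2 * x3^2 * x4 + 3 * x1 * x2^2 * x3 * x4^2
        + x2^3 * (x3^2 + x1 * x4^3 + x1 * x3 * x5))"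

definition polF :: "complex \<Rightarrow> complex \<Rightarrow> complex \<Rightarrow> complex \<Rightarrow> complex \<Rightarrow> complex \<Rightarrow> complex \<Rightarrow> complex"
  where "polF c x0 x1 x2 x3 x4 x5 =
    c * x0^2 * x2^3 * x3 + x1 * x2^3 * x3^2 * x5
    + x0 * (c * x1 * x3^3 + 3 * c * x1 * x2 * x3^2 * x4 + 3 * c * x1 * x2^2 * x3 * x4^2
        + x2^3 * (x3^2 + c * x1 * x4^3 + c * x1 * x3 * x5))"

definition polG :: "complex \<Rightarrow> complex \<Rightarrow> complex \<Rightarrow> complex \<Rightarrow> complex \<Rightarrow> complex \<Rightarrow> complex \<Rightarrow> complex"
  where "polG c x0 x1 x2 x3 x4 x5 =
    c * x0^2 * x2^3 * x3 + x1 * x2^3 * x3^2 * x5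
    + x0 * (x1 * x3^3 + (2 + c) * x1 * x2 * x3^2 * x4 + (1 + 2 * c) * x1 * x2^2 * x3 * x4^2
        + x2^3 * (x3^2 + c * x1 * x4^3 + c * x1 * x3 * x5))"

definition polH :: "complex \<Rightarrow> complex \<Rightarrow> complex \<Rightarrow> complex \<Rightarrow> complex \<Rightarrow> complex \<Rightarrow> complex \<Rightarrow> complex"
  where "polH c x0 x1 x2 x3 x4 x5 =
    c * x0^2 * x2^3 * x3 + x1 * x2^3 * x3^2 * x5
    + x0 * (x1 * x3^3 + 3 * x1 * x2 * x3^2 * x4 + 3 * x1 * x2^2 * x3 * x4^2
        + x2^3 * (x3^2 + x1 * x4^3 + c * x1 * x3 * x5))"

definition e0_explicit :: "complex \<Rightarrow> wmod \<rightharpoonup> wmod" where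
  "e0_explicit c = map_in_coords v1 (app6 (\<lambda>x0 x1 x2 x3 x4 x5.
     let D = polD c x0 x1 x2 x3 x4 x5; E = polE x0 x1 x2 x3 x4 x5; F = polF c x0 x1 x2 x3 x4 x5;
         G = polG c x0 x1 x2 x3 x4 x5; H = polH c x0 x1 x2 x3 x4 x5
     in tup6 (D / (c * E) * x0) (F / (c * E) * x1) (G / (c * E) * x2)
          (D * H / (c^2 * E * F) * x3) (D / (c * G) * x4) (D / (c * H) * x5)))"

definition eps0_explicit :: "wmod \<rightharpoonup> complex" where
  "eps0_explicit = fun_in_coords v1 (app6 (\<lambda>x0 x1 x2 x3 x4 x5.
     polE x0 x1 x2 x3 x4 x5 / (x0^3 * x2^3 * x3)))"

definition gamma0_explicit :: "wmod \<rightharpoonup> complex" where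
  "gamma0_explicit = fun_in_coords v1 (app6 (\<lambda>x0 x1 x2 x3 x4 x5. x0^2 / (x1 * x3 * x5)))"

end

theory Submission
  imports Defs
begin

text \<open>Quadrics vanishing on the cones over both varieties allow the rational inversion of \<open>v1\<close> and
  \<open>v2\<close> on these cones, so \<open>y(x)\<close> is read off the coordinates of \<open>v1 x\<close> and any two candidates for
  \<open>\<sigma>\<close> agree generically. In the coordinates \<open>y\<close> the action of 0 multiplies \<open>y\<^sub>0\<close> by \<open>c\<close>. At
  the explicit formula for \<open>e\<^sub>0\<^sup>c\<close>, the coordinates of \<open>v1\<close> from which \<open>y\<close> is read off are those of \<open>v1 x\<close>
  up to a common factor, except that \<open>Emp\<close> gets an additional factor \<open>c\<close>, so this is that action.
  The Verma relations that involve 0 compare functions of \<open>x\<close> and \<open>y\<close> that both actions change in a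
  simple way. The relation between 1 and 2 is a uniqueness statement for the conjugation of matrices
  in the 7-dimensional representation of \<open>G\<^sub>2\<close>.\<close>

section \<open>The Zariski topology and regular maps\<close>

text \<open>A rational map is known only through some partial function, and \<open>\<sigma>\<close>,
  \<open>\<tau>\<close> are arbitrary representatives. Identities are therefore proved at generic
  points of a torus and transported to \<open>V1\<close>. Using such an identity at an intermediate
  point of a composition requires each action to be dominant; it is, because acting with the inverse
  parameter is a generic right inverse.

  For the actions of 1 and 2, the diagonal of the lower triangular map \<open>B(x) t\<close> is
  given by the values of the simple roots \<alpha>_1, \<alpha>_2 on it. Acting by i with parameter c
  is a conjugation when the value of \<alpha>_i is 1/c, and this value then becomes c: the diagonal
  undergoes a simple reflection. The exponents in the Verma relation are the parameters that
  successive reflections force, starting from the values 1/c2 of \<alpha>_1 and 1/c1 of \<alpha>_2.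
  The longest Weyl group element of G_2 is -1, so both words end at the values c2 and c1, which
  explains why the two ends have the same diagonal. It does not depend on x, and it is regular for
  generic c1, c2.\<close>

lemma openin_zariski_iff:
  "openin zariski U \<longleftrightarrow> (\<forall>x\<in>U. \<exists>p. poly_fun p \<and> p x \<noteq> 0 \<and> {z. p z \<noteq> 0} \<subseteq> U)"
proof
  let ?B = "{{x :: 'a. p x \<noteq> 0} | p. poly_fun p}"
  assume "openin zariski U"
  then have "generate_topology_on ?B U"
    by (simp add: zariski_def openin_topology_generated_by)
  then show "\<forall>x\<in>U. \<exists>p. poly_fun p \<and> p x \<noteq> 0 \<and> {z. p z \<noteq> 0} \<subseteq> U"
  proof induction
    case (Int a b)
    show ?case
    proof
      fix x assume "x \<in> a \<inter> b"
      then obtain p q where "poly_fun p" "p x \<noteq> 0" "{z. p z \<noteq> 0} \<subseteq> a"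
          "poly_fun q" "q x \<noteq> 0" "{z. q z \<noteq> 0} \<subseteq> b"
        using Int.IH by blast
      \<comment> \<open>The product of two polynomials cuts out the intersection of their
        nonvanishing sets, so the generating family is already a base.\<close>
      then have "poly_fun (\<lambda>z. p z * q z)" "p x * q x \<noteq> 0" "{z. p z * q z \<noteq> 0} \<subseteq> a \<inter> b"
        by (auto intro: poly_fun.mult)
      then show "\<exists>p. poly_fun p \<and> p x \<noteq> 0 \<and> {z. p z \<noteq> 0} \<subseteq> a \<inter> b"
        by (intro exI[of _ "\<lambda>z. p z * q z"]) simp
    qed
  next
    case (UN K)
    show ?case
    proof
      fix x assume "x \<in> \<Union>K"
      then obtain k where "k \<in> K" "x \<in> k" by blast
      then obtain p where "poly_fun p" "p x \<noteq> 0" "{z. p z \<noteq> 0} \<subseteq> k"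
        using UN.IH by blast
      then show "\<exists>p. poly_fun p \<and> p x \<noteq> 0 \<and> {z. p z \<noteq> 0} \<subseteq> \<Union>K"
        using \<open>k \<in> K\<close> by blast
    qed
  qed auto
next
  assume *: "\<forall>x\<in>U. \<exists>p. poly_fun p \<and> p x \<noteq> 0 \<and> {z. p z \<noteq> 0} \<subseteq> U"
  have "openin zariski {z. p z \<noteq> 0}" if "poly_fun p" for p :: "'a \<Rightarrow> complex"
    unfolding zariski_def using that by (intro topology_generated_by_Basis) blast
  then have "\<forall>x\<in>U. \<exists>T. openin zariski T \<and> x \<in> T \<and> T \<subseteq> U"
    using * by fast
  then show "openin zariski U"
    by (subst openin_subopen) auto
qed

lemma openin_zariski_poly: "poly_fun p \<Longrightarrow> openin zariski {z. p z \<noteq> 0}"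
  by (auto simp: openin_zariski_iff)

lemma topspace_zariski [simp]: "topspace zariski = UNIV"
proof -
  have "openin zariski (UNIV :: 'a set)"
    unfolding openin_zariski_iff
    by (auto intro!: exI[of _ "\<lambda>_. 1"] poly_fun.const)
  then show ?thesis
    using openin_subset by blast
qed

abbreviation open_in :: "'a::affine_space set \<Rightarrow> 'a set \<Rightarrow> bool" where
  "open_in X \<equiv> openin (subtopology zariski X)"

lemma open_in_iff:
  "open_in X U \<longleftrightarrow> U \<subseteq> X \<and> (\<forall>x\<in>U. \<exists>p. poly_fun p \<and> p x \<noteq> 0 \<and> {z\<in>X. p z \<noteq> 0} \<subseteq> U)"
proof
  assume "open_in X U"
  then obtain T where T: "openin zariski T" "U = T \<inter> X"
    by (auto simp: openin_subtopology)
  show "U \<subseteq> X \<and> (\<forall>x\<in>U. \<exists>p. poly_fun p \<and> p x \<noteq> 0 \<and> {z\<in>X. p z \<noteq> 0} \<subseteq> U)"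
  proof (intro conjI ballI)
    fix x assume "x \<in> U"
    then obtain p where "poly_fun p" "p x \<noteq> 0" "{z. p z \<noteq> 0} \<subseteq> T"
      using T openin_zariski_iff by blast
    then show "\<exists>p. poly_fun p \<and> p x \<noteq> 0 \<and> {z\<in>X. p z \<noteq> 0} \<subseteq> U"
      using T by (intro exI[of _ p]) auto
  qed (use T in auto)
next
  assume *: "U \<subseteq> X \<and> (\<forall>x\<in>U. \<exists>p. poly_fun p \<and> p x \<noteq> 0 \<and> {z\<in>X. p z \<noteq> 0} \<subseteq> U)"
  \<comment> \<open>The union of all basic open sets with trace inside U has trace exactly U,
    without a choice of neighbourhoods.\<close>
  define T where "T = \<Union>{{z. p z \<noteq> 0} | p. poly_fun p \<and> {z\<in>X. p z \<noteq> 0} \<subseteq> U}"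
  have "openin zariski T"
    unfolding T_def by (intro openin_Union) (auto intro: openin_zariski_poly)
  moreover have "U = T \<inter> X"
  proof
    show "U \<subseteq> T \<inter> X"
    proof
      fix x assume "x \<in> U"
      then obtain p where "poly_fun p" "p x \<noteq> 0" "{z\<in>X. p z \<noteq> 0} \<subseteq> U"
        using * by blast
      then show "x \<in> T \<inter> X"
        using * \<open>x \<in> U\<close> unfolding T_def by (intro IntI UnionI[of "{z. p z \<noteq> 0}"]) blast+
    qed
    show "T \<inter> X \<subseteq> U"
      unfolding T_def by auto
  qed
  ultimately show "open_in X U"
    by (auto simp: openin_subtopology)
qed

lemma open_inE:
  assumes "open_in X U" "x \<in> U"
  obtains p where "poly_fun p" "p x \<noteq> 0" "{z\<in>X. p z \<noteq> 0} \<subseteq> U"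
  using assms unfolding open_in_iff by metis

lemma open_in_subset: "open_in X U \<Longrightarrow> U \<subseteq> X"
  by (simp add: open_in_iff)

lemma open_in_self [simp]: "open_in X X"
  using openin_topspace[of "subtopology zariski X"] by simp

lemma open_in_trans: "open_in X U \<Longrightarrow> open_in U V \<Longrightarrow> open_in X V"
  by (metis inf.absorb_iff2 open_in_subset openin_trans_full subtopology_subtopology)

text \<open>Shrinking the neighbourhood to a basic one, given by \<open>q\<close>, turns
  intersections of neighbourhoods into products of polynomials in the closure proofs below.\<close>

lemma regular_fun_iff:
  "regular_fun U f \<longleftrightarrow> (\<forall>p\<in>U. \<exists>q g h. poly_fun q \<and> poly_fun g \<and> poly_fun h \<and> q p \<noteq> 0 \<and>
     (\<forall>x\<in>U. q x \<noteq> 0 \<longrightarrow> h x \<noteq> 0 \<and> f x = g x / h x))"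
proof
  assume *: "regular_fun U f"
  show "\<forall>p\<in>U. \<exists>q g h. poly_fun q \<and> poly_fun g \<and> poly_fun h \<and> q p \<noteq> 0 \<and>
     (\<forall>x\<in>U. q x \<noteq> 0 \<longrightarrow> h x \<noteq> 0 \<and> f x = g x / h x)"
  proof
    fix p assume "p \<in> U"
    then obtain V g h where V: "open_in U V" "p \<in> V" "poly_fun g" "poly_fun h"
        "\<forall>x\<in>V. h x \<noteq> 0 \<and> f x = g x / h x"
      using * unfolding regular_fun_def by blast
    obtain q where q: "poly_fun q" "q p \<noteq> 0" "{z\<in>U. q z \<noteq> 0} \<subseteq> V"
      using open_inE[OF V(1,2)] .
    then have "\<forall>x\<in>U. q x \<noteq> 0 \<longrightarrow> h x \<noteq> 0 \<and> f x = g x / h x"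
      using V(5) by blast
    with q V(3,4) show "\<exists>q g h. poly_fun q \<and> poly_fun g \<and> poly_fun h \<and> q p \<noteq> 0 \<and>
     (\<forall>x\<in>U. q x \<noteq> 0 \<longrightarrow> h x \<noteq> 0 \<and> f x = g x / h x)"
      by (intro exI conjI)
  qed
next
  assume *: "\<forall>p\<in>U. \<exists>q g h. poly_fun q \<and> poly_fun g \<and> poly_fun h \<and> q p \<noteq> 0 \<and>
     (\<forall>x\<in>U. q x \<noteq> 0 \<longrightarrow> h x \<noteq> 0 \<and> f x = g x / h x)"
  show "regular_fun U f"
    unfolding regular_fun_def
  proof
    fix p assume "p \<in> U"
    then obtain q g h where q: "poly_fun q" "poly_fun g" "poly_fun h" "q p \<noteq> 0"
      "\<forall>x\<in>U. q x \<noteq> 0 \<longrightarrow> h x \<noteq> 0 \<and> f x = g x / h x"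
      using * by blast
    have "open_in U {z\<in>U. q z \<noteq> 0}"
      using q(1) by (auto simp: open_in_iff)
    then show "\<exists>V g h. open_in U V \<and> p \<in> V \<and>
     poly_fun g \<and> poly_fun h \<and> (\<forall>x\<in>V. h x \<noteq> 0 \<and> f x = g x / h x)"
      using q \<open>p \<in> U\<close> by (intro exI[of _ "{z\<in>U. q z \<noteq> 0}"] exI[of _ g] exI[of _ h]) auto
  qed
qed

lemma regular_funE:
  assumes "regular_fun U f" "p \<in> U"
  obtains q g h where "poly_fun q" "poly_fun g" "poly_fun h" "q p \<noteq> 0"
    "\<forall>x\<in>U. q x \<noteq> 0 \<longrightarrow> h x \<noteq> 0 \<and> f x = g x / h x"
  using assms unfolding regular_fun_iff by metis

section \<open>Closure properties of regular functions\<close>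

named_theorems regular_intros

lemma regular_fun_poly: "poly_fun f \<Longrightarrow> regular_fun U f"
  unfolding regular_fun_iff
  by (intro ballI exI[of _ "\<lambda>_. 1"] exI[of _ f]) (auto intro: poly_fun.const)

lemma regular_fun_const [regular_intros]: "regular_fun U (\<lambda>x. c)"
  by (intro regular_fun_poly poly_fun.const)

lemma regular_fun_coord: "\<phi> \<in> coord_funs \<Longrightarrow> regular_fun U \<phi>"
  by (intro regular_fun_poly poly_fun.coord)

lemma regular_fun_cong: "(\<And>x. x \<in> U \<Longrightarrow> f x = g x) \<Longrightarrow> regular_fun U f \<longleftrightarrow> regular_fun U g"
  unfolding regular_fun_iff by simp

lemma regular_fun_subset: "regular_fun U f \<Longrightarrow> V \<subseteq> U \<Longrightarrow> regular_fun V f"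
  unfolding regular_fun_iff
proof
  fix p
  assume *: "\<forall>p\<in>U. \<exists>q g h. poly_fun q \<and> poly_fun g \<and> poly_fun h \<and> q p \<noteq> 0 \<and>
     (\<forall>x\<in>U. q x \<noteq> 0 \<longrightarrow> h x \<noteq> 0 \<and> f x = g x / h x)" "V \<subseteq> U" "p \<in> V"
  then obtain q g h where "poly_fun q" "poly_fun g" "poly_fun h" "q p \<noteq> 0"
     "\<forall>x\<in>U. q x \<noteq> 0 \<longrightarrow> h x \<noteq> 0 \<and> f x = g x / h x"
    using subsetD[OF *(2,3)] by metis
  moreover from this(5) have "\<forall>x\<in>V. q x \<noteq> 0 \<longrightarrow> h x \<noteq> 0 \<and> f x = g x / h x"
    using *(2) by blast
  ultimately show "\<exists>q g h. poly_fun q \<and> poly_fun g \<and> poly_fun h \<and> q p \<noteq> 0 \<and>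
     (\<forall>x\<in>V. q x \<noteq> 0 \<longrightarrow> h x \<noteq> 0 \<and> f x = g x / h x)"
    by (intro exI conjI)
qed

text \<open>Common core for sums and products: the two local fractions are valid together where
  \<open>q\<close> and \<open>r\<close> are both nonzero, and the third assumption combines them
  into one fraction.\<close>

lemma regular_fun_binop:
  fixes f g :: "'a::affine_space \<Rightarrow> complex"
  assumes "regular_fun U f" "regular_fun U g"
    and "\<And>a b c d :: 'a \<Rightarrow> complex. poly_fun a \<Longrightarrow> poly_fun b \<Longrightarrow> poly_fun c \<Longrightarrow> poly_fun d \<Longrightarrow>
      \<exists>n m. poly_fun n \<and> poly_fun m \<and>
        (\<forall>x. b x \<noteq> 0 \<longrightarrow> d x \<noteq> 0 \<longrightarrow> m x \<noteq> 0 \<and> op (a x / b x) (c x / d x) = n x / m x)"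
  shows "regular_fun U (\<lambda>x. op (f x) (g x))"
  unfolding regular_fun_iff
proof
  fix p assume "p \<in> U"
  obtain q a b where 1: "poly_fun q" "poly_fun a" "poly_fun b" "q p \<noteq> 0"
     "\<forall>x\<in>U. q x \<noteq> 0 \<longrightarrow> b x \<noteq> 0 \<and> f x = a x / b x"
    using regular_funE[OF assms(1) \<open>p \<in> U\<close>] .
  obtain r c d where 2: "poly_fun r" "poly_fun c" "poly_fun d" "r p \<noteq> 0"
     "\<forall>x\<in>U. r x \<noteq> 0 \<longrightarrow> d x \<noteq> 0 \<and> g x = c x / d x"
    using regular_funE[OF assms(2) \<open>p \<in> U\<close>] .
  obtain n m where "poly_fun n" "poly_fun m"
    "\<forall>x. b x \<noteq> 0 \<longrightarrow> d x \<noteq> 0 \<longrightarrow> m x \<noteq> 0 \<and> op (a x / b x) (c x / d x) = n x / m x"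
    using assms(3)[of a b c d] 1 2 by blast
  then show "\<exists>q g' h. poly_fun q \<and> poly_fun g' \<and> poly_fun h \<and> q p \<noteq> 0 \<and>
     (\<forall>x\<in>U. q x \<noteq> 0 \<longrightarrow> h x \<noteq> 0 \<and> op (f x) (g x) = g' x / h x)"
    using 1 2 by (intro exI[of _ "\<lambda>x. q x * r x"] exI[of _ n] exI[of _ m])
      (auto intro: poly_fun.mult)
qed

lemma regular_fun_add [regular_intros]:
  assumes "regular_fun U f" "regular_fun U g"
  shows "regular_fun U (\<lambda>x. f x + g x)"
proof (rule regular_fun_binop[OF assms])
  fix a b c d :: "'a \<Rightarrow> complex" assume "poly_fun a" "poly_fun b" "poly_fun c" "poly_fun d"
  then show "\<exists>n m. poly_fun n \<and> poly_fun m \<and>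
        (\<forall>x. b x \<noteq> 0 \<longrightarrow> d x \<noteq> 0 \<longrightarrow> m x \<noteq> 0 \<and> a x / b x + c x / d x = n x / m x)"
    by (intro exI[of _ "\<lambda>x. a x * d x + c x * b x"] exI[of _ "\<lambda>x. b x * d x"])
      (auto intro!: poly_fun.mult poly_fun.add simp: field_simps)
qed

lemma regular_fun_mult [regular_intros]:
  assumes "regular_fun U f" "regular_fun U g"
  shows "regular_fun U (\<lambda>x. f x * g x)"
proof (rule regular_fun_binop[OF assms])
  fix a b c d :: "'a \<Rightarrow> complex" assume "poly_fun a" "poly_fun b" "poly_fun c" "poly_fun d"
  then show "\<exists>n m. poly_fun n \<and> poly_fun m \<and>
        (\<forall>x. b x \<noteq> 0 \<longrightarrow> d x \<noteq> 0 \<longrightarrow> m x \<noteq> 0 \<and> a x / b x * (c x / d x) = n x / m x)"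
    by (intro exI[of _ "\<lambda>x. a x * c x"] exI[of _ "\<lambda>x. b x * d x"])
      (auto intro!: poly_fun.mult)
qed

lemma regular_fun_inverse:
  assumes "regular_fun U f" "\<And>x. x \<in> U \<Longrightarrow> f x \<noteq> 0"
  shows "regular_fun U (\<lambda>x. inverse (f x))"
  unfolding regular_fun_iff
proof
  fix p assume "p \<in> U"
  obtain q a b where "poly_fun q" "poly_fun a" "poly_fun b" "q p \<noteq> 0"
     "\<forall>x\<in>U. q x \<noteq> 0 \<longrightarrow> b x \<noteq> 0 \<and> f x = a x / b x"
    using regular_funE[OF assms(1) \<open>p \<in> U\<close>] .
  then show "\<exists>q g h. poly_fun q \<and> poly_fun g \<and> poly_fun h \<and> q p \<noteq> 0 \<and>
     (\<forall>x\<in>U. q x \<noteq> 0 \<longrightarrow> h x \<noteq> 0 \<and> inverse (f x) = g x / h x)"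
    using assms(2) by (intro exI[of _ q] exI[of _ b] exI[of _ a]) auto
qed

lemma regular_fun_divide [regular_intros]:
  assumes "regular_fun U f" "regular_fun U g" "\<And>x. x \<in> U \<Longrightarrow> g x \<noteq> 0"
  shows "regular_fun U (\<lambda>x. f x / g x)"
  unfolding divide_inverse by (intro regular_intros assms regular_fun_inverse)

lemma regular_fun_uminus [regular_intros]:
  "regular_fun U f \<Longrightarrow> regular_fun U (\<lambda>x. - f x)"
  using regular_fun_mult[OF regular_fun_const[of U "-1"], of f] by simp

lemma regular_fun_diff [regular_intros]:
  "regular_fun U f \<Longrightarrow> regular_fun U g \<Longrightarrow> regular_fun U (\<lambda>x. f x - g x)"
  using regular_fun_add[OF _ regular_fun_uminus, of U f g] by simp

lemma regular_fun_power [regular_intros]: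
  "regular_fun U f \<Longrightarrow> regular_fun U (\<lambda>x. f x ^ n)"
  by (induction n) (auto intro: regular_intros)

lemma regular_fun_power_int:
  assumes "regular_fun U f" "\<And>x. x \<in> U \<Longrightarrow> f x \<noteq> 0"
  shows "regular_fun U (\<lambda>x. f x powi k)"
  by (cases "0 \<le> k")
    (simp_all add: power_int_def regular_fun_power regular_fun_inverse assms)

lemma regular_fun_prod:
  assumes "\<And>i. i \<in> I \<Longrightarrow> regular_fun U (f i)"
  shows "regular_fun U (\<lambda>x. \<Prod>i\<in>I. f i x)"
  using assms by (induction I rule: infinite_finite_induct) (auto intro: regular_intros)

lemma regular_fun_sum:
  assumes "\<And>i. i \<in> I \<Longrightarrow> regular_fun U (f i)"
  shows "regular_fun U (\<lambda>x. \<Sum>i\<in>I. f i x)"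
  using assms by (induction I rule: infinite_finite_induct) (auto intro: regular_intros)

lemma open_in_regular_nonzero:
  assumes "regular_fun U f"
  shows "open_in U {x\<in>U. f x \<noteq> 0}"
  unfolding open_in_iff
proof (intro conjI ballI)
  fix p assume p: "p \<in> {x\<in>U. f x \<noteq> 0}"
  obtain q a b where *: "poly_fun q" "poly_fun a" "poly_fun b" "q p \<noteq> 0"
     "\<forall>x\<in>U. q x \<noteq> 0 \<longrightarrow> b x \<noteq> 0 \<and> f x = a x / b x"
    using regular_funE[OF assms, of p] p by blast
  then show "\<exists>r. poly_fun r \<and> r p \<noteq> 0 \<and> {z \<in> U. r z \<noteq> 0} \<subseteq> {x \<in> U. f x \<noteq> 0}"
    using p by (intro exI[of _ "\<lambda>x. q x * a x"]) (auto intro: poly_fun.mult)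
qed auto

section \<open>Regular maps: composition, preimages and products\<close>

lemma regular_map_poly:
  assumes "poly_fun p" "regular_map U Q f"
  shows "regular_fun U (\<lambda>x. p (f x))"
  using assms(1)
proof induction
  case (coord \<phi>)
  then show ?case using assms(2) by (simp add: regular_map_def)
qed (auto intro: regular_intros)

lemma regular_map_image: "regular_map U Q f \<Longrightarrow> x \<in> U \<Longrightarrow> f x \<in> Q"
  by (auto simp: regular_map_def)

lemma regular_map_subset: "regular_map U Q f \<Longrightarrow> V \<subseteq> U \<Longrightarrow> regular_map V Q f"
  unfolding regular_map_def using regular_fun_subset by blast

lemma regular_map_cong:
  "(\<And>x. x \<in> U \<Longrightarrow> f x = g x) \<Longrightarrow> regular_map U Q f \<longleftrightarrow> regular_map U Q g"
  unfolding regular_map_def by (intro conj_cong ball_cong refl regular_fun_cong) auto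

lemma regular_fun_compose:
  assumes "regular_fun Q g" "regular_map U Q f"
  shows "regular_fun U (\<lambda>x. g (f x))"
  unfolding regular_fun_iff
proof
  fix p assume "p \<in> U"
  then have "f p \<in> Q"
    using assms(2) by (auto simp: regular_map_def)
  then obtain q a b where *: "poly_fun q" "poly_fun a" "poly_fun b" "q (f p) \<noteq> 0"
     "\<forall>y\<in>Q. q y \<noteq> 0 \<longrightarrow> b y \<noteq> 0 \<and> g y = a y / b y"
    using regular_funE[OF assms(1)] by blast
  have **: "regular_fun U (\<lambda>x. q (f x))" "regular_fun U (\<lambda>x. a (f x))" "regular_fun U (\<lambda>x. b (f x))"
    using * assms(2) by (auto intro: regular_map_poly)
  \<comment> \<open>On \<open>W\<close> the composite is a quotient of regular functions. Its local
    fractions hold only inside \<open>W\<close>, and the polynomial \<open>s\<close> obtained below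
    confines them to \<open>W\<close> near \<open>p\<close>.\<close>
  define W where "W = {x\<in>U. q (f x) \<noteq> 0}"
  have W: "open_in U W" "p \<in> W"
    using ** \<open>p \<in> U\<close> * by (auto simp: W_def intro: open_in_regular_nonzero)
  have "regular_fun W (\<lambda>x. a (f x) / b (f x))"
    using ** * assms(2) by (intro regular_intros) (auto simp: W_def regular_map_def intro: regular_fun_subset)
  then obtain r c d where r: "poly_fun r" "poly_fun c" "poly_fun d" "r p \<noteq> 0"
     "\<forall>x\<in>W. r x \<noteq> 0 \<longrightarrow> d x \<noteq> 0 \<and> a (f x) / b (f x) = c x / d x"
    using regular_funE[OF _ W(2)] by blast
  obtain s where s: "poly_fun s" "s p \<noteq> 0" "{z\<in>U. s z \<noteq> 0} \<subseteq> W"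
    using open_inE[OF W] .
  have "\<forall>x\<in>W. g (f x) = a (f x) / b (f x)"
    using * assms(2) by (auto simp: W_def regular_map_def)
  then show "\<exists>q g' h. poly_fun q \<and> poly_fun g' \<and> poly_fun h \<and> q p \<noteq> 0 \<and>
     (\<forall>x\<in>U. q x \<noteq> 0 \<longrightarrow> h x \<noteq> 0 \<and> g (f x) = g' x / h x)"
    using r s by (intro exI[of _ "\<lambda>x. s x * r x"] exI[of _ c] exI[of _ d])
      (auto intro: poly_fun.mult)
qed

lemma regular_map_compose:
  assumes "regular_map Q Z g" "regular_map U Q f"
  shows "regular_map U Z (\<lambda>x. g (f x))"
  using assms regular_fun_compose[OF _ assms(2)] unfolding regular_map_def by fast

lemma open_in_preimage:
  assumes "regular_map U Q f" "open_in Q V"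
  shows "open_in U {x\<in>U. f x \<in> V}"
proof -
  have "\<exists>T. open_in U T \<and> x \<in> T \<and> T \<subseteq> {x\<in>U. f x \<in> V}" if x: "x \<in> U" "f x \<in> V" for x
  proof -
    obtain q where q: "poly_fun q" "q (f x) \<noteq> 0" "{z\<in>Q. q z \<noteq> 0} \<subseteq> V"
      using open_inE[OF assms(2) x(2)] .
    then show ?thesis
      using x assms(1) open_in_regular_nonzero[OF regular_map_poly[OF q(1) assms(1)]]
      by (intro exI[of _ "{x\<in>U. q (f x) \<noteq> 0}"]) (auto simp: regular_map_def)
  qed
  then show ?thesis
    by (subst openin_subopen) auto
qed

lemma regular_map_id: "U \<subseteq> Q \<Longrightarrow> regular_map U Q (\<lambda>x. x)"
  by (auto simp: regular_map_def intro: regular_fun_coord)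

lemma regular_map_complexI: "regular_fun U f \<Longrightarrow> (\<And>x. x \<in> U \<Longrightarrow> f x \<in> Q) \<Longrightarrow> regular_map U Q f"
  by (auto simp: regular_map_def coord_funs_complex_def)

lemma regular_map_complexD: "regular_map U Q f \<Longrightarrow> regular_fun U (f :: _ \<Rightarrow> complex)"
  by (auto simp: regular_map_def coord_funs_complex_def)

lemma regular_map_PairI:
  assumes "regular_map U Q f" "regular_map U Z g"
  shows "regular_map U (Q \<times> Z) (\<lambda>x. (f x, g x))"
  using assms by (auto simp: regular_map_def coord_funs_prod_def)

lemma regular_map_fst: "U \<subseteq> Q \<times> Z \<Longrightarrow> regular_map U Q fst"
  unfolding regular_map_def by (auto intro!: regular_fun_coord simp: coord_funs_prod_def)

lemma regular_map_snd: "U \<subseteq> Q \<times> Z \<Longrightarrow> regular_map U Z snd"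
  unfolding regular_map_def by (auto intro!: regular_fun_coord simp: coord_funs_prod_def)

lemma regular_map_vecI:
  fixes f :: "'a::affine_space \<Rightarrow> complex ^ 'n"
  assumes "\<And>i. regular_fun U (\<lambda>x. f x $ i)" "\<And>x. x \<in> U \<Longrightarrow> f x \<in> Q"
  shows "regular_map U Q f"
  using assms by (auto simp: regular_map_def coord_funs_vec_def coord_funs_complex_def)

lemma regular_map_vecD:
  fixes f :: "'a::affine_space \<Rightarrow> complex ^ 'n"
  shows "regular_map U Q f \<Longrightarrow> regular_fun U (\<lambda>x. f x $ i)"
  by (auto simp: regular_map_def coord_funs_vec_def coord_funs_complex_def)

lemma regular_fun_fst [regular_intros]: "regular_fun U (fst :: complex \<times> 'a::affine_space \<Rightarrow> complex)"
  using regular_map_complexD[OF regular_map_fst[of U UNIV UNIV]] by simp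

lemma regular_fun_fst_snd [regular_intros]:
  "regular_fun U (\<lambda>x :: 'b::affine_space \<times> complex \<times> 'a::affine_space. fst (snd x))"
  by (rule regular_fun_coord) (auto simp: coord_funs_prod_def coord_funs_complex_def image_iff)

lemma regular_fun_vec [regular_intros]: "regular_fun U (\<lambda>x :: complex ^ 'n. x $ i)"
  by (rule regular_fun_coord) (auto simp: coord_funs_vec_def coord_funs_complex_def)

lemma regular_fun_snd_vec [regular_intros]:
  "regular_fun U (\<lambda>x :: 'a::affine_space \<times> (complex ^ 'n). snd x $ i)"
  by (rule regular_fun_coord)
    (auto simp: coord_funs_prod_def coord_funs_vec_def coord_funs_complex_def image_iff)

section \<open>Irreducible sets and generic points\<close>

text \<open>The irreducibility clause of \<open>quasi_affine_variety\<close>, isolated so that it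
  also serves tori and products with \<open>Cstar\<close>.\<close>

definition irreducible_set :: "'a::affine_space set \<Rightarrow> bool" where
  "irreducible_set X \<longleftrightarrow> X \<noteq> {} \<and>
     (\<forall>U V. open_in X U \<and> open_in X V \<and> U \<noteq> {} \<and> V \<noteq> {} \<longrightarrow> U \<inter> V \<noteq> {})"

text \<open>In an irreducible space every nonempty open set is dense, so each density claim is
  reduced to openness and one witness point.\<close>

lemma dense_open_in_iff:
  assumes "irreducible_set X"
  shows "dense_open_in X U \<longleftrightarrow> open_in X U \<and> U \<noteq> {}"
proof
  assume "dense_open_in X U"
  then show "open_in X U \<and> U \<noteq> {}"
    using assms unfolding dense_open_in_def irreducible_set_def by fastforce
next
  assume U: "open_in X U \<and> U \<noteq> {}"
  have "X \<subseteq> subtopology zariski X closure_of U"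
  proof
    fix x assume "x \<in> X"
    moreover have "\<exists>y. y \<in> U \<and> y \<in> T" if "open_in X T" "x \<in> T" for T
    proof -
      have "U \<inter> T \<noteq> {}"
        using assms U that unfolding irreducible_set_def by (metis empty_iff)
      then show ?thesis
        by blast
    qed
    ultimately show "x \<in> subtopology zariski X closure_of U"
      by (auto simp: in_closure_of)
  qed
  moreover have "subtopology zariski X closure_of U \<subseteq> X"
    using closure_of_subset_topspace[of "subtopology zariski X" U] by simp
  ultimately show "dense_open_in X U"
    using U unfolding dense_open_in_def by blast
qed

text \<open>An identity of rational maps holds eventually along this filter. For a regular map \<open>f\<close> on a
  dense open subset of \<open>X\<close>, \<open>filterlim f (generic Q) (generic X)\<close> says that \<open>f\<close> is dominant.\<close>

definition generic :: "'a::affine_space set \<Rightarrow> 'a filter" where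
  "generic X = (INF U\<in>Collect (dense_open_in X). principal U)"

lemma eventually_generic:
  assumes X: "irreducible_set X"
  shows "eventually P (generic X) \<longleftrightarrow> (\<exists>U. dense_open_in X U \<and> (\<forall>x\<in>U. P x))"
proof -
  have "dense_open_in X X"
    using X by (simp add: dense_open_in_iff irreducible_set_def)
  moreover have "dense_open_in X (U \<inter> V)" if "dense_open_in X U" "dense_open_in X V" for U V
    using X that by (auto simp: dense_open_in_iff irreducible_set_def)
  ultimately show ?thesis
    unfolding generic_def by (subst eventually_INF_base) (auto simp: eventually_principal)
qed

lemma eventually_genericI:
  assumes "irreducible_set X" "open_in X U" "x \<in> U" "\<And>x. x \<in> U \<Longrightarrow> P x"
  shows "eventually P (generic X)"
  using assms by (auto simp: eventually_generic dense_open_in_iff)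

lemma eventually_genericE:
  assumes "irreducible_set X" "eventually P (generic X)"
  obtains U where "open_in X U" "U \<noteq> {}" "\<And>x. x \<in> U \<Longrightarrow> P x"
  using assms by (auto simp: eventually_generic dense_open_in_iff)

lemma eventually_in_generic:
  "irreducible_set X \<Longrightarrow> \<forall>\<^sub>F x in generic X. x \<in> X"
  by (rule eventually_genericI[of X X "SOME x. x \<in> X"])
    (auto simp: irreducible_set_def some_in_eq)

lemma eventually_generic_meets_open:
  assumes "irreducible_set X" "eventually P (generic X)" "open_in X U" "U \<noteq> {}"
  obtains x where "x \<in> U" "P x"
proof -
  obtain V where V: "open_in X V" "V \<noteq> {}" "\<And>x. x \<in> V \<Longrightarrow> P x"
    using eventually_genericE[OF assms(1,2)] by blast
  then have "U \<inter> V \<noteq> {}"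
    using assms unfolding irreducible_set_def by blast
  then show ?thesis
    using V that by blast
qed

lemma eventually_generic_imp_ex:
  assumes "irreducible_set X" "eventually P (generic X)"
  obtains x where "x \<in> X" "P x"
  using eventually_generic_meets_open[OF assms open_in_self] assms(1)
  unfolding irreducible_set_def by blast

lemma eventually_generic_nonzero:
  assumes "irreducible_set X" "open_in X U" "regular_fun U f" "x \<in> U" "f x \<noteq> 0"
  shows "\<forall>\<^sub>F x in generic X. x \<in> U \<and> f x \<noteq> 0"
  using open_in_trans[OF assms(2) open_in_regular_nonzero[OF assms(3)]] assms
  by (intro eventually_genericI[of X "{x\<in>U. f x \<noteq> 0}" x]) auto

lemma rat_eq_iff:
  "irreducible_set X \<Longrightarrow> rat_eq X f g \<longleftrightarrow> (\<forall>\<^sub>F x in generic X. x \<in> dom f \<and> f x = g x)"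
  by (simp add: rat_eq_def eventually_generic)

text \<open>Preimages of nonempty open sets are open and nonempty, hence meet. Through this lemma
  \<open>V1\<close>, \<open>V2\<close> and the products with \<open>Cstar\<close> inherit
  irreducibility from tori.\<close>

lemma irreducible_set_image:
  assumes "irreducible_set T" "regular_map T X f" "f ` T = X"
  shows "irreducible_set X"
  unfolding irreducible_set_def
proof (intro conjI allI impI)
  show "X \<noteq> {}"
    using assms unfolding irreducible_set_def by blast
  fix U V assume *: "open_in X U \<and> open_in X V \<and> U \<noteq> {} \<and> V \<noteq> {}"
  then have "open_in T {x\<in>T. f x \<in> U}" "open_in T {x\<in>T. f x \<in> V}"
    using assms by (auto intro: open_in_preimage)
  moreover have "{x\<in>T. f x \<in> U} \<noteq> {}" "{x\<in>T. f x \<in> V} \<noteq> {}"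
    using * assms(3) open_in_subset[of X U] open_in_subset[of X V] by blast+
  ultimately have "{x\<in>T. f x \<in> U} \<inter> {x\<in>T. f x \<in> V} \<noteq> {}"
    using assms(1) unfolding irreducible_set_def by blast
  then show "U \<inter> V \<noteq> {}"
    by blast
qed

text \<open>If the image meets every nonempty open set, preimages of such sets are nonempty open,
  hence dense; so generic properties pull back along \<open>f\<close>.\<close>

lemma filterlim_generic:
  assumes X: "irreducible_set X" and Q: "irreducible_set Q" and S: "open_in X S"
    and f: "regular_map S Q f" and hit: "\<And>U. open_in Q U \<Longrightarrow> U \<noteq> {} \<Longrightarrow> \<exists>x\<in>S. f x \<in> U"
  shows "filterlim f (generic Q) (generic X)"
  unfolding filterlim_iff
proof (intro allI impI)
  fix P assume "eventually P (generic Q)"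
  then obtain U where U: "open_in Q U" "U \<noteq> {}" "\<And>x. x \<in> U \<Longrightarrow> P x"
    using eventually_genericE[OF Q] by blast
  have "open_in X {x\<in>S. f x \<in> U}"
    using open_in_trans[OF S open_in_preimage[OF f U(1)]] .
  moreover obtain x where "x \<in> {x\<in>S. f x \<in> U}"
    using hit[OF U(1,2)] by auto
  ultimately show "\<forall>\<^sub>F x in generic X. P (f x)"
    by (rule eventually_genericI[OF X]) (simp add: U(3))
qed

lemma filterlim_generic_surj:
  assumes "irreducible_set X" "irreducible_set Q" "regular_map X Q f" "f ` X = Q"
  shows "filterlim f (generic Q) (generic X)"
proof (rule filterlim_generic[OF assms(1,2) open_in_self assms(3)])
  fix U assume "open_in Q U" "U \<noteq> {}"
  then obtain y where "y \<in> U" "y \<in> Q"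
    using open_in_subset[of Q U] by blast
  then show "\<exists>x\<in>X. f x \<in> U"
    using assms(4) by blast
qed

text \<open>A nonempty open set contains a point x with \<open>f (g x) = x\<close>, and
  \<open>g x\<close> is then a point of \<open>S\<close> sent into that set.\<close>

lemma filterlim_generic_inverse:
  assumes X: "irreducible_set X" and S: "open_in X S" and f: "regular_map S X f"
    and g: "\<forall>\<^sub>F x in generic X. g x \<in> S \<and> f (g x) = x"
  shows "filterlim f (generic X) (generic X)"
proof (rule filterlim_generic[OF X X S f])
  fix U assume "open_in X U" "U \<noteq> {}"
  then obtain x where "x \<in> U" "g x \<in> S \<and> f (g x) = x"
    using eventually_generic_meets_open[OF X g] by blast
  then show "\<exists>x\<in>S. f x \<in> U"
    by (intro bexI[of _ "g x"]) auto
qed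

text \<open>Points of the torus are joined by polynomial curves, and a polynomial curve that meets an
  open set has all but finitely many of its points there.\<close>

definition polynomial_curve :: "(complex \<Rightarrow> 'a::affine_space) \<Rightarrow> bool" where
  "polynomial_curve L \<longleftrightarrow> (\<forall>\<phi>\<in>coord_funs. \<exists>P. \<forall>t. \<phi> (L t) = poly P t)"

definition curve_connected :: "'a::affine_space itself \<Rightarrow> bool" where
  "curve_connected _ \<longleftrightarrow> (\<forall>a b :: 'a. \<exists>L. polynomial_curve L \<and> L 0 = a \<and> L 1 = b)"

lemma curve_connected_complex: "curve_connected TYPE(complex)"
  unfolding curve_connected_def
proof (intro allI)
  fix a b :: complex
  have "\<exists>P. \<forall>t. a + t * (b - a) = poly P t"
    by (rule exI[of _ "[:a, b - a:]"]) simp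
  then show "\<exists>L. polynomial_curve L \<and> L 0 = a \<and> L 1 = b"
    by (intro exI[of _ "\<lambda>t. a + t * (b - a)"])
      (auto simp: polynomial_curve_def coord_funs_complex_def)
qed

lemma curve_connected_vec: "curve_connected TYPE(complex ^ 'n)"
  unfolding curve_connected_def
proof (intro allI)
  fix a b :: "complex ^ 'n"
  have "\<exists>P. \<forall>t. a $ i + t * (b $ i - a $ i) = poly P t" for i
    by (rule exI[of _ "[:a $ i, b $ i - a $ i:]"]) simp
  then show "\<exists>L. polynomial_curve L \<and> L 0 = a \<and> L 1 = b"
    by (intro exI[of _ "\<lambda>t. \<chi> i. a $ i + t * (b $ i - a $ i)"])
      (auto simp: polynomial_curve_def coord_funs_complex_def coord_funs_vec_def vec_eq_iff)
qed

lemma curve_connected_prod: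
  assumes "curve_connected TYPE('a::affine_space)" "curve_connected TYPE('b::affine_space)"
  shows "curve_connected TYPE('a \<times> 'b)"
  unfolding curve_connected_def
proof (intro allI)
  fix p q :: "'a \<times> 'b"
  obtain L where "polynomial_curve L" "L 0 = fst p" "L 1 = fst q"
    using assms(1) unfolding curve_connected_def by blast
  moreover obtain M where "polynomial_curve M" "M 0 = snd p" "M 1 = snd q"
    using assms(2) unfolding curve_connected_def by blast
  ultimately show "\<exists>L. polynomial_curve L \<and> L 0 = p \<and> L 1 = q"
    by (intro exI[of _ "\<lambda>t. (L t, M t)"]) (auto simp: polynomial_curve_def coord_funs_prod_def)
qed

lemma polynomial_curve_poly_fun:
  assumes "polynomial_curve L" "poly_fun p"
  shows "\<exists>P. \<forall>t. p (L t) = poly P t"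
  using assms(2)
proof induction
  case (coord \<phi>)
  then show ?case using assms(1) by (simp add: polynomial_curve_def)
next
  case (const c)
  then show ?case by (intro exI[of _ "[:c:]"]) simp
next
  case (add f g)
  then obtain P R where "\<forall>t. f (L t) = poly P t" "\<forall>t. g (L t) = poly R t"
    by blast
  then show ?case by (intro exI[of _ "P + R"]) simp
next
  case (mult f g)
  then obtain P R where "\<forall>t. f (L t) = poly P t" "\<forall>t. g (L t) = poly R t"
    by blast
  then show ?case by (intro exI[of _ "P * R"]) simp
qed

lemma finite_polynomial_curve_zeros:
  assumes "polynomial_curve L" "poly_fun p" "p (L a) \<noteq> 0"
  shows "finite {t. p (L t) = 0}"
proof -
  obtain P where P: "\<forall>t. p (L t) = poly P t"
    using polynomial_curve_poly_fun[OF assms(1,2)] by blast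
  then have "P \<noteq> 0"
    using assms(3) by auto
  then show ?thesis
    using poly_roots_finite[of P] P by simp
qed

lemma irreducible_torus:
  assumes "curve_connected TYPE('a::affine_space)" "(torus :: 'a set) \<noteq> {}"
  shows "irreducible_set (torus :: 'a set)"
  unfolding irreducible_set_def
proof (intro conjI allI impI assms(2))
  fix U V :: "'a set"
  assume *: "open_in torus U \<and> open_in torus V \<and> U \<noteq> {} \<and> V \<noteq> {}"
  then obtain a b where ab: "a \<in> U" "b \<in> V"
    by blast
  obtain p where p: "poly_fun p" "p a \<noteq> 0" "{z\<in>torus. p z \<noteq> 0} \<subseteq> U"
    using * ab open_inE[of torus U a] by metis
  obtain q where q: "poly_fun q" "q b \<noteq> 0" "{z\<in>torus. q z \<noteq> 0} \<subseteq> V"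
    using * ab open_inE[of torus V b] by metis
  have tor: "a \<in> torus" "b \<in> torus"
    using * ab open_in_subset[of torus U] open_in_subset[of torus V] by auto
  obtain L where L: "polynomial_curve L" "L 0 = a" "L 1 = b"
    using assms(1) unfolding curve_connected_def by blast
  have "finite {t. p (L t) = 0}" "finite {t. q (L t) = 0}"
    using finite_polynomial_curve_zeros[OF L(1) p(1), of 0]
      finite_polynomial_curve_zeros[OF L(1) q(1), of 1] p q L by auto
  moreover have "finite (\<Union>\<phi>\<in>coord_funs. {t. \<phi> (L t) = 0})"
  proof (rule finite_UN_I[OF finite_coord_funs])
    fix \<phi> :: "'a \<Rightarrow> complex" assume "\<phi> \<in> coord_funs"
    then show "finite {t. \<phi> (L t) = 0}"
      using finite_polynomial_curve_zeros[OF L(1) poly_fun.coord, of \<phi> 0] tor L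
      by (auto simp: torus_def)
  qed
  ultimately have "finite ({t. p (L t) = 0} \<union> {t. q (L t) = 0} \<union> (\<Union>\<phi>\<in>coord_funs. {t. \<phi> (L t) = 0}))"
    by blast
  then obtain t where "t \<notin> {t. p (L t) = 0} \<union> {t. q (L t) = 0} \<union> (\<Union>\<phi>\<in>coord_funs. {t. \<phi> (L t) = 0})"
    using ex_new_if_finite[OF infinite_UNIV_char_0] by metis
  then have "L t \<in> U \<inter> V"
    using p(3) q(3) by (auto simp: torus_def)
  then show "U \<inter> V \<noteq> {}"
    by blast
qed

lemma mem_torus_complex [simp]: "(c :: complex) \<in> torus \<longleftrightarrow> c \<noteq> 0"
  by (simp add: torus_def coord_funs_complex_def)

lemma mem_torus_vec: "(x :: complex ^ 'n) \<in> torus \<longleftrightarrow> (\<forall>i. x $ i \<noteq> 0)"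
  by (auto simp: torus_def coord_funs_complex_def coord_funs_vec_def)

lemma torus_prod: "torus = torus \<times> torus"
  by (simp add: torus_def coord_funs_prod_def ball_Un set_eq_iff)

lemma torus_complex: "torus = Cstar"
  by auto

section \<open>Partial regular maps\<close>

text \<open>Unlike \<open>rational_map\<close> this admits an empty domain, so it is closed under
  composition; nonemptiness is established separately from generic values.\<close>

definition partial_map :: "'a::affine_space set \<Rightarrow> 'b::affine_space set \<Rightarrow> ('a \<rightharpoonup> 'b) \<Rightarrow> bool" where
  "partial_map X Z f \<longleftrightarrow> open_in X (dom f) \<and> regular_map (dom f) Z (\<lambda>x. the (f x))"

lemma rational_map_iff:
  "irreducible_set X \<Longrightarrow> rational_map X Z f \<longleftrightarrow> partial_map X Z f \<and> dom f \<noteq> {}"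
  by (auto simp: rational_map_def partial_map_def dense_open_in_iff)

lemma partial_mapI:
  assumes "open_in X S" "regular_map S Z g" "\<And>x. f x = (if x \<in> S then Some (g x) else None)"
  shows "partial_map X Z f"
proof -
  have "dom f = S"
    using assms(3) by (auto split: if_splits)
  then show ?thesis
    using assms regular_map_cong[of S "\<lambda>x. the (f x)" g] by (auto simp: partial_map_def)
qed

lemma partial_map_total:
  "regular_map X Z g \<Longrightarrow> (\<And>x. x \<in> X \<Longrightarrow> f x = Some (g x)) \<Longrightarrow> dom f \<subseteq> X \<Longrightarrow> partial_map X Z f"
  by (rule partial_mapI[OF open_in_self]) auto

lemma partial_map_compose:
  assumes f: "partial_map X Z f" and g: "partial_map Z W g"
  shows "partial_map X W (g \<circ>\<^sub>m f)"
proof (rule partial_mapI)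
  let ?S = "{x\<in>dom f. the (f x) \<in> dom g}"
  show "open_in X ?S"
    using f g by (auto simp: partial_map_def intro: open_in_trans open_in_preimage)
  have "regular_map ?S (dom g) (\<lambda>x. the (f x))"
    using f unfolding partial_map_def regular_map_def
    by (auto intro: regular_fun_subset)
  then show "regular_map ?S W (\<lambda>x. the (g (the (f x))))"
    using g by (auto simp: partial_map_def intro: regular_map_compose[rotated])
  show "(g \<circ>\<^sub>m f) x = (if x \<in> ?S then Some (the (g (the (f x)))) else None)" for x
    by (auto simp: map_comp_def split: option.splits)
qed

text \<open>The product of f with the identity of \<open>Cstar\<close>. It allows a family such as
  \<open>\<tau>\<close> after \<open>e0_V2 c\<close> after \<open>\<sigma>\<close> to be written as
  one composition in the variables c and v; the case c = 0 keeps the domain inside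
  \<open>Cstar\<close>.\<close>

lemma partial_map_Pair:
  assumes "partial_map X Z f"
  shows "partial_map (Cstar \<times> X) (Cstar \<times> Z)
    (\<lambda>(c, x). if c = 0 then None else map_option (Pair c) (f x))"
proof (rule partial_mapI)
  let ?S = "Cstar \<times> dom f"
  have snd: "regular_map (Cstar \<times> X) X snd"
    by (rule regular_map_snd) auto
  have fX: "dom f \<subseteq> X"
    using assms open_in_subset by (auto simp: partial_map_def)
  have "open_in (Cstar \<times> X) {x\<in>Cstar \<times> X. snd x \<in> dom f}"
    using open_in_preimage[OF snd] assms by (simp add: partial_map_def)
  also have "{x\<in>Cstar \<times> X. snd x \<in> dom f} = ?S"
    using fX by auto
  finally show "open_in (Cstar \<times> X) ?S" .
  show "regular_map ?S (Cstar \<times> Z) (\<lambda>x. (fst x, the (f (snd x))))"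
    using assms regular_map_compose[OF _ regular_map_snd, of "dom f" Z "\<lambda>x. the (f x)" ?S Cstar]
    by (intro regular_map_PairI regular_map_fst[of _ _ "dom f"]) (auto simp: partial_map_def)
  show "(case x of (c, x) \<Rightarrow> if c = 0 then None else map_option (Pair c) (f x)) =
      (if x \<in> ?S then Some (fst x, the (f (snd x))) else None)" for x
    by (cases x) (auto split: if_splits)
qed

text \<open>If some coordinate of the two values differed at x, it would differ on a nonempty open
  set, which must contain a point of generic agreement.\<close>

lemma partial_map_eventually_eq_imp_eq:
  assumes X: "irreducible_set X" and f: "partial_map X Z f" and g: "partial_map X Z g"
    and eq: "\<forall>\<^sub>F x in generic X. f x = g x" and x: "x \<in> dom f" "x \<in> dom g"
  shows "f x = g x"
proof -
  let ?S = "dom f \<inter> dom g"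
  have S: "open_in X ?S"
    using f g by (auto simp: partial_map_def)
  have "\<phi> (the (f x)) = \<phi> (the (g x))" if \<phi>: "\<phi> \<in> coord_funs" for \<phi>
  proof (rule ccontr)
    assume ne: "\<phi> (the (f x)) \<noteq> \<phi> (the (g x))"
    have "regular_fun ?S (\<lambda>x. \<phi> (the (f x)) - \<phi> (the (g x)))"
      using f g \<phi> unfolding partial_map_def regular_map_def
      by (intro regular_intros) (auto intro: regular_fun_subset)
    then have "open_in X {x \<in> ?S. \<phi> (the (f x)) - \<phi> (the (g x)) \<noteq> 0}"
      by (intro open_in_trans[OF S] open_in_regular_nonzero)
    moreover have "{x \<in> ?S. \<phi> (the (f x)) - \<phi> (the (g x)) \<noteq> 0} \<noteq> {}"
      using ne x by auto
    ultimately obtain y where "y \<in> {x \<in> ?S. \<phi> (the (f x)) - \<phi> (the (g x)) \<noteq> 0}" "f y = g y"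
      by (rule eventually_generic_meets_open[OF X eq])
    then show False
      by auto
  qed
  then have "the (f x) = the (g x)"
    by (rule coord_funs_separate)
  then show ?thesis
    using x by auto
qed

text \<open>The choice operator selects an unknown representative, but all representatives defined
  at x have the same value there.\<close>

lemma rat_ext_eq:
  assumes X: "irreducible_set X" and g: "rational_map X Z g" "rat_eq X g f" "x \<in> dom g"
  shows "rat_ext X Z f x = g x"
proof -
  let ?P = "\<lambda>h. rational_map X Z h \<and> rat_eq X h f \<and> x \<in> dom h"
  have h: "?P (SOME h. ?P h)"
    by (rule someI[of ?P g]) (use g in simp)
  define k where "k = (SOME h. ?P h)"
  have k: "rational_map X Z k" "rat_eq X k f" "x \<in> dom k"
    using h by (simp_all add: k_def)
  have "k x = g x"
  proof (rule partial_map_eventually_eq_imp_eq[OF X])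
    show "partial_map X Z k" "partial_map X Z g" "x \<in> dom k" "x \<in> dom g"
      using k g rational_map_iff[OF X] by blast+
    have "\<forall>\<^sub>F y in generic X. k y = f y" "\<forall>\<^sub>F y in generic X. g y = f y"
      using k g by (auto simp: rat_eq_iff[OF X] elim: eventually_mono)
    then show "\<forall>\<^sub>F y in generic X. k y = g y"
      by eventually_elim simp
  qed
  moreover have "\<exists>h. ?P h"
    using g by blast
  ultimately show ?thesis
    by (simp add: rat_ext_def k_def)
qed

lemma open_in_dom_rat_ext:
  assumes X: "irreducible_set X"
  shows "open_in X (dom (rat_ext X Z f))"
proof -
  have "dom (rat_ext X Z f) = \<Union>{dom g | g. rational_map X Z g \<and> rat_eq X g f}"
  proof (intro equalityI subsetI)
    fix x assume "x \<in> dom (rat_ext X Z f)"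
    then have "\<exists>g. rational_map X Z g \<and> rat_eq X g f \<and> x \<in> dom g"
      unfolding rat_ext_def domIff by meson
    then show "x \<in> \<Union>{dom g | g. rational_map X Z g \<and> rat_eq X g f}"
      by blast
  next
    fix x assume "x \<in> \<Union>{dom g | g. rational_map X Z g \<and> rat_eq X g f}"
    then obtain g where g: "rational_map X Z g" "rat_eq X g f" "x \<in> dom g"
      by blast
    then show "x \<in> dom (rat_ext X Z f)"
      using rat_ext_eq[OF X g] by (simp add: domIff)
  qed
  also have "open_in X \<dots>"
    by (rule openin_Union) (auto simp: rational_map_iff[OF X] partial_map_def)
  finally show ?thesis .
qed

section \<open>Positivity\<close>

text \<open>Equality is asked on the torus only. Off the torus a product of two characters need not
  be a character: at 0 the product of the powers 1 and -1 is 0, while the power 0 is 1.\<close>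

definition pos_comb :: "('a::affine_space \<Rightarrow> complex) \<Rightarrow> bool" where
  "pos_comb f \<longleftrightarrow> (\<exists>g. positive_combination g \<and> (\<forall>x\<in>torus. f x = g x))"

text \<open>Generic equality matches the use of \<open>rat_eq\<close> in
  \<open>positive_fun\<close>, and the class is closed under products and inverses.\<close>

definition pos_quot :: "('a::affine_space \<Rightarrow> complex) \<Rightarrow> bool" where
  "pos_quot f \<longleftrightarrow> (\<exists>g h. pos_comb g \<and> pos_comb h \<and> (\<forall>\<^sub>F x in generic torus. f x = g x / h x))"

named_theorems pos_intros

lemma pos_comb_character:
  assumes "\<kappa> \<in> characters" "r > 0"
  shows "pos_comb (\<lambda>x. of_real r * \<kappa> x)"
  unfolding pos_comb_def positive_combination_def
  using assms by (intro exI[of _ "\<lambda>x. of_real r * \<kappa> x"] conjI exI[of _ "{\<kappa>}"] exI[of _ "\<lambda>_. r"]) auto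

lemma pos_comb_add [pos_intros]:
  assumes "pos_comb f" "pos_comb f'"
  shows "pos_comb (\<lambda>x. f x + f' x)"
proof -
  obtain S a where S: "finite S" "S \<noteq> {}" "S \<subseteq> characters" "\<forall>\<kappa>\<in>S. (a \<kappa> :: real) > 0"
      and f: "\<forall>x\<in>torus. f x = (\<Sum>\<kappa>\<in>S. of_real (a \<kappa>) * \<kappa> x)"
    using assms(1) unfolding pos_comb_def positive_combination_def by auto
  obtain R b where R: "finite R" "R \<noteq> {}" "R \<subseteq> characters" "\<forall>\<kappa>\<in>R. (b \<kappa> :: real) > 0"
      and f': "\<forall>x\<in>torus. f' x = (\<Sum>\<kappa>\<in>R. of_real (b \<kappa>) * \<kappa> x)"
    using assms(2) unfolding pos_comb_def positive_combination_def by auto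
  \<comment> \<open>The two supports may share characters, whose coefficients then add up.\<close>
  define c where "c \<kappa> = (if \<kappa> \<in> S then a \<kappa> else 0) + (if \<kappa> \<in> R then b \<kappa> else 0)" for \<kappa>
  have c: "\<forall>\<kappa>\<in>S \<union> R. c \<kappa> > 0"
    using S R by (auto simp: c_def intro: add_pos_pos)
  have "f x + f' x = (\<Sum>\<kappa>\<in>S \<union> R. of_real (c \<kappa>) * \<kappa> x)" if "x \<in> torus" for x
  proof -
    have "(\<Sum>\<kappa>\<in>S. of_real (a \<kappa>) * \<kappa> x) = (\<Sum>\<kappa>\<in>S \<union> R. of_real (if \<kappa> \<in> S then a \<kappa> else 0) * \<kappa> x)"
      using S R by (intro sum.mono_neutral_cong_left) auto
    moreover have "(\<Sum>\<kappa>\<in>R. of_real (b \<kappa>) * \<kappa> x) = (\<Sum>\<kappa>\<in>S \<union> R. of_real (if \<kappa> \<in> R then b \<kappa> else 0) * \<kappa> x)"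
      using S R by (intro sum.mono_neutral_cong_left) auto
    ultimately show ?thesis
      using f f' that by (simp add: c_def sum.distrib algebra_simps)
  qed
  then show ?thesis
    unfolding pos_comb_def positive_combination_def
    using S R c by (intro exI[of _ "\<lambda>x. \<Sum>\<kappa>\<in>S \<union> R. of_real (c \<kappa>) * \<kappa> x"] conjI exI[of _ "S \<union> R"] exI[of _ c]) auto
qed

lemma pos_comb_sum:
  assumes "finite S" "S \<noteq> {}" "\<And>\<kappa>. \<kappa> \<in> S \<Longrightarrow> pos_comb (f \<kappa>)"
  shows "pos_comb (\<lambda>x. \<Sum>\<kappa>\<in>S. f \<kappa> x)"
  using assms by (induction S rule: finite_ne_induct) (auto intro: pos_comb_add)

lemma pos_comb_cong: "(\<And>x. x \<in> torus \<Longrightarrow> f x = g x) \<Longrightarrow> pos_comb f \<longleftrightarrow> pos_comb g"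
  unfolding pos_comb_def by simp

lemma characters_mult:
  assumes "\<kappa> \<in> characters" "\<mu> \<in> characters"
  shows "\<exists>\<nu>\<in>characters. \<forall>x\<in>torus. \<kappa> x * \<mu> x = \<nu> x"
proof -
  obtain m n where "\<kappa> = (\<lambda>x. \<Prod>\<phi>\<in>coord_funs. \<phi> x powi m \<phi>)" "\<mu> = (\<lambda>x. \<Prod>\<phi>\<in>coord_funs. \<phi> x powi n \<phi>)"
    using assms unfolding characters_def by blast
  then have "\<forall>x\<in>torus. \<kappa> x * \<mu> x = (\<Prod>\<phi>\<in>coord_funs. \<phi> x powi (m \<phi> + n \<phi>))"
    by (auto simp: torus_def power_int_add simp flip: prod.distrib intro!: prod.cong)
  then show ?thesis
    unfolding characters_def by (intro bexI[of _ "\<lambda>x. \<Prod>\<phi>\<in>coord_funs. \<phi> x powi (m \<phi> + n \<phi>)"]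
      range_eqI[of _ _ "\<lambda>\<phi>. m \<phi> + n \<phi>"] refl)
qed

lemma pos_comb_mult [pos_intros]:
  assumes "pos_comb f" "pos_comb f'"
  shows "pos_comb (\<lambda>x. f x * f' x)"
proof -
  obtain S a where S: "finite S" "S \<noteq> {}" "S \<subseteq> characters" "\<forall>\<kappa>\<in>S. (a \<kappa> :: real) > 0"
      and f: "\<forall>x\<in>torus. f x = (\<Sum>\<kappa>\<in>S. of_real (a \<kappa>) * \<kappa> x)"
    using assms(1) unfolding pos_comb_def positive_combination_def by auto
  obtain R b where R: "finite R" "R \<noteq> {}" "R \<subseteq> characters" "\<forall>\<kappa>\<in>R. (b \<kappa> :: real) > 0"
      and f': "\<forall>x\<in>torus. f' x = (\<Sum>\<kappa>\<in>R. of_real (b \<kappa>) * \<kappa> x)"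
    using assms(2) unfolding pos_comb_def positive_combination_def by auto
  \<comment> \<open>Summing over pairs avoids grouping pairs with the same product character;
    \<open>pos_comb_sum\<close> does the grouping through repeated addition.\<close>
  have "pos_comb (\<lambda>x. \<Sum>p\<in>S \<times> R. of_real (a (fst p)) * fst p x * (of_real (b (snd p)) * snd p x))"
  proof (rule pos_comb_sum)
    fix p assume "p \<in> S \<times> R"
    then have "fst p \<in> characters" "snd p \<in> characters"
      using S R by auto
    then obtain \<nu> where \<nu>: "\<nu> \<in> characters" "\<forall>x\<in>torus. fst p x * snd p x = \<nu> x"
      using characters_mult by blast
    have "pos_comb (\<lambda>x. of_real (a (fst p) * b (snd p)) * \<nu> x)"
      using \<open>p \<in> S \<times> R\<close> S R by (intro pos_comb_character \<nu>) auto
    moreover have "of_real (a (fst p)) * fst p x * (of_real (b (snd p)) * snd p x)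
        = of_real (a (fst p) * b (snd p)) * \<nu> x" if "x \<in> torus" for x
      using \<nu>(2)[rule_format, OF that, symmetric] by (simp add: ac_simps)
    ultimately show "pos_comb (\<lambda>x. of_real (a (fst p)) * fst p x * (of_real (b (snd p)) * snd p x))"
      by (subst pos_comb_cong)
  qed (use S R in auto)
  moreover have "f x * f' x = (\<Sum>p\<in>S \<times> R. of_real (a (fst p)) * fst p x * (of_real (b (snd p)) * snd p x))"
    if "x \<in> torus" for x
    using f f' that by (simp add: sum_product sum.cartesian_product case_prod_beta)
  ultimately show ?thesis
    by (subst pos_comb_cong)
qed

lemma pos_comb_coord:
  assumes "\<phi> \<in> coord_funs"
  shows "pos_comb \<phi>"
proof -
  have "(\<lambda>x. \<Prod>\<psi>\<in>coord_funs. \<psi> x powi (if \<psi> = \<phi> then 1 else 0)) \<in> characters"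
    unfolding characters_def by (rule range_eqI[of _ _ "\<lambda>\<psi>. if \<psi> = \<phi> then 1 else 0"]) (rule refl)
  moreover have "(\<Prod>\<psi>\<in>coord_funs. \<psi> x powi (if \<psi> = \<phi> then 1 else 0)) = \<phi> x" for x
  proof -
    have "(\<Prod>\<psi>\<in>coord_funs. \<psi> x powi (if \<psi> = \<phi> then 1 else 0))
        = (\<Prod>\<psi>\<in>coord_funs. if \<psi> = \<phi> then \<psi> x else 1)"
      by (intro prod.cong) auto
    also have "\<dots> = \<phi> x"
      using assms finite_coord_funs by (subst prod.delta) auto
    finally show ?thesis .
  qed
  ultimately show ?thesis
    using pos_comb_character[of \<phi> 1] by simp
qed

lemma pos_comb_const:
  assumes "r > 0"
  shows "pos_comb (\<lambda>x. of_real r)"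
proof -
  have "(\<lambda>x. \<Prod>\<psi>\<in>coord_funs. \<psi> x powi 0) \<in> characters"
    unfolding characters_def by (rule range_eqI[of _ _ "\<lambda>_. 0"]) (rule refl)
  then show ?thesis
    using pos_comb_character[of "\<lambda>x. 1" r] assms by simp
qed

lemma pos_comb_1 [pos_intros]: "pos_comb (\<lambda>x. 1)"
  using pos_comb_const[of 1] by simp

lemma pos_comb_numeral [pos_intros]: "pos_comb (\<lambda>x. numeral n)"
  using pos_comb_const[of "numeral n"] by simp

lemma pos_comb_power [pos_intros]: "pos_comb f \<Longrightarrow> pos_comb (\<lambda>x. f x ^ n)"
  by (induction n) (auto intro: pos_intros)

lemma pos_comb_vec [pos_intros]: "pos_comb (\<lambda>x :: complex ^ 'n. x $ i)"
  by (rule pos_comb_coord) (auto simp: coord_funs_vec_def coord_funs_complex_def)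

lemma pos_comb_fst [pos_intros]: "pos_comb (\<lambda>x :: complex \<times> 'a::affine_space. fst x)"
  by (rule pos_comb_coord) (auto simp: coord_funs_prod_def coord_funs_complex_def)

lemma pos_comb_snd_vec [pos_intros]: "pos_comb (\<lambda>x :: 'a::affine_space \<times> (complex ^ 'n). snd x $ i)"
  by (rule pos_comb_coord)
    (auto simp: coord_funs_prod_def coord_funs_vec_def coord_funs_complex_def image_iff)

lemma regular_fun_character:
  assumes "\<kappa> \<in> characters"
  shows "regular_fun torus \<kappa>"
proof -
  obtain m where m: "\<kappa> = (\<lambda>x. \<Prod>\<phi>\<in>coord_funs. \<phi> x powi m \<phi>)"
    using assms unfolding characters_def by blast
  show ?thesis
    unfolding m
    by (intro regular_fun_prod regular_fun_power_int regular_fun_coord) (auto simp: torus_def)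
qed

lemma regular_fun_pos_comb:
  assumes "pos_comb f"
  shows "regular_fun torus f"
proof -
  obtain S a where S: "S \<subseteq> characters" and f: "\<forall>x\<in>torus. f x = (\<Sum>\<kappa>\<in>S. of_real (a \<kappa> :: real) * \<kappa> x)"
    using assms unfolding pos_comb_def positive_combination_def by auto
  have "regular_fun torus (\<lambda>x. \<Sum>\<kappa>\<in>S. of_real (a \<kappa>) * \<kappa> x)"
    using S by (intro regular_fun_sum regular_intros) (auto intro: regular_fun_character)
  then show ?thesis
    using f regular_fun_cong[of torus f "\<lambda>x. \<Sum>\<kappa>\<in>S. of_real (a \<kappa>) * \<kappa> x"] by simp
qed

text \<open>At the identity of the torus every character is 1, so the value is the sum of the
  positive coefficients.\<close>

lemma pos_comb_nonzero:
  assumes "pos_comb f" "\<forall>\<phi>\<in>coord_funs. \<phi> e = 1"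
  shows "f e \<noteq> 0"
proof -
  obtain S a where S: "finite S" "S \<noteq> {}" "S \<subseteq> characters" "\<forall>\<kappa>\<in>S. (a \<kappa> :: real) > 0"
      and f: "\<forall>x\<in>torus. f x = (\<Sum>\<kappa>\<in>S. of_real (a \<kappa>) * \<kappa> x)"
    using assms(1) unfolding pos_comb_def positive_combination_def by auto
  have "e \<in> torus"
    using assms(2) unfolding torus_def mem_Collect_eq by (metis zero_neq_one)
  moreover have "\<kappa> e = 1" if "\<kappa> \<in> S" for \<kappa>
  proof -
    obtain m where "\<kappa> = (\<lambda>x. \<Prod>\<phi>\<in>coord_funs. \<phi> x powi m \<phi>)"
      using \<open>\<kappa> \<in> S\<close> S(3) unfolding characters_def by blast
    then have "\<kappa> e = (\<Prod>\<phi>\<in>coord_funs. \<phi> e powi m \<phi>)"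
      by simp
    also have "\<dots> = 1"
      using assms(2) by (intro prod.neutral) (metis power_int_1_left)
    finally show ?thesis .
  qed
  ultimately have "f e = of_real (\<Sum>\<kappa>\<in>S. a \<kappa>)"
    using f by (auto intro!: sum.cong)
  moreover have "(\<Sum>\<kappa>\<in>S. a \<kappa>) > 0"
    using S by (intro sum_pos) auto
  ultimately show ?thesis
    by (metis less_irrefl of_real_eq_0_iff)
qed

lemma pos_quot_comb: "pos_comb f \<Longrightarrow> pos_quot f"
  unfolding pos_quot_def by (intro exI[of _ f] exI[of _ "\<lambda>_. 1"]) (auto intro: pos_intros)

lemma pos_quot_mult:
  assumes "pos_quot f" "pos_quot f'"
  shows "pos_quot (\<lambda>x. f x * f' x)"
proof -
  obtain g h g' h' where *: "pos_comb g" "pos_comb h" "pos_comb g'" "pos_comb h'"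
    and ev: "\<forall>\<^sub>F x in generic torus. f x = g x / h x" "\<forall>\<^sub>F x in generic torus. f' x = g' x / h' x"
    using assms unfolding pos_quot_def by blast
  from ev have "\<forall>\<^sub>F x in generic torus. f x * f' x = (g x * g' x) / (h x * h' x)"
    by eventually_elim simp
  moreover have "pos_comb (\<lambda>x. g x * g' x)" "pos_comb (\<lambda>x. h x * h' x)"
    by (intro pos_comb_mult *)+
  ultimately show ?thesis
    unfolding pos_quot_def by blast
qed

lemma pos_quot_inverse:
  assumes "pos_quot f"
  shows "pos_quot (\<lambda>x. inverse (f x))"
proof -
  obtain g h where *: "pos_comb g" "pos_comb h" "\<forall>\<^sub>F x in generic torus. f x = g x / h x"
    using assms unfolding pos_quot_def by blast
  from *(3) have "\<forall>\<^sub>F x in generic torus. inverse (f x) = h x / g x"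
    by eventually_elim simp
  then show ?thesis
    using * unfolding pos_quot_def by blast
qed

lemma pos_quot_divide: "pos_quot f \<Longrightarrow> pos_quot g \<Longrightarrow> pos_quot (\<lambda>x. f x / g x)"
  unfolding divide_inverse by (intro pos_quot_mult pos_quot_inverse)

lemma pos_quot_power: "pos_quot f \<Longrightarrow> pos_quot (\<lambda>x. f x ^ n)"
  by (induction n) (auto intro: pos_quot_mult pos_quot_comb pos_comb_1)

lemma pos_quot_power_int: "pos_quot f \<Longrightarrow> pos_quot (\<lambda>x. f x powi k)"
  by (cases "0 \<le> k") (auto simp: power_int_def intro: pos_quot_power pos_quot_inverse)

lemma pos_quot_prod:
  assumes "\<And>i. i \<in> I \<Longrightarrow> pos_quot (f i)"
  shows "pos_quot (\<lambda>x. \<Prod>i\<in>I. f i x)"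
  using assms
  by (induction I rule: infinite_finite_induct) (auto intro: pos_quot_mult pos_quot_comb pos_comb_1)

text \<open>Numerator and denominator are nonzero at the identity \<open>e\<close>, hence
  generically nonzero, which excludes the zero function.\<close>

lemma positive_funI:
  fixes f :: "'a::affine_space \<rightharpoonup> complex"
  assumes irr: "irreducible_set (torus :: 'a set)" and e: "\<forall>\<phi>\<in>coord_funs. \<phi> (e :: 'a) = 1"
    and f: "rational_map torus UNIV f" and F: "\<forall>\<^sub>F x in generic torus. f x = Some (F x)" "pos_quot F"
  shows "positive_fun f"
proof -
  obtain g h where gh: "pos_comb g" "pos_comb h" "\<forall>\<^sub>F x in generic torus. F x = g x / h x"
    using F(2) unfolding pos_quot_def by blast
  have e_torus: "e \<in> torus"
    using e unfolding torus_def mem_Collect_eq by (metis zero_neq_one)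
  have "\<forall>\<^sub>F x in generic torus. x \<in> torus \<and> u x \<noteq> 0" if "pos_comb u" for u :: "'a \<Rightarrow> complex"
    using that pos_comb_nonzero[OF that e]
    by (intro eventually_generic_nonzero[OF irr open_in_self _ e_torus] regular_fun_pos_comb)
  from this[OF gh(1)] this[OF gh(2)] gh(3) F(1)
  have nz: "\<forall>\<^sub>F x in generic torus. f x \<noteq> Some 0"
    by eventually_elim auto
  have "\<not> rat_eq torus f (\<lambda>_. Some 0)"
  proof
    assume "rat_eq torus f (\<lambda>_. Some 0)"
    then have "\<forall>\<^sub>F x in generic torus. f x = Some 0"
      by (auto simp: rat_eq_iff[OF irr] elim: eventually_mono)
    with nz have "\<forall>\<^sub>F x in generic (torus :: 'a set). False"
      by eventually_elim simp
    then show False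
      by (rule eventually_generic_imp_ex[OF irr])
  qed
  moreover obtain g' h' where gh': "positive_combination g'" "positive_combination h'"
      "\<forall>x\<in>torus. g x = g' x" "\<forall>x\<in>torus. h x = h' x"
    using gh(1,2) unfolding pos_comb_def by blast
  moreover have "rat_eq torus f (\<lambda>x. Some (g' x / h' x))"
    unfolding rat_eq_iff[OF irr] using eventually_in_generic[OF irr] F(1) gh(3)
    by eventually_elim (use gh' in auto)
  ultimately show ?thesis
    using f unfolding positive_fun_def by blast
qed

text \<open>Characters are Laurent monomials in the coordinates, so positivity of the coordinates of
  F suffices.\<close>

lemma positive_mapI:
  fixes f :: "'a::affine_space \<rightharpoonup> 'b::affine_space"
  assumes irr: "irreducible_set (torus :: 'a set)" and e: "\<forall>\<phi>\<in>coord_funs. \<phi> (e :: 'a) = 1"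
    and f: "rational_map torus torus f" and F: "\<forall>\<^sub>F x in generic torus. f x = Some (F x)"
    and pos: "\<And>\<phi>. \<phi> \<in> coord_funs \<Longrightarrow> pos_quot (\<lambda>x. \<phi> (F x))"
  shows "positive_map f"
  unfolding positive_map_def
proof (intro conjI ballI f)
  fix \<kappa> :: "'b \<Rightarrow> complex" assume \<kappa>: "\<kappa> \<in> characters"
  then obtain m where m: "\<kappa> = (\<lambda>x. \<Prod>\<phi>\<in>coord_funs. \<phi> x powi m \<phi>)"
    unfolding characters_def by blast
  let ?k = "\<lambda>x. map_option \<kappa> (f x)"
  show "positive_fun ?k"
  proof (rule positive_funI[OF irr e])
    have dom: "dom ?k = dom f"
      by auto
    have "regular_fun (dom f) (\<lambda>x. \<kappa> (the (f x)))"
      using f regular_fun_compose[OF regular_fun_character[OF \<kappa>]] by (auto simp: rational_map_def)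
    moreover have "the (?k x) = \<kappa> (the (f x))" if "x \<in> dom f" for x
      using that by (metis domD option.map_sel option.sel option.distinct(1))
    ultimately have "regular_fun (dom f) (\<lambda>x. the (?k x))"
      by (subst regular_fun_cong)
    then show "rational_map torus UNIV ?k"
      using f unfolding rational_map_def dom by (auto intro: regular_map_complexI)
    show "\<forall>\<^sub>F x in generic torus. ?k x = Some (\<kappa> (F x))"
      using F by eventually_elim simp
    show "pos_quot (\<lambda>x. \<kappa> (F x))"
      unfolding m by (intro pos_quot_prod pos_quot_power_int pos)
  qed
qed

section \<open>The module $W(\varpi_1)$ in coordinates\<close>

lemma UNIV_6: "(UNIV :: 6 set) = {0, 1, 2, 3, 4, 5}"
proof -
  have "card {0, 1, 2, 3, 4, 5 :: 6} = CARD(6)"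
    by simp
  then show ?thesis
    by (metis card_eq_UNIV_imp_eq_UNIV finite)
qed

lemma forall_6: "(\<forall>i::6. P i) \<longleftrightarrow> P 0 \<and> P 1 \<and> P 2 \<and> P 3 \<and> P 4 \<and> P 5"
  by (metis (full_types) UNIV_6 UNIV_I empty_iff insert_iff)

lemma tup6_nth [simp]:
  "tup6 x0 x1 x2 x3 x4 x5 $ 0 = x0" "tup6 x0 x1 x2 x3 x4 x5 $ 1 = x1" "tup6 x0 x1 x2 x3 x4 x5 $ 2 = x2"
  "tup6 x0 x1 x2 x3 x4 x5 $ 3 = x3" "tup6 x0 x1 x2 x3 x4 x5 $ 4 = x4" "tup6 x0 x1 x2 x3 x4 x5 $ 5 = x5"
  by (simp_all add: tup6_def)

lemma tup6_eq_iff: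
  "tup6 x0 x1 x2 x3 x4 x5 = tup6 y0 y1 y2 y3 y4 y5 \<longleftrightarrow>
     x0 = y0 \<and> x1 = y1 \<and> x2 = y2 \<and> x3 = y3 \<and> x4 = y4 \<and> x5 = y5"
  by (simp add: vec_eq_iff forall_6)

lemma tup6_eta: "tup6 (x $ 0) (x $ 1) (x $ 2) (x $ 3) (x $ 4) (x $ 5) = x"
  by (simp add: vec_eq_iff forall_6)

lemma tup6_in_torus [simp]:
  "tup6 x0 x1 x2 x3 x4 x5 \<in> torus \<longleftrightarrow>
     x0 \<noteq> 0 \<and> x1 \<noteq> 0 \<and> x2 \<noteq> 0 \<and> x3 \<noteq> 0 \<and> x4 \<noteq> 0 \<and> x5 \<noteq> 0"
  by (simp add: mem_torus_vec forall_6)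

lemma torus6E:
  assumes "x \<in> torus"
  obtains x0 x1 x2 x3 x4 x5 where "x = tup6 x0 x1 x2 x3 x4 x5"
    "x0 \<noteq> 0" "x1 \<noteq> 0" "x2 \<noteq> 0" "x3 \<noteq> 0" "x4 \<noteq> 0" "x5 \<noteq> 0"
  using assms tup6_eta[of x] by (metis tup6_in_torus)

lemma app6_tup6 [simp]: "app6 f (tup6 x0 x1 x2 x3 x4 x5) = f x0 x1 x2 x3 x4 x5"
  by (simp add: app6_def)

lemma wbasis_all:
  "(\<forall>b. P b) \<longleftrightarrow> P N1 \<and> P N2 \<and> P N3 \<and> P N4 \<and> P N5 \<and> P N6 \<and> P B1 \<and> P B2 \<and> P B3 \<and> P B4 \<and> P B5 \<and>
     P B6 \<and> P Z1 \<and> P Z2 \<and> P Emp"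
proof (intro iffI allI)
  fix b
  assume "P N1 \<and> P N2 \<and> P N3 \<and> P N4 \<and> P N5 \<and> P N6 \<and> P B1 \<and> P B2 \<and> P B3 \<and> P B4 \<and> P B5 \<and>
     P B6 \<and> P Z1 \<and> P Z2 \<and> P Emp"
  then show "P b"
    by (cases b) simp_all
qed simp

text \<open>The exponent 4 fits the longest string of the module, from N2 through N3 and N4 to N6
  under \<open>f_2\<close>; the exponential series then stops at the cubic term.\<close>

lemma exp_op_nilpotent:
  assumes "(T ^^ 4) v = 0" "T 0 = 0"
  shows "exp_op T v = v + T v + (1 / 2) *s T (T v) + (1 / 6) *s T (T (T v))"
proof -
  have "(T ^^ n) 0 = 0" for n
    by (induction n) (use assms in auto)
  then have "(T ^^ (n + 4)) v = 0" for n
    by (simp only: funpow_add o_apply assms)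
  then have "(T ^^ n) v = 0" if "n \<notin> {..<4}" for n
    using that by (metis le_add_diff_inverse2 lessThan_iff not_less)
  then have "exp_op T v = (\<Sum>n<4. (1 / fact n) *s (T ^^ n) v)"
    unfolding exp_op_def by (intro suminf_finite) auto
  also have "\<dots> = v + T v + (1 / 2) *s T (T v) + (1 / 6) *s T (T (T v))"
    by (simp add: eval_nat_numeral)
  finally show ?thesis .
qed

lemma axis_nth_eq: "axis i c $ j = (if j = i then c else 0)"
  by (auto simp: axis_def)

lemma Y_expand:
  assumes "i < 3"
  defines "T \<equiv> \<lambda>c w. (1 / c) *s f_op i w"
  shows "Y i c v = (let w = coroot_op i c v in
    w + T c w + (1 / 2) *s T c (T c w) + (1 / 6) *s T c (T c (T c w)))"
proof -
  have i: "i = 0 \<or> i = 1 \<or> i = 2"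
    using assms(1) by auto
  have "(T c ^^ 4) w = 0" for w
    using i unfolding T_def
    by (elim disjE) (simp_all add: vec_eq_iff wbasis_all f_op_def f_action_def axis_nth_eq eval_nat_numeral)
  moreover have "T c 0 = 0"
    using i unfolding T_def
    by (elim disjE) (simp_all add: vec_eq_iff wbasis_all f_op_def f_action_def axis_nth_eq)
  ultimately show ?thesis
    unfolding Y_def T_def Let_def by (subst exp_op_nilpotent) simp_all
qed

section \<open>Explicit coordinates of the generators and of the two parametrizations\<close>

lemma Y0_nth:
  assumes "c \<noteq> 0"
  shows "Y 0 c v $ N1 = v $ N1 / c^2 + (v $ Z2 + 2 * v $ Emp) / c + v $ B1"
    "Y 0 c v $ N2 = v $ N2 / c + v $ B6" "Y 0 c v $ N3 = v $ N3 / c + v $ B4"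
    "Y 0 c v $ N4 = v $ N4 / c + v $ B3" "Y 0 c v $ N5 = v $ N5" "Y 0 c v $ N6 = v $ N6 / c + v $ B2"
    "Y 0 c v $ B1 = c^2 * v $ B1" "Y 0 c v $ B2 = c * v $ B2" "Y 0 c v $ B3 = c * v $ B3"
    "Y 0 c v $ B4 = c * v $ B4" "Y 0 c v $ B5 = v $ B5" "Y 0 c v $ B6 = c * v $ B6"
    "Y 0 c v $ Z1 = v $ Z1" "Y 0 c v $ Z2 = v $ Z2" "Y 0 c v $ Emp = v $ Emp + c * v $ B1"
  using assms
  by (simp_all add: Y_expand Let_def coroot_op_def f_op_def f_action_def axis_nth_eq
      power_int_def field_simps power2_eq_square)

lemma Y1_nth:
  assumes "c \<noteq> 0"
  shows "Y 1 c v $ N1 = c * v $ N1" "Y 1 c v $ N2 = v $ N2 / c + v $ N1" "Y 1 c v $ N3 = v $ N3"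
    "Y 1 c v $ N4 = c * v $ N4" "Y 1 c v $ N5 = v $ N5 / c + v $ N4" "Y 1 c v $ N6 = c^2 * v $ N6"
    "Y 1 c v $ B1 = v $ B1 / c + v $ B2" "Y 1 c v $ B2 = c * v $ B2" "Y 1 c v $ B3 = v $ B3"
    "Y 1 c v $ B4 = v $ B4 / c + v $ B5" "Y 1 c v $ B5 = c * v $ B5"
    "Y 1 c v $ B6 = v $ B6 / c^2 + (3 * v $ Z1 + 2 * v $ Z2 + v $ Emp) / c + v $ N6"
    "Y 1 c v $ Z1 = v $ Z1" "Y 1 c v $ Z2 = v $ Z2 + c * v $ N6" "Y 1 c v $ Emp = v $ Emp"
  using assms
  by (simp_all add: Y_expand Let_def coroot_op_def f_op_def f_action_def axis_nth_eq
      power_int_def field_simps power2_eq_square)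

lemma Y2_nth:
  assumes "c \<noteq> 0"
  shows "Y 2 c v $ N1 = v $ N1" "Y 2 c v $ N2 = c^3 * v $ N2" "Y 2 c v $ N3 = c * v $ N3 + c^2 * v $ N2"
    "Y 2 c v $ N4 = v $ N4 / c + 2 * v $ N3 + c * v $ N2" "Y 2 c v $ N5 = c^2 * v $ N5"
    "Y 2 c v $ N6 = v $ N6 / c^3 + 3 * v $ N4 / c^2 + 3 * v $ N3 / c + v $ N2"
    "Y 2 c v $ B1 = v $ B1" "Y 2 c v $ B2 = v $ B2 / c^3 + 3 * v $ B3 / c^2 + 3 * v $ B4 / c + v $ B6"
    "Y 2 c v $ B3 = v $ B3 / c + 2 * v $ B4 + c * v $ B6" "Y 2 c v $ B4 = c * v $ B4 + c^2 * v $ B6"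
    "Y 2 c v $ B5 = v $ B5 / c^2 + (2 * v $ Z1 + v $ Z2) / c + v $ N5" "Y 2 c v $ B6 = c^3 * v $ B6"
    "Y 2 c v $ Z1 = v $ Z1 + c * v $ N5" "Y 2 c v $ Z2 = v $ Z2" "Y 2 c v $ Emp = v $ Emp"
  using assms
  by (simp_all add: Y_expand Let_def coroot_op_def f_op_def f_action_def axis_nth_eq
      power_int_def field_simps eval_nat_numeral)

text \<open>The abbreviation \<open>s\<close> satisfies \<open>B5 = x1 * s\<close>. It is fixed by
  the action of 2, and many coordinates involve x2 and x4 largely through it.\<close>

lemma v1_nth:
  assumes "x0 \<noteq> 0" "x1 \<noteq> 0" "x2 \<noteq> 0" "x3 \<noteq> 0" "x4 \<noteq> 0" "x5 \<noteq> 0"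
  defines "w \<equiv> v1 (tup6 x0 x1 x2 x3 x4 x5)" and "s \<equiv> x4 + x3 / x2"
  shows "w $ N1 = 1 + (x1 * x5 + x1 * s^3 / x3 + x3) / x0 + x1 * x3 * x5 / x0^2"
    "w $ N2 = x5 + s^3 / x3 + 3 * x2 * x4 / x1 + 2 * x3 / x1 + x2^3 / x1^2
       + (x3 * x5 + x2^3 * x5 / x1 + x2^3 * x4^3 / (x1 * x3)) / x0"
    "w $ N3 = s + x2^2 * (1 / x1 + x5 / x0) + x2^2 * x4^2 * s / (x0 * x3)"
    "w $ N4 = x2 + x1 / x0 * (x2 * x5 + x2 * x4 * s^2 / x3)"
    "w $ N5 = x2 * x5 + x2 * x4 * s^2 / x3 + x2^2 * x4 / x1"
    "w $ N6 = x1 + x1^2 / x0 * (x5 + s^3 / x3)"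
    "w $ B1 = x0^2" "w $ B2 = x0 * x1" "w $ B3 = x0 * x2" "w $ B4 = x0 * (s + x2^2 / x1)"
    "w $ B5 = x1 * s"
    "w $ B6 = x0 * (x5 + s^3 / x3 + 3 * x2 * x4 / x1 + 2 * x3 / x1 + x2^3 / x1^2)"
    "w $ Z1 = x2 * x4" "w $ Z2 = x1 * x5 + x1 * s^3 / x3 + x3" "w $ Emp = x0"
  unfolding w_def s_def v1_def tup6_nth
  using assms(1-6)
  by (simp_all add: Y0_nth Y1_nth Y2_nth axis_nth_eq field_simps power2_eq_square power3_eq_cube
      del: One_nat_def)

text \<open>The quotients are named \<open>u\<close>, \<open>v\<close>, \<open>m\<close>,
  \<open>j\<close> so that later identities become polynomial ones modulo the relations defining
  these names.\<close>

lemma v2_nth: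
  assumes "y0 \<noteq> 0" "y1 \<noteq> 0" "y2 \<noteq> 0" "y3 \<noteq> 0" "y4 \<noteq> 0" "y5 \<noteq> 0"
  defines "w \<equiv> v2 (tup6 y0 y1 y2 y3 y4 y5)" and "j \<equiv> y3 + y4^3 / y1" and "m \<equiv> y5 / y4^3"
    and "u \<equiv> 1 / (y1 * y3)" and "v \<equiv> 1 / y2"
  shows "w $ N1 = y1 * y3" "w $ N2 = y2^3 * j" "w $ N3 = y2^2 * j + y2 * y4^2"
    "w $ N4 = y1 * y4 * v + y2 * j + 2 * y4^2" "w $ N5 = y2^2 * y4"
    "w $ N6 = y1^2 * v^3 * (y3^2 * m + 1) + 3 * y1 * y4 * v^2 + j + 3 * y4^2 * v"
    "w $ Z1 = y2 * y4" "w $ Z2 = y1 * (1 + m * y3 * j)" "w $ Emp = y0"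
    "w $ B1 = y0^2 * u + y0 * y1 * u + y0 * m * j + y4^3 * m"
    "w $ B2 = (y0 * j * u + 1 + m * j^2) + 3 * y4^2 * v * (y0 * u + m * j)
       + 3 * y4 * v^2 * (y0 * y1 * u + y4^3 * m) + y1 * v^3 * (y0 * y3 * m + y0 * y1 * u + y4^3 * m)"
    "w $ B3 = y2 * (y0 * j * u + 1 + m * j^2) + 2 * y4^2 * (y0 * u + m * j) + y4 * v * (y0 * y1 * u + y4^3 * m)"
    "w $ B4 = y2^2 * (y0 * j * u + 1 + m * j^2) + y2 * y4^2 * (y0 * u + m * j)"
    "w $ B5 = y1 * v * (1 + y3 * m * j) + y1 * y3 * m * y4^2 * v^2 + y4"
    "w $ B6 = y2^3 * (y0 * j * u + 1 + m * j^2)"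
  unfolding w_def j_def m_def u_def v_def v2_def tup6_nth
  using assms(1-6)
  by (simp_all add: Y0_nth Y1_nth Y2_nth axis_nth_eq field_simps power2_eq_square power3_eq_cube
      del: One_nat_def)

text \<open>Quadrics that vanish on the cones over both \<open>V1\<close> and \<open>V2\<close>, chosen so that the coordinates
  \<open>N1, N2, N3, N5, Z1, Z2, Emp\<close>, and likewise \<open>B1, B2, B3, B5, Z1, Z2, Emp\<close>, determine a point of
  the cone.\<close>

definition on_cone :: "wmod \<Rightarrow> bool" where
  "on_cone w \<longleftrightarrow>
     w $ N1 * w $ N5 = w $ N2 * w $ N4 - (w $ N3)^2 \<and>
     w $ N1 * (2 * w $ Z1 + w $ Z2) = w $ N2 * w $ N6 - w $ N3 * w $ N4 \<and>
     w $ N1 * w $ B5 = w $ N3 * w $ N6 - (w $ N4)^2 \<and>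
     w $ N1 * w $ B4 = w $ N2 * w $ B5 - w $ N3 * (w $ Z1 - w $ Emp) \<and>
     w $ N1 * w $ B3 = w $ N3 * w $ B5 - w $ N4 * (w $ Z1 - w $ Emp) \<and>
     w $ N1 * w $ B6 = w $ N2 * (w $ Z1 + w $ Z2 + w $ Emp) - w $ N3 * w $ N5 \<and>
     w $ N1 * w $ B2 = w $ N4 * w $ B5 - w $ N6 * (w $ Z1 - w $ Emp) \<and>
     w $ N1 * w $ B1 = w $ N2 * w $ B2 - w $ N3 * w $ B3 + (w $ Z1 - w $ Emp)^2 \<and>
     w $ N2 * w $ B5 + w $ N4 * w $ N5 = w $ N3 * (2 * w $ Z1 + w $ Z2) \<and>
     w $ B2 * w $ B4 = w $ B1 * w $ B5 + (w $ B3)^2 \<and>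
     w $ B2 * w $ B6 = (2 * w $ Z1 + w $ Z2) * w $ B1 + w $ B3 * w $ B4 \<and>
     w $ B1 * w $ N6 = (w $ Z1 + w $ Z2 + w $ Emp) * w $ B2 - w $ B3 * w $ B5 \<and>
     w $ B2 * w $ N5 = (2 * w $ Z1 + w $ Z2) * w $ B3 - w $ B4 * w $ B5 \<and>
     w $ B1 * w $ N4 = w $ N5 * w $ B2 - (w $ Z1 - w $ Emp) * w $ B3 \<and>
     w $ B1 * w $ N2 = w $ N5 * w $ B4 - (w $ Z1 - w $ Emp) * w $ B6 \<and>
     w $ B1 * w $ N3 = w $ N5 * w $ B3 - (w $ Z1 - w $ Emp) * w $ B4"

lemma on_cone_v2:
  assumes "y \<in> torus"
  shows "on_cone (v2 y)"
  using assms
proof (rule torus6E)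
  fix y0 y1 y2 y3 y4 y5 :: complex
  assume y: "y = tup6 y0 y1 y2 y3 y4 y5"
  assume nz: "y0 \<noteq> 0" "y1 \<noteq> 0" "y2 \<noteq> 0" "y3 \<noteq> 0" "y4 \<noteq> 0" "y5 \<noteq> 0"
  define u v j m where defs: "u = 1 / (y1 * y3)" "v = 1 / y2" "j = y3 + y4^3 / y1" "m = y5 / y4^3"
  \<comment> \<open>With these relations each quadric is an ideal membership statement, which the
    method \<open>algebra\<close> decides.\<close>
  have rels: "u * y1 * y3 = 1" "v * y2 = 1" "y1 * j = y1 * y3 + y4^3"
    using nz by (auto simp: defs field_simps)
  show ?thesis
    unfolding on_cone_def y v2_nth[OF nz] unfolding defs[symmetric]
    using rels
    by (intro conjI; algebra)
qed

lemma on_cone_v1: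
  assumes "x \<in> torus"
  shows "on_cone (v1 x)"
  using assms
proof (rule torus6E)
  fix x0 x1 x2 x3 x4 x5 :: complex
  assume x: "x = tup6 x0 x1 x2 x3 x4 x5"
  assume nz: "x0 \<noteq> 0" "x1 \<noteq> 0" "x2 \<noteq> 0" "x3 \<noteq> 0" "x4 \<noteq> 0" "x5 \<noteq> 0"
  define s where "s = x4 + x3 / x2"
  define i0 i1 i3 where i: "i0 = inverse x0" "i1 = inverse x1" "i3 = inverse x3"
  have rels: "x0 * i0 = 1" "x1 * i1 = 1" "x3 * i3 = 1" "x2 * s = x2 * x4 + x3"
    using nz by (auto simp: s_def i field_simps)
  show ?thesis
    unfolding on_cone_def x v1_nth[OF nz] unfolding s_def[symmetric] unfolding divide_inverse
      inverse_mult_distrib power_inverse[symmetric] i[symmetric]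
    using rels
    by (intro conjI; algebra)
qed

lemma on_cone_scale:
  assumes "on_cone w"
  shows "on_cone (k *s w)"
  using assms unfolding on_cone_def vector_smult_component
  by (elim conjE; intro conjI; algebra)

text \<open>The quadrics form a triangular system: two of them are linear in N4 and N6 with
  coefficient N2, and the others give B5, B4, B3, B6, B2, B1 with coefficient N1.\<close>

lemma cone_eqN:
  assumes w: "on_cone w" "on_cone w'" and nz: "w $ N1 \<noteq> 0" "w $ N2 \<noteq> 0"
    and eq: "w' $ N1 = w $ N1" "w' $ N2 = w $ N2" "w' $ N3 = w $ N3" "w' $ N5 = w $ N5"
      "w' $ Z1 = w $ Z1" "w' $ Z2 = w $ Z2" "w' $ Emp = w $ Emp"
  shows "w' = w"
proof -
  note c = w(1)[unfolded on_cone_def] w(2)[unfolded on_cone_def eq]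
  have "w $ N2 * w' $ N4 = w $ N2 * w $ N4"
    using c by algebra
  then have N4: "w' $ N4 = w $ N4"
    using nz by simp
  have "w $ N2 * w' $ N6 = w $ N2 * w $ N6"
    using c N4 by algebra
  then have N6: "w' $ N6 = w $ N6"
    using nz by simp
  have B5: "w' $ B5 = w $ B5"
    using c nz unfolding N4 N6 by (metis mult_left_cancel)
  have B4: "w' $ B4 = w $ B4"
    using c nz unfolding N4 N6 B5 by (metis mult_left_cancel)
  have B3: "w' $ B3 = w $ B3"
    using c nz unfolding N4 N6 B5 by (metis mult_left_cancel)
  have B6: "w' $ B6 = w $ B6"
    using c nz unfolding N4 N6 B5 by (metis mult_left_cancel)
  have B2: "w' $ B2 = w $ B2"
    using c nz unfolding N4 N6 B5 by (metis mult_left_cancel)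
  have B1: "w' $ B1 = w $ B1"
    using c nz unfolding N4 N6 B5 B2 B3 by (metis mult_left_cancel)
  show ?thesis
    by (simp add: vec_eq_iff wbasis_all eq N4 N6 B1 B2 B3 B4 B5 B6)
qed

text \<open>Again a triangular system: B4, B6 and N5 come with coefficient B2, and N6, N4, N2, N3,
  N1 with coefficient B1.\<close>

lemma cone_eqB:
  assumes w: "on_cone w" "on_cone w'" and nz: "w $ B1 \<noteq> 0" "w $ B2 \<noteq> 0"
    and eq: "w' $ B1 = w $ B1" "w' $ B2 = w $ B2" "w' $ B3 = w $ B3" "w' $ B5 = w $ B5"
      "w' $ Z1 = w $ Z1" "w' $ Z2 = w $ Z2" "w' $ Emp = w $ Emp"
  shows "w' = w"
proof -
  note c = w(1)[unfolded on_cone_def] w(2)[unfolded on_cone_def eq]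
  have B4: "w' $ B4 = w $ B4"
    using c nz by (metis mult_left_cancel)
  have B6: "w' $ B6 = w $ B6"
    using c nz unfolding B4 by (metis mult_left_cancel)
  have N6: "w' $ N6 = w $ N6"
    using c nz by (metis mult_left_cancel)
  have N5: "w' $ N5 = w $ N5"
    using c nz unfolding B4 by (metis mult_left_cancel)
  have N4: "w' $ N4 = w $ N4"
    using c nz unfolding N5 by (metis mult_left_cancel)
  have N2: "w' $ N2 = w $ N2"
    using c nz unfolding N5 B4 B6 by (metis mult_left_cancel)
  have N3: "w' $ N3 = w $ N3"
    using c nz unfolding N5 B4 by (metis mult_left_cancel)
  have "w' $ N1 * w $ B1 = w $ N1 * w $ B1"
    using c unfolding N2 N3 by argo
  then have N1: "w' $ N1 = w $ N1"
    using nz by simp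
  show ?thesis
    by (simp add: vec_eq_iff wbasis_all eq B4 B6 N1 N2 N3 N4 N5 N6)
qed

section \<open>Inverting the two parametrizations\<close>

text \<open>On \<open>k *s v1 x\<close> the coordinates Emp and B1 are k x0 and k x0^2, so this
  quotient recovers k.\<close>

definition scale1 :: "wmod \<Rightarrow> complex" where
  "scale1 w = (w $ Emp)^2 / w $ B1"

text \<open>Solves \<open>v1_nth\<close> step by step for w equal to m times \<open>v1 x\<close>:
  B1, B2, B3 divided by Emp are x0, x1, x2, while B5 = m x1 s and Z1 = m x2 x4 give s and x4, hence
  x3, and Z2 is linear in x5.\<close>

definition xi :: "wmod \<Rightarrow> complex ^ 6" where
  "xi w = (let m = scale1 w; x1 = w $ B2 / w $ Emp; x2 = w $ B3 / w $ Emp;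
     s = w $ B5 / (m * x1); x4 = w $ Z1 / (m * x2); x3 = x2 * (s - x4)
   in tup6 (w $ B1 / w $ Emp) x1 x2 x3 x4 ((w $ Z2 / m - x3) / x1 - s^3 / x3))"

text \<open>For w equal to k times \<open>v2 y\<close>, the relations N5 = y2 Z1, N3 - N2 / y2 = y4
  Z1 and Z1 = k y2 y4 yield y2, y4 and k in turn. Then N4 yields y1, N1 yields y3, and the
  difference of y2 B5 and Z2 yields y5.\<close>

definition eta2 :: "wmod \<Rightarrow> complex" where "eta2 w = w $ N5 / w $ Z1"
definition eta4 :: "wmod \<Rightarrow> complex" where "eta4 w = (w $ N3 - w $ N2 / eta2 w) / w $ Z1"
definition scale2 :: "wmod \<Rightarrow> complex" where "scale2 w = w $ Z1 / (eta2 w * eta4 w)"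
definition eta1 :: "wmod \<Rightarrow> complex" where
  "eta1 w = ((w $ N4 - w $ N2 / (eta2 w)^2) / scale2 w - 2 * (eta4 w)^2) * eta2 w / eta4 w"
definition eta3 :: "wmod \<Rightarrow> complex" where "eta3 w = w $ N1 / (scale2 w * eta1 w)"
definition eta5 :: "wmod \<Rightarrow> complex" where
  "eta5 w = ((w $ B5 * eta2 w - w $ Z2) / scale2 w - eta2 w * eta4 w) * (eta2 w * eta4 w) / (eta1 w * eta3 w)"

definition eta :: "wmod \<Rightarrow> complex ^ 6" where
  "eta w = tup6 (w $ Emp / scale2 w) (eta1 w) (eta2 w) (eta3 w) (eta4 w) (eta5 w)"

lemma xi_v1:
  assumes "x \<in> torus" "k \<noteq> 0"
  shows "xi (k *s v1 x) = x" "scale1 (k *s v1 x) = k"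
proof -
  obtain x0 x1 x2 x3 x4 x5 where x: "x = tup6 x0 x1 x2 x3 x4 x5"
    and nz: "x0 \<noteq> 0" "x1 \<noteq> 0" "x2 \<noteq> 0" "x3 \<noteq> 0" "x4 \<noteq> 0" "x5 \<noteq> 0"
    using torus6E[OF assms(1)] .
  define s where "s = x4 + x3 / x2"
  have s: "x2 * (s - x4) = x3"
    using nz by (simp add: s_def)
  show m: "scale1 (k *s v1 x) = k"
    using assms(2) nz by (simp add: scale1_def x v1_nth[OF nz] power2_eq_square)
  have "x5 = ((x1 * x5 + x1 * s^3 / x3 + x3) - x3) / x1 - s^3 / x3"
    using nz by (simp add: field_simps)
  then show "xi (k *s v1 x) = x"
    unfolding xi_def m Let_def unfolding x vector_smult_component v1_nth[OF nz] tup6_eq_iff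
    unfolding s_def[symmetric]
    using assms(2) nz s by (simp add: power2_eq_square)
qed

text \<open>The formulas of \<open>xi\<close> make both vectors agree in the seven coordinates of
  \<open>cone_eqB\<close>, and \<open>xi w\<close> in the torus forces B1 and B2 to be
  nonzero.\<close>

lemma v1_xi:
  assumes w: "on_cone w" "xi w \<in> torus"
  shows "w = scale1 w *s v1 (xi w)" "scale1 w \<noteq> 0" "w $ Emp \<noteq> 0" "w $ B1 \<noteq> 0"
proof -
  define m where "m = scale1 w"
  define x1 x2 where "x1 = w $ B2 / w $ Emp" "x2 = w $ B3 / w $ Emp"
  define s x4 where "s = w $ B5 / (m * x1)" "x4 = w $ Z1 / (m * x2)"
  define x3 where "x3 = x2 * (s - x4)"
  define x5 where "x5 = (w $ Z2 / m - x3) / x1 - s^3 / x3"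
  define x0 where "x0 = w $ B1 / w $ Emp"
  have xi: "xi w = tup6 x0 x1 x2 x3 x4 x5"
    by (simp add: xi_def m_def x1_x2_def s_x4_def x3_def x5_def x0_def Let_def)
  then have nz: "x0 \<noteq> 0" "x1 \<noteq> 0" "x2 \<noteq> 0" "x3 \<noteq> 0" "x4 \<noteq> 0" "x5 \<noteq> 0"
    using w(2) by auto
  show wnz: "w $ Emp \<noteq> 0" "w $ B1 \<noteq> 0"
    using nz(1) by (auto simp: x0_def)
  then show m: "scale1 w \<noteq> 0"
    by (simp add: scale1_def)
  have B2: "w $ B2 \<noteq> 0"
    using nz(2) by (auto simp: x1_x2_def)
  have s: "s = x4 + x3 / x2"
    using nz(3) by (simp add: x3_def)
  have x5: "x1 * x5 + x1 * s^3 / x3 + x3 = w $ Z2 / m"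
    using nz by (simp add: x5_def field_simps)
  have "m \<noteq> 0"
    using m by (simp add: m_def)
  have on: "on_cone (m *s v1 (xi w))"
    using w(2) by (intro on_cone_scale on_cone_v1)
  have "m *s v1 (xi w) = w"
  proof (rule cone_eqB[OF w(1) on wnz(2) B2])
    show "(m *s v1 (xi w)) $ Z2 = w $ Z2"
      using x5 \<open>m \<noteq> 0\<close> by (simp add: xi v1_nth[OF nz] flip: s)
    show "(m *s v1 (xi w)) $ B5 = w $ B5"
      using \<open>m \<noteq> 0\<close> nz by (simp add: xi v1_nth[OF nz] flip: s) (simp add: s_x4_def)
    show "(m *s v1 (xi w)) $ Z1 = w $ Z1"
      using \<open>m \<noteq> 0\<close> nz by (simp add: xi v1_nth[OF nz]) (simp add: s_x4_def)
  qed (use wnz in \<open>simp_all only: vector_smult_component xi v1_nth[OF nz],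
      simp_all add: m_def scale1_def x0_def x1_x2_def power2_eq_square\<close>)
  then show "w = scale1 w *s v1 (xi w)"
    by (simp add: m_def)
qed

lemma eta_v2:
  assumes "y \<in> torus" "k \<noteq> 0"
  shows "eta (k *s v2 y) = y" "scale2 (k *s v2 y) = k"
proof -
  obtain y0 y1 y2 y3 y4 y5 where y: "y = tup6 y0 y1 y2 y3 y4 y5"
    and nz: "y0 \<noteq> 0" "y1 \<noteq> 0" "y2 \<noteq> 0" "y3 \<noteq> 0" "y4 \<noteq> 0" "y5 \<noteq> 0"
    using torus6E[OF assms(1)] .
  let ?w = "k *s v2 y"
  have 2: "eta2 ?w = y2"
    using assms(2) nz by (simp add: eta2_def y v2_nth[OF nz] power2_eq_square)
  have 4: "eta4 ?w = y4"
    unfolding eta4_def 2 using assms(2) nz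
    by (simp add: y v2_nth[OF nz] field_simps power2_eq_square power3_eq_cube)
  show s: "scale2 ?w = k"
    unfolding scale2_def 2 4 using nz by (simp add: y v2_nth[OF nz])
  have 1: "eta1 ?w = y1"
    unfolding eta1_def 2 4 s using assms(2) nz
    by (simp add: y v2_nth[OF nz] field_simps power2_eq_square power3_eq_cube)
  have 3: "eta3 ?w = y3"
    unfolding eta3_def 1 s using assms(2) nz by (simp add: y v2_nth[OF nz])
  have 5: "eta5 ?w = y5"
    unfolding eta5_def 1 2 3 4 s using assms(2) nz
    by (simp add: y v2_nth[OF nz] field_simps power2_eq_square power3_eq_cube)
  show "eta ?w = y"
    unfolding eta_def 1 2 3 4 5 s using assms(2) nz by (simp add: y v2_nth[OF nz])
qed

text \<open>\<open>cone_eqN\<close> needs agreement in seven coordinates. N1, N5, Z1, Emp agree by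
  the recipe for \<open>eta\<close>, and N3 does once N2 does; N2 and Z2 have to be recovered from
  quadrics.\<close>

lemma v2_eta:
  assumes w: "on_cone w" "eta w \<in> torus" "w $ N2 \<noteq> 0"
  shows "w = scale2 w *s v2 (eta w)" "scale2 w \<noteq> 0" "w $ N1 \<noteq> 0"
proof -
  define k where "k = scale2 w"
  define y0 y1 y2 y3 y4 y5 where y: "y0 = w $ Emp / k" "y1 = eta1 w" "y2 = eta2 w"
    "y3 = eta3 w" "y4 = eta4 w" "y5 = eta5 w"
  have eta: "eta w = tup6 y0 y1 y2 y3 y4 y5"
    by (simp add: eta_def y k_def)
  then have nz: "y0 \<noteq> 0" "y1 \<noteq> 0" "y2 \<noteq> 0" "y3 \<noteq> 0" "y4 \<noteq> 0" "y5 \<noteq> 0"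
    using w(2) by auto
  have Z1: "w $ Z1 \<noteq> 0"
    using nz(3) by (auto simp: y eta2_def)
  then show "scale2 w \<noteq> 0"
    using nz by (simp add: y scale2_def)
  then have k: "k \<noteq> 0"
    by (simp add: k_def)
  show N1: "w $ N1 \<noteq> 0"
    using nz(4) by (auto simp: y eta3_def)
  have eZ1: "w $ Z1 = k * (y2 * y4)"
    using nz by (simp add: k_def scale2_def y)
  have eN5: "w $ N5 = k * (y2^2 * y4)"
  proof -
    have "w $ N5 = y2 * w $ Z1"
      using Z1 by (simp add: y eta2_def)
    then show ?thesis
      by (simp add: eZ1 power2_eq_square)
  qed
  have eN3: "w $ N3 = w $ N2 / y2 + k * (y2 * y4^2)"
  proof -
    have "w $ N3 - w $ N2 / y2 = y4 * w $ Z1"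
      using Z1 by (simp add: y eta4_def)
    then show ?thesis
      by (simp add: eZ1 power2_eq_square algebra_simps)
  qed
  have eN1: "w $ N1 = k * (y1 * y3)"
    using nz k by (simp add: y eta3_def k_def)
  have eN4: "w $ N4 = k * (y1 * y4 / y2 + 2 * y4^2) + w $ N2 / y2^2"
  proof -
    have "y1 = ((w $ N4 - w $ N2 / y2^2) / k - 2 * y4^2) * y2 / y4"
      by (simp add: y eta1_def k_def)
    then have "y1 * y4 / y2 + 2 * y4^2 = (w $ N4 - w $ N2 / y2^2) / k"
      using nz by simp
    then show ?thesis
      using k by simp
  qed
  \<comment> \<open>The quadric for the product of N1 and N5 is used: the squares of N2 cancel after
    N3 and N4 are expressed through N2, which leaves a linear equation.\<close>
  have eN2: "w $ N2 = k * (y2^3 * (y3 + y4^3 / y1))"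
  proof -
    define v where "v = 1 / y2"
    have v: "v * y2 = 1"
      using nz by (simp add: v_def)
    have N3: "w $ N3 = w $ N2 * v + k * (y2 * y4^2)"
      using eN3 by (simp add: v_def)
    have N4: "w $ N4 = k * (y1 * y4 * v + 2 * y4^2) + w $ N2 * v^2"
      using eN4 by (simp add: v_def power2_eq_square)
    have q: "w $ N1 * w $ N5 = w $ N2 * w $ N4 - (w $ N3)^2"
      using w(1) by (simp add: on_cone_def)
    have N3s: "(w $ N3)^2 = (w $ N2)^2 * v^2 + 2 * (w $ N2) * k * y4^2 + k^2 * y2^2 * y4^4"
      unfolding N3 using v by algebra
    have "k * (y1 * y3) * (k * (y2^2 * y4)) = w $ N2 * k * y1 * y4 * v - k^2 * y2^2 * y4^4"
      using q unfolding N3s N4 eN1 eN5 by (simp add: algebra_simps power2_eq_square)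
    from arg_cong[OF this, of "\<lambda>t. t * y2"]
    have "k * (y1 * y3) * (k * (y2^2 * y4)) * y2 = w $ N2 * k * y1 * y4 * (v * y2) - k^2 * y2^2 * y4^4 * y2"
      by (simp add: algebra_simps)
    then have "(k * y4) * (w $ N2 * y1) = (k * y4) * (k * (y2^3 * (y1 * y3 + y4^3)))"
      unfolding v by (simp add: algebra_simps power2_eq_square power3_eq_cube power4_eq_xxxx)
    then have "w $ N2 * y1 = k * (y2^3 * (y1 * y3 + y4^3))"
      using k nz by simp
    then show ?thesis
      using nz by (simp add: field_simps)
  qed
  have T: "w $ B5 * y2 - w $ Z2 = k * (y2 * y4 + y1 * y3 * y5 / (y2 * y4))"
  proof -
    have "y5 = ((w $ B5 * y2 - w $ Z2) / k - y2 * y4) * (y2 * y4) / (y1 * y3)"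
      by (simp add: y eta5_def k_def)
    then have "y5 * (y1 * y3) = ((w $ B5 * y2 - w $ Z2) / k - y2 * y4) * (y2 * y4)"
      using nz by simp
    then have "y5 * (y1 * y3) / (y2 * y4) = (w $ B5 * y2 - w $ Z2) / k - y2 * y4"
      using nz by (metis mult_eq_0_iff nonzero_mult_div_cancel_right)
    then have "y5 * (y1 * y3) / (y2 * y4) + y2 * y4 = (w $ B5 * y2 - w $ Z2) / k"
      by simp
    then show ?thesis
      using k by (simp add: field_simps)
  qed
  \<comment> \<open>The quadric relating N2 B5 + N4 N5 to N3 is combined with T, the equation solved
    by y5; this is linear in Z2 with coefficient k y2^2 y4^2.\<close>
  have eZ2: "w $ Z2 = k * (y1 * (1 + y5 / y4^3 * y3 * (y3 + y4^3 / y1)))"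
  proof -
    define v m i where defs: "v = 1 / y2" "m = y5 / y4^3" "i = 1 / y1"
    have v: "v * y2 = 1" "y5 = m * y4^3" "i * y1 = 1"
      using nz by (auto simp: defs)
    have N2: "w $ N2 = k * (y2^3 * (y3 + y4^3 * i))"
      using eN2 by (simp add: defs)
    have N3: "w $ N3 = w $ N2 * v + k * (y2 * y4^2)"
      using eN3 by (simp add: defs)
    have N4: "w $ N4 = k * (y1 * y4 * v + 2 * y4^2) + w $ N2 * v^2"
      using eN4 by (simp add: defs power2_eq_square)
    have q: "w $ N2 * w $ B5 + w $ N4 * w $ N5 = w $ N3 * (2 * w $ Z1 + w $ Z2)"
      using w(1) by (simp add: on_cone_def)
    have B5: "w $ B5 * y2 = w $ Z2 + k * (y2 * y4 + y1 * y3 * (m * y4^2) * v)"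
      using T nz unfolding v(2) by (simp add: defs(1) field_simps power2_eq_square power3_eq_cube)
    have "(k * y2^2 * y4^2) * w $ Z2 = (k * y2^2 * y4^2) * (k * (y1 * (1 + m * y3 * (y3 + y4^3 * i))))"
      using q v B5 unfolding N4 N3 eN5 eZ1 unfolding N2 by algebra
    then show ?thesis
      using k nz by (simp add: defs)
  qed
  have on: "on_cone (k *s v2 (eta w))"
    using w(2) by (intro on_cone_scale on_cone_v2)
  have "k *s v2 (eta w) = w"
  proof (rule cone_eqN[OF w(1) on N1 w(3)])
    show "(k *s v2 (eta w)) $ N3 = w $ N3"
      unfolding eN3 eN2 using nz by (simp add: eta v2_nth[OF nz] field_simps power2_eq_square power3_eq_cube)
    show "(k *s v2 (eta w)) $ Emp = w $ Emp"
      unfolding eta vector_smult_component v2_nth[OF nz] using k by (simp add: y)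
  qed (simp_all add: eta v2_nth[OF nz] eN1 eN2 eN5 eZ1 eZ2)
  then show "w = scale2 w *s v2 (eta w)"
    by (simp add: k_def)
qed

lemma open_in_torus_coords:
  fixes f :: "'a::affine_space \<Rightarrow> complex ^ 6"
  assumes "\<And>i. regular_fun U (\<lambda>x. f x $ i)"
  shows "open_in U {x\<in>U. f x \<in> torus}"
proof -
  have "regular_fun U (\<lambda>x. \<Prod>i\<in>UNIV. f x $ i)"
    by (intro regular_fun_prod assms)
  from open_in_regular_nonzero[OF this] show ?thesis
    by (simp add: mem_torus_vec)
qed

lemma xi_regular:
  shows "open_in UNIV {w. xi w \<in> torus}" "regular_map {w. xi w \<in> torus} torus xi"
proof -
  let ?S = "{w \<in> (UNIV :: wmod set). w $ B1 * w $ Emp * w $ B2 * w $ B3 \<noteq> 0}"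
  define s where "s w = w $ B5 / (scale1 w * (w $ B2 / w $ Emp))" for w
  define x3 where "x3 w = w $ B3 / w $ Emp * (s w - w $ Z1 / (scale1 w * (w $ B3 / w $ Emp)))" for w
  let ?R = "{w \<in> ?S. x3 w \<noteq> 0}"
  have S: "open_in UNIV ?S"
    by (intro open_in_regular_nonzero regular_intros)
  have sc: "regular_fun ?S scale1" "regular_fun ?S s"
    unfolding scale1_def s_def by (intro regular_intros; simp)+
  have x3: "regular_fun ?S x3"
    unfolding x3_def by (intro regular_intros sc) (auto simp: scale1_def)
  have R: "open_in UNIV ?R"
    by (intro open_in_trans[OF S] open_in_regular_nonzero x3)
  have sub: "regular_fun ?S f \<Longrightarrow> regular_fun ?R f" for f
    by (rule regular_fun_subset) auto
  have xi: "xi w = tup6 (w $ B1 / w $ Emp) (w $ B2 / w $ Emp) (w $ B3 / w $ Emp) (x3 w)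
      (w $ Z1 / (scale1 w * (w $ B3 / w $ Emp)))
      ((w $ Z2 / scale1 w - x3 w) / (w $ B2 / w $ Emp) - (s w)^3 / x3 w)" for w
    by (simp add: xi_def x3_def s_def Let_def)
  have "\<forall>i. regular_fun ?R (\<lambda>w. xi w $ i)"
    unfolding forall_6 xi tup6_nth
    by (intro conjI regular_intros sub[OF x3] sub[OF sc(1)] sub[OF sc(2)]) (auto simp: scale1_def)
  then have reg: "\<And>i. regular_fun ?R (\<lambda>w. xi w $ i)"
    by blast
  \<comment> \<open>A vanishing denominator, by the convention z / 0 = 0, or x3 = 0 makes some
    coordinate of \<open>xi w\<close> zero. Membership in the torus thus already implies all
    conditions in \<open>?R\<close>.\<close>
  have eq: "{w. xi w \<in> torus} = {w \<in> ?R. xi w \<in> torus}"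
    by (auto simp: xi)
  show "open_in UNIV {w. xi w \<in> torus}"
    unfolding eq by (intro open_in_trans[OF R] open_in_torus_coords reg)
  show "regular_map {w. xi w \<in> torus} torus xi"
    by (rule regular_map_vecI) (auto intro: regular_fun_subset[OF reg] simp: eq)
qed

lemma eta_regular:
  shows "open_in UNIV {w. eta w \<in> torus}" "regular_map {w. eta w \<in> torus} torus eta"
proof -
  let ?S = "{w \<in> (UNIV :: wmod set). w $ N5 * w $ Z1 \<noteq> 0}"
  let ?R = "{w \<in> ?S. eta4 w \<noteq> 0}"
  let ?P = "{w \<in> ?R. eta1 w \<noteq> 0}"
  let ?Q = "{w \<in> ?P. eta3 w \<noteq> 0}"
  have S: "open_in UNIV ?S"
    by (intro open_in_regular_nonzero regular_intros)
  have 2: "regular_fun ?S eta2"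
    unfolding eta2_def by (intro regular_intros) auto
  have 4: "regular_fun ?S eta4"
    unfolding eta4_def by (intro regular_intros 2) (auto simp: eta2_def)
  have R: "open_in UNIV ?R"
    by (intro open_in_trans[OF S] open_in_regular_nonzero 4)
  have 24: "regular_fun ?R eta2" "regular_fun ?R eta4"
    by (auto intro: regular_fun_subset 2 4)
  have sc: "regular_fun ?R scale2"
    unfolding scale2_def by (intro regular_intros 24) (auto simp: eta2_def)
  have 1: "regular_fun ?R eta1"
    unfolding eta1_def by (intro regular_intros 24 sc) (auto simp: eta2_def scale2_def)
  have P: "open_in UNIV ?P"
    by (intro open_in_trans[OF R] open_in_regular_nonzero 1)
  have P124: "regular_fun ?P eta1" "regular_fun ?P eta2" "regular_fun ?P eta4" "regular_fun ?P scale2"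
    by (auto intro: regular_fun_subset 1 24 sc)
  have 3: "regular_fun ?P eta3"
    unfolding eta3_def by (intro regular_intros P124) (auto simp: eta2_def scale2_def)
  have Q: "open_in UNIV ?Q"
    by (intro open_in_trans[OF P] open_in_regular_nonzero 3)
  have Q124: "regular_fun ?Q eta1" "regular_fun ?Q eta2" "regular_fun ?Q eta3" "regular_fun ?Q eta4"
      "regular_fun ?Q scale2"
    by (auto intro: regular_fun_subset P124 3)
  have 5: "regular_fun ?Q eta5"
    unfolding eta5_def by (intro regular_intros Q124) (auto simp: eta2_def scale2_def)
  have "\<forall>i. regular_fun ?Q (\<lambda>w. eta w $ i)"
    unfolding forall_6 eta_def tup6_nth
    by (intro conjI regular_intros Q124 5) (auto simp: scale2_def eta2_def)
  then have reg: "\<And>i. regular_fun ?Q (\<lambda>w. eta w $ i)"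
    by blast
  have eq: "{w. eta w \<in> torus} = {w \<in> ?Q. eta w \<in> torus}"
    by (auto simp: eta_def eta2_def)
  show "open_in UNIV {w. eta w \<in> torus}"
    unfolding eq by (intro open_in_trans[OF Q] open_in_torus_coords reg)
  show "regular_map {w. eta w \<in> torus} torus eta"
    by (rule regular_map_vecI) (auto intro: regular_fun_subset[OF reg] simp: eq)
qed

lemma v1_inject: "x \<in> torus \<Longrightarrow> x' \<in> torus \<Longrightarrow> v1 x = v1 x' \<Longrightarrow> x = x'"
  using xi_v1(1)[of _ 1] by (metis vector_scalar_mult_def vector_smult_lid zero_neq_one)

section \<open>The actions in coordinates\<close>

text \<open>The numerators and denominators of \<open>C1\<close>, \<open>C3\<close>,
  \<open>C5\<close> are \<open>q1\<close> times the monomial x0 / (x1^2 x3^2 x5); a and b are the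
  weights of the first and the second term.\<close>

definition q1 :: "complex \<Rightarrow> complex \<Rightarrow> complex ^ 6 \<Rightarrow> complex" where
  "q1 a b x = a * x $ 1 * (x $ 3)^2 * x $ 5 + b * (x $ 2)^3 * x $ 3 * x $ 5 + (x $ 2)^3 * (x $ 4)^3"

text \<open>The same for \<open>C2\<close> and \<open>C4\<close>, with the common monomial x1 /
  (x2^2 x4).\<close>

definition q2 :: "complex \<Rightarrow> complex ^ 6 \<Rightarrow> complex" where
  "q2 a x = a * x $ 2 * x $ 4 + x $ 3"

definition act0 :: "complex \<Rightarrow> complex ^ 6 \<Rightarrow> complex ^ 6" where
  "act0 c = app6 (\<lambda>x0 x1 x2 x3 x4 x5.
     let D = polD c x0 x1 x2 x3 x4 x5; E = polE x0 x1 x2 x3 x4 x5; F = polF c x0 x1 x2 x3 x4 x5;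
         G = polG c x0 x1 x2 x3 x4 x5; H = polH c x0 x1 x2 x3 x4 x5
     in tup6 (D / (c * E) * x0) (F / (c * E) * x1) (G / (c * E) * x2)
          (D * H / (c^2 * E * F) * x3) (D / (c * G) * x4) (D / (c * H) * x5))"

definition act1 :: "complex \<Rightarrow> complex ^ 6 \<Rightarrow> complex ^ 6" where
  "act1 c x = tup6 (x $ 0) (q1 c 1 x / q1 1 1 x * x $ 1) (x $ 2) (q1 c c x / q1 c 1 x * x $ 3) (x $ 4)
     (c * q1 1 1 x / q1 c c x * x $ 5)"

definition act2 :: "complex \<Rightarrow> complex ^ 6 \<Rightarrow> complex ^ 6" where
  "act2 c x = tup6 (x $ 0) (x $ 1) (q2 c x / q2 1 x * x $ 2) (x $ 3) (c * q2 1 x / q2 c x * x $ 4) (x $ 5)"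

definition act :: "nat \<Rightarrow> complex \<Rightarrow> complex ^ 6 \<Rightarrow> complex ^ 6" where
  "act i = [act0, act1, act2] ! i"

definition gam :: "nat \<Rightarrow> complex ^ 6 \<Rightarrow> complex" where
  "gam i = [app6 (\<lambda>x0 x1 x2 x3 x4 x5. x0^2 / (x1 * x3 * x5)),
     app6 (\<lambda>x0 x1 x2 x3 x4 x5. x1^2 * x3^2 * x5^2 / (x0 * x2^3 * x4^3)),
     app6 (\<lambda>x0 x1 x2 x3 x4 x5. x2^2 * x4^2 / (x1 * x3 * x5))] ! i"

definition eps :: "nat \<Rightarrow> complex ^ 6 \<Rightarrow> complex" where
  "eps i = [app6 (\<lambda>x0 x1 x2 x3 x4 x5. polE x0 x1 x2 x3 x4 x5 / (x0^3 * x2^3 * x3)),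
     app6 (\<lambda>x0 x1 x2 x3 x4 x5. x0 / x1 + x0 * x2^3 / (x1^2 * x3) + x0 * x2^3 * x4^3 / (x1^2 * x3^2 * x5)),
     app6 (\<lambda>x0 x1 x2 x3 x4 x5. x1 / x2 + x1 * x3 / (x2^2 * x4))] ! i"

lemma act_simps [simp]: "act 0 = act0" "act (Suc 0) = act1" "act 1 = act1" "act 2 = act2"
  by (simp_all add: act_def eval_nat_numeral)

lemma gam_simps:
  "gam 0 = app6 (\<lambda>x0 x1 x2 x3 x4 x5. x0^2 / (x1 * x3 * x5))"
  "gam 1 = app6 (\<lambda>x0 x1 x2 x3 x4 x5. x1^2 * x3^2 * x5^2 / (x0 * x2^3 * x4^3))"
  "gam 2 = app6 (\<lambda>x0 x1 x2 x3 x4 x5. x2^2 * x4^2 / (x1 * x3 * x5))"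
  by (simp_all add: gam_def)

lemma eps_simps:
  "eps 0 = app6 (\<lambda>x0 x1 x2 x3 x4 x5. polE x0 x1 x2 x3 x4 x5 / (x0^3 * x2^3 * x3))"
  "eps 1 = app6 (\<lambda>x0 x1 x2 x3 x4 x5. x0 / x1 + x0 * x2^3 / (x1^2 * x3) + x0 * x2^3 * x4^3 / (x1^2 * x3^2 * x5))"
  "eps 2 = app6 (\<lambda>x0 x1 x2 x3 x4 x5. x1 / x2 + x1 * x3 / (x2^2 * x4))"
  by (simp_all add: eps_def)

lemma act0_eq:
  "act0 c x = tup6 (app6 (polD c) x / (c * app6 polE x) * x $ 0) (app6 (polF c) x / (c * app6 polE x) * x $ 1)
     (app6 (polG c) x / (c * app6 polE x) * x $ 2)
     (app6 (polD c) x * app6 (polH c) x / (c^2 * app6 polE x * app6 (polF c) x) * x $ 3)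
     (app6 (polD c) x / (c * app6 (polG c) x) * x $ 4) (app6 (polD c) x / (c * app6 (polH c) x) * x $ 5)"
  by (simp add: act0_def app6_def Let_def)

section \<open>The three actions on the torus: domains, composition, and their effect on gamma and
  epsilon\<close>

lemma act1_in_torus_iff:
  "x \<in> torus \<Longrightarrow> act1 c x \<in> torus \<longleftrightarrow> c \<noteq> 0 \<and> q1 1 1 x \<noteq> 0 \<and> q1 c 1 x \<noteq> 0 \<and> q1 c c x \<noteq> 0"
  by (auto simp: act1_def mem_torus_vec[of x])

lemma act2_in_torus_iff:
  "x \<in> torus \<Longrightarrow> act2 c x \<in> torus \<longleftrightarrow> c \<noteq> 0 \<and> q2 1 x \<noteq> 0 \<and> q2 c x \<noteq> 0"
  by (auto simp: act2_def mem_torus_vec[of x])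

lemma act0_in_torus_iff:
  "x \<in> torus \<Longrightarrow> act0 c x \<in> torus \<longleftrightarrow> c \<noteq> 0 \<and> app6 (polD c) x \<noteq> 0 \<and> app6 polE x \<noteq> 0 \<and>
     app6 (polF c) x \<noteq> 0 \<and> app6 (polG c) x \<noteq> 0 \<and> app6 (polH c) x \<noteq> 0"
  by (auto simp: act0_eq mem_torus_vec[of x])

lemma act0_one: "x \<in> torus \<Longrightarrow> act0 1 x \<in> torus \<Longrightarrow> act0 1 x = x"
proof -
  assume x: "x \<in> torus" "act0 1 x \<in> torus"
  obtain x0 x1 x2 x3 x4 x5 where [simp]: "x = tup6 x0 x1 x2 x3 x4 x5"
    using torus6E[OF x(1)] by metis
  let ?E = "polE x0 x1 x2 x3 x4 x5"
  have "?E \<noteq> 0"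
    using act0_in_torus_iff[OF x(1), of 1] x(2) by simp
  moreover have "polD 1 x0 x1 x2 x3 x4 x5 = ?E" "polF 1 x0 x1 x2 x3 x4 x5 = ?E"
    "polG 1 x0 x1 x2 x3 x4 x5 = ?E" "polH 1 x0 x1 x2 x3 x4 x5 = ?E"
    by (simp_all add: polD_def polE_def polF_def polG_def polH_def)
  ultimately show ?thesis
    by (simp add: act0_eq)
qed

lemma act1_one: "x \<in> torus \<Longrightarrow> act1 1 x \<in> torus \<Longrightarrow> act1 1 x = x"
  by (simp add: act1_in_torus_iff) (simp add: act1_def tup6_eta)

lemma act2_one: "x \<in> torus \<Longrightarrow> act2 1 x \<in> torus \<Longrightarrow> act2 1 x = x"
  by (simp add: act2_in_torus_iff) (simp add: act2_def tup6_eta)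

text \<open>\<open>q1\<close> is linear in three monomials A, B, C. Their images under the action
  have the common denominator v, and what remains are polynomial identities in A, B, C and
  d.\<close>

lemma q1_act1:
  assumes x: "x \<in> torus" "act1 d x \<in> torus"
  shows "q1 1 1 (act1 d x) = q1 d d x" "q1 c 1 (act1 d x) = q1 (c * d) 1 x * q1 d d x / q1 d 1 x"
    "q1 c c (act1 d x) = q1 (c * d) (c * d) x"
proof -
  define A B C where ABC: "A = x $ 1 * (x $ 3)^2 * x $ 5" "B = (x $ 2)^3 * x $ 3 * x $ 5"
    "C = (x $ 2)^3 * (x $ 4)^3"
  have q: "q1 a b x = a * A + b * B + C" for a b
    by (simp add: q1_def ABC)
  define u v w where uvw: "u = q1 1 1 x" "v = q1 d 1 x" "w = q1 d d x"
  have nz': "u \<noteq> 0" "v \<noteq> 0" "w \<noteq> 0"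
    using x act1_in_torus_iff[OF x(1), of d] by (auto simp: uvw)
  have q': "v * q1 a b (act1 d x) = a * d * A * w + b * d * B * u + C * v" for a b
    unfolding q1_def[of _ _ "act1 d x"] unfolding act1_def tup6_nth uvw[symmetric] ABC
    using nz' by (simp add: field_simps power2_eq_square)
  have rels: "u = A + B + C" "v = d * A + B + C" "w = d * A + d * B + C"
    by (simp_all add: uvw q)
  have "v * q1 1 1 (act1 d x) = v * w"
    unfolding q' unfolding rels by algebra
  then show "q1 1 1 (act1 d x) = q1 d d x"
    using nz' by (simp add: uvw)
  have "v * q1 c 1 (act1 d x) = (c * d * A + B + C) * w"
    unfolding q' unfolding rels by algebra
  then show "q1 c 1 (act1 d x) = q1 (c * d) 1 x * q1 d d x / q1 d 1 x"
    using nz' by (simp add: q[of "c * d" 1] uvw[symmetric] field_simps)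
  have "v * q1 c c (act1 d x) = v * (c * d * A + c * d * B + C)"
    unfolding q' unfolding rels by algebra
  then show "q1 c c (act1 d x) = q1 (c * d) (c * d) x"
    using nz' by (simp add: q[of "c * d"])
qed

lemma act1_act1:
  assumes x: "x \<in> torus" "act1 d x \<in> torus" "act1 c (act1 d x) \<in> torus"
  shows "act1 c (act1 d x) = act1 (c * d) x"
proof -
  have nz: "d \<noteq> 0" "q1 1 1 x \<noteq> 0" "q1 d 1 x \<noteq> 0" "q1 d d x \<noteq> 0"
    using x act1_in_torus_iff[OF x(1), of d] by auto
  show ?thesis
    unfolding act1_def[of c] act1_def[of "c * d"] q1_act1[OF x(1,2)]
    using nz by (simp add: act1_def tup6_eq_iff)
qed

lemma act2_act2:
  assumes x: "x \<in> torus" "act2 d x \<in> torus" "act2 c (act2 d x) \<in> torus"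
  shows "act2 c (act2 d x) = act2 (c * d) x"
proof -
  have nz: "d \<noteq> 0" "q2 1 x \<noteq> 0" "q2 d x \<noteq> 0"
    using x act2_in_torus_iff[OF x(1), of d] by auto
  have "q2 a (act2 d x) = q2 (a * d) x" for a
    unfolding q2_def[of a] q2_def[of "a * d"] using nz by (simp add: act2_def)
  then show ?thesis
    unfolding act2_def[of c] act2_def[of "c * d"]
    using nz by (simp add: act2_def tup6_eq_iff)
qed

lemma eps1_eq: "x \<in> torus \<Longrightarrow> eps 1 x = x $ 0 / ((x $ 1)^2 * (x $ 3)^2 * x $ 5) * q1 1 1 x"
  unfolding eps_simps app6_def q1_def mem_torus_vec forall_6
  by (simp add: field_simps power2_eq_square)

lemma eps2_eq: "x \<in> torus \<Longrightarrow> eps 2 x = x $ 1 / ((x $ 2)^2 * x $ 4) * q2 1 x"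
  unfolding eps_simps app6_def q2_def mem_torus_vec forall_6
  by (simp add: field_simps power2_eq_square)

lemma eps1_act1:
  assumes x: "x \<in> torus" "act1 c x \<in> torus"
  shows "eps 1 (act1 c x) = inverse c * eps 1 x"
proof -
  have nz: "c \<noteq> 0" "q1 1 1 x \<noteq> 0" "q1 c 1 x \<noteq> 0" "q1 c c x \<noteq> 0" "\<And>i. x $ i \<noteq> 0"
    using x act1_in_torus_iff[OF x(1), of c] by (auto simp: mem_torus_vec)
  show ?thesis
    unfolding eps1_eq[OF x(1)] eps1_eq[OF x(2)] q1_act1[OF x]
    using nz by (simp add: act1_def) (simp add: field_simps power2_eq_square)
qed

lemma eps2_act2:
  assumes x: "x \<in> torus" "act2 c x \<in> torus"
  shows "eps 2 (act2 c x) = inverse c * eps 2 x"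
proof -
  have nz: "c \<noteq> 0" "q2 1 x \<noteq> 0" "q2 c x \<noteq> 0" "\<And>i. x $ i \<noteq> 0"
    using x act2_in_torus_iff[OF x(1), of c] by (auto simp: mem_torus_vec)
  have q: "q2 1 (act2 c x) = q2 c x"
    unfolding q2_def[of _ "act2 c x"] using nz by (simp add: act2_def) (simp add: q2_def)
  show ?thesis
    unfolding eps2_eq[OF x(1)] eps2_eq[OF x(2)] q
    using nz by (simp add: act2_def) (simp add: field_simps power2_eq_square)
qed

text \<open>The torus part of Y_1(x1) Y_2(x2) Y_1(x3) Y_2(x4) Y_1(x5) is the coroot of the long root
  \<alpha>_1 at this product times the coroot of the short root \<alpha>_2 at
  \<open>short_prod\<close>. Hence every gamma is a monomial in x0 and these two.\<close>

definition long_prod :: "complex ^ 6 \<Rightarrow> complex" where "long_prod x = x $ 1 * x $ 3 * x $ 5"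
definition short_prod :: "complex ^ 6 \<Rightarrow> complex" where "short_prod x = x $ 2 * x $ 4"

lemma prods_nonzero: "x \<in> torus \<Longrightarrow> long_prod x \<noteq> 0" "x \<in> torus \<Longrightarrow> short_prod x \<noteq> 0"
  by (simp_all add: long_prod_def short_prod_def mem_torus_vec)

lemma act1_products:
  assumes x: "x \<in> torus" "act1 c x \<in> torus"
  shows "long_prod (act1 c x) = c * long_prod x" "short_prod (act1 c x) = short_prod x"
  unfolding long_prod_def short_prod_def using act1_in_torus_iff[OF x(1), of c] x(2) by (simp_all add: act1_def)

lemma act2_products:
  assumes x: "x \<in> torus" "act2 c x \<in> torus"
  shows "short_prod (act2 c x) = c * short_prod x" "long_prod (act2 c x) = long_prod x"
  unfolding long_prod_def short_prod_def
  using act2_in_torus_iff[OF x(1), of c] x(2) by (simp_all add: act2_def)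

text \<open>F, G and H cancel in these products. The remaining factor \<open>k\<close> reappears in
  \<open>v1_act0\<close> as the common scale of the coordinates.\<close>

lemma act0_products:
  assumes x: "x \<in> torus" "act0 c x \<in> torus"
  defines "k \<equiv> app6 (polD c) x / (c^2 * app6 polE x)"
  shows "long_prod (act0 c x) = k^2 * long_prod x"
    "short_prod (act0 c x) = k * short_prod x" "act0 c x $ 0 = k * c * x $ 0" "k \<noteq> 0" "c \<noteq> 0"
proof -
  note t = act0_in_torus_iff[OF x(1), of c, THEN iffD1, OF x(2)]
  define D E F G H where a: "D = app6 (polD c) x" "E = app6 polE x" "F = app6 (polF c) x"
    "G = app6 (polG c) x" "H = app6 (polH c) x"
  have nz: "c \<noteq> 0" "D \<noteq> 0" "E \<noteq> 0" "F \<noteq> 0" "G \<noteq> 0" "H \<noteq> 0"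
    using t by (simp_all add: a)
  show "long_prod (act0 c x) = k^2 * long_prod x"
    "short_prod (act0 c x) = k * short_prod x" "act0 c x $ 0 = k * c * x $ 0" "k \<noteq> 0" "c \<noteq> 0"
    unfolding long_prod_def short_prod_def k_def act0_eq tup6_nth a[symmetric] using nz
    by (simp_all add: field_simps power2_eq_square)
qed

lemma gam_eq:
  "gam 0 x = (x $ 0)^2 / long_prod x"
  "gam 1 x = (long_prod x)^2 / (x $ 0 * (short_prod x)^3)"
  "gam 2 x = (short_prod x)^2 / long_prod x"
  unfolding gam_simps long_prod_def short_prod_def app6_def by (simp_all add: power_mult_distrib ac_simps)

lemma gam_act:
  assumes x: "x \<in> torus" "act i c x \<in> torus" and ij: "i \<in> {0, 1, 2}" "j \<in> {0, 1, 2}"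
  shows "gam j (act i c x) = c powi cartan i j * gam j x"
proof -
  have nz: "x $ 0 \<noteq> 0" "long_prod x \<noteq> 0" "short_prod x \<noteq> 0"
    using x prods_nonzero by (simp_all add: mem_torus_vec)
  consider "i = 0" | "i = 1" | "i = 2"
    using ij by auto
  then show ?thesis
  proof cases
    case 1
    note p = act0_products[OF x(1) x(2)[unfolded 1 act_simps]]
    show ?thesis
      using ij(2) 1 nz p(4,5) by (auto simp: gam_eq p cartan_def field_simps power2_eq_square power3_eq_cube
          power_int_def simp del: One_nat_def)
  next
    case 2
    note p = act1_products[OF x(1) x(2)[unfolded 2 act_simps]]
    have q: "act1 c x $ 0 = x $ 0"
      by (simp_all add: act1_def)
    have "c \<noteq> 0"
      using x act1_in_torus_iff[of x c] 2 by simp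
    then show ?thesis
      using ij(2) 2 nz by (auto simp: gam_eq p q cartan_def field_simps power2_eq_square power3_eq_cube
          power_int_def simp del: One_nat_def)
  next
    case 3
    note p = act2_products[OF x(1) x(2)[unfolded 3 act_simps]]
    have q: "act2 c x $ 0 = x $ 0"
      by (simp_all add: act2_def)
    have "c \<noteq> 0"
      using x act2_in_torus_iff[of x c] 3 by simp
    then show ?thesis
      using ij(2) 3 nz by (auto simp: gam_eq p q cartan_def field_simps power2_eq_square power3_eq_cube
          power_int_def simp del: One_nat_def)
  qed
qed

text \<open>In terms of \<open>s = x\<^sub>4 + x\<^sub>3 / x\<^sub>2\<close> the polynomials \<open>D, E, F, H\<close> are \<open>x\<^sub>2\<^sup>3\<close> times
  polynomials in \<open>x\<^sub>0, x\<^sub>1, x\<^sub>3, x\<^sub>5, s\<close>, and \<open>G\<close> is a combination of \<open>F\<close> and \<open>H\<close>.\<close>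

definition redD :: "complex \<Rightarrow> complex \<Rightarrow> complex \<Rightarrow> complex \<Rightarrow> complex \<Rightarrow> complex \<Rightarrow> complex" where
  "redD c x0 x1 x3 x5 s = c^2 * x0^2 * x3 + x1 * x3^2 * x5 + c * x0 * (x3^2 + x1 * x3 * x5 + x1 * s^3)"
definition redE :: "complex \<Rightarrow> complex \<Rightarrow> complex \<Rightarrow> complex \<Rightarrow> complex \<Rightarrow> complex" where
  "redE x0 x1 x3 x5 s = x0^2 * x3 + x1 * x3^2 * x5 + x0 * (x3^2 + x1 * x3 * x5 + x1 * s^3)"
definition redF :: "complex \<Rightarrow> complex \<Rightarrow> complex \<Rightarrow> complex \<Rightarrow> complex \<Rightarrow> complex \<Rightarrow> complex" where
  "redF c x0 x1 x3 x5 s = c * x0^2 * x3 + x1 * x3^2 * x5 + x0 * (x3^2 + c * x1 * x3 * x5 + c * x1 * s^3)"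
definition redH :: "complex \<Rightarrow> complex \<Rightarrow> complex \<Rightarrow> complex \<Rightarrow> complex \<Rightarrow> complex \<Rightarrow> complex" where
  "redH c x0 x1 x3 x5 s = c * x0^2 * x3 + x1 * x3^2 * x5 + x0 * (x3^2 + c * x1 * x3 * x5 + x1 * s^3)"

lemma pol_red:
  assumes "x2 * s = x2 * x4 + x3"
  shows "polD c x0 x1 x2 x3 x4 x5 = x2^3 * redD c x0 x1 x3 x5 s"
    "polE x0 x1 x2 x3 x4 x5 = x2^3 * redE x0 x1 x3 x5 s"
    "polF c x0 x1 x2 x3 x4 x5 = x2^3 * redF c x0 x1 x3 x5 s"
    "polH c x0 x1 x2 x3 x4 x5 = x2^3 * redH c x0 x1 x3 x5 s"
    "polG c x0 x1 x2 x3 x4 x5 * s * x2 = x2^3 * (x2 * x4 * redF c x0 x1 x3 x5 s + x3 * redH c x0 x1 x3 x5 s)"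
  using assms unfolding polD_def polE_def polF_def polG_def polH_def redD_def redE_def redF_def redH_def
  by algebra+

text \<open>Each identity serves a coordinate in \<open>v1_act0\<close>: the first one Z2, the
  second N6, the last two N4.\<close>

lemma red_relations:
  fixes c x0 x1 x3 x5 s :: complex
  defines "D \<equiv> redD c x0 x1 x3 x5 s" and "E \<equiv> redE x0 x1 x3 x5 s" and "F \<equiv> redF c x0 x1 x3 x5 s"
    and "H \<equiv> redH c x0 x1 x3 x5 s"
  shows "x3 * (F^2 * x1 * x5 + H^2 * x3) + D * E * x1 * s^3 = F * H * (x1 * x5 * x3 + x1 * s^3 + x3^2)"
    "F * (c * x0 * x3 + x1 * x5 * x3 + x1 * s^3 + x3^2) - H * x3^2 = D * (x0 * x3 + x1 * x5 * x3 + x1 * s^3)"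
    "c * x0 * H + x1 * x5 * F = D * (x0 + x1 * x5)"
    "(c * x0 * F * H + x1 * x5 * F^2) * x3 + D * E * x1 * s^3 = D * H * ((x0 + x1 * x5) * x3 + x1 * s^3)"
  unfolding D_def E_def F_def H_def redD_def redE_def redF_def redH_def by algebra+

text \<open>Emp, B5, Z1, Z2, N1, N6 and N4 are computed directly. N3, N2 and N5 then follow from
  quadrics of the cone, after division by N6 or N1, instead of by expansion.\<close>

lemma v1_act0:
  fixes c x
  assumes x: "x \<in> torus" "act0 c x \<in> torus" and s: "q2 1 x \<noteq> 0" and N6: "v1 x $ N6 \<noteq> 0"
  defines "w \<equiv> v1 x" and "w' \<equiv> v1 (act0 c x)" and "k \<equiv> app6 (polD c) x / (c^2 * app6 polE x)"
  shows "w' $ N1 = k * w $ N1" "w' $ N2 = k * w $ N2" "w' $ N3 = k * w $ N3" "w' $ N4 = k * w $ N4"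
    "w' $ N5 = k * w $ N5" "w' $ N6 = k * w $ N6" "w' $ B5 = k * w $ B5" "w' $ Z1 = k * w $ Z1"
    "w' $ Z2 = k * w $ Z2" "w' $ Emp = k * c * w $ Emp" "k \<noteq> 0" "w $ N1 \<noteq> 0"
proof -
  obtain x0 x1 x2 x3 x4 x5 where xx: "x = tup6 x0 x1 x2 x3 x4 x5"
    and nz: "x0 \<noteq> 0" "x1 \<noteq> 0" "x2 \<noteq> 0" "x3 \<noteq> 0" "x4 \<noteq> 0" "x5 \<noteq> 0"
    using torus6E[OF x(1)] by metis
  define s where "s = x4 + x3 / x2"
  have xs: "x2 * s = x2 * x4 + x3"
    using nz by (simp add: s_def distrib_left)
  then have s0: "s \<noteq> 0"
    using s by (auto simp: xx q2_def)
  note red = pol_red[OF xs]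
  define D E F H where a: "D = redD c x0 x1 x3 x5 s" "E = redE x0 x1 x3 x5 s" "F = redF c x0 x1 x3 x5 s"
    "H = redH c x0 x1 x3 x5 s"
  note rel = red_relations[where c = c and ?x0.0 = x0 and ?x1.0 = x1 and ?x3.0 = x3 and ?x5.0 = x5 and s = s,
      folded a]
  define G where "G = polG c x0 x1 x2 x3 x4 x5 / x2^3"
  have G: "G * s * x2 = x2 * x4 * F + x3 * H"
    using nz red(5)[of c x0 x1 x5] unfolding a[symmetric] by (simp add: G_def field_simps)
  have pG: "polG c x0 x1 x2 x3 x4 x5 = x2^3 * G"
    using nz by (simp add: G_def)
  have c: "c \<noteq> 0" and polnz: "D \<noteq> 0" "E \<noteq> 0" "F \<noteq> 0" "G \<noteq> 0" "H \<noteq> 0"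
    using act0_in_torus_iff[OF x(1), of c] x(2) nz unfolding xx app6_tup6 red(1-4) a[symmetric] pG by auto
  have k: "k = D / (c^2 * E)"
    unfolding k_def xx app6_tup6 red a[symmetric] using nz by simp
  then show knz: "k \<noteq> 0"
    using c polnz by simp
  define t0 t1 t2 t3 t4 t5 where t: "t0 = k * c * x0" "t1 = F / (c * E) * x1" "t2 = G / (c * E) * x2"
    "t3 = k * H / F * x3" "t4 = D / (c * G) * x4" "t5 = D / (c * H) * x5"
  have act: "act0 c x = tup6 t0 t1 t2 t3 t4 t5"
    unfolding act0_eq xx app6_tup6 tup6_nth red(1-4) a[symmetric] pG tup6_eq_iff t k
    using nz c polnz by (simp add: field_simps power2_eq_square)
  have tnz: "t0 \<noteq> 0" "t1 \<noteq> 0" "t2 \<noteq> 0" "t3 \<noteq> 0" "t4 \<noteq> 0" "t5 \<noteq> 0"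
    using x(2) unfolding act by auto
  have p: "t2 * t4 = k * (x2 * x4)"
    using c polnz by (simp add: t k power2_eq_square ac_simps)
  \<comment> \<open>The decomposition of G through F and H makes the bracket equal to G s x2, so G
    cancels and \<open>s\<close> is multiplied by a simple factor.\<close>
  have s': "t4 + t3 / t2 = D / (c * F) * s"
  proof -
    have "t4 + t3 / t2 = D / (c * G * F * x2) * (x2 * x4 * F + x3 * H)"
      using nz c polnz by (simp add: t k field_simps power2_eq_square)
    also have "\<dots> = D / (c * F) * s"
      unfolding G[symmetric] using nz c polnz by simp
    finally show ?thesis .
  qed
  note W = v1_nth[OF nz, folded s_def xx w_def]
  note W' = v1_nth[OF tnz, unfolded s', folded act w'_def]
  have x2: "x2 = (x2 * x4 + x3) / s"
    using xs s0 by (simp add: field_simps)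
  show Emp: "w' $ Emp = k * c * w $ Emp"
    by (simp add: W W' t)
  show B5: "w' $ B5 = k * w $ B5"
    using c polnz by (simp add: W W' t k power2_eq_square ac_simps)
  show Z1: "w' $ Z1 = k * w $ Z1"
    by (simp add: W W' p)
  have Z2': "w' $ Z2 = k * (F / H * (x1 * x5) + D * E / (F * H) * (x1 * s^3 / x3) + H / F * x3)"
    unfolding W'(14) t k using nz c polnz by (simp add: field_simps power2_eq_square power3_eq_cube)
  have "F / H * (x1 * x5) + D * E / (F * H) * (x1 * s^3 / x3) + H / F * x3
      = (x3 * (F^2 * x1 * x5 + H^2 * x3) + D * E * x1 * s^3) / (F * H * x3)"
    using nz polnz by (simp add: field_simps power2_eq_square)
  also have "\<dots> = w $ Z2"
    unfolding rel(1) W(14) using nz polnz by (simp add: field_simps power2_eq_square)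
  finally show Z2: "w' $ Z2 = k * w $ Z2"
    unfolding Z2' by simp
  have z2: "x3 * w $ Z2 = x1 * x5 * x3 + x1 * s^3 + x3^2"
    unfolding W(14) using nz by (simp add: field_simps power2_eq_square)
  have N1x: "w $ N1 = 1 + w $ Z2 / x0 + x1 * x3 * x5 / x0^2"
    by (simp add: W)
  have E: "E = x3 * (x0^2 * w $ N1)"
  proof -
    have "x0^2 * w $ N1 = x0^2 + x0 * w $ Z2 + x1 * x3 * x5"
      unfolding N1x using nz by (simp add: field_simps power2_eq_square)
    then show ?thesis
      unfolding a redE_def using z2 by (simp add: algebra_simps power2_eq_square)
  qed
  then show "w $ N1 \<noteq> 0"
    using polnz by auto
  have D: "D = x3 * (c^2 * x0^2 + c * x0 * w $ Z2 + x1 * x3 * x5)"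
    unfolding a redD_def using z2 by (simp add: algebra_simps power2_eq_square)
  show N1: "w' $ N1 = k * w $ N1"
  proof -
    have "w' $ N1 = 1 + w' $ Z2 / t0 + t1 * t3 * t5 / t0^2"
      by (simp add: W')
    also have "\<dots> = 1 + w $ Z2 / (c * x0) + x1 * x3 * x5 / (c^2 * x0^2)"
      unfolding Z2 t using nz c polnz by (simp add: k field_simps power2_eq_square)
    also have "\<dots> = D / (c^2 * x0^2 * x3)"
      unfolding D using nz c by (simp add: field_simps power2_eq_square)
    also have "\<dots> = k * w $ N1"
      unfolding k using E nz c polnz by (simp add: field_simps)
    finally show ?thesis .
  qed
  have N6x: "w $ N6 = x1 / x0 * (x0 + (w $ Z2 - x3))" "w' $ N6 = t1 / t0 * (t0 + (w' $ Z2 - t3))"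
    unfolding W W' using nz tnz by (simp_all add: field_simps power2_eq_square)
  show N6': "w' $ N6 = k * w $ N6"
  proof -
    have "w' $ N6 = x1 / (x0 * c^2 * E) * ((F * (c * x0 * x3 + x3 * w $ Z2) - H * x3^2) / x3)"
      unfolding N6x Z2 t using nz c polnz by (simp add: k field_simps power2_eq_square)
    also have "\<dots> = x1 / (x0 * c^2 * E) * (D * (x0 * x3 + x1 * x5 * x3 + x1 * s^3) / x3)"
      unfolding z2 rel(2)[symmetric] by (simp add: algebra_simps)
    also have "x0 * x3 + x1 * x5 * x3 + x1 * s^3 = x3 * (x0 + (w $ Z2 - x3))"
      using z2 by (simp add: algebra_simps power2_eq_square)
    finally have *: "w' $ N6 = x1 / (x0 * c^2 * E) * (D * (x3 * (x0 + (w $ Z2 - x3))) / x3)" .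
    show ?thesis
      unfolding * N6x(1) k using nz by (simp add: ac_simps)
  qed
  show N4: "w' $ N4 = k * w $ N4"
  proof -
    have t2: "t2 = (x2 * x4 * F + x3 * H) / (c * E * s)"
      unfolding t G[symmetric] using s0 c polnz by (simp add: field_simps)
    have "w' $ N4 = t2 * (1 + t1 * t5 / t0) + t1 / t0 * (t2 * t4) * (D / (c * F) * s)^2 / t3"
      unfolding W' using tnz by (simp add: field_simps power2_eq_square)
    also have "\<dots> = (x2 * x4 * F + x3 * H) / (c * E * s) * (1 + F * x1 * x5 / (c * H * x0))
        + D * x1 * (x2 * x4) * s^2 / (c^2 * H * x0 * x3)"
      unfolding p unfolding t2 unfolding t using nz s0 c polnz by (simp add: k field_simps power2_eq_square)
    also have "\<dots> = (x2 * x4 * ((c * x0 * F * H + x1 * x5 * F^2) * x3 + D * E * x1 * s^3)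
        + x3^2 * H * (c * x0 * H + x1 * x5 * F)) / (c^2 * E * H * s * x0 * x3)"
      using nz s0 c polnz by (simp add: field_simps power2_eq_square power3_eq_cube)
    also have "\<dots> = (x2 * x4 * (D * H * ((x0 + x1 * x5) * x3 + x1 * s^3))
        + x3^2 * H * (D * (x0 + x1 * x5))) / (c^2 * E * H * s * x0 * x3)"
      unfolding rel(3,4) ..
    also have "\<dots> = k * ((x2 * x4 + x3) / s * (1 + x1 * x5 / x0) + x1 / x0 * (x2 * x4) * s^2 / x3)"
      using nz s0 c polnz by (simp add: k field_simps power2_eq_square power3_eq_cube)
    also have "\<dots> = k * w $ N4"
      unfolding x2[symmetric] W using nz by (simp add: field_simps)
    finally show ?thesis .
  qed
  \<comment> \<open>These quadrics are homogeneous, so known coordinates scaled by k force the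
    missing one to be scaled by k too.\<close>
  have q: "w $ N1 * w $ B5 = w $ N3 * w $ N6 - (w $ N4)^2" "w' $ N1 * w' $ B5 = w' $ N3 * w' $ N6 - (w' $ N4)^2"
    "w $ N1 * (2 * w $ Z1 + w $ Z2) = w $ N2 * w $ N6 - w $ N3 * w $ N4"
    "w' $ N1 * (2 * w' $ Z1 + w' $ Z2) = w' $ N2 * w' $ N6 - w' $ N3 * w' $ N4"
    "w $ N1 * w $ N5 = w $ N2 * w $ N4 - (w $ N3)^2" "w' $ N1 * w' $ N5 = w' $ N2 * w' $ N4 - (w' $ N3)^2"
    using on_cone_v1[OF x(1)] on_cone_v1[OF x(2)] unfolding on_cone_def w_def w'_def by blast+
  have n6: "w $ N6 \<noteq> 0"
    using N6 by (simp add: w_def)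
  have "k * w $ N6 * (w' $ N3) = k * w $ N6 * (k * w $ N3)"
    using q(1,2) unfolding N1 B5 N6' N4 by algebra
  then show N3: "w' $ N3 = k * w $ N3"
    using n6 knz by simp
  have "k * w $ N6 * (w' $ N2) = k * w $ N6 * (k * w $ N2)"
    using q(3,4) unfolding N1 Z1 Z2 N6' N4 N3 by algebra
  then show N2: "w' $ N2 = k * w $ N2"
    using n6 knz by simp
  have "k * w $ N1 * (w' $ N5) = k * w $ N1 * (k * w $ N5)"
    using q(5,6) unfolding N1 N2 N3 N4 by algebra
  then show "w' $ N5 = k * w $ N5"
    using \<open>w $ N1 \<noteq> 0\<close> knz by simp
qed

text \<open>All entries of \<open>eta\<close> are homogeneous of degree 0, and among the coordinates
  used Emp enters only the first entry.\<close>

lemma eta_scaled: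
  assumes k: "k \<noteq> 0"
    and eq: "w' $ N1 = k * w $ N1" "w' $ N2 = k * w $ N2" "w' $ N3 = k * w $ N3" "w' $ N4 = k * w $ N4"
    "w' $ N5 = k * w $ N5" "w' $ B5 = k * w $ B5" "w' $ Z1 = k * w $ Z1"
    "w' $ Z2 = k * w $ Z2" "w' $ Emp = k * c * w $ Emp"
  shows "eta w' = tup6 (c * eta w $ 0) (eta w $ 1) (eta w $ 2) (eta w $ 3) (eta w $ 4) (eta w $ 5)"
proof -
  have 2: "eta2 w' = eta2 w"
    unfolding eta2_def eq using k by simp
  have "k * w $ N3 - k * w $ N2 / eta2 w = k * (w $ N3 - w $ N2 / eta2 w)"
    by (simp add: right_diff_distrib)
  then have 4: "eta4 w' = eta4 w"
    unfolding eta4_def 2 eq using k by simp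
  have s: "scale2 w' = k * scale2 w"
    unfolding scale2_def 2 4 eq by simp
  have "k * w $ N4 - k * w $ N2 / (eta2 w)^2 = k * (w $ N4 - w $ N2 / (eta2 w)^2)"
    by (simp add: right_diff_distrib)
  then have 1: "eta1 w' = eta1 w"
    unfolding eta1_def 2 4 s eq using k by simp
  have 3: "eta3 w' = eta3 w"
    unfolding eta3_def 1 s eq using k by simp
  have "k * w $ B5 * eta2 w - k * w $ Z2 = k * (w $ B5 * eta2 w - w $ Z2)"
    by (simp add: right_diff_distrib)
  then have 5: "eta5 w' = eta5 w"
    unfolding eta5_def 1 2 3 4 s eq using k by simp
  show ?thesis
    unfolding eta_def tup6_nth 1 2 3 4 5 s eq using k by simp
qed

text \<open>The conditions on \<open>eta\<close> and N2 are those of \<open>v2_eta\<close>; those on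
  N6 and B5 give the hypotheses of \<open>v1_act0\<close>, since B5 is a nonzero multiple of
  \<open>q2 1 x\<close> on the torus.\<close>

definition good :: "complex ^ 6 \<Rightarrow> bool" where
  "good x \<longleftrightarrow> x \<in> torus \<and> eta (v1 x) \<in> torus \<and> v1 x $ N2 \<noteq> 0 \<and> v1 x $ N6 \<noteq> 0 \<and> v1 x $ B5 \<noteq> 0"

lemma B5_v1: "x \<in> torus \<Longrightarrow> v1 x $ B5 = x $ 1 / x $ 2 * q2 1 x"
  by (erule torus6E) (simp add: v1_nth q2_def field_simps)

lemma good_eta:
  assumes "good x"
  obtains k where "k \<noteq> 0" "v1 x = k *s v2 (eta (v1 x))" "scale2 (v1 x) = k"
  using v2_eta(1,2)[OF on_cone_v1, of x] assms by (auto simp: good_def)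

text \<open>The value of \<open>eta\<close> fixes \<open>v1 x\<close> up to a scalar, and
  \<open>xi\<close> recovers x from any nonzero multiple of \<open>v1 x\<close>. Equalities of
  points may therefore be checked in the coordinates y.\<close>

lemma good_inject:
  assumes "good x" "good x'" "eta (v1 x) = eta (v1 x')"
  shows "x = x'"
proof -
  obtain k k' where k: "k \<noteq> 0" "v1 x = k *s v2 (eta (v1 x))" and k': "k' \<noteq> 0" "v1 x' = k' *s v2 (eta (v1 x'))"
    using good_eta[OF assms(1)] good_eta[OF assms(2)] by metis
  have "v1 x' = (k' / k) *s v1 x"
  proof -
    have "(k' / k) *s v1 x = (k' / k) *s (k *s v2 (eta (v1 x)))"
      using k(2) by simp
    also have "\<dots> = k' *s v2 (eta (v1 x))"
      using k(1) by simp
    finally show ?thesis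
      using k'(2) assms(3) by simp
  qed
  then have "xi (v1 x') = x"
    using xi_v1(1)[of x "k' / k"] k(1) k'(1) assms(1) by (simp add: good_def)
  then show ?thesis
    using xi_v1(1)[of x' 1] assms(2) by (simp add: good_def)
qed

lemma act0_good:
  assumes x: "good x" "act0 c x \<in> torus"
  shows "good (act0 c x)"
    "eta (v1 (act0 c x)) = tup6 (c * eta (v1 x) $ 0) (eta (v1 x) $ 1) (eta (v1 x) $ 2) (eta (v1 x) $ 3)
       (eta (v1 x) $ 4) (eta (v1 x) $ 5)"
proof -
  have t: "x \<in> torus" "v1 x $ N6 \<noteq> 0" "q2 1 x \<noteq> 0" "eta (v1 x) \<in> torus"
    using x B5_v1[of x] by (auto simp: good_def)
  note s = v1_act0[OF t(1) x(2) t(3,2)]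
  show e: "eta (v1 (act0 c x)) = tup6 (c * eta (v1 x) $ 0) (eta (v1 x) $ 1) (eta (v1 x) $ 2) (eta (v1 x) $ 3)
       (eta (v1 x) $ 4) (eta (v1 x) $ 5)"
    by (rule eta_scaled[OF s(11) s(1-5) s(7-10)])
  have "c \<noteq> 0"
    using act0_in_torus_iff[OF t(1), of c] x(2) by simp
  then show "good (act0 c x)"
    unfolding good_def e using x s t(4) by (auto simp: good_def mem_torus_vec[of "eta (v1 x)"])
qed

text \<open>In the coordinates y both sides multiply y0 by c d, which avoids substituting the
  polynomials D, E, F, G, H into each other.\<close>

lemma act0_act0:
  assumes x: "good x" "act0 d x \<in> torus" "act0 c (act0 d x) \<in> torus" "act0 (c * d) x \<in> torus"
  shows "act0 c (act0 d x) = act0 (c * d) x"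
proof (rule good_inject)
  note g = act0_good[OF x(1,2)]
  show "good (act0 c (act0 d x))" "good (act0 (c * d) x)"
    using act0_good(1)[OF g(1) x(3)] act0_good(1)[OF x(1,4)] .
  show "eta (v1 (act0 c (act0 d x))) = eta (v1 (act0 (c * d) x))"
    unfolding act0_good(2)[OF g(1) x(3)] act0_good(2)[OF x(1,4)] g(2) by (simp add: mult.assoc)
qed

lemma act0_inverse:
  assumes x: "good x" "act0 d x \<in> torus" "act0 c (act0 d x) \<in> torus" "c * d = 1"
  shows "act0 c (act0 d x) = x"
proof (rule good_inject[OF _ x(1)])
  note g = act0_good[OF x(1,2)]
  show "good (act0 c (act0 d x))"
    using act0_good(1)[OF g(1) x(3)] .
  show "eta (v1 (act0 c (act0 d x))) = eta (v1 x)"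
    unfolding act0_good(2)[OF g(1) x(3)] g(2) tup6_nth
    using x(4) by (simp flip: mult.assoc add: tup6_eta)
qed

lemma act1_inverse:
  "x \<in> torus \<Longrightarrow> act1 d x \<in> torus \<Longrightarrow> act1 c (act1 d x) \<in> torus \<Longrightarrow> c * d = 1 \<Longrightarrow> act1 c (act1 d x) = x"
  using act1_act1[of x d c] act1_one[of x] by simp

lemma act2_inverse:
  "x \<in> torus \<Longrightarrow> act2 d x \<in> torus \<Longrightarrow> act2 c (act2 d x) \<in> torus \<Longrightarrow> c * d = 1 \<Longrightarrow> act2 c (act2 d x) = x"
  using act2_act2[of x d c] act2_one[of x] by simp

text \<open>A ratio of coordinates of the module is insensitive to scaling, so it can be compared
  with y1 y3 / y0, which is the same ratio on \<open>V2\<close>, and its change under the action of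
  0 comes from \<open>v1_act0\<close>.\<close>

lemma eps0_v1:
  assumes "x \<in> torus"
  shows "eps 0 x = v1 x $ N1 / v1 x $ Emp"
  using assms
proof (rule torus6E)
  fix x0 x1 x2 x3 x4 x5
  assume x: "x = tup6 x0 x1 x2 x3 x4 x5" and nz: "x0 \<noteq> 0" "x1 \<noteq> 0" "x2 \<noteq> 0" "x3 \<noteq> 0" "x4 \<noteq> 0" "x5 \<noteq> 0"
  define s where "s = x4 + x3 / x2"
  have "x2 * s = x2 * x4 + x3"
    using nz by (simp add: s_def distrib_left)
  note red = pol_red(2)[OF this, of x0 x1 x5]
  show ?thesis
    unfolding x eps_simps app6_tup6 red v1_nth[OF nz] unfolding s_def[symmetric] redE_def
    using nz by (simp add: field_simps power2_eq_square power3_eq_cube)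
qed

lemma eps0_act0:
  assumes x: "good x" "act0 c x \<in> torus"
  shows "eps 0 (act0 c x) = inverse c * eps 0 x"
proof -
  have t: "x \<in> torus" "v1 x $ N6 \<noteq> 0" "q2 1 x \<noteq> 0"
    using x B5_v1[of x] by (auto simp: good_def)
  note s = v1_act0[OF t(1) x(2) t(3,2)]
  show ?thesis
    unfolding eps0_v1[OF t(1)] eps0_v1[OF x(2)] s(1,10) using s(11) by (simp add: field_simps)
qed

text \<open>The same quadratic form in the coordinates of the module gives this product on
  \<open>V2\<close>, so proportional points have products differing by the square of the
  factor.\<close>

lemma long_prod_v1: "x \<in> torus \<Longrightarrow> long_prod x = v1 x $ N1 * v1 x $ B1 - (v1 x $ Emp)^2 - v1 x $ Emp * v1 x $ Z2"
  by (erule torus6E) (simp add: v1_nth long_prod_def field_simps power2_eq_square)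

lemma long_prod_v2:
  assumes "y \<in> torus"
  shows "long_prod y = v2 y $ N1 * v2 y $ B1 - (v2 y $ Emp)^2 - v2 y $ Emp * v2 y $ Z2"
  using assms
proof (rule torus6E)
  fix y0 y1 y2 y3 y4 y5
  assume y: "y = tup6 y0 y1 y2 y3 y4 y5" and nz: "y0 \<noteq> 0" "y1 \<noteq> 0" "y2 \<noteq> 0" "y3 \<noteq> 0" "y4 \<noteq> 0" "y5 \<noteq> 0"
  show ?thesis
    unfolding y v2_nth[OF nz] long_prod_def tup6_nth
    using nz by (simp add: field_simps power2_eq_square power3_eq_cube)
qed

lemma v1_Emp: "x \<in> torus \<Longrightarrow> v1 x $ Emp = x $ 0"
  by (erule torus6E) (simp add: v1_nth)

lemma v2_simple_nth:
  "y \<in> torus \<Longrightarrow> v2 y $ Emp = y $ 0" "y \<in> torus \<Longrightarrow> v2 y $ N1 = y $ 1 * y $ 3"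
  "y \<in> torus \<Longrightarrow> v2 y $ N2 = (y $ 2)^3 * (y $ 3 + (y $ 4)^3 / y $ 1)"
  by (erule torus6E, simp add: v2_nth)+

lemma good_long_prod:
  assumes "good x"
  shows "long_prod x = (scale2 (v1 x))^2 * long_prod (eta (v1 x))"
proof -
  obtain k where k: "v1 x = k *s v2 (eta (v1 x))" "scale2 (v1 x) = k"
    using good_eta[OF assms] by metis
  have t: "x \<in> torus" "eta (v1 x) \<in> torus"
    using assms by (auto simp: good_def)
  have c: "v1 x $ b = k * v2 (eta (v1 x)) $ b" for b
    using arg_cong[OF k(1), of "\<lambda>v. v $ b"] by simp
  show ?thesis
    unfolding long_prod_v1[OF t(1)] long_prod_v2[OF t(2)] k(2) c
    by (simp add: algebra_simps power2_eq_square)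
qed

lemma gam0_eta:
  assumes "good x"
  shows "gam 0 x = app6 (\<lambda>y0 y1 y2 y3 y4 y5. y0^2 / (y1 * y3 * y5)) (eta (v1 x))"
proof -
  obtain k where k: "k \<noteq> 0" "v1 x = k *s v2 (eta (v1 x))" "scale2 (v1 x) = k"
    using good_eta[OF assms] by metis
  have t: "x \<in> torus" "eta (v1 x) \<in> torus"
    using assms by (auto simp: good_def)
  have "x $ 0 = k * eta (v1 x) $ 0"
    using arg_cong[OF k(2), of "\<lambda>v. v $ Emp"] v1_Emp[OF t(1)] v2_simple_nth(1)[OF t(2)] by simp
  then show ?thesis
    unfolding gam_eq good_long_prod[OF assms] k(3) using k(1)
    by (simp add: app6_def long_prod_def power_mult_distrib)
qed

lemma eps0_eta:
  assumes "good x"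
  shows "eps 0 x = app6 (\<lambda>y0 y1 y2 y3 y4 y5. y1 * y3 / y0) (eta (v1 x))"
proof -
  obtain k where k: "k \<noteq> 0" "v1 x = k *s v2 (eta (v1 x))"
    using good_eta[OF assms] by metis
  have t: "x \<in> torus" "eta (v1 x) \<in> torus"
    using assms by (auto simp: good_def)
  have c: "v1 x $ b = k * v2 (eta (v1 x)) $ b" for b
    using arg_cong[OF k(2), of "\<lambda>v. v $ b"] by simp
  show ?thesis
    unfolding eps0_v1[OF t(1)] c v2_simple_nth[OF t(2)] using k(1) by (simp add: app6_def)
qed

subsection \<open>The relation between the actions of 0 and 2\<close>

text \<open>B5 equals x1 (\<open>short_prod x\<close> + x3) / x2. As it is nonzero, it determines x2
  from the other data, and the short product then determines x4.\<close>

lemma torus_eqI: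
  assumes t: "x \<in> torus" "x' \<in> torus" and eq: "x $ 0 = x' $ 0" "x $ 1 = x' $ 1" "x $ 3 = x' $ 3" "x $ 5 = x' $ 5"
    "short_prod x = short_prod x'" "v1 x $ B5 = v1 x' $ B5" and nz: "v1 x $ B5 \<noteq> 0"
  shows "x = x'"
proof -
  have n: "\<And>i. x $ i \<noteq> 0" "\<And>i. x' $ i \<noteq> 0"
    using t by (simp_all add: mem_torus_vec)
  have q: "q2 1 z = short_prod z + z $ 3" for z
    by (simp add: q2_def short_prod_def)
  have "x $ 1 / x $ 2 * q2 1 x = x $ 1 / x' $ 2 * q2 1 x" "q2 1 x \<noteq> 0"
    using eq nz B5_v1[OF t(1)] B5_v1[OF t(2)] by (auto simp: q)
  then have 2: "x $ 2 = x' $ 2"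
    using n by simp
  then have "x $ 4 = x' $ 4"
    using eq(5) n by (simp add: short_prod_def)
  with 2 eq show ?thesis
    by (simp add: vec_eq_iff forall_6)
qed

lemma v1_act2_B5:
  assumes x: "x \<in> torus" "act2 c x \<in> torus"
  shows "v1 (act2 c x) $ B5 = v1 x $ B5"
proof -
  have nz: "q2 1 x \<noteq> 0" "q2 c x \<noteq> 0" "c \<noteq> 0"
    using x act2_in_torus_iff[OF x(1), of c] by auto
  have q: "q2 1 (act2 c x) = q2 c x"
    unfolding q2_def[of _ "act2 c x"] using nz by (simp add: act2_def) (simp add: q2_def)
  show ?thesis
    unfolding B5_v1[OF x(1)] B5_v1[OF x(2)] q using nz by (simp add: act2_def)
qed

text \<open>Apart from the factor x2^3, these four polynomials depend only on x0, x1, x3, x5 and s,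
  and s is fixed because B5 = x1 s is.\<close>

lemma pol_act2:
  assumes x: "x \<in> torus" "act2 d x \<in> torus"
  defines "r \<equiv> (act2 d x $ 2 / x $ 2)^3"
  shows "app6 (polD c) (act2 d x) = r * app6 (polD c) x" "app6 polE (act2 d x) = r * app6 polE x"
    "app6 (polF c) (act2 d x) = r * app6 (polF c) x" "app6 (polH c) (act2 d x) = r * app6 (polH c) x" "r \<noteq> 0"
proof -
  let ?x = "act2 d x"
  have n: "\<And>i. x $ i \<noteq> 0" "\<And>i. ?x $ i \<noteq> 0"
    using x by (simp_all add: mem_torus_vec)
  define s where "s = x $ 4 + x $ 3 / x $ 2"
  have s: "x $ 2 * s = x $ 2 * x $ 4 + x $ 3"
    using n by (simp add: s_def distrib_left)
  have same: "?x $ 0 = x $ 0" "?x $ 1 = x $ 1" "?x $ 3 = x $ 3" "?x $ 5 = x $ 5"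
    by (simp_all add: act2_def)
  have q: "q2 1 z = z $ 2 * z $ 4 + z $ 3" for z
    by (simp add: q2_def)
  have "x $ 1 / ?x $ 2 * q2 1 ?x = x $ 1 / x $ 2 * q2 1 x"
    using v1_act2_B5[OF x] unfolding B5_v1[OF x(1)] B5_v1[OF x(2)] same .
  then have "x $ 1 * (q2 1 ?x / ?x $ 2) = x $ 1 * (q2 1 x / x $ 2)"
    by simp
  then have "q2 1 ?x / ?x $ 2 = q2 1 x / x $ 2"
    using n by (simp del: times_divide_eq_right)
  also have "\<dots> = s"
    using n by (simp add: q s_def field_simps)
  finally have "q2 1 ?x / ?x $ 2 = s" .
  then have s': "?x $ 2 * s = ?x $ 2 * ?x $ 4 + x $ 3"
    using n same by (simp add: q field_simps)
  show "app6 (polD c) ?x = r * app6 (polD c) x" "app6 polE ?x = r * app6 polE x"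
    "app6 (polF c) ?x = r * app6 (polF c) x" "app6 (polH c) ?x = r * app6 (polH c) x" "r \<noteq> 0"
    unfolding app6_def same pol_red(1-4)[OF s] pol_red(1-4)[OF s'] r_def using n
    by (simp_all add: power_divide)
qed

text \<open>Coordinates 0, 1, 3, 5 agree because they involve only ratios of D, E, F, H, which the
  action of 2 preserves. G would enter x2 and x4, so these are compared through the short product
  and B5.\<close>

lemma act0_act2_commute:
  assumes x: "good x" "act2 d x \<in> torus" "act0 c (act2 d x) \<in> torus" "act0 c x \<in> torus"
    "act2 d (act0 c x) \<in> torus" "good (act2 d x)"
  shows "act0 c (act2 d x) = act2 d (act0 c x)"
proof -
  have t: "x \<in> torus" "v1 x $ N6 \<noteq> 0" "q2 1 x \<noteq> 0" "v1 x $ B5 \<noteq> 0"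
    using x B5_v1[of x] by (auto simp: good_def)
  have t': "v1 (act2 d x) $ N6 \<noteq> 0" "q2 1 (act2 d x) \<noteq> 0"
    using x(6) B5_v1[of "act2 d x"] by (auto simp: good_def)
  note p = pol_act2[OF t(1) x(2)]
  have same: "act2 d z $ 0 = z $ 0" "act2 d z $ 1 = z $ 1" "act2 d z $ 3 = z $ 3" "act2 d z $ 5 = z $ 5" for z
    by (simp_all add: act2_def)
  have B5: "v1 (act0 c (act2 d x)) $ B5 = app6 (polD c) x / (c^2 * app6 polE x) * v1 x $ B5"
    using v1_act0(7)[OF x(2,3) t'(2,1)] v1_act2_B5[OF t(1) x(2)] p by simp
  show ?thesis
  proof (rule torus_eqI[OF x(3,5)])
    show "act0 c (act2 d x) $ 0 = act2 d (act0 c x) $ 0" "act0 c (act2 d x) $ 1 = act2 d (act0 c x) $ 1"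
      "act0 c (act2 d x) $ 3 = act2 d (act0 c x) $ 3" "act0 c (act2 d x) $ 5 = act2 d (act0 c x) $ 5"
      unfolding same unfolding act0_eq tup6_nth same p(1-4) using p(5) by (simp_all add: field_simps)
    show "short_prod (act0 c (act2 d x)) = short_prod (act2 d (act0 c x))"
      using act0_products(2)[OF x(2,3)] act0_products(2)[OF t(1) x(4)] act2_products(1)[OF t(1) x(2)]
        act2_products(1)[OF x(4,5)] p by simp
    show "v1 (act0 c (act2 d x)) $ B5 = v1 (act2 d (act0 c x)) $ B5"
      using B5 v1_act2_B5[OF x(4,5)] v1_act0(7)[OF t(1) x(4) t(3,2)] by simp
    show "v1 (act0 c (act2 d x)) $ B5 \<noteq> 0"
      using B5 v1_act0(11)[OF t(1) x(4) t(3,2)] t(4) by simp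
  qed
qed

subsection \<open>The relation between the actions of 0 and 1\<close>

text \<open>The action of 1 fixes \<open>y\<^sub>0, y\<^sub>2, y\<^sub>4\<close>, \<open>J1\<close> and \<open>J2\<close> and multiplies \<open>long_prod\<close> by \<open>c\<close>, while the
  action of 0 is simple in the coordinates \<open>y\<close> themselves. Where \<open>KK\<close> does not vanish, these six
  functions determine \<open>y\<close>.\<close>

definition J1 :: "complex ^ 6 \<Rightarrow> complex" where "J1 y = y $ 3 + (y $ 4)^3 / y $ 1"
definition J2 :: "complex ^ 6 \<Rightarrow> complex" where "J2 y = y $ 5 + y $ 0 / y $ 3"
definition KK :: "complex ^ 6 \<Rightarrow> complex" where
  "KK y = long_prod y * J1 y + (y $ 4)^3 * y $ 0"

text \<open>In these coordinates x1, x3, x5 occur only through \<open>i\<close> and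
  \<open>j\<close>, which \<open>v1_act1\<close> shows to be fixed by the action of 1, as x0, x2, x4
  are.\<close>

lemma v1_by_invariants:
  assumes "x \<in> torus"
  defines "i \<equiv> x $ 3 + (x $ 2)^3 / x $ 1" and "j \<equiv> x $ 5 + (x $ 4)^3 / x $ 3"
  shows "v1 x $ N5 = x $ 2 * j + 2 * (x $ 4)^2 + x $ 4 * i / x $ 2"
    "v1 x $ N3 = x $ 4 + i / x $ 2 + ((x $ 2)^2 * j + x $ 2 * (x $ 4)^2) / x $ 0"
    "v1 x $ N2 = j + 3 * (x $ 4)^2 / x $ 2 + 3 * x $ 4 * i / (x $ 2)^2 + i^2 / (x $ 2)^3 + (i * j - (x $ 4)^3) / x $ 0"
    "v1 x $ B6 = x $ 0 * (j + 3 * (x $ 4)^2 / x $ 2 + 3 * x $ 4 * i / (x $ 2)^2 + i^2 / (x $ 2)^3)"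
    "v1 x $ Z1 = x $ 2 * x $ 4" "v1 x $ Emp = x $ 0"
proof -
  obtain x0 x1 x2 x3 x4 x5 where x: "x = tup6 x0 x1 x2 x3 x4 x5"
    and nz: "x0 \<noteq> 0" "x1 \<noteq> 0" "x2 \<noteq> 0" "x3 \<noteq> 0" "x4 \<noteq> 0" "x5 \<noteq> 0"
    using torus6E[OF assms(1)] by metis
  show "v1 x $ N5 = x $ 2 * j + 2 * (x $ 4)^2 + x $ 4 * i / x $ 2"
    "v1 x $ N3 = x $ 4 + i / x $ 2 + ((x $ 2)^2 * j + x $ 2 * (x $ 4)^2) / x $ 0"
    "v1 x $ N2 = j + 3 * (x $ 4)^2 / x $ 2 + 3 * x $ 4 * i / (x $ 2)^2 + i^2 / (x $ 2)^3 + (i * j - (x $ 4)^3) / x $ 0"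
    "v1 x $ B6 = x $ 0 * (j + 3 * (x $ 4)^2 / x $ 2 + 3 * x $ 4 * i / (x $ 2)^2 + i^2 / (x $ 2)^3)"
    "v1 x $ Z1 = x $ 2 * x $ 4" "v1 x $ Emp = x $ 0"
    unfolding i_def j_def unfolding x tup6_nth v1_nth[OF nz] using nz
    by (simp_all add: field_simps power2_eq_square power3_eq_cube)
qed

lemma v1_act1:
  assumes x: "x \<in> torus" "act1 c x \<in> torus"
  shows "v1 (act1 c x) $ N5 = v1 x $ N5" "v1 (act1 c x) $ N3 = v1 x $ N3" "v1 (act1 c x) $ N2 = v1 x $ N2"
    "v1 (act1 c x) $ B6 = v1 x $ B6" "v1 (act1 c x) $ Z1 = v1 x $ Z1" "v1 (act1 c x) $ Emp = v1 x $ Emp"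
proof -
  have n: "\<And>i. x $ i \<noteq> 0"
    using x by (simp add: mem_torus_vec)
  define u v w where uvw: "u = q1 1 1 x" "v = q1 c 1 x" "w = q1 c c x"
  have nz: "u \<noteq> 0" "v \<noteq> 0" "w \<noteq> 0" "c \<noteq> 0"
    using x act1_in_torus_iff[OF x(1), of c] by (auto simp: uvw)
  define x1 x3 x5 A B where ab: "x1 = x $ 1" "x3 = x $ 3" "x5 = x $ 5" "A = (x $ 2)^3" "B = (x $ 4)^3"
  have rels: "u = x1 * x3^2 * x5 + A * x3 * x5 + A * B" "v = c * x1 * x3^2 * x5 + A * x3 * x5 + A * B"
    "w = c * x1 * x3^2 * x5 + c * A * x3 * x5 + A * B"
    by (simp_all add: uvw ab q1_def)
  have same: "act1 c x $ 0 = x $ 0" "act1 c x $ 2 = x $ 2" "act1 c x $ 4 = x $ 4"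
    by (simp_all add: act1_def)
  have "act1 c x $ 3 + A / act1 c x $ 1 = (x1 * x3 * w + A * u) / (x1 * v)"
    unfolding act1_def tup6_nth uvw[symmetric] ab(1-3)[symmetric] using nz n
    by (simp add: ab field_simps)
  also have "x1 * x3 * w + A * u = v * (x1 * x3 + A)"
    unfolding rels by algebra
  also have "v * (x1 * x3 + A) / (x1 * v) = x3 + A / x1"
    using nz n by (simp add: ab field_simps)
  finally have i: "act1 c x $ 3 + (x $ 2)^3 / act1 c x $ 1 = x $ 3 + (x $ 2)^3 / x $ 1"
    by (simp add: ab)
  have "act1 c x $ 5 + B / act1 c x $ 3 = (c * x3 * x5 * u + B * v) / (x3 * w)"
    unfolding act1_def tup6_nth uvw[symmetric] ab(1-3)[symmetric] using nz n
    by (simp add: ab field_simps)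
  also have "c * x3 * x5 * u + B * v = w * (x3 * x5 + B)"
    unfolding rels by algebra
  also have "w * (x3 * x5 + B) / (x3 * w) = x5 + B / x3"
    using nz n by (simp add: ab field_simps)
  finally have j: "act1 c x $ 5 + (x $ 4)^3 / act1 c x $ 3 = x $ 5 + (x $ 4)^3 / x $ 3"
    by (simp add: ab)
  show "v1 (act1 c x) $ N5 = v1 x $ N5" "v1 (act1 c x) $ N3 = v1 x $ N3" "v1 (act1 c x) $ N2 = v1 x $ N2"
    "v1 (act1 c x) $ B6 = v1 x $ B6" "v1 (act1 c x) $ Z1 = v1 x $ Z1" "v1 (act1 c x) $ Emp = v1 x $ Emp"
    unfolding v1_by_invariants[OF x(1)] v1_by_invariants[OF x(2)] same i j by (rule refl)+
qed

lemma v2_B6: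
  assumes "y \<in> torus"
  shows "v2 y $ B6 = (y $ 2)^3 * (1 + J1 y / (y $ 4)^3 * (J1 y * J2 y - y $ 0))"
  using assms
proof (rule torus6E)
  fix y0 y1 y2 y3 y4 y5
  assume y: "y = tup6 y0 y1 y2 y3 y4 y5" and nz: "y0 \<noteq> 0" "y1 \<noteq> 0" "y2 \<noteq> 0" "y3 \<noteq> 0" "y4 \<noteq> 0" "y5 \<noteq> 0"
  show ?thesis
    unfolding y v2_nth[OF nz] J1_def J2_def tup6_nth
    using nz by (simp add: field_simps power2_eq_square power3_eq_cube)
qed

text \<open>y0, y2, y4 and the scale are read off coordinates that the action fixes, so both points
  have the same scale k. N2 then gives J1, B6 gives J2, and the long product carries its factor c
  over from x to y.\<close>

lemma act1_eta:
  assumes x: "good x" "good (act1 c x)"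
  defines "y \<equiv> eta (v1 x)" and "y' \<equiv> eta (v1 (act1 c x))"
  shows "y' $ 0 = y $ 0" "y' $ 2 = y $ 2" "y' $ 4 = y $ 4" "J1 y' = J1 y" "J2 y' = J2 y"
    "long_prod y' = c * long_prod y"
proof -
  have t: "x \<in> torus" "act1 c x \<in> torus" "y \<in> torus" "y' \<in> torus"
    using x by (auto simp: good_def y_def y'_def)
  note v = v1_act1[OF t(1,2)]
  have e: "eta2 (v1 (act1 c x)) = eta2 (v1 x)" "eta4 (v1 (act1 c x)) = eta4 (v1 x)"
    by (simp_all add: eta2_def eta4_def v)
  then have sc: "scale2 (v1 (act1 c x)) = scale2 (v1 x)"
    by (simp add: scale2_def v)
  show y024: "y' $ 0 = y $ 0" "y' $ 2 = y $ 2" "y' $ 4 = y $ 4"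
    unfolding y_def y'_def eta_def tup6_nth e sc v by (rule refl)+
  obtain k where k: "k \<noteq> 0" "v1 x = k *s v2 y" "scale2 (v1 x) = k"
    using good_eta[OF x(1)] unfolding y_def by metis
  have k': "v1 (act1 c x) = k *s v2 y'"
    using good_eta[OF x(2)] sc k(3) unfolding y'_def by metis
  have c: "v1 x $ b = k * v2 y $ b" "v1 (act1 c x) $ b = k * v2 y' $ b" for b
    using arg_cong[OF k(2), of "\<lambda>v. v $ b"] arg_cong[OF k', of "\<lambda>v. v $ b"] by simp_all
  have nz: "\<And>i. y $ i \<noteq> 0" "\<And>i. y' $ i \<noteq> 0"
    using t by (simp_all add: mem_torus_vec)
  show J1: "J1 y' = J1 y"
    using v(3) unfolding c v2_simple_nth(3)[OF t(3)] v2_simple_nth(3)[OF t(4)] y024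
    using k(1) nz by (simp add: J1_def y024)
  have "v1 x $ N2 \<noteq> 0"
    using x by (simp add: good_def)
  then have J1nz: "J1 y \<noteq> 0"
    unfolding c v2_simple_nth(3)[OF t(3)] using k(1) by (simp add: J1_def)
  show "J2 y' = J2 y"
    using v(4) unfolding c v2_B6[OF t(3)] v2_B6[OF t(4)] y024 J1
    using k(1) nz J1nz by simp
  show "long_prod y' = c * long_prod y"
    using good_long_prod[OF x(1)] good_long_prod[OF x(2)] act1_products(1)[OF t(1,2)] sc k(1,3)
    by (simp add: y_def y'_def)
qed

lemma J_relations:
  assumes "y \<in> torus"
  shows "y $ 3 * (long_prod y + (y $ 4)^3 * J2 y) = KK y" "y $ 1 * (J1 y - y $ 3) = (y $ 4)^3"
  using assms by (simp_all add: KK_def J1_def J2_def long_prod_def mem_torus_vec field_simps)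

text \<open>The first of the \<open>J_relations\<close> is linear in y3, with nonzero coefficient
  because \<open>KK\<close> is nonzero; the second then gives y1, and the long product gives
  y5.\<close>

lemma J_determine:
  assumes y: "y \<in> torus" "y' \<in> torus" and eq: "y' $ 0 = y $ 0" "y' $ 2 = y $ 2" "y' $ 4 = y $ 4"
    "J1 y' = J1 y" "J2 y' = J2 y" "long_prod y' = long_prod y" and K: "KK y \<noteq> 0"
  shows "y' = y"
proof -
  have nz: "\<And>i. y $ i \<noteq> 0" "\<And>i. y' $ i \<noteq> 0"
    using y by (simp_all add: mem_torus_vec)
  have "KK y' = KK y"
    by (simp add: KK_def eq)
  then have "y' $ 3 * (long_prod y + (y $ 4)^3 * J2 y) = y $ 3 * (long_prod y + (y $ 4)^3 * J2 y)"
    using J_relations(1)[OF y(1)] J_relations(1)[OF y(2)] by (simp add: eq)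
  moreover have "long_prod y + (y $ 4)^3 * J2 y \<noteq> 0"
    using J_relations(1)[OF y(1)] K by auto
  ultimately have 3: "y' $ 3 = y $ 3"
    by simp
  have "y' $ 1 * (J1 y - y $ 3) = y $ 1 * (J1 y - y $ 3)" "J1 y - y $ 3 \<noteq> 0"
    using J_relations(2)[OF y(1)] J_relations(2)[OF y(2)] nz(1) eq 3 by auto
  then have 1: "y' $ 1 = y $ 1"
    by simp
  have "y' $ 5 = y $ 5"
    using eq(6) nz by (simp add: long_prod_def 1 3)
  then show ?thesis
    using eq 1 3 by (simp add: vec_eq_iff forall_6)
qed

text \<open>The increment of J2 is (c - 1) y0 / y3. Eliminating y3 with \<open>J_relations\<close>
  expresses it through the six functions alone.\<close>

lemma act0_J:
  assumes x: "good x" "act0 c x \<in> torus"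
  defines "y \<equiv> eta (v1 x)" and "y' \<equiv> eta (v1 (act0 c x))"
  shows "y' $ 0 = c * y $ 0" "y' $ 2 = y $ 2" "y' $ 4 = y $ 4" "J1 y' = J1 y"
    "(J2 y' - J2 y) * KK y = (c - 1) * y $ 0 * (long_prod y + (y $ 4)^3 * J2 y)" "long_prod y' = long_prod y"
proof -
  have y': "y' = tup6 (c * y $ 0) (y $ 1) (y $ 2) (y $ 3) (y $ 4) (y $ 5)"
    unfolding y_def y'_def by (rule act0_good(2)[OF x])
  have y: "y \<in> torus"
    using x by (simp add: y_def good_def)
  then have nz: "\<And>i. y $ i \<noteq> 0"
    by (simp add: mem_torus_vec)
  show "y' $ 0 = c * y $ 0" "y' $ 2 = y $ 2" "y' $ 4 = y $ 4" "J1 y' = J1 y" "long_prod y' = long_prod y"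
    by (simp_all add: y' J1_def long_prod_def)
  have "(J2 y' - J2 y) * y $ 3 = (c - 1) * y $ 0"
    using nz by (simp add: y' J2_def field_simps)
  then show "(J2 y' - J2 y) * KK y = (c - 1) * y $ 0 * (long_prod y + (y $ 4)^3 * J2 y)"
    unfolding J_relations(1)[OF y, symmetric] by (simp flip: mult.assoc)
qed

lemma act0_act1_verma:
  fixes x
  assumes c: "c1 \<noteq> 0" "c2 \<noteq> 0"
  defines "u1 \<equiv> act0 c2 x" defines "u2 \<equiv> act1 (c1 * c2) u1" defines "u3 \<equiv> act0 c1 u2"
  defines "z1 \<equiv> act1 c1 x" defines "z2 \<equiv> act0 (c1 * c2) z1" defines "z3 \<equiv> act1 c2 z2"
  assumes g: "good x" "good u1" "good u2" "good u3" "good z1" "good z2" "good z3"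
    and K: "KK (eta (v1 x)) \<noteq> 0" "KK (eta (v1 u2)) \<noteq> 0" "KK (eta (v1 z1)) \<noteq> 0" "KK (eta (v1 z3)) \<noteq> 0"
  shows "u3 = z3"
proof (rule good_inject[OF g(4,7)])
  have t: "act0 c2 x \<in> torus" "act0 c1 u2 \<in> torus" "act0 (c1 * c2) z1 \<in> torus"
    using g by (auto simp: good_def u1_def u3_def z2_def)
  note a = act0_J[OF g(1) t(1), folded u1_def] act1_eta[OF g(2) g(3)[unfolded u2_def], folded u2_def]
    act0_J[OF g(3) t(2), folded u3_def]
  note b = act1_eta[OF g(1) g(5)[unfolded z1_def], folded z1_def] act0_J[OF g(5) t(3), folded z2_def]
    act1_eta[OF g(6) g(7)[unfolded z3_def], folded z3_def]
  define R y0 B J a0 a1 a2 b1 where d: "R = long_prod (eta (v1 x))" "y0 = eta (v1 x) $ 0" "B = (eta (v1 x) $ 4)^3"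
    "J = J1 (eta (v1 x))" "a0 = J2 (eta (v1 x))" "a1 = J2 (eta (v1 u1))" "a2 = J2 (eta (v1 u3))" "b1 = J2 (eta (v1 z2))"
  \<comment> \<open>The action of 1 fixes J2, so each occurrence of 0 gives one linear equation: e1
    and e2 on one side of the relation, e3 on the other. Eliminating a1 leaves a2 = b1.\<close>
  have e1: "(a1 - a0) * (R * J + B * y0) = (c2 - 1) * y0 * (R + B * a0)"
    using a(5) by (simp add: d KK_def)
  have e2: "(a2 - a1) * (c1 * c2 * R * J + B * (c2 * y0)) = (c1 - 1) * (c2 * y0) * (c1 * c2 * R + B * a1)"
    using a(17) by (simp add: d KK_def a)
  have e3: "(b1 - a0) * (c1 * R * J + B * y0) = (c1 * c2 - 1) * y0 * (c1 * R + B * a0)"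
    using b(11) by (simp add: d KK_def b)
  have K0: "R * J + B * y0 \<noteq> 0" "c1 * R * J + B * y0 \<noteq> 0"
    using K(1,3) by (simp_all add: d KK_def b)
  have "(R * J + B * y0) * (c2 * (c1 * R * J + B * y0)) * (a2 - b1) = 0"
    using e1 e2 e3 by algebra
  then have J2: "a2 = b1"
    using K0 c by simp
  show "eta (v1 u3) = eta (v1 z3)"
  proof (rule J_determine)
    show "eta (v1 z3) \<in> torus" "eta (v1 u3) \<in> torus"
      using g by (simp_all add: good_def)
    show "J2 (eta (v1 u3)) = J2 (eta (v1 z3))"
      using J2 by (simp add: d b)
  qed (use K in \<open>simp_all add: a b ac_simps\<close>)
qed

subsection \<open>The relation between the actions of 1 and 2\<close>

text \<open>In the 7-dimensional representation of \<open>G\<^sub>2\<close> let \<open>B(x)\<close> be the product of the matrices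
  \<open>Y\<^sub>1(x\<^sub>1) Y\<^sub>2(x\<^sub>2) Y\<^sub>1(x\<^sub>3) Y\<^sub>2(x\<^sub>4) Y\<^sub>1(x\<^sub>5)\<close>. The actions of 1 and 2 come from moving a one-parameter
  unipotent element through \<open>B(x)\<close>. If \<open>t\<close> is the torus element for which the first step on either
  side of the Verma relation is a conjugation of \<open>B(x) t\<close>, then so are all later steps. Both ends are
  thus lower triangular with the same diagonal and conjugate under the unipotent upper triangular
  group, and since the diagonal is regular, they are equal.\<close>

type_synonym vec7 = "nat \<Rightarrow> complex"

definition v7 :: "complex \<Rightarrow> complex \<Rightarrow> complex \<Rightarrow> complex \<Rightarrow> complex \<Rightarrow> complex \<Rightarrow> complex \<Rightarrow> vec7" where
  "v7 a0 a1 a2 a3 a4 a5 a6 k = (if k = 0 then a0 else if k = 1 then a1 else if k = 2 then a2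
     else if k = 3 then a3 else if k = 4 then a4 else if k = 5 then a5 else if k = 6 then a6 else 0)"

text \<open>Vectors are functions on all naturals; identities between operators are asserted on this
  subspace.\<close>

definition S7 :: "vec7 set" where "S7 = {v. \<forall>k\<ge>7. v k = 0}"

lemma v7_nth [simp]:
  "v7 a0 a1 a2 a3 a4 a5 a6 0 = a0" "v7 a0 a1 a2 a3 a4 a5 a6 (Suc 0) = a1" "v7 a0 a1 a2 a3 a4 a5 a6 2 = a2"
  "v7 a0 a1 a2 a3 a4 a5 a6 3 = a3" "v7 a0 a1 a2 a3 a4 a5 a6 4 = a4" "v7 a0 a1 a2 a3 a4 a5 a6 5 = a5"
  "v7 a0 a1 a2 a3 a4 a5 a6 6 = a6"
  by (simp_all add: v7_def)

lemma v7_in_S7 [simp]: "v7 a0 a1 a2 a3 a4 a5 a6 \<in> S7"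
  by (auto simp: S7_def v7_def)

lemma v7_eqI:
  "a0 = b0 \<Longrightarrow> a1 = b1 \<Longrightarrow> a2 = b2 \<Longrightarrow> a3 = b3 \<Longrightarrow> a4 = b4 \<Longrightarrow> a5 = b5 \<Longrightarrow> a6 = b6 \<Longrightarrow>
     v7 a0 a1 a2 a3 a4 a5 a6 = v7 b0 b1 b2 b3 b4 b5 b6"
  by simp

lemma S7_v7: "v \<in> S7 \<Longrightarrow> v7 (v 0) (v 1) (v 2) (v 3) (v 4) (v 5) (v 6) = v"
  by (rule ext) (auto simp: S7_def v7_def)

lemma less_7: "k < 7 \<longleftrightarrow> k = 0 \<or> k = 1 \<or> k = 2 \<or> k = 3 \<or> k = 4 \<or> k = 5 \<or> k = (6::nat)"
  by auto

definition lin7 :: "(vec7 \<Rightarrow> vec7) \<Rightarrow> bool" where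
  "lin7 f \<longleftrightarrow> (\<forall>v\<in>S7. f v \<in> S7) \<and> (\<forall>u v a. f (\<lambda>k. u k + a * v k) = (\<lambda>k. f u k + a * f v k))"

text \<open>Triangularity is phrased by supports: a vector supported up to index k stays so and
  keeps its entry k. \<open>lower7\<close> is the mirror image with diagonal
  \<open>d\<close>.\<close>

definition upper7 :: "(vec7 \<Rightarrow> vec7) \<Rightarrow> bool" where
  "upper7 f \<longleftrightarrow> lin7 f \<and> (\<forall>v\<in>S7. \<forall>k<7. (\<forall>j>k. v j = 0) \<longrightarrow> f v k = v k \<and> (\<forall>j>k. f v j = 0))"

definition lower7 :: "(nat \<Rightarrow> complex) \<Rightarrow> (vec7 \<Rightarrow> vec7) \<Rightarrow> bool" where
  "lower7 d f \<longleftrightarrow> lin7 f \<and> (\<forall>v\<in>S7. \<forall>k<7. (\<forall>j<k. v j = 0) \<longrightarrow> f v k = d k * v k \<and> (\<forall>j<k. f v j = 0))"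

lemma lin7_compose: "lin7 f \<Longrightarrow> lin7 g \<Longrightarrow> lin7 (\<lambda>v. f (g v))"
  by (simp add: lin7_def)

lemma lin7_zero: "lin7 f \<Longrightarrow> f (\<lambda>_. 0) = (\<lambda>_. 0)"
proof -
  assume "lin7 f"
  then have "f (\<lambda>k. 0 + (-1) * 0) = (\<lambda>k. f (\<lambda>_. 0) k + (-1) * f (\<lambda>_. 0) k)"
    unfolding lin7_def by fast
  then show ?thesis
    by simp
qed

lemma lin7D: "lin7 f \<Longrightarrow> v \<in> S7 \<Longrightarrow> f v \<in> S7"
  "lin7 f \<Longrightarrow> f (\<lambda>k. u k + a * w k) = (\<lambda>k. f u k + a * f w k)"
  unfolding lin7_def by simp_all

lemma upper7D:
  assumes "upper7 f"
  shows "lin7 f" "v \<in> S7 \<Longrightarrow> f v \<in> S7"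
    "v \<in> S7 \<Longrightarrow> k < 7 \<Longrightarrow> (\<And>j. j > k \<Longrightarrow> v j = 0) \<Longrightarrow> f v k = v k"
    "v \<in> S7 \<Longrightarrow> k < 7 \<Longrightarrow> (\<And>j. j > k \<Longrightarrow> v j = 0) \<Longrightarrow> i > k \<Longrightarrow> f v i = 0"
  using assms unfolding upper7_def by (simp_all add: lin7D(1))

lemma lower7D:
  assumes "lower7 d f"
  shows "lin7 f" "v \<in> S7 \<Longrightarrow> f v \<in> S7"
    "v \<in> S7 \<Longrightarrow> k < 7 \<Longrightarrow> (\<And>j. j < k \<Longrightarrow> v j = 0) \<Longrightarrow> f v k = d k * v k"
    "v \<in> S7 \<Longrightarrow> k < 7 \<Longrightarrow> (\<And>j. j < k \<Longrightarrow> v j = 0) \<Longrightarrow> i < k \<Longrightarrow> f v i = 0"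
  using assms unfolding lower7_def by (simp_all add: lin7D(1))

lemma upper7_compose:
  assumes f: "upper7 f" and g: "upper7 g"
  shows "upper7 (\<lambda>v. f (g v))"
  unfolding upper7_def
proof (intro conjI ballI allI impI)
  show "lin7 (\<lambda>v. f (g v))"
    by (rule lin7_compose[OF upper7D(1)[OF f] upper7D(1)[OF g]])
  fix v :: vec7 and k :: nat assume v: "v \<in> S7" "k < 7" "\<forall>j>k. v j = 0"
  then have v': "\<And>j. j > k \<Longrightarrow> v j = 0"
    by simp
  note gv = upper7D(2)[OF g v(1)] upper7D(3)[OF g v(1,2) v'] upper7D(4)[OF g v(1,2) v']
  show "f (g v) k = v k"
    using upper7D(3)[OF f gv(1) v(2) gv(3)] gv(2) by simp
  fix j assume "k < j"
  then show "f (g v) j = 0"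
    using upper7D(4)[OF f gv(1) v(2), of j] gv(3) by simp
qed

lemma lower7_compose:
  assumes f: "lower7 d f" and g: "lower7 d' g"
  shows "lower7 (\<lambda>k. d k * d' k) (\<lambda>v. f (g v))"
  unfolding lower7_def
proof (intro conjI ballI allI impI)
  show "lin7 (\<lambda>v. f (g v))"
    by (rule lin7_compose[OF lower7D(1)[OF f] lower7D(1)[OF g]])
  fix v :: vec7 and k :: nat assume v: "v \<in> S7" "k < 7" "\<forall>j<k. v j = 0"
  then have v': "\<And>j. j < k \<Longrightarrow> v j = 0"
    by simp
  note gv = lower7D(2)[OF g v(1)] lower7D(3)[OF g v(1,2) v'] lower7D(4)[OF g v(1,2) v']
  show "f (g v) k = d k * d' k * v k"
    using lower7D(3)[OF f gv(1) v(2) gv(3)] gv(2) by simp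
  fix j assume "j < k"
  then show "f (g v) j = 0"
    using lower7D(4)[OF f gv(1) v(2), of j] gv(3) by simp
qed

text \<open>The inverse \<open>m\<close> is part of the data, so that symmetry and transitivity are
  immediate.\<close>

definition unip_conj :: "(vec7 \<Rightarrow> vec7) \<Rightarrow> (vec7 \<Rightarrow> vec7) \<Rightarrow> bool" where
  "unip_conj f g \<longleftrightarrow> (\<exists>n m. upper7 n \<and> upper7 m \<and> (\<forall>v\<in>S7. m (n v) = v \<and> n (m v) = v \<and> n (f v) = g (n v)))"

lemma unip_conj_trans:
  assumes "unip_conj f g" "unip_conj g h" and S: "\<And>v. v \<in> S7 \<Longrightarrow> f v \<in> S7"
  shows "unip_conj f h"
proof -
  obtain n m where n: "upper7 n" "upper7 m" "\<forall>v\<in>S7. m (n v) = v \<and> n (m v) = v \<and> n (f v) = g (n v)"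
    using assms(1) unfolding unip_conj_def by blast
  obtain n' m' where n': "upper7 n'" "upper7 m'" "\<forall>v\<in>S7. m' (n' v) = v \<and> n' (m' v) = v \<and> n' (g v) = h (n' v)"
    using assms(2) unfolding unip_conj_def by blast
  have "\<forall>v\<in>S7. n v \<in> S7 \<and> m' v \<in> S7"
    using upper7D(2)[OF n(1)] upper7D(2)[OF n'(2)] by simp
  then have "\<forall>v\<in>S7. m (m' (n' (n v))) = v \<and> n' (n (m (m' v))) = v \<and> n' (n (f v)) = h (n' (n v))"
    using n(3) n'(3) by simp
  then show ?thesis
    unfolding unip_conj_def using upper7_compose[OF n'(1) n(1)] upper7_compose[OF n(2) n'(2)] by blast
qed

lemma unip_conj_sym:
  assumes "unip_conj f g" and S: "\<And>v. v \<in> S7 \<Longrightarrow> f v \<in> S7"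
  shows "unip_conj g f"
proof -
  obtain n m where n: "upper7 n" "upper7 m" "\<forall>v\<in>S7. m (n v) = v \<and> n (m v) = v \<and> n (f v) = g (n v)"
    using assms(1) unfolding unip_conj_def by blast
  have "m (g v) = f (m v)" if v: "v \<in> S7" for v
  proof -
    have m: "m v \<in> S7"
      using upper7D(2)[OF n(2) v] .
    then have "n (f (m v)) = g v"
      using n(3) v by simp
    then show ?thesis
      using n(3) S[OF m] by metis
  qed
  then show ?thesis
    unfolding unip_conj_def using n by blast
qed

text \<open>The conjugating \<open>n\<close> is shown to be the identity on \<open>S7\<close>: it
  fixes the basis vectors from the last to the first, because the diagonal entries are pairwise
  distinct.\<close>

lemma unip_conj_imp_eq:
  assumes f: "lower7 d f" and g: "lower7 d g" and conj: "unip_conj f g" and d: "inj_on d {..<7}"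
    and v: "v \<in> S7"
  shows "f v = g v"
proof -
  obtain n where n: "upper7 n" "\<forall>v\<in>S7. n (f v) = g (n v)"
    using conj unfolding unip_conj_def by blast
  have lin: "n (\<lambda>k. u k + a * v k) = (\<lambda>k. n u k + a * n v k)" "g (\<lambda>k. u k + a * v k) = (\<lambda>k. g u k + a * g v k)"
    for u v a
    by (rule lin7D(2)[OF upper7D(1)[OF n(1)]] lin7D(2)[OF lower7D(1)[OF g]])+
  have S: "n v \<in> S7" "f v \<in> S7" "g v \<in> S7" if "v \<in> S7" for v
    by (rule upper7D(2)[OF n(1) that] lower7D(2)[OF f that] lower7D(2)[OF g that])+
  \<comment> \<open>Induction on the number k of last indices in which the vector is
    supported.\<close>
  have *: "\<forall>v\<in>S7. (\<forall>j<7 - k. v j = 0) \<longrightarrow> n v = v" if "k \<le> 7" for k :: nat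
    using that
  proof (induction k)
    case 0
    have "v = (\<lambda>_. 0)" if "v \<in> S7" "\<forall>j<7. v j = 0" for v
      using that by (auto simp: S7_def) (metis not_le)
    then show ?case
      using lin7_zero[OF upper7D(1)[OF n(1)]] by (metis diff_zero)
  next
    case (Suc k')
    define k where "k = 7 - Suc k'"
    have k: "k < 7" "7 - k' = Suc k"
      using Suc.prems by (auto simp: k_def)
    have IH: "n v = v" if "v \<in> S7" "\<forall>j\<le>k. v j = 0" for v
      using Suc that k by (simp add: less_Suc_eq_le)
    define e :: vec7 where "e = (\<lambda>j. if j = k then 1 else 0)"
    have e: "e \<in> S7"
      using k by (auto simp: S7_def e_def)
    have fe: "f e k = d k" "\<forall>j<k. f e j = 0" "g e k = d k" "\<forall>j<k. g e j = 0"
      using lower7D(3,4)[OF f e k(1)] lower7D(3,4)[OF g e k(1)] by (simp_all add: e_def)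
    have ne: "n e k = 1" "\<forall>j>k. n e j = 0"
      using upper7D(3,4)[OF n(1) e k(1)] by (simp_all add: e_def)
    \<comment> \<open>The part of \<open>f e\<close> strictly beyond index k, which \<open>n\<close>
      fixes by the induction hypothesis.\<close>
    define r where "r = (\<lambda>j. f e j + (- d k) * e j)"
    have r: "r \<in> S7" "\<forall>j\<le>k. r j = 0"
      using S(2)[OF e] e fe by (auto simp: r_def S7_def e_def le_less)
    define w where "w = (\<lambda>j. n e j + (-1) * e j)"
    have w: "w \<in> S7"
      using S(1)[OF e] e by (auto simp: w_def S7_def)
    have w0: "w j = 0" if "j \<ge> k" for j
      using that ne by (cases "j = k") (auto simp: w_def e_def)
    have "f e = (\<lambda>j. r j + d k * e j)"
      by (simp add: r_def)
    then have "n (f e) = (\<lambda>j. r j + d k * n e j)"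
      using IH[OF r] by (simp add: lin)
    then have gn: "g (n e) = (\<lambda>j. r j + d k * n e j)"
      using n(2) e by simp
    have gw: "g w j = r j + d k * n e j - g e j" for j
      unfolding w_def lin gn by simp
    \<comment> \<open>With all earlier entries of w zero, lower triangularity gives entry d j w j of
      \<open>g w\<close>, while the conjugation identity gives d k w j; the two factors differ for j
      < k.\<close>
    have "w j = 0" for j
    proof (induction j rule: less_induct)
      case (less j)
      show ?case
      proof (cases "j < k")
        case True
        have "g w j = d j * w j"
          using less.IH True k(1) by (intro lower7D(3)[OF g w]) auto
        moreover have "g w j = d k * w j"
          unfolding gw using r(2) True fe by (simp add: w_def e_def)
        moreover have "d j \<noteq> d k"
          using d True k(1) by (auto dest: inj_onD)
        ultimately show ?thesis
          by simp
      qed (use w0 in simp)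
    qed
    then have n_e: "n e = e"
      by (auto simp: w_def)
    show ?case
    proof (intro ballI impI)
      fix v assume v: "v \<in> S7" "\<forall>j<7 - Suc k'. v j = 0"
      define v' where "v' = (\<lambda>j. v j + (- v k) * e j)"
      have "v' \<in> S7" "\<forall>j\<le>k. v' j = 0"
        using v e by (auto simp: v'_def S7_def e_def k_def le_less)
      then have "n v' = v'"
        by (rule IH)
      moreover have "v = (\<lambda>j. v' j + v k * e j)"
        by (simp add: v'_def)
      ultimately show "n v = v"
        using lin(1)[of v' "v k" e] n_e by metis
    qed
  qed
  from *[of 7] have "n u = u" if "u \<in> S7" for u
    using that by simp
  then show ?thesis
    using n(2) v S by metis
qed

text \<open>The basis vectors have weights \<alpha>_1 + 2\<alpha>_2, \<alpha>_1 + \<alpha>_2,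
  \<alpha>_2, 0 and the negatives in reverse order. \<open>X1\<close>, \<open>X2\<close> are the
  raising one-parameter subgroups, \<open>W1\<close>, \<open>W2\<close> are Y_1, Y_2 in this
  representation, and \<open>T7 s t\<close> is the torus element with \<alpha>_1 = s and \<alpha>_2
  = t.\<close>

definition X1 :: "complex \<Rightarrow> vec7 \<Rightarrow> vec7" where
  "X1 a v = v7 (v 0) (v 1 + a * v 2) (v 2) (v 3) (v 4 + a * v 5) (v 5) (v 6)"
definition X2 :: "complex \<Rightarrow> vec7 \<Rightarrow> vec7" where
  "X2 a v = v7 (v 0 + a * v 1) (v 1) (v 2 + 2 * a * v 3 + a^2 * v 4) (v 3 + a * v 4) (v 4) (v 5 + a * v 6) (v 6)"
definition W1 :: "complex \<Rightarrow> vec7 \<Rightarrow> vec7" where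
  "W1 c v = v7 (v 0) (c * v 1) (v 2 / c + v 1) (v 3) (c * v 4) (v 5 / c + v 4) (v 6)"
definition W2 :: "complex \<Rightarrow> vec7 \<Rightarrow> vec7" where
  "W2 c v = v7 (c * v 0) (v 1 / c + v 0) (c^2 * v 2) (v 3 + c * v 2) (v 4 / c^2 + 2 * v 3 / c + v 2) (c * v 5)
     (v 6 / c + v 5)"
definition T7 :: "complex \<Rightarrow> complex \<Rightarrow> vec7 \<Rightarrow> vec7" where
  "T7 s t v = v7 (s * t^2 * v 0) (s * t * v 1) (t * v 2) (v 3) (v 4 / t) (v 5 / (s * t)) (v 6 / (s * t^2))"

text \<open>A computation in SL_2. The shift from c to c + a is the source of the factors in the
  actions of 1 and 2.\<close>

lemma X1_W1: "c \<noteq> 0 \<Longrightarrow> c + a \<noteq> 0 \<Longrightarrow> X1 a (W1 c v) = W1 (c + a) (X1 (a / (c * (c + a))) v)"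
proof -
  assume c: "c \<noteq> 0" "c + a \<noteq> 0"
  define e where "e = c + a"
  have e: "e \<noteq> 0" "a = e - c"
    using c by (simp_all add: e_def)
  show ?thesis
    unfolding e_def[symmetric] unfolding e(2) X1_def W1_def using c(1) e(1)
    by (intro v7_eqI) (simp_all add: field_simps)
qed

text \<open>The raising element for 1 commutes with the exponential of \<open>f_2\<close>; only the
  coroot part rescales it, with exponent 3 from the Cartan entry -3.\<close>

lemma X1_W2: "c \<noteq> 0 \<Longrightarrow> X1 a (W2 c v) = W2 c (X1 (a * c^3) v)"
  unfolding X1_def W2_def by (rule v7_eqI) (simp_all add: field_simps power2_eq_square power3_eq_cube)

lemma X2_W1: "c \<noteq> 0 \<Longrightarrow> X2 a (W1 c v) = W1 c (X2 (a * c) v)"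
  unfolding X2_def W1_def by (rule v7_eqI) (simp_all add: field_simps power2_eq_square power3_eq_cube)

lemma X2_W2: "c \<noteq> 0 \<Longrightarrow> c + a \<noteq> 0 \<Longrightarrow> X2 a (W2 c v) = W2 (c + a) (X2 (a / (c * (c + a))) v)"
proof -
  assume c: "c \<noteq> 0" "c + a \<noteq> 0"
  define e where "e = c + a"
  have e: "e \<noteq> 0" "a = e - c"
    using c by (simp_all add: e_def)
  show ?thesis
    unfolding e_def[symmetric] unfolding e(2) X2_def W2_def using c(1) e(1)
    by (intro v7_eqI) (simp_all add: field_simps power2_eq_square power3_eq_cube)
qed

lemma X1_T7: "s \<noteq> 0 \<Longrightarrow> t \<noteq> 0 \<Longrightarrow> X1 (a * s) (T7 s t v) = T7 s t (X1 a v)"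
  unfolding X1_def T7_def by (rule v7_eqI) (simp_all add: field_simps power2_eq_square)

lemma X2_T7: "s \<noteq> 0 \<Longrightarrow> t \<noteq> 0 \<Longrightarrow> X2 (a * t) (T7 s t v) = T7 s t (X2 a v)"
  unfolding X2_def T7_def by (rule v7_eqI) (simp_all add: field_simps power2_eq_square)

lemma lin7_ops [simp]: "lin7 (X1 a)" "lin7 (X2 a)" "lin7 (W1 a)" "lin7 (W2 a)" "lin7 (T7 s t)"
  unfolding lin7_def X1_def X2_def W1_def W2_def T7_def
  by (auto simp: fun_eq_iff v7_def field_simps add_divide_distrib)

lemma upper7_X: "upper7 (X1 a)" "upper7 (X2 a)"
  unfolding upper7_def by (auto simp: less_7 X1_def X2_def v7_def)

lemma lower7_W1: "lower7 (v7 1 c (1 / c) 1 c (1 / c) 1) (W1 c)"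
  unfolding lower7_def by (auto simp: less_7 W1_def v7_def)

lemma lower7_W2: "lower7 (v7 c (1 / c) (c^2) 1 (1 / c^2) c (1 / c)) (W2 c)"
  unfolding lower7_def by (auto simp: less_7 W2_def v7_def)

lemma lower7_T7: "lower7 (v7 (s * t^2) (s * t) t 1 (1 / t) (1 / (s * t)) (1 / (s * t^2))) (T7 s t)"
  unfolding lower7_def by (auto simp: less_7 T7_def v7_def)

lemma X_inverse: "v \<in> S7 \<Longrightarrow> X1 (- a) (X1 a v) = v" "v \<in> S7 \<Longrightarrow> X2 (- a) (X2 a v) = v"
  using S7_v7[of v] by (simp_all add: X1_def X2_def algebra_simps power2_eq_square)

definition BB :: "complex ^ 6 \<Rightarrow> vec7 \<Rightarrow> vec7" where
  "BB x v = W1 (x $ 1) (W2 (x $ 2) (W1 (x $ 3) (W2 (x $ 4) (W1 (x $ 5) v))))"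

text \<open>The parameter is chosen so that the first factor becomes \<open>C1\<close> x1. Moving
  the element through the product gives it the parameters a1, a2, a3 at the three factors
  \<open>W1\<close>, and their shifts multiply x1, x3, x5 by p/u, w/p and cu/w.\<close>

lemma X1_BB:
  assumes x: "x \<in> torus" "act1 c x \<in> torus"
  shows "X1 ((c - 1) * (x $ 1)^2 * (x $ 3)^2 * x $ 5 / q1 1 1 x) (BB x v) =
    BB (act1 c x) (X1 ((c - 1) * (x $ 2)^3 * (x $ 4)^3 / (c * x $ 5 * q1 1 1 x)) v)"
proof -
  obtain x0 x1 x2 x3 x4 x5 where xx: "x = tup6 x0 x1 x2 x3 x4 x5"
    and n: "x0 \<noteq> 0" "x1 \<noteq> 0" "x2 \<noteq> 0" "x3 \<noteq> 0" "x4 \<noteq> 0" "x5 \<noteq> 0"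
    using torus6E[OF x(1)] by metis
  define u p w where uvw: "u = q1 1 1 x" "p = q1 c 1 x" "w = q1 c c x"
  have nz: "u \<noteq> 0" "p \<noteq> 0" "w \<noteq> 0" "c \<noteq> 0"
    using x act1_in_torus_iff[OF x(1), of c] by (auto simp: uvw)
  have up: "p = u + (c - 1) * (x1 * x3^2 * x5)" "w = p + (c - 1) * (x2^3 * x3 * x5)"
    "c * u = w + (c - 1) * (x2^3 * x4^3)"
    by (simp_all add: uvw xx q1_def algebra_simps)
  define a1 a2 a3 where a: "a1 = (c - 1) * x1^2 * x3^2 * x5 / u" "a2 = (c - 1) * x2^3 * x3^2 * x5 / p"
    "a3 = (c - 1) * x2^3 * x5 * x4^3 / w"
  have s: "x1 + a1 = p / u * x1" "x3 + a2 = w / p * x3" "x5 + a3 = c * u / w * x5"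
    unfolding a up(3) using nz n by (simp_all add: up(1) up(2) field_simps power2_eq_square)
  have snz: "x1 + a1 \<noteq> 0" "x3 + a2 \<noteq> 0" "x5 + a3 \<noteq> 0"
    unfolding s using nz n by auto
  have t: "a1 / (x1 * (x1 + a1)) * x2^3 = a2" "a2 / (x3 * (x3 + a2)) * x4^3 = a3"
    "a3 / (x5 * (x5 + a3)) = (c - 1) * x2^3 * x4^3 / (c * x5 * u)"
    unfolding s unfolding a using nz n by (simp_all add: field_simps power2_eq_square)
  have "X1 a1 (BB x v) = W1 (x1 + a1) (W2 x2 (W1 (x3 + a2) (W2 x4 (W1 (x5 + a3)
      (X1 ((c - 1) * x2^3 * x4^3 / (c * x5 * u)) v)))))"
    unfolding BB_def xx tup6_nth X1_W1[OF n(2) snz(1)] X1_W2[OF n(3)] t(1) X1_W1[OF n(4) snz(2)]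
      X1_W2[OF n(5)] t(2) X1_W1[OF n(6) snz(3)] t(3) ..
  then show ?thesis
    unfolding s BB_def act1_def tup6_nth uvw[symmetric] unfolding a xx tup6_nth by simp
qed

lemma X2_BB:
  assumes x: "x \<in> torus" "act2 c x \<in> torus"
  shows "X2 ((c - 1) * x $ 2 * (x $ 2 * x $ 4) / (x $ 1 * q2 1 x)) (BB x v) =
    BB (act2 c x) (X2 ((c - 1) * x $ 3 * x $ 5 / (c * x $ 4 * q2 1 x)) v)"
proof -
  obtain x0 x1 x2 x3 x4 x5 where xx: "x = tup6 x0 x1 x2 x3 x4 x5"
    and n: "x0 \<noteq> 0" "x1 \<noteq> 0" "x2 \<noteq> 0" "x3 \<noteq> 0" "x4 \<noteq> 0" "x5 \<noteq> 0"
    using torus6E[OF x(1)] by metis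
  define u p where up: "u = q2 1 x" "p = q2 c x"
  have nz: "u \<noteq> 0" "p \<noteq> 0" "c \<noteq> 0"
    using x act2_in_torus_iff[OF x(1), of c] by (auto simp: up)
  have e: "p = u + (c - 1) * (x2 * x4)" "c * u = p + (c - 1) * x3"
    by (simp_all add: up xx q2_def algebra_simps)
  define a0 a1 a2 where a: "a0 = (c - 1) * x2 * (x2 * x4) / (x1 * u)" "a1 = (c - 1) * x2 * (x2 * x4) / u"
    "a2 = (c - 1) * x4 * x3 / p"
  have s: "x2 + a1 = p / u * x2" "x4 + a2 = c * u / p * x4"
    unfolding a e(2) using nz n by (simp_all add: e(1) field_simps power2_eq_square)
  have snz: "x2 + a1 \<noteq> 0" "x4 + a2 \<noteq> 0"
    unfolding s using nz n by auto
  have t: "a0 * x1 = a1" "a1 / (x2 * (x2 + a1)) * x3 = a2"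
    "a2 / (x4 * (x4 + a2)) * x5 = (c - 1) * x3 * x5 / (c * x4 * u)"
    unfolding s unfolding a using nz n by (simp_all add: field_simps power2_eq_square)
  have "X2 a0 (BB x v) = W1 x1 (W2 (x2 + a1) (W1 x3 (W2 (x4 + a2) (W1 x5
      (X2 ((c - 1) * x3 * x5 / (c * x4 * u)) v)))))"
    unfolding BB_def xx tup6_nth X2_W1[OF n(2)] t(1) X2_W2[OF n(3) snz(1)] X2_W1[OF n(4)] t(2)
      X2_W2[OF n(5) snz(2)] X2_W1[OF n(6)] t(3) ..
  then show ?thesis
    unfolding s BB_def act2_def tup6_nth up[symmetric] unfolding a xx tup6_nth by simp
qed

definition GG :: "complex \<Rightarrow> complex \<Rightarrow> complex ^ 6 \<Rightarrow> vec7 \<Rightarrow> vec7" where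
  "GG s t x v = BB x (T7 s t v)"

text \<open>The condition on s says that the value of \<alpha>_1 on the diagonal of
  \<open>GG s t x\<close> is 1/c. The element leaving \<open>BB\<close> on the right is then
  \<open>X1 (a * s)\<close>, which \<open>T7\<close> turns back into \<open>X1 a\<close>, the
  element that entered on the left.\<close>

lemma unip_conj_act1:
  assumes x: "x \<in> torus" "act1 c x \<in> torus" and st: "s \<noteq> 0" "t \<noteq> 0"
    and s: "s * c * (long_prod x)^2 = (short_prod x)^3"
  shows "unip_conj (GG s t x) (GG s t (act1 c x))"
proof -
  define a where "a = (c - 1) * (x $ 1)^2 * (x $ 3)^2 * x $ 5 / q1 1 1 x"
  have nz: "\<And>i. x $ i \<noteq> 0" "c \<noteq> 0" "q1 1 1 x \<noteq> 0"
    using x act1_in_torus_iff[OF x(1), of c] by (auto simp: mem_torus_vec)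
  have sp: "(x $ 2)^3 * (x $ 4)^3 = s * c * (x $ 1 * x $ 3 * x $ 5)^2"
    using s by (simp add: long_prod_def short_prod_def power_mult_distrib)
  have "(c - 1) * (x $ 2)^3 * (x $ 4)^3 / (c * x $ 5 * q1 1 1 x) =
      (c - 1) * ((x $ 2)^3 * (x $ 4)^3) / (c * x $ 5 * q1 1 1 x)"
    by simp
  also have "\<dots> = a * s"
    unfolding sp a_def using nz by (simp add: field_simps power2_eq_square)
  finally have "X1 a (GG s t x v) = GG s t (act1 c x) (X1 a v)" for v
    using X1_BB[OF x, of "T7 s t v"] X1_T7[OF st, of a v] by (simp add: GG_def a_def)
  then show ?thesis
    unfolding unip_conj_def using X_inverse(1)[of _ a] X_inverse(1)[of _ "- a"] upper7_X(1)
    by (intro exI[of _ "X1 a"] exI[of _ "X1 (- a)"]) simp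
qed

lemma unip_conj_act2:
  assumes x: "x \<in> torus" "act2 c x \<in> torus" and st: "s \<noteq> 0" "t \<noteq> 0"
    and t: "t * c * (short_prod x)^2 = long_prod x"
  shows "unip_conj (GG s t x) (GG s t (act2 c x))"
proof -
  define a where "a = (c - 1) * x $ 2 * (x $ 2 * x $ 4) / (x $ 1 * q2 1 x)"
  have nz: "\<And>i. x $ i \<noteq> 0" "c \<noteq> 0" "q2 1 x \<noteq> 0"
    using x act2_in_torus_iff[OF x(1), of c] by (auto simp: mem_torus_vec)
  have e: "x $ 3 * x $ 5 = t * c * (x $ 2 * x $ 4)^2 / x $ 1"
    using t nz by (simp add: long_prod_def short_prod_def field_simps)
  have "(c - 1) * (x $ 3 * x $ 5) / (c * x $ 4 * q2 1 x) = a * t"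
    unfolding e a_def using nz by (simp add: field_simps power2_eq_square)
  then have "(c - 1) * x $ 3 * x $ 5 / (c * x $ 4 * q2 1 x) = a * t"
    by (simp add: mult.assoc)
  then have "X2 a (GG s t x v) = GG s t (act2 c x) (X2 a v)" for v
    using X2_BB[OF x, of "T7 s t v"] X2_T7[OF st, of a v] by (simp add: GG_def a_def)
  then show ?thesis
    unfolding unip_conj_def using X_inverse(2)[of _ a] X_inverse(2)[of _ "- a"] upper7_X(2)
    by (intro exI[of _ "X2 a"] exI[of _ "X2 (- a)"]) simp
qed

text \<open>The weights of the 7-dimensional representation at \<alpha>_2 = a and \<alpha>_1 =
  b.\<close>

definition diag7 :: "complex \<Rightarrow> complex \<Rightarrow> nat \<Rightarrow> complex" where
  "diag7 a b = v7 (a^2 * b) (a * b) a 1 (1 / a) (1 / (a * b)) (1 / (a^2 * b))"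

lemma lower7_GG:
  assumes x: "x \<in> torus" and st: "s \<noteq> 0" "t \<noteq> 0"
  shows "lower7 (diag7 (t * (short_prod x)^2 / long_prod x) (s * (long_prod x)^2 / (short_prod x)^3)) (GG s t x)"
proof -
  have nz: "\<And>i. x $ i \<noteq> 0"
    using x by (simp add: mem_torus_vec)
  note l = lower7_compose[OF lower7_W1 lower7_compose[OF lower7_W2 lower7_compose[OF lower7_W1
    lower7_compose[OF lower7_W2 lower7_compose[OF lower7_W1 lower7_T7]]]]]
  have "lower7 d f \<Longrightarrow> (\<And>k. k < 7 \<Longrightarrow> d k = d' k) \<Longrightarrow> lower7 d' f" for d d' f
    unfolding lower7_def by metis
  note cong = this
  show ?thesis
    unfolding GG_def[abs_def] BB_def
  proof (rule cong[OF l])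
    fix k :: nat assume "k < 7"
    then show "v7 1 (x $ 1) (1 / x $ 1) 1 (x $ 1) (1 / x $ 1) 1 k *
        (v7 (x $ 2) (1 / x $ 2) ((x $ 2)^2) 1 (1 / (x $ 2)^2) (x $ 2) (1 / x $ 2) k *
         (v7 1 (x $ 3) (1 / x $ 3) 1 (x $ 3) (1 / x $ 3) 1 k *
          (v7 (x $ 4) (1 / x $ 4) ((x $ 4)^2) 1 (1 / (x $ 4)^2) (x $ 4) (1 / x $ 4) k *
           (v7 1 (x $ 5) (1 / x $ 5) 1 (x $ 5) (1 / x $ 5) 1 k *
            v7 (s * t^2) (s * t) t 1 (1 / t) (1 / (s * t)) (1 / (s * t^2)) k)))) =
        diag7 (t * (short_prod x)^2 / long_prod x) (s * (long_prod x)^2 / (short_prod x)^3) k"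
      using nz st unfolding less_7 diag7_def long_prod_def short_prod_def
      by (auto simp: field_simps power2_eq_square power3_eq_cube)
  qed
qed

lemma ops_v7:
  "W1 c (v7 a0 a1 a2 a3 a4 a5 a6) = v7 a0 (c * a1) (a2 / c + a1) a3 (c * a4) (a5 / c + a4) a6"
  "W2 c (v7 a0 a1 a2 a3 a4 a5 a6) = v7 (c * a0) (a1 / c + a0) (c^2 * a2) (a3 + c * a2)
     (a4 / c^2 + 2 * a3 / c + a2) (c * a5) (a6 / c + a5)"
  "T7 s t (v7 a0 a1 a2 a3 a4 a5 a6) = v7 (s * t^2 * a0) (s * t * a1) (t * a2) a3 (a4 / t) (a5 / (s * t))
     (a6 / (s * t^2))"
  by (simp_all add: W1_def W2_def T7_def)

lemma GG_inject:
  assumes x: "x \<in> torus" "x' \<in> torus" and st: "s \<noteq> 0" "t \<noteq> 0"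
    and eq: "\<And>v. v \<in> S7 \<Longrightarrow> GG s t x v = GG s t x' v" "x $ 0 = x' $ 0" "long_prod x = long_prod x'"
  shows "x = x'"
proof -
  have nz: "\<And>i. x $ i \<noteq> 0" "\<And>i. x' $ i \<noteq> 0"
    using x by (simp_all add: mem_torus_vec)
  \<comment> \<open>The image of the first basis vector, normalized to cancel \<open>T7\<close>,
    shows x1 to x4. Neither x0 nor x5 occurs in it; they come from the last two assumptions.\<close>
  have G: "GG s t z (v7 (1 / (s * t^2)) 0 0 0 0 0 0) = v7 (z $ 2 * z $ 4) (z $ 1 * (z $ 3 / z $ 2 + z $ 4))
     ((z $ 2)^2 / z $ 1 + (z $ 3 / z $ 2 + z $ 4)) (z $ 2) (z $ 1) 1 0" for z
    unfolding GG_def BB_def ops_v7 using st by (intro v7_eqI) simp_all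
  have e: "v7 (x $ 2 * x $ 4) (x $ 1 * (x $ 3 / x $ 2 + x $ 4))
     ((x $ 2)^2 / x $ 1 + (x $ 3 / x $ 2 + x $ 4)) (x $ 2) (x $ 1) 1 0 =
    v7 (x' $ 2 * x' $ 4) (x' $ 1 * (x' $ 3 / x' $ 2 + x' $ 4))
     ((x' $ 2)^2 / x' $ 1 + (x' $ 3 / x' $ 2 + x' $ 4)) (x' $ 2) (x' $ 1) 1 0" (is "?l = ?r")
    unfolding G[symmetric] by (rule eq(1)) simp
  have 1: "x $ 1 = x' $ 1" and 2: "x $ 2 = x' $ 2"
    using fun_cong[OF e, of 4] fun_cong[OF e, of 3] by simp_all
  have 4: "x $ 4 = x' $ 4"
    using fun_cong[OF e, of 0] 2 nz by simp
  have 3: "x $ 3 = x' $ 3"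
    using fun_cong[OF e, of 1] 1 2 4 nz by simp
  have "x $ 5 = x' $ 5"
    using eq(3) nz by (simp add: long_prod_def 1 3)
  then show ?thesis
    using 1 2 3 4 eq(2) by (simp add: vec_eq_iff forall_6)
qed

lemma act_0_nth: "act1 c x $ 0 = x $ 0" "act2 c x $ 0 = x $ 0"
  by (simp_all add: act1_def act2_def)

lemma act1_act2_verma:
  fixes x
  assumes c: "c1 \<noteq> 0" "c2 \<noteq> 0" and x: "x \<in> torus"
  defines "l1 \<equiv> act1 c2 x" defines "l2 \<equiv> act2 (c1 * c2) l1" defines "l3 \<equiv> act1 (c1^3 * c2^2) l2"
  defines "l4 \<equiv> act2 (c1^2 * c2) l3" defines "l5 \<equiv> act1 (c1^3 * c2) l4" defines "l6 \<equiv> act2 c1 l5"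
  defines "r1 \<equiv> act2 c1 x" defines "r2 \<equiv> act1 (c1^3 * c2) r1" defines "r3 \<equiv> act2 (c1^2 * c2) r2"
  defines "r4 \<equiv> act1 (c1^3 * c2^2) r3" defines "r5 \<equiv> act2 (c1 * c2) r4" defines "r6 \<equiv> act1 c2 r5"
  assumes l: "l1 \<in> torus" "l2 \<in> torus" "l3 \<in> torus" "l4 \<in> torus" "l5 \<in> torus" "l6 \<in> torus"
    and r: "r1 \<in> torus" "r2 \<in> torus" "r3 \<in> torus" "r4 \<in> torus" "r5 \<in> torus" "r6 \<in> torus"
    and d: "inj_on (diag7 c1 c2) {..<7}"
  shows "l6 = r6"
proof -
  define P p where Pp: "P = long_prod x" "p = short_prod x"
  have nz: "P \<noteq> 0" "p \<noteq> 0"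
    using prods_nonzero[OF x] by (simp_all add: Pp)
  \<comment> \<open>This choice makes the root values on the diagonal at x equal to 1/c2 for
    \<alpha>_1 and 1/c1 for \<alpha>_2, as the first step on either side requires.\<close>
  define s t where st: "s = p^3 / (c2 * P^2)" "t = P / (c1 * p^2)"
  have stnz: "s \<noteq> 0" "t \<noteq> 0"
    using nz c by (simp_all add: st)
  have L: "long_prod l1 = c2 * P" "short_prod l1 = p" "long_prod l2 = c2 * P" "short_prod l2 = c1 * c2 * p"
    "long_prod l3 = c1^3 * c2^2 * (c2 * P)" "short_prod l3 = c1 * c2 * p"
    "long_prod l4 = c1^3 * c2^2 * (c2 * P)" "short_prod l4 = c1^2 * c2 * (c1 * c2 * p)"
    "long_prod l5 = c1^3 * c2 * (c1^3 * c2^2 * (c2 * P))" "short_prod l5 = c1^2 * c2 * (c1 * c2 * p)"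
    "long_prod l6 = c1^3 * c2 * (c1^3 * c2^2 * (c2 * P))" "short_prod l6 = c1 * (c1^2 * c2 * (c1 * c2 * p))"
    using act1_products[OF x l(1)[unfolded l1_def], folded l1_def]
      act2_products[OF l(1) l(2)[unfolded l2_def], folded l2_def]
      act1_products[OF l(2) l(3)[unfolded l3_def], folded l3_def]
      act2_products[OF l(3) l(4)[unfolded l4_def], folded l4_def]
      act1_products[OF l(4) l(5)[unfolded l5_def], folded l5_def]
      act2_products[OF l(5) l(6)[unfolded l6_def], folded l6_def]
    by (simp_all add: Pp)
  have R: "long_prod r1 = P" "short_prod r1 = c1 * p" "long_prod r2 = c1^3 * c2 * P" "short_prod r2 = c1 * p"
    "long_prod r3 = c1^3 * c2 * P" "short_prod r3 = c1^2 * c2 * (c1 * p)"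
    "long_prod r4 = c1^3 * c2^2 * (c1^3 * c2 * P)" "short_prod r4 = c1^2 * c2 * (c1 * p)"
    "long_prod r5 = c1^3 * c2^2 * (c1^3 * c2 * P)" "short_prod r5 = c1 * c2 * (c1^2 * c2 * (c1 * p))"
    "long_prod r6 = c2 * (c1^3 * c2^2 * (c1^3 * c2 * P))" "short_prod r6 = c1 * c2 * (c1^2 * c2 * (c1 * p))"
    using act2_products[OF x r(1)[unfolded r1_def], folded r1_def]
      act1_products[OF r(1) r(2)[unfolded r2_def], folded r2_def]
      act2_products[OF r(2) r(3)[unfolded r3_def], folded r3_def]
      act1_products[OF r(3) r(4)[unfolded r4_def], folded r4_def]
      act2_products[OF r(4) r(5)[unfolded r5_def], folded r5_def]
      act1_products[OF r(5) r(6)[unfolded r6_def], folded r6_def]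
    by (simp_all add: Pp)
  note simps = st field_simps power2_eq_square power3_eq_cube
  have L1: "unip_conj (GG s t x) (GG s t l1)"
    unfolding l1_def using c nz
    by (intro unip_conj_act1 stnz x l(1)[unfolded l1_def])
      (simp add: L R simps flip: Pp)
  have L2: "unip_conj (GG s t l1) (GG s t l2)"
    unfolding l2_def using c nz
    by (intro unip_conj_act2 stnz l(1) l(2)[unfolded l2_def])
      (simp add: L R simps flip: Pp)
  have L3: "unip_conj (GG s t l2) (GG s t l3)"
    unfolding l3_def using c nz
    by (intro unip_conj_act1 stnz l(2) l(3)[unfolded l3_def])
      (simp add: L R simps flip: Pp)
  have L4: "unip_conj (GG s t l3) (GG s t l4)"
    unfolding l4_def using c nz
    by (intro unip_conj_act2 stnz l(3) l(4)[unfolded l4_def])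
      (simp add: L R simps flip: Pp)
  have L5: "unip_conj (GG s t l4) (GG s t l5)"
    unfolding l5_def using c nz
    by (intro unip_conj_act1 stnz l(4) l(5)[unfolded l5_def])
      (simp add: L R simps flip: Pp)
  have L6: "unip_conj (GG s t l5) (GG s t l6)"
    unfolding l6_def using c nz
    by (intro unip_conj_act2 stnz l(5) l(6)[unfolded l6_def])
      (simp add: L R simps flip: Pp)
  have R1: "unip_conj (GG s t x) (GG s t r1)"
    unfolding r1_def using c nz
    by (intro unip_conj_act2 stnz x r(1)[unfolded r1_def])
      (simp add: L R simps flip: Pp)
  have R2: "unip_conj (GG s t r1) (GG s t r2)"
    unfolding r2_def using c nz
    by (intro unip_conj_act1 stnz r(1) r(2)[unfolded r2_def])
      (simp add: L R simps flip: Pp)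
  have R3: "unip_conj (GG s t r2) (GG s t r3)"
    unfolding r3_def using c nz
    by (intro unip_conj_act2 stnz r(2) r(3)[unfolded r3_def])
      (simp add: L R simps flip: Pp)
  have R4: "unip_conj (GG s t r3) (GG s t r4)"
    unfolding r4_def using c nz
    by (intro unip_conj_act1 stnz r(3) r(4)[unfolded r4_def])
      (simp add: L R simps flip: Pp)
  have R5: "unip_conj (GG s t r4) (GG s t r5)"
    unfolding r5_def using c nz
    by (intro unip_conj_act2 stnz r(4) r(5)[unfolded r5_def])
      (simp add: L R simps flip: Pp)
  have R6: "unip_conj (GG s t r5) (GG s t r6)"
    unfolding r6_def using c nz
    by (intro unip_conj_act1 stnz r(5) r(6)[unfolded r6_def])
      (simp add: L R simps flip: Pp)
  have GS: "GG s t z v \<in> S7" for z v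
    by (simp add: GG_def BB_def W1_def)
  note tr = unip_conj_trans[OF _ _ GS]
  \<comment> \<open>The point x is the common start of both chains, so the two ends are linked by
    reversing one of them.\<close>
  have "unip_conj (GG s t x) (GG s t l6)"
    by (rule tr[OF tr[OF tr[OF tr[OF tr[OF L1 L2] L3] L4] L5] L6])
  then have "unip_conj (GG s t l6) (GG s t x)"
    by (rule unip_conj_sym[OF _ GS])
  then have "unip_conj (GG s t l6) (GG s t r6)"
    by (rule tr[OF _ tr[OF tr[OF tr[OF tr[OF tr[OF R1 R2] R3] R4] R5] R6]])
  moreover have "lower7 (diag7 c1 c2) (GG s t l6)" "lower7 (diag7 c1 c2) (GG s t r6)"
  proof -
    have "t * (short_prod l6)^2 / long_prod l6 = c1" "s * (long_prod l6)^2 / (short_prod l6)^3 = c2"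
      "t * (short_prod r6)^2 / long_prod r6 = c1" "s * (long_prod r6)^2 / (short_prod r6)^3 = c2"
      unfolding L R st using nz c by (simp_all add: field_simps power2_eq_square power3_eq_cube)
    then show "lower7 (diag7 c1 c2) (GG s t l6)" "lower7 (diag7 c1 c2) (GG s t r6)"
      using lower7_GG[OF l(6) stnz] lower7_GG[OF r(6) stnz] by simp_all
  qed
  ultimately have "GG s t l6 v = GG s t r6 v" if "v \<in> S7" for v
    using unip_conj_imp_eq d that by blast
  moreover have "l6 $ 0 = r6 $ 0"
    by (simp add: l1_def l2_def l3_def l4_def l5_def l6_def r1_def r2_def r3_def r4_def r5_def r6_def act_0_nth)
  moreover have "long_prod l6 = long_prod r6"
    by (simp add: L R)
  ultimately show ?thesis
    by (intro GG_inject[OF l(6) r(6) stnz])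
qed

section \<open>Regularity and generic behaviour of the coordinate maps\<close>

definition one6 :: "complex ^ 6" where "one6 = tup6 1 1 1 1 1 1"

lemma one6_nth [simp]: "one6 $ i = 1"
  using forall_6[of "\<lambda>i. one6 $ i = 1"] by (simp add: one6_def)

lemma one6_torus [simp]: "one6 \<in> torus"
  by (simp add: mem_torus_vec)

lemma mem_torus_prod: "p \<in> torus \<longleftrightarrow> fst p \<in> torus \<and> snd p \<in> torus"
  by (subst torus_prod) (auto simp: mem_Times_iff)

lemma irreducible_T1: "irreducible_set (torus :: (complex ^ 6) set)"
  by (rule irreducible_torus[OF curve_connected_vec]) (use one6_torus in blast)

lemma irreducible_T2: "irreducible_set (torus :: (complex \<times> (complex ^ 6)) set)"
proof (rule irreducible_torus)
  have "(1 :: complex, one6) \<in> torus"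
    by (simp add: mem_torus_prod)
  then show "(torus :: (complex \<times> (complex ^ 6)) set) \<noteq> {}"
    by blast
qed (intro curve_connected_prod curve_connected_complex curve_connected_vec)

lemma irreducible_T3: "irreducible_set (torus :: (complex \<times> complex \<times> (complex ^ 6)) set)"
proof (rule irreducible_torus)
  have "(1 :: complex, 1 :: complex, one6) \<in> torus"
    by (simp add: mem_torus_prod)
  then show "(torus :: (complex \<times> complex \<times> (complex ^ 6)) set) \<noteq> {}"
    by blast
qed (intro curve_connected_prod curve_connected_complex curve_connected_vec)

section \<open>The varieties: regular charts, irreducibility, transfer of generic statements\<close>

lemma regular_map_into:
  "regular_map U Q f \<Longrightarrow> (\<And>x. x \<in> U \<Longrightarrow> f x \<in> R) \<Longrightarrow> regular_map U R f"
  by (auto simp: regular_map_def)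

lemma regular_map_Pair_torus:
  "regular_map U torus f \<Longrightarrow> regular_map U torus g \<Longrightarrow> regular_map U torus (\<lambda>x. (f x, g x))"
  by (subst torus_prod) (rule regular_map_PairI)

lemma regular_map_fst_torus: "U \<subseteq> torus \<Longrightarrow> regular_map U torus fst"
  by (rule regular_map_fst[of _ _ torus]) (simp flip: torus_prod)

lemma regular_map_snd_torus: "U \<subseteq> torus \<Longrightarrow> regular_map U torus snd"
  by (rule regular_map_snd[of _ torus]) (simp flip: torus_prod)

lemma regular_Y:
  fixes V :: "'a::affine_space \<Rightarrow> wmod"
  assumes V: "\<And>b. regular_fun U (\<lambda>x. V x $ b)" and c: "regular_fun U c" "\<And>x. x \<in> U \<Longrightarrow> c x \<noteq> 0"
  shows "regular_fun U (\<lambda>x. Y 0 (c x) (V x) $ b)" "regular_fun U (\<lambda>x. Y 1 (c x) (V x) $ b)"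
    "regular_fun U (\<lambda>x. Y 2 (c x) (V x) $ b)"
proof -
  have "\<forall>b. regular_fun U (\<lambda>x. Y 0 (c x) (V x) $ b)"
    unfolding wbasis_all
    by (simp add: Y0_nth c(2) cong: regular_fun_cong) (intro conjI regular_intros V c; simp add: c(2))
  then show "regular_fun U (\<lambda>x. Y 0 (c x) (V x) $ b)" ..
  have "\<forall>b. regular_fun U (\<lambda>x. Y 1 (c x) (V x) $ b)"
    unfolding wbasis_all
    by (simp add: Y1_nth c(2) del: One_nat_def cong: regular_fun_cong) (intro conjI regular_intros V c; simp add: c(2))
  then show "regular_fun U (\<lambda>x. Y 1 (c x) (V x) $ b)" ..
  have "\<forall>b. regular_fun U (\<lambda>x. Y 2 (c x) (V x) $ b)"
    unfolding wbasis_all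
    by (simp add: Y2_nth c(2) cong: regular_fun_cong) (intro conjI regular_intros V c; simp add: c(2))
  then show "regular_fun U (\<lambda>x. Y 2 (c x) (V x) $ b)" ..
qed

lemma regular_v1: "regular_map torus V1 v1"
proof (rule regular_map_vecI)
  have nz: "regular_fun torus (\<lambda>x :: complex ^ 6. x $ i)" "x \<in> torus \<Longrightarrow> x $ i \<noteq> 0" for i and x :: "complex ^ 6"
    by (simp_all add: regular_fun_vec mem_torus_vec)
  show "regular_fun torus (\<lambda>x. v1 x $ b)" for b
    unfolding v1_def by (intro regular_Y nz regular_fun_const)
qed (simp add: V1_def)

lemma regular_v2: "regular_map torus V2 v2"
proof (rule regular_map_vecI)
  have nz: "regular_fun torus (\<lambda>x :: complex ^ 6. x $ i)" "x \<in> torus \<Longrightarrow> x $ i \<noteq> 0" for i and x :: "complex ^ 6"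
    by (simp_all add: regular_fun_vec mem_torus_vec)
  show "regular_fun torus (\<lambda>x. v2 x $ b)" for b
    unfolding v2_def by (intro regular_Y nz regular_fun_const)
qed (simp add: V2_def)

lemma xi_v1_id [simp]: "x \<in> torus \<Longrightarrow> xi (v1 x) = x"
  using xi_v1(1)[of x 1] by simp

lemma eta_v2_id [simp]: "y \<in> torus \<Longrightarrow> eta (v2 y) = y"
  using eta_v2(1)[of y 1] by simp

lemma V1_xi: "w \<in> V1 \<Longrightarrow> xi w \<in> torus" "w \<in> V1 \<Longrightarrow> v1 (xi w) = w"
  by (auto simp: V1_def)

lemma V2_eta: "w \<in> V2 \<Longrightarrow> eta w \<in> torus" "w \<in> V2 \<Longrightarrow> v2 (eta w) = w"
  by (auto simp: V2_def)

lemma regular_xi: "regular_map V1 torus xi"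
  by (rule regular_map_subset[OF xi_regular(2)]) (auto simp: V1_xi)

lemma regular_eta: "regular_map V2 torus eta"
  by (rule regular_map_subset[OF eta_regular(2)]) (auto simp: V2_eta)

lemma irreducible_V1: "irreducible_set V1"
  by (rule irreducible_set_image[OF irreducible_T1 regular_v1]) (simp add: V1_def)

lemma irreducible_V2: "irreducible_set V2"
  by (rule irreducible_set_image[OF irreducible_T1 regular_v2]) (simp add: V2_def)

lemma regular_v1_param:
  "regular_map torus (Cstar \<times> V1) (\<lambda>p. (fst p, v1 (snd p)))"
  "regular_map torus (Cstar \<times> Cstar \<times> V1) (\<lambda>p. (fst p, fst (snd p), v1 (snd (snd p))))"
  unfolding torus_complex[symmetric]
  by (intro regular_map_PairI regular_map_fst_torus regular_map_compose[OF regular_v1]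
      regular_map_compose[OF regular_map_fst_torus[of torus] regular_map_snd_torus]
      regular_map_compose[OF regular_map_snd_torus[of torus] regular_map_snd_torus]
      regular_map_snd_torus order.refl)+

lemma image_v1_param:
  "(\<lambda>p. (fst p, v1 (snd p))) ` torus = Cstar \<times> V1"
  "(\<lambda>p. (fst p, fst (snd p), v1 (snd (snd p)))) ` torus = Cstar \<times> Cstar \<times> V1"
  unfolding torus_prod torus_complex V1_def by (auto simp: image_iff)

lemma irreducible_CV1: "irreducible_set (Cstar \<times> V1)" "irreducible_set (Cstar \<times> Cstar \<times> V1)"
  by (rule irreducible_set_image[OF irreducible_T2 regular_v1_param(1) image_v1_param(1)]
      irreducible_set_image[OF irreducible_T3 regular_v1_param(2) image_v1_param(2)])+

lemma irreducible_1V1: "irreducible_set ({1 :: complex} \<times> V1)"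
proof (rule irreducible_set_image[OF irreducible_T1])
  show "regular_map torus ({1 :: complex} \<times> V1) (\<lambda>x. (1, v1 x))"
    by (intro regular_map_PairI regular_v1 regular_map_complexI regular_fun_const) simp
qed (auto simp: V1_def)

lemma regular_xi_param:
  "regular_map (Cstar \<times> V1) torus (\<lambda>p. (fst p, xi (snd p)))"
  "regular_map (Cstar \<times> Cstar \<times> V1) torus (\<lambda>p. (fst p, fst (snd p), xi (snd (snd p))))"
proof -
  have f: "regular_map (Cstar \<times> X) torus fst" for X :: "'a::affine_space set"
    unfolding torus_complex by (rule regular_map_fst[of _ _ X]) simp
  have s: "regular_map (Cstar \<times> X) X snd" for X :: "'a::affine_space set"
    by (rule regular_map_snd[of _ Cstar]) simp
  show "regular_map (Cstar \<times> V1) torus (\<lambda>p. (fst p, xi (snd p)))"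
    by (intro regular_map_Pair_torus f regular_map_compose[OF regular_xi] s)
  show "regular_map (Cstar \<times> Cstar \<times> V1) torus (\<lambda>p. (fst p, fst (snd p), xi (snd (snd p))))"
    by (intro regular_map_Pair_torus f regular_map_compose[OF f s]
        regular_map_compose[OF regular_xi] regular_map_compose[OF s s])
qed

text \<open>\<open>xi\<close> is a regular surjection from \<open>V1\<close> to the torus with
  \<open>v1 (xi v) = v\<close>, so generic statements on the torus pull back. The versions with
  parameters below work in the same way.\<close>

lemma eventually_V1I:
  assumes "\<forall>\<^sub>F x in generic torus. P (v1 x)"
  shows "\<forall>\<^sub>F v in generic V1. P v"
proof -
  have "filterlim xi (generic torus) (generic V1)"
    by (rule filterlim_generic_surj[OF irreducible_V1 irreducible_T1 regular_xi])
      (use V1_xi in \<open>auto simp: V1_def image_iff intro!: bexI[of _ "v1 _"]\<close>)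
  then have "\<forall>\<^sub>F v in generic V1. P (v1 (xi v))"
    using assms unfolding filterlim_iff by blast
  with eventually_in_generic[OF irreducible_V1] show ?thesis
    by eventually_elim (simp add: V1_xi)
qed

lemma eventually_V1D:
  assumes "\<forall>\<^sub>F v in generic V1. P v"
  shows "\<forall>\<^sub>F x in generic torus. P (v1 x)"
  using filterlim_generic_surj[OF irreducible_T1 irreducible_V1 regular_v1] assms
  unfolding filterlim_iff V1_def by blast

lemma eventually_CV1I:
  assumes "\<forall>\<^sub>F p in generic torus. P (fst p, v1 (snd p))"
  shows "\<forall>\<^sub>F p in generic (Cstar \<times> V1). P p"
proof -
  have "filterlim (\<lambda>p. (fst p, xi (snd p))) (generic torus) (generic (Cstar \<times> V1))"
  proof (rule filterlim_generic_surj[OF irreducible_CV1(1) irreducible_T2 regular_xi_param(1)])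
    show "(\<lambda>p. (fst p, xi (snd p))) ` (Cstar \<times> V1) = torus"
      unfolding image_v1_param(1)[symmetric] image_image by (auto simp: mem_torus_prod image_iff)
  qed
  then have "\<forall>\<^sub>F p in generic (Cstar \<times> V1). P (fst p, v1 (xi (snd p)))"
    using assms unfolding filterlim_iff by force
  with eventually_in_generic[OF irreducible_CV1(1)] show ?thesis
    by eventually_elim (auto simp: V1_xi)
qed

lemma eventually_CCV1I:
  assumes "\<forall>\<^sub>F p in generic torus. P (fst p, fst (snd p), v1 (snd (snd p)))"
  shows "\<forall>\<^sub>F p in generic (Cstar \<times> Cstar \<times> V1). P p"
proof -
  have "filterlim (\<lambda>p. (fst p, fst (snd p), xi (snd (snd p)))) (generic torus) (generic (Cstar \<times> Cstar \<times> V1))"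
  proof (rule filterlim_generic_surj[OF irreducible_CV1(2) irreducible_T3 regular_xi_param(2)])
    show "(\<lambda>p. (fst p, fst (snd p), xi (snd (snd p)))) ` (Cstar \<times> Cstar \<times> V1) = torus"
      unfolding image_v1_param(2)[symmetric] image_image by (auto simp: mem_torus_prod image_iff)
  qed
  then have "\<forall>\<^sub>F p in generic (Cstar \<times> Cstar \<times> V1). P (fst p, fst (snd p), v1 (xi (snd (snd p))))"
    using assms unfolding filterlim_iff by force
  with eventually_in_generic[OF irreducible_CV1(2)] show ?thesis
    by eventually_elim (auto simp: V1_xi)
qed

text \<open>\<open>V1\<close> is the closed locus \<open>w = v1 (xi w)\<close> inside the open set
  on which \<open>xi\<close> lands in the torus.\<close>

lemma quasi_affine_V1: "quasi_affine_variety V1"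
proof -
  let ?U = "{w. xi w \<in> torus}"
  have U: "openin zariski ?U"
    using xi_regular(1) by simp
  have reg: "regular_fun ?U (\<lambda>w. w $ b - v1 (xi w) $ b)" for b
    using regular_map_vecD[OF regular_map_compose[OF regular_v1 xi_regular(2)]] by (intro regular_intros) auto
  define N where "N = (\<Union>b. {w\<in>?U. w $ b - v1 (xi w) $ b \<noteq> 0})"
  have "open_in ?U N"
    unfolding N_def
  proof (rule openin_Union)
    fix S assume "S \<in> range (\<lambda>b. {w\<in>?U. w $ b - v1 (xi w) $ b \<noteq> 0})"
    then show "open_in ?U S"
      using open_in_regular_nonzero[OF reg] by blast
  qed
  then have "openin zariski N"
    using U by (metis openin_trans_full)
  then have "closedin zariski (- N)"
    by (simp add: closedin_def Compl_eq_Diff_UNIV double_diff)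
  moreover have "V1 = ?U \<inter> - N"
  proof (intro equalityI subsetI)
    fix w assume "w \<in> ?U \<inter> - N"
    then have "w = v1 (xi w)" "xi w \<in> torus"
      by (auto simp: N_def vec_eq_iff)
    then show "w \<in> V1"
      unfolding V1_def by blast
  qed (auto simp: V1_xi N_def)
  ultimately show ?thesis
    using U irreducible_V1 unfolding quasi_affine_variety_def irreducible_set_def by blast
qed

section \<open>Regularity and dominance of the actions\<close>

lemma regular_act:
  assumes "i \<in> {0, 1, 2}"
  shows "open_in torus {p\<in>torus. act i (fst p) (snd p) \<in> torus}"
    "regular_map {p\<in>torus. act i (fst p) (snd p) \<in> torus} torus (\<lambda>p. act i (fst p) (snd p))"
proof -
  let ?S = "\<lambda>i. {p\<in>torus. act i (fst p) (snd p) \<in> torus}"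
  have pol: "regular_fun U (\<lambda>p. app6 (polD (fst p)) (snd p))" "regular_fun U (\<lambda>p. app6 polE (snd p))"
    "regular_fun U (\<lambda>p. app6 (polF (fst p)) (snd p))" "regular_fun U (\<lambda>p. app6 (polG (fst p)) (snd p))"
    "regular_fun U (\<lambda>p. app6 (polH (fst p)) (snd p))" for U :: "(complex \<times> (complex ^ 6)) set"
    unfolding app6_def polD_def polE_def polF_def polG_def polH_def by (intro regular_intros)+
  have q: "regular_fun U (\<lambda>p. q1 1 1 (snd p))" "regular_fun U (\<lambda>p. q1 (fst p) 1 (snd p))"
    "regular_fun U (\<lambda>p. q1 (fst p) (fst p) (snd p))" "regular_fun U (\<lambda>p. q2 1 (snd p))"
    "regular_fun U (\<lambda>p. q2 (fst p) (snd p))" for U :: "(complex \<times> (complex ^ 6)) set"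
    unfolding q1_def q2_def by (intro regular_intros)+
  have S0: "?S 0 = {p\<in>torus. fst p * app6 (polD (fst p)) (snd p) * app6 polE (snd p) *
      app6 (polF (fst p)) (snd p) * app6 (polG (fst p)) (snd p) * app6 (polH (fst p)) (snd p) \<noteq> 0}"
    by (auto simp: mem_torus_prod act0_in_torus_iff)
  have S1: "?S 1 = {p\<in>torus. fst p * q1 1 1 (snd p) * q1 (fst p) 1 (snd p) * q1 (fst p) (fst p) (snd p) \<noteq> 0}"
    by (auto simp: mem_torus_prod act1_in_torus_iff)
  have S2: "?S 2 = {p\<in>torus. fst p * q2 1 (snd p) * q2 (fst p) (snd p) \<noteq> 0}"
    by (auto simp: mem_torus_prod act2_in_torus_iff)
  have open0: "open_in torus (?S 0)"
    unfolding S0 by (intro open_in_regular_nonzero regular_intros pol)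
  have open1: "open_in torus (?S 1)"
    unfolding S1 by (intro open_in_regular_nonzero regular_intros q)
  have open2: "open_in torus (?S 2)"
    unfolding S2 by (intro open_in_regular_nonzero regular_intros q)
  show "open_in torus (?S i)"
    using assms open0 open1 open2 by auto
  have "\<forall>k. regular_fun (?S 0) (\<lambda>p. act0 (fst p) (snd p) $ k)"
    unfolding S0 forall_6 act0_eq tup6_nth by (intro conjI regular_intros pol; auto)
  then have r0: "regular_map (?S 0) torus (\<lambda>p. act0 (fst p) (snd p))"
    by (intro regular_map_vecI) auto
  have "\<forall>k. regular_fun (?S 1) (\<lambda>p. act1 (fst p) (snd p) $ k)"
    unfolding S1 forall_6 act1_def tup6_nth by (intro conjI regular_intros q; auto)
  then have r1: "regular_map (?S 1) torus (\<lambda>p. act1 (fst p) (snd p))"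
    by (intro regular_map_vecI) auto
  have "\<forall>k. regular_fun (?S 2) (\<lambda>p. act2 (fst p) (snd p) $ k)"
    unfolding S2 forall_6 act2_def tup6_nth by (intro conjI regular_intros q; auto)
  then have r2: "regular_map (?S 2) torus (\<lambda>p. act2 (fst p) (snd p))"
    by (intro regular_map_vecI) auto
  show "regular_map (?S i) torus (\<lambda>p. act i (fst p) (snd p))"
    using assms r0 r1 r2 by auto
qed

lemma act_one6: "i \<in> {0, 1, 2} \<Longrightarrow> act i 1 one6 = one6"
proof -
  assume "i \<in> {0, 1, 2}"
  moreover have "act0 1 one6 \<in> torus" "act1 1 one6 \<in> torus" "act2 1 one6 \<in> torus"
    by (simp_all add: act0_in_torus_iff act1_in_torus_iff act2_in_torus_iff app6_def polD_def polE_def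
        polF_def polG_def polH_def q1_def q2_def)
  ultimately show ?thesis
    using act0_one[of one6] act1_one[of one6] act2_one[of one6] by auto
qed

lemma act_one: "i \<in> {0, 1, 2} \<Longrightarrow> x \<in> torus \<Longrightarrow> act i 1 x \<in> torus \<Longrightarrow> act i 1 x = x"
  using act0_one[of x] act1_one[of x] act2_one[of x] by auto

text \<open>At this point s = 2. Its only purpose is to supply a point where the open conditions
  \<open>good\<close> and nonvanishing of \<open>KK\<close> hold, hence hold generically.\<close>

lemma eta_one6: "eta (v1 one6) = tup6 18 162 6 (4/3) 3 (3/2)"
proof -
  have nz: "(1 :: complex) \<noteq> 0"
    by simp
  note v = v1_nth[OF nz nz nz nz nz nz, folded one6_def]
  have 2: "eta2 (v1 one6) = 6"
    by (simp add: eta2_def v)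
  have 4: "eta4 (v1 one6) = 3"
    by (simp add: eta4_def 2 v)
  have s: "scale2 (v1 one6) = 1 / 18"
    by (simp add: scale2_def 2 4 v)
  have 1: "eta1 (v1 one6) = 162"
    by (simp add: eta1_def 2 4 s v)
  have 3: "eta3 (v1 one6) = 4 / 3"
    by (simp add: eta3_def 1 s v)
  have 5: "eta5 (v1 one6) = 3 / 2"
    by (simp add: eta5_def 1 2 3 4 s v)
  show ?thesis
    by (simp add: eta_def 1 2 3 4 5 s v)
qed

lemma good_one6: "good one6" "KK (eta (v1 one6)) \<noteq> 0"
proof -
  have nz: "(1 :: complex) \<noteq> 0"
    by simp
  note v = v1_nth[OF nz nz nz nz nz nz, folded one6_def]
  show "good one6"
    unfolding good_def eta_one6 by (simp add: v)
  show "KK (eta (v1 one6)) \<noteq> 0"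
    unfolding eta_one6 KK_def long_prod_def J1_def by simp
qed

lemma regular_eta_v1: "regular_map {x\<in>torus. eta (v1 x) \<in> torus} torus (\<lambda>x. eta (v1 x))"
  by (rule regular_map_compose[OF eta_regular(2)], rule regular_map_into[OF regular_map_subset[OF regular_v1]]) auto

lemma open_good: "open_in torus {x. good x}"
proof -
  have v: "regular_map torus UNIV v1"
    by (rule regular_map_into[OF regular_v1]) simp
  then have 1: "open_in torus {x\<in>torus. v1 x \<in> {w. eta w \<in> torus}}"
    by (rule open_in_preimage[OF _ eta_regular(1)])
  have "regular_fun torus (\<lambda>x. v1 x $ N2 * v1 x $ N6 * v1 x $ B5)"
    by (intro regular_intros regular_map_vecD[OF v])
  from openin_Int[OF 1 open_in_regular_nonzero[OF this]] show ?thesis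
    by (rule back_subst) (auto simp: good_def)
qed

lemma eventually_good: "\<forall>\<^sub>F x in generic torus. good x \<and> KK (eta (v1 x)) \<noteq> 0"
proof -
  have e: "regular_map {x. good x} torus (\<lambda>x. eta (v1 x))"
    by (rule regular_map_subset[OF regular_eta_v1]) (auto simp: good_def)
  have "regular_fun torus KK"
    unfolding KK_def[abs_def] long_prod_def J1_def by (intro regular_intros) (simp_all add: mem_torus_vec)
  from regular_fun_compose[OF this e] show ?thesis
    using eventually_generic_nonzero[OF irreducible_T1 open_good _ , of "\<lambda>x. KK (eta (v1 x))" one6] good_one6 by simp
qed

lemma act_inverse:
  assumes "i \<in> {0, 1, 2}" "good x" "act i d x \<in> torus" "act i c (act i d x) \<in> torus" "c * d = 1"
  shows "act i c (act i d x) = x"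
  using assms act0_inverse[of x d c] act1_inverse[of x d c] act2_inverse[of x d c] by (auto simp: good_def)

text \<open>A parameter space \<open>'p\<close> carries a projection \<open>pr\<close> to the 6-dimensional torus, \<open>upd p x\<close> replaces
  that component of \<open>p\<close> by \<open>x\<close>, and \<open>m\<close> is a function of the remaining components.\<close>

lemma act_dominant:
  fixes pr :: "'p::affine_space \<Rightarrow> complex ^ 6" and upd :: "'p \<Rightarrow> complex ^ 6 \<Rightarrow> 'p" and m :: "'p \<Rightarrow> complex"
  assumes irr: "irreducible_set (torus :: 'p set)" and i: "i \<in> {0, 1, 2}"
    and m: "regular_map torus torus m" and pr: "regular_map torus torus pr"
    and upd: "\<And>U f. U \<subseteq> torus \<Longrightarrow> regular_map U torus f \<Longrightarrow> regular_map U torus (\<lambda>p. upd p (f p))"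
    and laws: "\<And>p x. pr (upd p x) = x" "\<And>p. upd p (pr p) = p" "\<And>p x y. upd (upd p x) y = upd p y"
      "\<And>p x. m (upd p x) = m p"
    and base: "p0 \<in> torus" "m p0 = 1" "pr p0 = one6"
  shows "\<forall>\<^sub>F p in generic torus. act i (m p) (pr p) \<in> torus"
    "filterlim (\<lambda>p. upd p (act i (m p) (pr p))) (generic torus) (generic torus)"
proof -
  let ?A = "{q\<in>torus. act i (fst q) (snd q) \<in> torus}"
  define S where "S = {p\<in>torus. act i (m p) (pr p) \<in> torus}"
  have mp: "regular_map torus torus (\<lambda>p. (m p, pr p))"
    by (intro regular_map_Pair_torus m pr)
  have torus_mp: "m p \<noteq> 0" "pr p \<in> torus" if "p \<in> torus" for p
    using regular_map_image[OF mp that] by (simp_all add: mem_torus_prod)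
  have "open_in torus {p\<in>torus. (m p, pr p) \<in> ?A}"
    by (rule open_in_preimage[OF mp regular_act(1)[OF i]])
  moreover have "{p\<in>torus. (m p, pr p) \<in> ?A} = S"
    using torus_mp by (auto simp: S_def mem_torus_prod)
  ultimately have S: "open_in torus S"
    by simp
  have SA: "regular_map S ?A (\<lambda>p. (m p, pr p))"
    by (rule regular_map_into[OF regular_map_subset[OF mp]]) (auto simp: S_def mem_torus_prod torus_mp)
  have "p0 \<in> S"
    using base act_one6[OF i] by (simp add: S_def)
  then show "\<forall>\<^sub>F p in generic torus. act i (m p) (pr p) \<in> torus"
    by (rule eventually_genericI[OF irr S]) (simp add: S_def)
  have "regular_map S torus (\<lambda>p. act i (m p) (pr p))"
    using regular_map_compose[OF regular_act(2)[OF i] SA] by simp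
  then have reg: "regular_map S torus (\<lambda>p. upd p (act i (m p) (pr p)))"
    by (rule upd[rotated]) (auto simp: S_def)
  \<comment> \<open>Acting with the inverse parameter is the generic right inverse. The open sets
    below collect the points where both actions are defined and \<open>act_inverse\<close> applies;
    \<open>p0\<close> lies in all of them.\<close>
  define g where "g p = act i (inverse (m p)) (pr p)" for p
  define R where "R = {p\<in>torus. g p \<in> torus}"
  have im: "regular_map torus torus (\<lambda>p. inverse (m p))"
    by (intro regular_map_complexI regular_fun_inverse regular_map_complexD[OF m]) (simp_all add: torus_mp)
  have imp: "regular_map torus torus (\<lambda>p. (inverse (m p), pr p))"
    by (intro regular_map_Pair_torus im pr)
  have "open_in torus {p\<in>torus. (inverse (m p), pr p) \<in> ?A}"
    by (rule open_in_preimage[OF imp regular_act(1)[OF i]])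
  moreover have "{p\<in>torus. (inverse (m p), pr p) \<in> ?A} = R"
    using torus_mp by (auto simp: R_def g_def mem_torus_prod)
  ultimately have R: "open_in torus R"
    by simp
  have RA: "regular_map R ?A (\<lambda>p. (inverse (m p), pr p))"
    by (rule regular_map_into[OF regular_map_subset[OF imp]]) (auto simp: R_def g_def mem_torus_prod torus_mp)
  have gR: "regular_map R torus g"
    using regular_map_compose[OF regular_act(2)[OF i] RA] by (simp add: g_def[abs_def])
  have "regular_map R torus (\<lambda>p. (m p, g p))"
    by (intro regular_map_Pair_torus gR regular_map_subset[OF m]) (auto simp: R_def)
  then have "open_in R {p\<in>R. (m p, g p) \<in> ?A}"
    by (rule open_in_preimage[OF _ regular_act(1)[OF i]])
  then have Q: "open_in torus {p\<in>R. (m p, g p) \<in> ?A}"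
    by (rule open_in_trans[OF R])
  have P: "open_in torus {p\<in>torus. pr p \<in> {x. good x}}"
    by (rule open_in_preimage[OF pr open_good])
  have "\<forall>\<^sub>F p in generic torus. upd p (g p) \<in> S \<and>
      upd (upd p (g p)) (act i (m (upd p (g p))) (pr (upd p (g p)))) = p"
  proof (rule eventually_genericI[OF irr openin_Int[OF Q P]])
    show "p0 \<in> {p\<in>R. (m p, g p) \<in> ?A} \<inter> {p\<in>torus. pr p \<in> {x. good x}}"
      using base act_one6[OF i] good_one6 by (simp add: R_def g_def mem_torus_prod)
    fix p assume "p \<in> {p\<in>R. (m p, g p) \<in> ?A} \<inter> {p\<in>torus. pr p \<in> {x. good x}}"
    then have p: "p \<in> R" "p \<in> torus" "g p \<in> torus" "act i (m p) (g p) \<in> torus" "good (pr p)"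
      by (auto simp: R_def)
    have "act i (m p) (g p) = pr p"
      using act_inverse[OF i p(5), of "inverse (m p)" "m p"] p(3,4) torus_mp(1)[OF p(2)] by (simp add: g_def)
    moreover have "upd p (g p) \<in> torus"
      using regular_map_image[OF upd[OF _ gR] p(1)] by (auto simp: R_def)
    ultimately show "upd p (g p) \<in> S \<and>
        upd (upd p (g p)) (act i (m (upd p (g p))) (pr (upd p (g p)))) = p"
      using torus_mp(2)[OF p(2)] by (simp add: S_def laws)
  qed
  then show "filterlim (\<lambda>p. upd p (act i (m p) (pr p))) (generic torus) (generic torus)"
    by (rule filterlim_generic_inverse[OF irr S reg])
qed

lemma act_dominant_T2:
  assumes i: "i \<in> {0, 1, 2}"
  shows "\<forall>\<^sub>F p in generic torus. act i (fst p) (snd p) \<in> torus"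
    "filterlim (\<lambda>p. act i (fst p) (snd p)) (generic torus) (generic torus)"
proof -
  have u: "regular_map U torus (\<lambda>p. (fst p, f p))" if "U \<subseteq> torus" "regular_map U torus f"
    for U :: "(complex \<times> (complex ^ 6)) set" and f :: "complex \<times> (complex ^ 6) \<Rightarrow> complex ^ 6"
    using that by (intro regular_map_Pair_torus regular_map_fst_torus)
  note d = act_dominant[OF irreducible_T2 i, of fst snd "\<lambda>p x. (fst p, x)" "(1, one6)", OF
      regular_map_fst_torus[OF order.refl] regular_map_snd_torus[OF order.refl] u]
  show "\<forall>\<^sub>F p in generic torus. act i (fst p) (snd p) \<in> torus"
    by (rule d(1)) (auto simp: mem_torus_prod)
  have "filterlim (\<lambda>p. (fst p, act i (fst p) (snd p))) (generic torus) (generic torus)"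
    by (rule d(2)) (auto simp: mem_torus_prod)
  moreover have "filterlim snd (generic torus) (generic (torus :: (complex \<times> (complex ^ 6)) set))"
    by (rule filterlim_generic_surj[OF irreducible_T2 irreducible_T1 regular_map_snd_torus[OF order.refl]])
      (auto simp: mem_torus_prod image_iff intro!: bexI[of _ "(1, _)"])
  ultimately have "filterlim (\<lambda>p. snd (fst p, act i (fst p) (snd p))) (generic torus) (generic torus)"
    by (rule filterlim_compose[rotated])
  then show "filterlim (\<lambda>p. act i (fst p) (snd p)) (generic torus) (generic torus)"
    by simp
qed

section \<open>Words in the actions\<close>

text \<open>A letter \<open>(i, m)\<close> stands for the action of \<open>i\<close> with parameter \<open>m c d\<close>. The letters of a word are
  applied from left to right, so a word lists the factors of a composition in reverse order.\<close>

type_synonym letter = "nat \<times> (complex \<Rightarrow> complex \<Rightarrow> complex)"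

text \<open>Value 1 at (1, 1) fits the base point of \<open>act_dominant\<close>; attaining every
  nonzero value gives the surjectivity used in \<open>eventually_letter\<close>.\<close>

definition valid_letter :: "letter \<Rightarrow> bool" where
  "valid_letter l \<longleftrightarrow> fst l \<in> {0, 1, 2} \<and>
     regular_fun UNIV (\<lambda>p :: complex \<times> complex \<times> (complex ^ 6). snd l (fst p) (fst (snd p))) \<and>
     (\<forall>c d. c \<noteq> 0 \<longrightarrow> d \<noteq> 0 \<longrightarrow> snd l c d \<noteq> 0) \<and> snd l 1 1 = 1 \<and>
     (\<forall>a. a \<noteq> 0 \<longrightarrow> (\<exists>c d. c \<noteq> 0 \<and> d \<noteq> 0 \<and> snd l c d = a))"

lemma valid_letterI:
  assumes "i \<in> {0, 1, 2}" "regular_fun UNIV (\<lambda>p :: complex \<times> complex \<times> (complex ^ 6). m (fst p) (fst (snd p)))"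
    "\<And>c d. c \<noteq> 0 \<Longrightarrow> d \<noteq> 0 \<Longrightarrow> m c d \<noteq> 0" "m 1 1 = 1"
    "\<And>a. a \<noteq> 0 \<Longrightarrow> g a \<noteq> 0 \<and> h a \<noteq> 0 \<and> m (g a) (h a) = a"
  shows "valid_letter (i, m)"
  unfolding valid_letter_def fst_conv snd_conv
proof (intro conjI allI impI)
  fix a :: complex assume "a \<noteq> 0"
  then show "\<exists>c d. c \<noteq> 0 \<and> d \<noteq> 0 \<and> m c d = a"
    using assms(5)[of a] by (intro exI[of _ "g a"] exI[of _ "h a"]) simp
qed (fact assms | erule (1) assms(3))+

lemma valid_letters:
  assumes i: "i \<in> {0, 1, 2}"
  shows "valid_letter (i, \<lambda>c d. c)" "valid_letter (i, \<lambda>c d. d)" "valid_letter (i, \<lambda>c d. c * d)"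
    "valid_letter (i, \<lambda>c d. c^2 * d)" "valid_letter (i, \<lambda>c d. c^3 * d)" "valid_letter (i, \<lambda>c d. c^3 * d^2)"
proof -
  have r: "regular_fun UNIV (\<lambda>p :: complex \<times> complex \<times> (complex ^ 6). fst p)"
    "regular_fun UNIV (\<lambda>p :: complex \<times> complex \<times> (complex ^ 6). fst (snd p))"
    by (intro regular_intros)+
  show "valid_letter (i, \<lambda>c d. c)"
    by (rule valid_letterI[OF i r(1), where g = "\<lambda>a. a" and h = "\<lambda>_. 1"]) simp_all
  show "valid_letter (i, \<lambda>c d. d)"
    by (rule valid_letterI[OF i r(2), where g = "\<lambda>_. 1" and h = "\<lambda>a. a"]) simp_all
  show "valid_letter (i, \<lambda>c d. c * d)"
    by (rule valid_letterI[OF i regular_fun_mult[OF r], where g = "\<lambda>_. 1" and h = "\<lambda>a. a"]) simp_all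
  show "valid_letter (i, \<lambda>c d. c^2 * d)" "valid_letter (i, \<lambda>c d. c^3 * d)"
    by (rule valid_letterI[OF i regular_fun_mult[OF regular_fun_power[OF r(1)] r(2)], where g = "\<lambda>_. 1" and h = "\<lambda>a. a"]; simp)+
  \<comment> \<open>Since 3 - 2 = 1, the pair (a, 1/a) attains the value a without extracting
    roots.\<close>
  show "valid_letter (i, \<lambda>c d. c^3 * d^2)"
    by (rule valid_letterI[OF i regular_fun_mult[OF regular_fun_power[OF r(1)] regular_fun_power[OF r(2)]],
          where g = "\<lambda>a. a" and h = "\<lambda>a. 1 / a"]) (simp_all add: power2_eq_square power3_eq_cube)
qed

definition move :: "letter \<Rightarrow> complex \<times> complex \<times> (complex ^ 6) \<Rightarrow> complex \<times> complex \<times> (complex ^ 6)" where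
  "move l p = (fst p, fst (snd p), act (fst l) (snd l (fst p) (fst (snd p))) (snd (snd p)))"

primrec run :: "letter list \<Rightarrow> complex \<times> complex \<times> (complex ^ 6) \<Rightarrow> complex \<times> complex \<times> (complex ^ 6)" where
  "run [] p = p"
| "run (l # w) p = run w (move l p)"

primrec chain :: "(nat \<Rightarrow> complex \<Rightarrow> wmod \<rightharpoonup> wmod) \<Rightarrow> letter list \<Rightarrow> complex \<Rightarrow> complex \<Rightarrow> wmod \<rightharpoonup> wmod" where
  "chain e [] c d v = Some v"
| "chain e (l # w) c d v = Option.bind (e (fst l) (snd l c d) v) (chain e w c d)"

lemma chain_simps:
  "chain e [] c d = Some" "chain e (l # w) c d = (\<lambda>v. Option.bind (e (fst l) (snd l c d) v) (chain e w c d))"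
  by (simp_all add: fun_eq_iff)

lemma list_all_take: "list_all P w \<Longrightarrow> list_all P (take k w)"
  by (auto simp: list_all_iff dest: in_set_takeD)

lemma filterlim_move:
  assumes "valid_letter l"
  shows "filterlim (move l) (generic torus) (generic torus)"
  unfolding move_def[abs_def]
proof (rule act_dominant(2)[OF irreducible_T3, where m = "\<lambda>p. snd l (fst p) (fst (snd p))" and pr = "\<lambda>p. snd (snd p)"
      and upd = "\<lambda>p x. (fst p, fst (snd p), x)" and ?p0.0 = "(1, 1, one6)"])
  show "fst l \<in> {0, 1, 2}"
    using assms by (simp add: valid_letter_def)
  show "regular_map torus torus (\<lambda>p :: complex \<times> complex \<times> (complex ^ 6). snd l (fst p) (fst (snd p)))"
    using assms by (intro regular_map_complexI) (auto simp: valid_letter_def mem_torus_prod intro: regular_fun_subset)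
  show "regular_map torus torus (\<lambda>p :: complex \<times> complex \<times> (complex ^ 6). snd (snd p))"
    by (intro regular_map_compose[OF regular_map_snd_torus[of torus] regular_map_snd_torus] order.refl)
  show "regular_map U torus (\<lambda>p. (fst p, fst (snd p), f p))" if "U \<subseteq> torus" "regular_map U torus f"
    for U :: "(complex \<times> complex \<times> (complex ^ 6)) set" and f
    using that by (intro regular_map_Pair_torus regular_map_fst_torus
        regular_map_compose[OF regular_map_fst_torus[of torus] regular_map_snd_torus] order.refl)
qed (use assms in \<open>auto simp: valid_letter_def mem_torus_prod\<close>)

lemma filterlim_run: "list_all valid_letter w \<Longrightarrow> filterlim (run w) (generic torus) (generic torus)"
proof (induction w)
  case Nil
  then show ?case by (simp add: filterlim_ident)
next
  case (Cons l w)
  then have "filterlim (\<lambda>p. run w (move l p)) (generic torus) (generic torus)"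
    using filterlim_compose[OF Cons.IH filterlim_move[of l]] by simp
  then show ?case by simp
qed

lemma filterlim_snd_snd:
  "filterlim (\<lambda>p. snd (snd p)) (generic (torus :: (complex ^ 6) set))
     (generic (torus :: (complex \<times> complex \<times> (complex ^ 6)) set))"
proof (rule filterlim_generic_surj[OF irreducible_T3 irreducible_T1])
  show "regular_map torus torus (\<lambda>p :: complex \<times> complex \<times> (complex ^ 6). snd (snd p))"
    by (intro regular_map_compose[OF regular_map_snd_torus[of torus] regular_map_snd_torus] order.refl)
qed (auto simp: mem_torus_prod image_iff intro!: bexI[of _ "(1, 1, _)"])

text \<open>Words are dominant, so the generic conditions pull back to the point reached. Applied to
  prefixes, this covers every intermediate point.\<close>

lemma eventually_good_run:
  assumes "list_all valid_letter w"
  shows "\<forall>\<^sub>F p in generic torus. good (snd (snd (run w p))) \<and> KK (eta (v1 (snd (snd (run w p))))) \<noteq> 0"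
  using eventually_good filterlim_compose[OF filterlim_snd_snd filterlim_run[OF assms]]
  unfolding filterlim_iff by blast

text \<open>Only generic agreement is asked, so that the composite of \<open>\<tau>\<close>,
  \<open>e0_V2\<close> and \<open>\<sigma>\<close> qualifies for any representatives.\<close>

definition agrees :: "(nat \<Rightarrow> complex \<Rightarrow> wmod \<rightharpoonup> wmod) \<Rightarrow> bool" where
  "agrees e \<longleftrightarrow> (\<forall>i\<in>{0, 1, 2}. \<forall>\<^sub>F q in generic torus. e i (fst q) (v1 (snd q)) = Some (v1 (act i (fst q) (snd q))))"

lemma fst_move [simp]: "fst (move l p) = fst p" "fst (snd (move l p)) = fst (snd p)"
  by (simp_all add: move_def)

text \<open>Agreement is generic in one parameter and x. The map from two parameters and x to the
  parameter of the letter and x is surjective, so agreement pulls back.\<close>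

lemma eventually_letter:
  assumes e: "agrees e" and l: "valid_letter l"
  shows "\<forall>\<^sub>F p in generic torus. e (fst l) (snd l (fst p) (fst (snd p))) (v1 (snd (snd p))) =
    Some (v1 (snd (snd (move l p))))"
proof -
  have "filterlim (\<lambda>p :: complex \<times> complex \<times> (complex ^ 6). (snd l (fst p) (fst (snd p)), snd (snd p)))
      (generic torus) (generic torus)"
  proof (rule filterlim_generic_surj[OF irreducible_T3 irreducible_T2])
    show "regular_map torus torus (\<lambda>p :: complex \<times> complex \<times> (complex ^ 6). (snd l (fst p) (fst (snd p)), snd (snd p)))"
      using l by (intro regular_map_Pair_torus regular_map_complexI
          regular_map_compose[OF regular_map_snd_torus[of torus] regular_map_snd_torus] order.refl)
        (auto simp: valid_letter_def mem_torus_prod intro: regular_fun_subset)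
    show "(\<lambda>p :: complex \<times> complex \<times> (complex ^ 6). (snd l (fst p) (fst (snd p)), snd (snd p))) ` torus = torus"
    proof (intro equalityI subsetI)
      fix q :: "complex \<times> (complex ^ 6)" assume "q \<in> torus"
      then have q: "fst q \<noteq> 0" "snd q \<in> torus"
        by (auto simp: mem_torus_prod)
      then obtain c d where "c \<noteq> 0" "d \<noteq> 0" "snd l c d = fst q"
        using l unfolding valid_letter_def by blast
      then show "q \<in> (\<lambda>p. (snd l (fst p) (fst (snd p)), snd (snd p))) ` torus"
        using q by (intro image_eqI[of _ _ "(c, d, snd q)"]) (auto simp: mem_torus_prod)
    qed (use l in \<open>auto simp: valid_letter_def mem_torus_prod\<close>)
  qed
  moreover have "\<forall>\<^sub>F q in generic torus. e (fst l) (fst q) (v1 (snd q)) = Some (v1 (act (fst l) (fst q) (snd q)))"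
    using e l unfolding agrees_def valid_letter_def by blast
  ultimately show ?thesis
    unfolding filterlim_iff move_def by force
qed

lemma eventually_chain:
  assumes e: "agrees e"
  shows "list_all valid_letter w \<Longrightarrow> \<forall>\<^sub>F p in generic torus.
    chain e w (fst p) (fst (snd p)) (v1 (snd (snd p))) = Some (v1 (snd (snd (run w p))))"
proof (induction w)
  case Nil
  then show ?case by simp
next
  case (Cons l w)
  then have w: "valid_letter l" "list_all valid_letter w"
    by simp_all
  have "\<forall>\<^sub>F p in generic torus. chain e w (fst (move l p)) (fst (snd (move l p))) (v1 (snd (snd (move l p)))) =
      Some (v1 (snd (snd (run w (move l p)))))"
    using Cons.IH[OF w(2)] filterlim_move[OF w(1)] unfolding filterlim_iff by blast
  with eventually_letter[OF e w(1)] show ?case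
    by eventually_elim simp
qed

lemma rat_eq_words:
  assumes e: "agrees e" and w: "list_all valid_letter w" "list_all valid_letter w'"
    and eq: "\<forall>\<^sub>F p in generic torus. snd (snd (run w p)) = snd (snd (run w' p))"
    and f: "\<And>c d v. f (c, d, v) = chain e w c d v" "\<And>c d v. g (c, d, v) = chain e w' c d v"
  shows "rat_eq (Cstar \<times> Cstar \<times> V1) f g"
proof -
  have "\<forall>\<^sub>F p in generic torus. (fst p, fst (snd p), v1 (snd (snd p))) \<in> dom f \<and>
      f (fst p, fst (snd p), v1 (snd (snd p))) = g (fst p, fst (snd p), v1 (snd (snd p)))"
    using eventually_chain[OF e w(1)] eventually_chain[OF e w(2)] eq
    by eventually_elim (auto simp: f)
  then show ?thesis
    unfolding rat_eq_iff[OF irreducible_CV1(2)] by (rule eventually_CCV1I)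
qed

lemma map_comp_bind: "f \<circ>\<^sub>m g = (\<lambda>k. Option.bind (g k) f)"
  by (auto simp: map_comp_def fun_eq_iff split: option.split bind_split)

lemma act_act:
  assumes "i \<in> {0, 1, 2}" "good x" "act i d x \<in> torus" "act i c (act i d x) \<in> torus" "act i (c * d) x \<in> torus"
  shows "act i c (act i d x) = act i (c * d) x"
  using assms act0_act0[of x d c] act1_act1[of x d c] act2_act2[of x d c] by (auto simp: good_def)

lemma good_torus: "good x \<Longrightarrow> x \<in> torus"
  by (simp add: good_def)

lemma eps_act:
  assumes "i \<in> {0, 1, 2}" "good x" "act i c x \<in> torus"
  shows "eps i (act i c x) = inverse c * eps i x"
  using assms eps0_act0[of x c] eps1_act1[of x c] eps2_act2[of x c] by (auto simp: good_def simp del: One_nat_def)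

lemma action_words:
  assumes i: "i \<in> {0, 1, 2}" and e: "agrees e"
  shows "rat_eq (Cstar \<times> Cstar \<times> V1) (\<lambda>(c, d, x). (e i c \<circ>\<^sub>m e i d) x) (\<lambda>(c, d, x). e i (c * d) x)"
proof (rule rat_eq_words[OF e, of "[(i, \<lambda>c d. d), (i, \<lambda>c d. c)]" "[(i, \<lambda>c d. c * d)]"])
  note v = valid_letters[OF i]
  show w: "list_all valid_letter [(i, \<lambda>c d. d), (i, \<lambda>c d. c)]" "list_all valid_letter [(i, \<lambda>c d. c * d)]"
    using v by simp_all
  have "list_all valid_letter [(i, \<lambda>c d. d)]"
    using v by simp
  from eventually_good_run[of "[]", simplified] eventually_good_run[OF this] eventually_good_run[OF w(1)]
    eventually_good_run[OF w(2)]
  show "\<forall>\<^sub>F p in generic torus. snd (snd (run [(i, \<lambda>c d. d), (i, \<lambda>c d. c)] p)) =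
      snd (snd (run [(i, \<lambda>c d. c * d)] p))"
    by eventually_elim (auto simp: move_def dest: good_torus intro!: act_act[OF i])
qed (simp_all add: map_comp_bind chain_simps)

lemma verma_words_01:
  assumes e: "agrees e"
  shows "rat_eq (Cstar \<times> Cstar \<times> V1) (\<lambda>(c1, c2, x). (e 0 c1 \<circ>\<^sub>m e 1 (c1 * c2) \<circ>\<^sub>m e 0 c2) x)
      (\<lambda>(c1, c2, x). (e 1 c2 \<circ>\<^sub>m e 0 (c1 * c2) \<circ>\<^sub>m e 1 c1) x)" (is ?A)
    and "rat_eq (Cstar \<times> Cstar \<times> V1) (\<lambda>(c1, c2, x). (e 1 c1 \<circ>\<^sub>m e 0 (c1 * c2) \<circ>\<^sub>m e 1 c2) x)
      (\<lambda>(c1, c2, x). (e 0 c2 \<circ>\<^sub>m e 1 (c1 * c2) \<circ>\<^sub>m e 0 c1) x)" (is ?B)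
proof -
  have v: "valid_letter (i, \<lambda>c d. c)" "valid_letter (i, \<lambda>c d. d)" "valid_letter (i, \<lambda>c d. c * d)"
    if "i = 0 \<or> i = 1" for i
    using valid_letters[of i] that by auto
  let ?w = "[(0, \<lambda>c d. d), (1, \<lambda>c d. c * d), (0, \<lambda>c d. c)] :: letter list"
  let ?w' = "[(1, \<lambda>c d. c), (0, \<lambda>c d. c * d), (1, \<lambda>c d. d)] :: letter list"
  have ww: "list_all valid_letter ?w" "list_all valid_letter ?w'"
    by (simp_all add: v del: One_nat_def)
  \<comment> \<open>The prefixes of both words provide goodness at all points that occur in
    \<open>act0_act1_verma\<close>.\<close>
  note w = list_all_take[OF ww(1)] list_all_take[OF ww(2)]
  note g = eventually_good_run[OF w(1)[of 0]] eventually_good_run[OF w(1)[of 1]] eventually_good_run[OF w(1)[of 2]]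
    eventually_good_run[OF w(1)[of 3]] eventually_good_run[OF w(2)[of 1]] eventually_good_run[OF w(2)[of 2]]
    eventually_good_run[OF w(2)[of 3]] eventually_in_generic[OF irreducible_T3]
  from g have "\<forall>\<^sub>F p in generic torus. snd (snd (run ?w p)) = snd (snd (run ?w' p))"
  proof eventually_elim
    case (elim p)
    then show ?case
      using act0_act1_verma[of "fst p" "fst (snd p)" "snd (snd p)"] by (simp add: move_def mem_torus_prod)
  qed
  then show ?A
    by (rule rat_eq_words[OF e ww]) (simp_all add: map_comp_bind chain_simps)
  \<comment> \<open>The relation for the pair (1, 0) is the one for (0, 1) with c1 and c2 exchanged
    and the two sides swapped.\<close>
  let ?u = "[(1, \<lambda>c d. d), (0, \<lambda>c d. c * d), (1, \<lambda>c d. c)] :: letter list"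
  let ?u' = "[(0, \<lambda>c d. c), (1, \<lambda>c d. c * d), (0, \<lambda>c d. d)] :: letter list"
  have ww: "list_all valid_letter ?u" "list_all valid_letter ?u'"
    by (simp_all add: v del: One_nat_def)
  note w = list_all_take[OF ww(1)] list_all_take[OF ww(2)]
  note g = eventually_good_run[OF w(1)[of 0]] eventually_good_run[OF w(1)[of 1]] eventually_good_run[OF w(1)[of 2]]
    eventually_good_run[OF w(1)[of 3]] eventually_good_run[OF w(2)[of 1]] eventually_good_run[OF w(2)[of 2]]
    eventually_good_run[OF w(2)[of 3]] eventually_in_generic[OF irreducible_T3]
  from g have "\<forall>\<^sub>F p in generic torus. snd (snd (run ?u p)) = snd (snd (run ?u' p))"
  proof eventually_elim
    case (elim p)
    then show ?case
      using act0_act1_verma[of "fst (snd p)" "fst p" "snd (snd p)"]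
      by (simp add: move_def mem_torus_prod mult.commute[of "fst (snd p)" "fst p"])
  qed
  then show ?B
    by (rule rat_eq_words[OF e ww]) (simp_all add: map_comp_bind chain_simps)
qed

lemma verma_words_02:
  assumes e: "agrees e"
  shows "rat_eq (Cstar \<times> Cstar \<times> V1) (\<lambda>(c1, c2, x). (e 0 c1 \<circ>\<^sub>m e 2 c2) x)
      (\<lambda>(c1, c2, x). (e 2 c2 \<circ>\<^sub>m e 0 c1) x)" (is ?A)
    and "rat_eq (Cstar \<times> Cstar \<times> V1) (\<lambda>(c1, c2, x). (e 2 c1 \<circ>\<^sub>m e 0 c2) x)
      (\<lambda>(c1, c2, x). (e 0 c2 \<circ>\<^sub>m e 2 c1) x)" (is ?B)
proof -
  have v: "valid_letter (i, \<lambda>c d. c)" "valid_letter (i, \<lambda>c d. d)" if "i = 0 \<or> i = 2" for i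
    using valid_letters[of i] that by auto
  let ?w = "[(2, \<lambda>c d. d), (0, \<lambda>c d. c)] :: letter list"
  let ?w' = "[(0, \<lambda>c d. c), (2, \<lambda>c d. d)] :: letter list"
  have ww: "list_all valid_letter ?w" "list_all valid_letter ?w'"
    by (simp_all add: v)
  note w = list_all_take[OF ww(1)] list_all_take[OF ww(2)]
  note g = eventually_good_run[OF w(1)[of 0]] eventually_good_run[OF w(1)[of 1]] eventually_good_run[OF w(1)[of 2]]
    eventually_good_run[OF w(2)[of 1]] eventually_good_run[OF w(2)[of 2]]
  from g have "\<forall>\<^sub>F p in generic torus. snd (snd (run ?w p)) = snd (snd (run ?w' p))"
    by eventually_elim (auto simp: move_def dest: good_torus intro!: act0_act2_commute)
  then show ?A
    by (rule rat_eq_words[OF e ww]) (simp_all add: map_comp_bind chain_simps)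
  let ?u = "[(0, \<lambda>c d. d), (2, \<lambda>c d. c)] :: letter list"
  let ?u' = "[(2, \<lambda>c d. c), (0, \<lambda>c d. d)] :: letter list"
  have ww: "list_all valid_letter ?u" "list_all valid_letter ?u'"
    by (simp_all add: v)
  note w = list_all_take[OF ww(1)] list_all_take[OF ww(2)]
  note g = eventually_good_run[OF w(1)[of 0]] eventually_good_run[OF w(1)[of 1]] eventually_good_run[OF w(1)[of 2]]
    eventually_good_run[OF w(2)[of 1]] eventually_good_run[OF w(2)[of 2]]
  from g have "\<forall>\<^sub>F p in generic torus. snd (snd (run ?u p)) = snd (snd (run ?u' p))"
    by eventually_elim
      (auto simp: move_def dest: good_torus intro!: act0_act2_commute[symmetric])
  then show ?B
    by (rule rat_eq_words[OF e ww]) (simp_all add: map_comp_bind chain_simps)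
qed

lemma eventually_regular_diag: "\<forall>\<^sub>F p in generic (torus :: (complex \<times> complex \<times> (complex ^ 6)) set).
    inj_on (diag7 (fst p) (fst (snd p))) {..<7}"
proof -
  \<comment> \<open>Here the diagonal is 12, 6, 2, 1, 1/2, 1/6, 1/12, with distinct entries.\<close>
  let ?p = "(2 :: complex, 3 :: complex, one6)"
  have "\<forall>\<^sub>F p in generic (torus :: (complex \<times> complex \<times> (complex ^ 6)) set).
      p \<in> torus \<and> diag7 (fst p) (fst (snd p)) i - diag7 (fst p) (fst (snd p)) j \<noteq> 0"
    if ij: "i < 7" "j < 7" "i \<noteq> j" for i j :: nat
  proof (rule eventually_generic_nonzero[OF irreducible_T3 open_in_self, of _ ?p])
    have "regular_fun torus (\<lambda>p :: complex \<times> complex \<times> (complex ^ 6). diag7 (fst p) (fst (snd p)) k)" if "k < 7" for k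
      using that unfolding less_7 diag7_def
      by (elim disjE) (auto simp: mem_torus_prod intro!: regular_intros)
    then show "regular_fun torus (\<lambda>p :: complex \<times> complex \<times> (complex ^ 6).
        diag7 (fst p) (fst (snd p)) i - diag7 (fst p) (fst (snd p)) j)"
      using ij by (intro regular_fun_diff)
    show "diag7 (fst ?p) (fst (snd ?p)) i - diag7 (fst ?p) (fst (snd ?p)) j \<noteq> 0"
      using ij unfolding less_7 diag7_def by (elim disjE) simp_all
  qed (simp add: mem_torus_prod)
  then have "\<forall>\<^sub>F p in generic (torus :: (complex \<times> complex \<times> (complex ^ 6)) set).
      \<forall>q\<in>{(i, j). i < 7 \<and> j < 7 \<and> i \<noteq> j}.
        p \<in> torus \<and> diag7 (fst p) (fst (snd p)) (fst q) - diag7 (fst p) (fst (snd p)) (snd q) \<noteq> 0"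
    by (intro eventually_ball_finite) (auto intro: finite_subset[of _ "{..<7} \<times> {..<7}"])
  then show ?thesis
    by eventually_elim (fastforce simp: inj_on_def)
qed

lemma verma_words_21:
  assumes e: "agrees e"
  shows "rat_eq (Cstar \<times> Cstar \<times> V1)
      (\<lambda>(c1, c2, x). (e 2 c1 \<circ>\<^sub>m e 1 (c1^3 * c2) \<circ>\<^sub>m e 2 (c1^2 * c2) \<circ>\<^sub>m
         e 1 (c1^3 * c2^2) \<circ>\<^sub>m e 2 (c1 * c2) \<circ>\<^sub>m e 1 c2) x)
      (\<lambda>(c1, c2, x). (e 1 c2 \<circ>\<^sub>m e 2 (c1 * c2) \<circ>\<^sub>m e 1 (c1^3 * c2^2) \<circ>\<^sub>m
         e 2 (c1^2 * c2) \<circ>\<^sub>m e 1 (c1^3 * c2) \<circ>\<^sub>m e 2 c1) x)"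
proof -
  have v: "valid_letter (1, \<lambda>c d. d)" "valid_letter (2, \<lambda>c d. c * d)" "valid_letter (1, \<lambda>c d. c^3 * d^2)"
    "valid_letter (2, \<lambda>c d. c^2 * d)" "valid_letter (1, \<lambda>c d. c^3 * d)" "valid_letter (2, \<lambda>c d. c)"
    by (intro valid_letters; simp)+
  let ?w = "[(1, \<lambda>c d. d), (2, \<lambda>c d. c * d), (1, \<lambda>c d. c^3 * d^2), (2, \<lambda>c d. c^2 * d), (1, \<lambda>c d. c^3 * d),
      (2, \<lambda>c d. c)] :: letter list"
  let ?w' = "[(2, \<lambda>c d. c), (1, \<lambda>c d. c^3 * d), (2, \<lambda>c d. c^2 * d), (1, \<lambda>c d. c^3 * d^2), (2, \<lambda>c d. c * d),
      (1, \<lambda>c d. d)] :: letter list"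
  have ww: "list_all valid_letter ?w" "list_all valid_letter ?w'"
    by (simp_all add: v del: One_nat_def)
  note w = list_all_take[OF ww(1)] list_all_take[OF ww(2)]
  note g = eventually_good_run[OF w(1)[of 1]] eventually_good_run[OF w(1)[of 2]]
    eventually_good_run[OF w(1)[of 3]] eventually_good_run[OF w(1)[of 4]] eventually_good_run[OF w(1)[of 5]]
    eventually_good_run[OF w(1)[of 6]] eventually_good_run[OF w(2)[of 1]] eventually_good_run[OF w(2)[of 2]]
    eventually_good_run[OF w(2)[of 3]] eventually_good_run[OF w(2)[of 4]] eventually_good_run[OF w(2)[of 5]]
    eventually_good_run[OF w(2)[of 6]] eventually_in_generic[OF irreducible_T3] eventually_regular_diag
  from g have "\<forall>\<^sub>F p in generic torus. snd (snd (run ?w p)) = snd (snd (run ?w' p))"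
  proof eventually_elim
    case (elim p)
    then show ?case
      using act1_act2_verma[of "fst p" "fst (snd p)" "snd (snd p)"]
      by (simp add: move_def mem_torus_prod good_torus)
  qed
  then show ?thesis
    by (rule rat_eq_words[OF e ww]) (simp_all add: map_comp_bind chain_simps)
qed

text \<open>Of the nine pairs only (0,1), (1,0), (0,2), (2,0) and (2,1) meet a premise of
  \<open>verma_relations\<close>; for (1,2) and equal indices the statement is vacuous.\<close>

lemma verma_relations_act:
  assumes e: "agrees e" and ij: "i \<in> {0, 1, 2}" "j \<in> {0, 1, 2}"
  shows "verma_relations (e i) (e j) (cartan i j) (cartan j i) V1"
proof -
  have cartan: "cartan 0 0 = 2" "cartan 0 1 = -1" "cartan 0 2 = 0" "cartan 1 0 = -1" "cartan 1 1 = 2"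
    "cartan 1 2 = -1" "cartan 2 0 = 0" "cartan 2 1 = -3" "cartan 2 2 = 2"
    by (simp_all add: cartan_def)
  have "\<forall>i\<in>{0, 1, 2}. \<forall>j\<in>{0, 1, 2}. verma_relations (e i) (e j) (cartan i j) (cartan j i) V1"
    unfolding ball_simps verma_relations_def cartan
    by (intro conjI impI TrueI)
      (rule verma_words_01[OF e] verma_words_02[OF e] verma_words_21[OF e] | simp del: One_nat_def)+
  with ij show ?thesis
    by blast
qed

section \<open>The geometric crystal\<close>

lemma inv_into_v1: "x \<in> torus \<Longrightarrow> inv_into torus v1 (v1 x) = x"
  by (rule inv_into_f_f) (auto intro!: inj_onI dest: v1_inject)

lemma inv_into_v2: "y \<in> torus \<Longrightarrow> inv_into torus v2 (v2 y) = y"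
  by (rule inv_into_f_f) (metis inj_onI eta_v2_id)

lemma map_in_coords_v1:
  "x \<in> torus \<Longrightarrow> map_in_coords v1 \<phi> (v1 x) = (if \<phi> x \<in> torus then Some (v1 (\<phi> x)) else None)"
  by (simp add: map_in_coords_def inv_into_v1 Let_def)

lemma map_in_coords_v2:
  "y \<in> torus \<Longrightarrow> map_in_coords v2 \<phi> (v2 y) = (if \<phi> y \<in> torus then Some (v2 (\<phi> y)) else None)"
  by (simp add: map_in_coords_def inv_into_v2 Let_def)

lemma map_in_coords_outside: "w \<notin> v ` torus \<Longrightarrow> map_in_coords v \<phi> w = None"
  by (simp add: map_in_coords_def Let_def)

lemma map_in_coords_cong:
  assumes "\<And>x. x \<in> torus \<Longrightarrow> \<phi> x = \<psi> x"
  shows "map_in_coords v \<phi> = map_in_coords v \<psi>"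
  using assms inv_into_into[of _ v torus] by (auto simp: map_in_coords_def Let_def fun_eq_iff)

lemma fun_in_coords_v1: "x \<in> torus \<Longrightarrow> fun_in_coords v1 g (v1 x) = Some (g x)"
  by (simp add: fun_in_coords_def inv_into_v1)

lemma fun_in_coords_v2: "y \<in> torus \<Longrightarrow> fun_in_coords v2 g (v2 y) = Some (g y)"
  by (simp add: fun_in_coords_def inv_into_v2)

lemma partial_map_fun_in_coords_v1:
  assumes "regular_fun torus g"
  shows "partial_map V1 UNIV (fun_in_coords v1 g)"
proof (rule partial_map_total)
  show "regular_map V1 UNIV (\<lambda>w. g (xi w))"
    by (intro regular_map_complexI regular_fun_compose[OF assms regular_xi]) simp
  show "dom (fun_in_coords v1 g) \<subseteq> V1"
    by (auto simp: fun_in_coords_def V1_def split: if_splits)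
qed (auto simp: V1_def fun_in_coords_v1)

lemma partial_map_fun_in_coords_v2:
  assumes "regular_fun torus g"
  shows "partial_map V2 UNIV (fun_in_coords v2 g)"
proof (rule partial_map_total)
  show "regular_map V2 UNIV (\<lambda>w. g (eta w))"
    by (intro regular_map_complexI regular_fun_compose[OF assms regular_eta]) simp
  show "dom (fun_in_coords v2 g) \<subseteq> V2"
    by (auto simp: fun_in_coords_def V2_def split: if_splits)
qed (auto simp: V2_def fun_in_coords_v2)

text \<open>A reference representative, defined where \<open>act i c\<close> stays in the torus;
  \<open>e1_V1\<close>, \<open>e2_V1\<close> and \<open>e0_explicit\<close> all turn out to equal
  it.\<close>

definition ee :: "nat \<Rightarrow> complex \<Rightarrow> wmod \<rightharpoonup> wmod" where
  "ee i c = map_in_coords v1 (act i c)"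

lemma act_zero: "i \<in> {0, 1, 2} \<Longrightarrow> x \<in> torus \<Longrightarrow> act i 0 x \<notin> torus"
  using act0_in_torus_iff[of x 0] act1_in_torus_iff[of x 0] act2_in_torus_iff[of x 0] by auto

lemma partial_map_ee:
  assumes i: "i \<in> {0, 1, 2}"
  shows "partial_map (Cstar \<times> V1) V1 (\<lambda>(c, v). ee i c v)"
proof (rule partial_mapI)
  let ?A = "{q\<in>torus. act i (fst q) (snd q) \<in> torus}"
  let ?S = "{p\<in>Cstar \<times> V1. (fst p, xi (snd p)) \<in> ?A}"
  show "open_in (Cstar \<times> V1) ?S"
    by (rule open_in_preimage[OF regular_xi_param(1) regular_act(1)[OF i]])
  have "regular_map ?S ?A (\<lambda>p. (fst p, xi (snd p)))"
    by (rule regular_map_into[OF regular_map_subset[OF regular_xi_param(1)]]) auto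
  from regular_map_compose[OF regular_v1 regular_map_compose[OF regular_act(2)[OF i] this]]
  show "regular_map ?S V1 (\<lambda>p. v1 (act i (fst p) (xi (snd p))))"
    by simp
  show "(case p of (c, v) \<Rightarrow> ee i c v) = (if p \<in> ?S then Some (v1 (act i (fst p) (xi (snd p)))) else None)" for p
  proof (cases "snd p \<in> V1")
    case True
    then obtain x where x: "x \<in> torus" "snd p = v1 x"
      by (auto simp: V1_def)
    then show ?thesis
      using act_zero[OF i x(1)] True
      by (cases p) (auto simp: ee_def map_in_coords_v1 mem_torus_prod)
  next
    case False
    then show ?thesis
      by (cases p) (auto simp: ee_def map_in_coords_outside V1_def)
  qed
qed

lemma coord_funs_6: "(coord_funs :: (complex ^ 6 \<Rightarrow> complex) set) = range (\<lambda>i x. x $ i)"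
  by (auto simp: coord_funs_vec_def coord_funs_complex_def)

lemma one6_coords: "\<forall>\<phi>\<in>coord_funs. \<phi> one6 = 1" "\<forall>\<phi>\<in>coord_funs. \<phi> (1 :: complex, one6) = 1"
  by (auto simp: coord_funs_prod_def coord_funs_6 coord_funs_complex_def)

lemma pos_quot_act:
  assumes "i \<in> {0, 1, 2}" "\<phi> \<in> coord_funs"
  shows "pos_quot (\<lambda>p :: complex \<times> (complex ^ 6). \<phi> (act i (fst p) (snd p)))"
proof -
  let ?P = "\<lambda>f :: complex \<times> (complex ^ 6) \<Rightarrow> complex. pos_comb f"
  have pol: "?P (\<lambda>p. app6 (polD (fst p)) (snd p))" "?P (\<lambda>p. app6 polE (snd p))"
    "?P (\<lambda>p. app6 (polF (fst p)) (snd p))" "?P (\<lambda>p. app6 (polG (fst p)) (snd p))"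
    "?P (\<lambda>p. app6 (polH (fst p)) (snd p))"
    unfolding app6_def polD_def polE_def polF_def polG_def polH_def by (intro pos_intros)+
  have q: "?P (\<lambda>p. q1 1 1 (snd p))" "?P (\<lambda>p. q1 (fst p) 1 (snd p))" "?P (\<lambda>p. q1 (fst p) (fst p) (snd p))"
    "?P (\<lambda>p. q2 1 (snd p))" "?P (\<lambda>p. q2 (fst p) (snd p))"
    unfolding q1_def q2_def by (intro pos_intros)+
  have var: "?P (\<lambda>p. fst p)" "?P (\<lambda>p. snd p $ k)" for k
    by (intro pos_intros)+
  note pq = pol[THEN pos_quot_comb] q[THEN pos_quot_comb] var[THEN pos_quot_comb]
  have "\<forall>k. pos_quot (\<lambda>p :: complex \<times> (complex ^ 6). act0 (fst p) (snd p) $ k)"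
    unfolding forall_6 act0_eq tup6_nth by (intro conjI pos_quot_divide pos_quot_mult pos_quot_power pq)
  moreover have "\<forall>k. pos_quot (\<lambda>p :: complex \<times> (complex ^ 6). act1 (fst p) (snd p) $ k)"
    unfolding forall_6 act1_def tup6_nth by (intro conjI pos_quot_divide pos_quot_mult pos_quot_power pq)
  moreover have "\<forall>k. pos_quot (\<lambda>p :: complex \<times> (complex ^ 6). act2 (fst p) (snd p) $ k)"
    unfolding forall_6 act2_def tup6_nth by (intro conjI pos_quot_divide pos_quot_mult pos_quot_power pq)
  ultimately show ?thesis
    using assms by (auto simp: coord_funs_6)
qed

lemma pos_quot_gam_eps:
  assumes "i \<in> {0, 1, 2}"
  shows "pos_quot (gam i)" "pos_quot (eps i)"
proof -
  have "pos_quot (gam 0)" "pos_quot (gam 1)" "pos_quot (gam 2)"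
    unfolding gam_simps app6_def by (intro pos_quot_divide pos_quot_comb pos_intros)+
  then show "pos_quot (gam i)"
    using assms by auto
  have pos: "pos_comb (\<lambda>x. app6 polE x)" "pos_comb (\<lambda>x. q1 1 1 x)" "pos_comb (\<lambda>x. q2 1 x)"
    unfolding app6_def polE_def q1_def q2_def by (intro pos_intros)+
  have e: "\<forall>\<^sub>F x :: complex ^ 6 in generic torus. x \<in> torus"
    by (rule eventually_in_generic[OF irreducible_T1])
  have "pos_quot (eps 0)"
    unfolding eps_simps app6_def[abs_def]
    using pos(1) unfolding app6_def by (intro pos_quot_divide pos_quot_comb pos_intros)
  moreover have "pos_quot (eps 1)"
    unfolding pos_quot_def
  proof (intro exI conjI)
    show "\<forall>\<^sub>F x in generic torus. eps 1 x = x $ 0 * q1 1 1 x / ((x $ 1)^2 * (x $ 3)^2 * x $ 5)"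
      using e by eventually_elim (simp add: eps1_eq del: One_nat_def)
  qed (intro pos_intros pos)+
  moreover have "pos_quot (eps 2)"
    unfolding pos_quot_def
  proof (intro exI conjI)
    show "\<forall>\<^sub>F x in generic torus. eps 2 x = x $ 1 * q2 1 x / ((x $ 2)^2 * x $ 4)"
      using e by eventually_elim (simp add: eps2_eq)
  qed (intro pos_intros pos)+
  ultimately show "pos_quot (eps i)"
    using assms by auto
qed

lemma regular_gam_eps:
  assumes "i \<in> {0, 1, 2}"
  shows "regular_fun torus (gam i)" "regular_fun torus (eps i)"
proof -
  have "regular_fun torus (gam 0)" "regular_fun torus (gam 1)" "regular_fun torus (gam 2)"
    unfolding gam_simps app6_def by (intro regular_intros; simp add: mem_torus_vec)+
  then show "regular_fun torus (gam i)"
    using assms by auto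
  have "regular_fun torus (eps 0)" "regular_fun torus (eps 1)" "regular_fun torus (eps 2)"
    unfolding eps_simps app6_def polE_def by (intro regular_intros; simp add: mem_torus_vec)+
  then show "regular_fun torus (eps i)"
    using assms by auto
qed

lemma eventually_snd:
  assumes "\<forall>\<^sub>F x in generic torus. P x"
  shows "\<forall>\<^sub>F q in generic (torus :: (complex \<times> (complex ^ 6)) set). P (snd q)"
proof -
  have "filterlim snd (generic torus) (generic (torus :: (complex \<times> (complex ^ 6)) set))"
    by (rule filterlim_generic_surj[OF irreducible_T2 irreducible_T1 regular_map_snd_torus[OF order.refl]])
      (auto simp: mem_torus_prod image_iff intro!: bexI[of _ "(1, _)"])
  then show ?thesis
    using assms unfolding filterlim_iff by blast
qed

text \<open>Isolates what the crystal and positivity arguments use: regularity on open domains and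
  generic agreement with the coordinate formulas. In this way they apply to every choice of
  representatives.\<close>

locale coordinate_crystal =
  fixes e :: "nat \<Rightarrow> complex \<Rightarrow> wmod \<rightharpoonup> wmod" and \<gamma> \<epsilon> :: "nat \<Rightarrow> wmod \<rightharpoonup> complex"
  assumes partial_e: "\<And>i. i \<in> {0, 1, 2} \<Longrightarrow> partial_map (Cstar \<times> V1) V1 (\<lambda>(c, v). e i c v)"
    and agrees_e: "agrees e"
    and partial_\<gamma>: "\<And>i. i \<in> {0, 1, 2} \<Longrightarrow> partial_map V1 UNIV (\<gamma> i)"
    and partial_\<epsilon>: "\<And>i. i \<in> {0, 1, 2} \<Longrightarrow> partial_map V1 UNIV (\<epsilon> i)"
    and agrees_\<gamma>: "\<And>i. i \<in> {0, 1, 2} \<Longrightarrow> \<forall>\<^sub>F x in generic torus. \<gamma> i (v1 x) = Some (gam i x)"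
    and agrees_\<epsilon>: "\<And>i. i \<in> {0, 1, 2} \<Longrightarrow> \<forall>\<^sub>F x in generic torus. \<epsilon> i (v1 x) = Some (eps i x)"
begin

lemma e_generic:
  "i \<in> {0, 1, 2} \<Longrightarrow> \<forall>\<^sub>F q in generic torus. e i (fst q) (v1 (snd q)) = Some (v1 (act i (fst q) (snd q)))"
  using agrees_e unfolding agrees_def by blast

lemma rational_e:
  assumes i: "i \<in> {0, 1, 2}"
  shows "rational_map (Cstar \<times> V1) V1 (\<lambda>(c, v). e i c v)"
proof -
  obtain q where "e i (fst q) (v1 (snd q)) = Some (v1 (act i (fst q) (snd q)))"
    using eventually_generic_imp_ex[OF irreducible_T2 e_generic[OF i]] by metis
  then have "(fst q, v1 (snd q)) \<in> dom (\<lambda>(c, v). e i c v)"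
    by (simp add: domIff)
  then have "dom (\<lambda>(c, v). e i c v) \<noteq> {}"
    by blast
  then show ?thesis
    using partial_e[OF i] by (simp only: rational_map_iff[OF irreducible_CV1(1)] not_False_eq_True simp_thms)
qed

lemma rat_eq_ee:
  assumes i: "i \<in> {0, 1, 2}"
  shows "rat_eq (Cstar \<times> V1) (\<lambda>(c, v). e i c v) (\<lambda>(c, v). ee i c v)"
    "rat_eq (Cstar \<times> V1) (\<lambda>(c, v). ee i c v) (\<lambda>(c, v). e i c v)"
proof -
  have "\<forall>\<^sub>F q in generic torus. e i (fst q) (v1 (snd q)) = Some (v1 (act i (fst q) (snd q))) \<and>
      ee i (fst q) (v1 (snd q)) = Some (v1 (act i (fst q) (snd q)))"
    using e_generic[OF i] act_dominant_T2(1)[OF i] eventually_in_generic[OF irreducible_T2]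
    by eventually_elim (simp add: ee_def map_in_coords_v1 mem_torus_prod)
  then have "\<forall>\<^sub>F q in generic torus. (case (fst q, v1 (snd q)) of (c, v) \<Rightarrow>
      e i c v \<noteq> None \<and> ee i c v \<noteq> None \<and> e i c v = ee i c v)"
    by eventually_elim simp
  then have "\<forall>\<^sub>F p in generic (Cstar \<times> V1). (case p of (c, v) \<Rightarrow>
      e i c v \<noteq> None \<and> ee i c v \<noteq> None \<and> e i c v = ee i c v)"
    by (rule eventually_CV1I)
  then show "rat_eq (Cstar \<times> V1) (\<lambda>(c, v). e i c v) (\<lambda>(c, v). ee i c v)"
    "rat_eq (Cstar \<times> V1) (\<lambda>(c, v). ee i c v) (\<lambda>(c, v). e i c v)"
    unfolding rat_eq_iff[OF irreducible_CV1(1)] by (eventually_elim; auto simp: domIff)+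
qed

text \<open>The assumptions of the locale do not place any point with c = 1 in the domain of
  \<open>e i\<close>. The extension contains the domain of \<open>ee i\<close>, which does reach c =
  1 and is the identity there.\<close>

lemma rat_ext_one:
  assumes i: "i \<in> {0, 1, 2}"
  shows "\<forall>\<^sub>F v in generic V1. rat_ext (Cstar \<times> V1) V1 (\<lambda>(c, x). e i c x) (1, v) = Some v"
proof (rule eventually_V1I)
  let ?A = "{q\<in>torus. act i (fst q) (snd q) \<in> torus}"
  have "regular_map torus torus (\<lambda>x :: complex ^ 6. (1 :: complex, x))"
    by (intro regular_map_Pair_torus regular_map_complexI regular_fun_const regular_map_id) simp_all
  then have "open_in torus {x\<in>torus. (1, x) \<in> ?A}"
    by (rule open_in_preimage[OF _ regular_act(1)[OF i]])
  moreover have "one6 \<in> {x\<in>torus. (1, x) \<in> ?A}"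
    using act_one6[OF i] by (simp add: mem_torus_prod)
  ultimately show "\<forall>\<^sub>F x in generic torus. rat_ext (Cstar \<times> V1) V1 (\<lambda>(c, x). e i c x) (1, v1 x) = Some (v1 x)"
  proof (rule eventually_genericI[OF irreducible_T1])
    fix x assume "x \<in> {x\<in>torus. (1, x) \<in> ?A}"
    then have x: "x \<in> torus" "act i 1 x \<in> torus"
      by simp_all
    then have ee: "ee i 1 (v1 x) = Some (v1 x)"
      using act_one[OF i x] by (simp add: ee_def map_in_coords_v1)
    then have dom: "(1, v1 x) \<in> dom (\<lambda>(c, v). ee i c v)"
      by (simp add: domIff)
    then have "dom (\<lambda>(c, v). ee i c v) \<noteq> {}"
      by blast
    then have "rational_map (Cstar \<times> V1) V1 (\<lambda>(c, v). ee i c v)"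
      using partial_map_ee[OF i] by (simp only: rational_map_iff[OF irreducible_CV1(1)] not_False_eq_True simp_thms)
    then show "rat_ext (Cstar \<times> V1) V1 (\<lambda>(c, x). e i c x) (1, v1 x) = Some (v1 x)"
      using rat_ext_eq[OF irreducible_CV1(1) _ rat_eq_ee(2)[OF i] dom] ee by simp
  qed
qed

lemma rational_action:
  assumes i: "i \<in> {0, 1, 2}"
  shows "rational_Cstar_action V1 (e i)"
  unfolding rational_Cstar_action_def
proof (intro conjI)
  show "rat_eq V1 (\<lambda>x. rat_ext (Cstar \<times> V1) V1 (\<lambda>(c, x). e i c x) (1, x)) Some"
    unfolding rat_eq_iff[OF irreducible_V1] using rat_ext_one[OF i] by eventually_elim auto
qed (rule rational_e[OF i] action_words[OF i agrees_e])+

lemma rational_fun: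
  assumes f: "partial_map V1 UNIV f" and "\<forall>\<^sub>F x in generic torus. f (v1 x) = Some (g x)"
  shows "rational_map V1 UNIV f"
proof -
  obtain x where "f (v1 x) = Some (g x)"
    using eventually_generic_imp_ex[OF irreducible_T1 assms(2)] by metis
  then have "dom f \<noteq> {}"
    by blast
  with f show ?thesis
    by (simp add: rational_map_iff[OF irreducible_V1])
qed

lemma dense_one:
  assumes i: "i \<in> {0, 1, 2}"
  shows "dense_open_in ({1} \<times> V1) (({1} \<times> V1) \<inter> dom (rat_ext (Cstar \<times> V1) V1 (\<lambda>(c, x). e i c x)))"
proof -
  let ?D = "dom (rat_ext (Cstar \<times> V1) V1 (\<lambda>(c, x). e i c x))"
  obtain v where "v \<in> V1" "rat_ext (Cstar \<times> V1) V1 (\<lambda>(c, x). e i c x) (1, v) = Some v"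
    using eventually_generic_imp_ex[OF irreducible_V1 rat_ext_one[OF i]] by metis
  then have "(1, v) \<in> ({1} \<times> V1) \<inter> ?D"
    by (simp add: domIff)
  moreover have "open_in ({1} \<times> V1) (({1} \<times> V1) \<inter> ?D)"
  proof -
    have "regular_map ({1} \<times> V1) (Cstar \<times> V1) (\<lambda>p. p)"
      by (rule regular_map_id) auto
    from open_in_preimage[OF this open_in_dom_rat_ext[OF irreducible_CV1(1)]]
    show ?thesis
      by (simp add: Collect_conj_eq)
  qed
  ultimately show ?thesis
    unfolding dense_open_in_iff[OF irreducible_1V1] by blast
qed

lemma transform_fun:
  assumes i: "i \<in> {0, 1, 2}" and f: "\<forall>\<^sub>F x in generic torus. f (v1 x) = Some (g x)"
    and g: "\<And>c x. good x \<Longrightarrow> act i c x \<in> torus \<Longrightarrow> g (act i c x) = h c * g x"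
  shows "rat_eq (Cstar \<times> V1) (\<lambda>(c, x). (f \<circ>\<^sub>m e i c) x) (\<lambda>(c, x). map_option (\<lambda>t. h c * t) (f x))"
proof -
  note eventually_snd[OF f] eventually_snd[OF eventually_good]
  moreover have "\<forall>\<^sub>F q in generic torus. f (v1 (act i (fst q) (snd q))) = Some (g (act i (fst q) (snd q)))"
    using act_dominant_T2(2)[OF i] f unfolding filterlim_iff by blast
  ultimately have "\<forall>\<^sub>F q in generic torus. (case (fst q, v1 (snd q)) of (c, v) \<Rightarrow>
      (f \<circ>\<^sub>m e i c) v \<noteq> None \<and> (f \<circ>\<^sub>m e i c) v = map_option (\<lambda>t. h c * t) (f v))"
    using e_generic[OF i] act_dominant_T2(1)[OF i] by eventually_elim (simp add: g)
  then have "\<forall>\<^sub>F p in generic (Cstar \<times> V1). (case p of (c, v) \<Rightarrow>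
      (f \<circ>\<^sub>m e i c) v \<noteq> None \<and> (f \<circ>\<^sub>m e i c) v = map_option (\<lambda>t. h c * t) (f v))"
    by (rule eventually_CV1I)
  then show ?thesis
    unfolding rat_eq_iff[OF irreducible_CV1(1)] by eventually_elim (auto simp: domIff)
qed

lemma crystal: "geometric_crystal {0, 1, 2} cartan V1 e \<gamma> \<epsilon>"
  unfolding geometric_crystal_def
proof (intro conjI ballI)
  show "quasi_affine_variety V1"
    by (rule quasi_affine_V1)
next
  fix i :: nat assume i: "i \<in> {0, 1, 2}"
  show "rational_Cstar_action V1 (e i)"
    by (rule rational_action[OF i])
  show "rational_map V1 UNIV (\<gamma> i)"
    by (rule rational_fun[OF partial_\<gamma>[OF i] agrees_\<gamma>[OF i]])
  show "rational_map V1 UNIV (\<epsilon> i)"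
    by (rule rational_fun[OF partial_\<epsilon>[OF i] agrees_\<epsilon>[OF i]])
  show "dense_open_in ({1} \<times> V1) (({1} \<times> V1) \<inter> dom (rat_ext (Cstar \<times> V1) V1 (\<lambda>(c, x). e i c x)))"
    by (rule dense_one[OF i])
  show "rat_eq (Cstar \<times> V1) (\<lambda>(c, x). (\<epsilon> i \<circ>\<^sub>m e i c) x) (\<lambda>(c, x). map_option (\<lambda>t. inverse c * t) (\<epsilon> i x))"
    by (rule transform_fun[OF i agrees_\<epsilon>[OF i] eps_act[OF i]])
  fix j :: nat assume j: "j \<in> {0, 1, 2}"
  show "rat_eq (Cstar \<times> V1) (\<lambda>(c, x). (\<gamma> j \<circ>\<^sub>m e i c) x)
      (\<lambda>(c, x). map_option (\<lambda>t. c powi cartan i j * t) (\<gamma> j x))"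
    by (rule transform_fun[OF i agrees_\<gamma>[OF j] gam_act[OF good_torus _ i j]])
  show "verma_relations (e i) (e j) (cartan i j) (cartan j i) V1"
    by (rule verma_relations_act[OF agrees_e i j])
qed

section \<open>The parametrization as a positive structure\<close>

lemma partial_param1: "partial_map torus V1 param1"
  by (rule partial_map_total[OF regular_v1]) (auto simp: param1_def split: if_splits)

lemma positive_fun_param1:
  assumes f: "partial_map V1 UNIV f" "\<forall>\<^sub>F x in generic torus. f (v1 x) = Some (g x)" and g: "pos_quot g"
  shows "positive_fun (f \<circ>\<^sub>m param1)"
proof (rule positive_funI[OF irreducible_T1 one6_coords(1)])
  show g': "\<forall>\<^sub>F x in generic torus. (f \<circ>\<^sub>m param1) x = Some (g x)"
    using f(2) eventually_in_generic[OF irreducible_T1] by eventually_elim (simp add: param1_def)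
  obtain x where "(f \<circ>\<^sub>m param1) x = Some (g x)"
    using eventually_generic_imp_ex[OF irreducible_T1 g'] by metis
  then have "dom (f \<circ>\<^sub>m param1) \<noteq> {}"
    by blast
  then show "rational_map torus UNIV (f \<circ>\<^sub>m param1)"
    using partial_map_compose[OF partial_param1 f(1)] by (simp add: rational_map_iff[OF irreducible_T1])
qed (rule g)

definition chart :: "wmod \<rightharpoonup> complex ^ 6" where
  "chart v = (if v \<in> V1 then Some (xi v) else None)"

lemma partial_chart: "partial_map V1 torus chart"
  by (rule partial_map_total[OF regular_xi]) (auto simp: chart_def split: if_splits)

lemma birational_param1: "birational_pair torus V1 param1 chart"
proof -
  have "param1 one6 = Some (v1 one6)" "chart (v1 one6) = Some one6"
    by (simp_all add: param1_def chart_def V1_def)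
  then have "dom param1 \<noteq> {}" "dom chart \<noteq> {}"
    by blast+
  moreover have "rat_eq torus (chart \<circ>\<^sub>m param1) Some"
    unfolding rat_eq_iff[OF irreducible_T1] using eventually_in_generic[OF irreducible_T1]
    by eventually_elim (auto simp: param1_def chart_def V1_def domIff)
  moreover have "rat_eq V1 (param1 \<circ>\<^sub>m chart) Some"
    unfolding rat_eq_iff[OF irreducible_V1] using eventually_in_generic[OF irreducible_V1]
    by eventually_elim (auto simp: param1_def chart_def V1_xi domIff)
  ultimately show ?thesis
    using partial_param1 partial_chart
    by (simp add: birational_pair_def rational_map_iff[OF irreducible_T1] rational_map_iff[OF irreducible_V1])
qed

lemma positive_map_e:
  assumes i: "i \<in> {0, 1, 2}"
  shows "positive_map (\<lambda>(c, t). (chart \<circ>\<^sub>m e i c \<circ>\<^sub>m param1) t)" (is "positive_map ?f")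
proof (rule positive_mapI[OF irreducible_T2 one6_coords(2)])
  let ?lift = "\<lambda>(c, t). if c = 0 then None else map_option (Pair c) (param1 t)"
  \<comment> \<open>\<open>?lift\<close> is undefined at c = 0, so the equation \<open>f\<close>
    below requires \<open>e i 0\<close> to be undefined as well; this follows from its domain lying
    over \<open>Cstar\<close>.\<close>
  have zero: "e i 0 v = None" for v
  proof (rule ccontr)
    assume "e i 0 v \<noteq> None"
    then have "(0, v) \<in> dom (\<lambda>(c, v). e i c v)"
      by (simp add: domIff)
    then have "(0, v) \<in> Cstar \<times> V1"
      using partial_e[OF i] open_in_subset unfolding partial_map_def by (metis subsetD)
    then show False
      by simp
  qed
  have f: "?f = chart \<circ>\<^sub>m (\<lambda>(c, v). e i c v) \<circ>\<^sub>m ?lift"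
    by (auto simp: fun_eq_iff map_comp_def zero split: option.splits)
  have "partial_map (torus :: (complex \<times> (complex ^ 6)) set) (Cstar \<times> V1) ?lift"
    unfolding torus_prod torus_complex by (rule partial_map_Pair[OF partial_param1])
  from partial_map_compose[OF this partial_map_compose[OF partial_e[OF i] partial_chart]]
  have part: "partial_map torus torus ?f"
    by (simp only: f)
  show ev: "\<forall>\<^sub>F q in generic torus. ?f q = Some (act i (fst q) (snd q))"
    using e_generic[OF i] act_dominant_T2(1)[OF i] eventually_in_generic[OF irreducible_T2]
    by eventually_elim (auto simp: param1_def chart_def V1_def mem_torus_prod)
  obtain q where "?f q = Some (act i (fst q) (snd q))"
    using eventually_generic_imp_ex[OF irreducible_T2 ev] by metis
  then have "dom ?f \<noteq> {}"
    by blast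
  then show "rational_map torus torus ?f"
    using part by (simp add: rational_map_iff[OF irreducible_T2])
  show "pos_quot (\<lambda>q. \<phi> (act i (fst q) (snd q)))" if "\<phi> \<in> coord_funs" for \<phi>
    by (rule pos_quot_act[OF i that])
qed

lemma positive: "positive_structure {0, 1, 2} V1 e \<gamma> \<epsilon> param1"
  unfolding positive_structure_def
  using birational_param1 positive_map_e positive_fun_param1[OF partial_\<gamma> agrees_\<gamma> pos_quot_gam_eps(1)]
    positive_fun_param1[OF partial_\<epsilon> agrees_\<epsilon> pos_quot_gam_eps(2)]
  by (intro exI[of _ chart] conjI ballI) auto

end

section \<open>The birational isomorphism between the two varieties\<close>

lemma e1_V1_eq: "e1_V1 c = ee 1 c"
  unfolding e1_V1_def ee_def act_simps
proof (rule map_in_coords_cong)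
  fix x :: "complex ^ 6" assume x: "x \<in> torus"
  \<comment> \<open>The monomial common to all numerators and denominators, which cancels in each
    factor.\<close>
  define K where "K = x $ 0 / ((x $ 1)^2 * (x $ 3)^2 * x $ 5)"
  have nz: "\<And>i. x $ i \<noteq> 0" and K: "K \<noteq> 0"
    using x by (auto simp: mem_torus_vec K_def)
  have h: "a * x $ 0 / x $ 1 + b * x $ 0 * (x $ 2)^3 / ((x $ 1)^2 * x $ 3) +
      x $ 0 * (x $ 2)^3 * (x $ 4)^3 / ((x $ 1)^2 * (x $ 3)^2 * x $ 5) = K * q1 a b x" for a b
    using nz by (simp add: K_def q1_def field_simps power2_eq_square)
  note h' = h[of 1 1, simplified] h[of c 1, simplified] h[of c c]
  show "app6 (\<lambda>x0 x1 x2 x3 x4 x5.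
     let C1 = (c * x0 / x1 + x0 * x2^3 / (x1^2 * x3) + x0 * x2^3 * x4^3 / (x1^2 * x3^2 * x5)) /
              (x0 / x1 + x0 * x2^3 / (x1^2 * x3) + x0 * x2^3 * x4^3 / (x1^2 * x3^2 * x5));
         C3 = (c * x0 / x1 + c * x0 * x2^3 / (x1^2 * x3) + x0 * x2^3 * x4^3 / (x1^2 * x3^2 * x5)) /
              (c * x0 / x1 + x0 * x2^3 / (x1^2 * x3) + x0 * x2^3 * x4^3 / (x1^2 * x3^2 * x5));
         C5 = c * (x0 / x1 + x0 * x2^3 / (x1^2 * x3) + x0 * x2^3 * x4^3 / (x1^2 * x3^2 * x5)) /
              (c * x0 / x1 + c * x0 * x2^3 / (x1^2 * x3) + x0 * x2^3 * x4^3 / (x1^2 * x3^2 * x5))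
     in tup6 x0 (C1 * x1) x2 (C3 * x3) x4 (C5 * x5)) x = act1 c x"
    unfolding app6_def Let_def h' act1_def using K by simp
qed

lemma e2_V1_eq: "e2_V1 c = ee 2 c"
  unfolding e2_V1_def ee_def act_simps
proof (rule map_in_coords_cong)
  fix x :: "complex ^ 6" assume x: "x \<in> torus"
  define K where "K = x $ 1 / ((x $ 2)^2 * x $ 4)"
  have nz: "\<And>i. x $ i \<noteq> 0" and K: "K \<noteq> 0"
    using x by (auto simp: mem_torus_vec K_def)
  have h: "a * x $ 1 / x $ 2 + x $ 1 * x $ 3 / ((x $ 2)^2 * x $ 4) = K * q2 a x" for a
    using nz by (simp add: K_def q2_def field_simps power2_eq_square)
  note h' = h[of 1, simplified] h[of c]
  show "app6 (\<lambda>x0 x1 x2 x3 x4 x5.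
     let C2 = (c * x1 / x2 + x1 * x3 / (x2^2 * x4)) / (x1 / x2 + x1 * x3 / (x2^2 * x4));
         C4 = c * (x1 / x2 + x1 * x3 / (x2^2 * x4)) / (c * x1 / x2 + x1 * x3 / (x2^2 * x4))
     in tup6 x0 x1 (C2 * x2) x3 (C4 * x4) x5) x = act2 c x"
    unfolding app6_def Let_def h' act2_def using K by simp
qed

lemma e0_explicit_eq: "e0_explicit c = ee 0 c"
  by (simp add: e0_explicit_def ee_def act0_def)

lemma fun_V1_eq:
  "gamma0_explicit = fun_in_coords v1 (gam 0)" "gamma1_V1 = fun_in_coords v1 (gam 1)"
  "gamma2_V1 = fun_in_coords v1 (gam 2)" "eps0_explicit = fun_in_coords v1 (eps 0)"
  "eps1_V1 = fun_in_coords v1 (eps 1)" "eps2_V1 = fun_in_coords v1 (eps 2)"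
  unfolding gam_simps eps_simps
  by (simp_all only: gamma0_explicit_def gamma1_V1_def gamma2_V1_def eps0_explicit_def eps1_V1_def eps2_V1_def)

text \<open>At good points \<open>v2 (eta v)\<close> is proportional to \<open>v\<close>, and
  \<open>xi\<close> leads back from it. The domain is restricted so that both inversion formulas are
  valid.\<close>

definition sigma :: "wmod \<rightharpoonup> wmod" where
  "sigma v = (if v \<in> V1 \<and> good (xi v) then Some (v2 (eta v)) else None)"

definition sigma_inv :: "wmod \<rightharpoonup> wmod" where
  "sigma_inv w = (if w \<in> V2 \<and> xi w \<in> torus \<and> good (xi w) then Some (v1 (xi w)) else None)"

lemma sigma_v1:
  assumes "good x"
  shows "sigma (v1 x) = Some (v2 (eta (v1 x)))" "sigma_inv (v2 (eta (v1 x))) = Some (v1 x)"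
    "v2 (eta (v1 x)) = (1 / scale2 (v1 x)) *s v1 x" "scale2 (v1 x) \<noteq> 0"
proof -
  have x: "x \<in> torus" "eta (v1 x) \<in> torus"
    using assms by (simp_all add: good_def)
  obtain k where k: "k \<noteq> 0" "v1 x = k *s v2 (eta (v1 x))" "scale2 (v1 x) = k"
    using good_eta[OF assms] .
  then show v2: "v2 (eta (v1 x)) = (1 / scale2 (v1 x)) *s v1 x" and "scale2 (v1 x) \<noteq> 0"
    by (metis nonzero_eq_divide_eq vector_smult_assoc vector_smult_lid, simp)
  show "sigma (v1 x) = Some (v2 (eta (v1 x)))"
    using assms x by (auto simp: sigma_def V1_def)
  have "xi (v2 (eta (v1 x))) = x"
    unfolding v2 using xi_v1(1)[OF x(1), of "1 / scale2 (v1 x)"] k by simp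
  then show "sigma_inv (v2 (eta (v1 x))) = Some (v1 x)"
    using assms x by (auto simp: sigma_inv_def V2_def)
qed

lemma sigma_inv_v2:
  assumes y: "y \<in> torus" "xi (v2 y) \<in> torus" "good (xi (v2 y))"
  shows "sigma_inv (v2 y) = Some (v1 (xi (v2 y)))" "sigma (v1 (xi (v2 y))) = Some (v2 y)"
proof -
  show "sigma_inv (v2 y) = Some (v1 (xi (v2 y)))"
    using y by (auto simp: sigma_inv_def V2_def)
  note w = v1_xi[OF on_cone_v2[OF y(1)] y(2)]
  have "v1 (xi (v2 y)) = (1 / scale1 (v2 y)) *s v2 y"
    using w(1,2) by (metis nonzero_eq_divide_eq vector_smult_assoc vector_smult_lid)
  then have "eta (v1 (xi (v2 y))) = y"
    using eta_v2(1)[OF y(1), of "1 / scale1 (v2 y)"] w(2) by simp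
  then show "sigma (v1 (xi (v2 y))) = Some (v2 y)"
    using sigma_v1(1)[OF y(3)] by simp
qed

lemma open_dom_sigma: "open_in V1 {v\<in>V1. good (xi v)}"
  using open_in_preimage[OF regular_xi open_good] by simp

lemma regular_eta_dom_sigma: "regular_map {v\<in>V1. good (xi v)} torus eta"
proof (rule regular_map_subset[OF eta_regular(2)], rule subsetI)
  fix v assume "v \<in> {v\<in>V1. good (xi v)}"
  then have "eta (v1 (xi v)) \<in> torus" "v1 (xi v) = v"
    by (auto simp: good_def V1_xi)
  then show "v \<in> {w. eta w \<in> torus}"
    by simp
qed

lemma good_xi_one6: "v1 one6 \<in> {v\<in>V1. good (xi v)}"
  using good_one6(1) by (auto simp: V1_def)

lemma partial_sigma: "partial_map V1 V2 sigma"
  by (rule partial_mapI[OF open_dom_sigma regular_map_compose[OF regular_v2 regular_eta_dom_sigma]])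
    (simp add: sigma_def)

lemma open_dom_sigma_inv: "open_in V2 {w\<in>V2. xi w \<in> torus \<and> good (xi w)}" (is "open_in V2 ?R")
  and regular_xi_dom_sigma_inv: "regular_map {w\<in>V2. xi w \<in> torus \<and> good (xi w)} torus xi"
proof -
  let ?S = "{w\<in>V2. w \<in> {w. xi w \<in> torus}}"
  have "regular_map V2 UNIV (\<lambda>w. w)"
    by (rule regular_map_id) simp
  then have S: "open_in V2 ?S"
    by (rule open_in_preimage[OF _ xi_regular(1)])
  have xi: "regular_map ?S torus xi"
    by (rule regular_map_subset[OF xi_regular(2)]) auto
  then show "regular_map ?R torus xi"
    by (rule regular_map_subset) auto
  from open_in_trans[OF S open_in_preimage[OF xi open_good]] show "open_in V2 ?R"
    by (simp add: conj_assoc)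
qed

lemma partial_sigma_inv: "partial_map V2 V1 sigma_inv"
  by (rule partial_mapI[OF open_dom_sigma_inv regular_map_compose[OF regular_v1 regular_xi_dom_sigma_inv]])
    (simp add: sigma_inv_def)

lemma birational_sigma: "birational_pair V1 V2 sigma sigma_inv"
proof -
  note one = sigma_v1(1,2)[OF good_one6(1)]
  then have "dom sigma \<noteq> {}" "dom sigma_inv \<noteq> {}"
    by blast+
  moreover have "rat_eq V1 (sigma_inv \<circ>\<^sub>m sigma) Some"
    unfolding rat_eq_iff[OF irreducible_V1]
  proof (rule eventually_V1I)
    show "\<forall>\<^sub>F x in generic torus. v1 x \<in> dom (sigma_inv \<circ>\<^sub>m sigma) \<and> (sigma_inv \<circ>\<^sub>m sigma) (v1 x) = Some (v1 x)"
      using eventually_good by eventually_elim (auto simp: sigma_v1(1,2))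
  qed
  moreover have "rat_eq V2 (sigma \<circ>\<^sub>m sigma_inv) Some"
    unfolding rat_eq_iff[OF irreducible_V2]
  proof (rule eventually_genericI[OF irreducible_V2 open_dom_sigma_inv])
    let ?w = "v2 (eta (v1 one6))"
    have "?w \<in> dom sigma_inv"
      using one by blast
    then show "?w \<in> {w\<in>V2. xi w \<in> torus \<and> good (xi w)}"
      by (auto simp: sigma_inv_def split: if_splits)
    fix w assume "w \<in> {w\<in>V2. xi w \<in> torus \<and> good (xi w)}"
    then obtain y where "y \<in> torus" "w = v2 y" "xi (v2 y) \<in> torus" "good (xi (v2 y))"
      by (auto simp: V2_def)
    then show "w \<in> dom (sigma \<circ>\<^sub>m sigma_inv) \<and> (sigma \<circ>\<^sub>m sigma_inv) w = Some w"
      by (auto simp: sigma_inv_v2)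
  qed
  ultimately show ?thesis
    using partial_sigma partial_sigma_inv
    by (simp add: birational_pair_def rational_map_iff[OF irreducible_V1] rational_map_iff[OF irreducible_V2])
qed

lemma is_sigma_bar_sigma: "is_sigma_bar sigma"
proof -
  let ?S = "{v\<in>V1. good (xi v)}"
  define a where "a v = (if v \<in> ?S then Some (1 / scale2 v) else None)" for v
  have S: "v \<in> ?S \<Longrightarrow> v1 (xi v) = v" for v
    by (simp add: V1_xi)
  have k: "scale2 v \<noteq> 0" "sigma v = Some ((1 / scale2 v) *s v)" if "v \<in> ?S" for v
    using sigma_v1[of "xi v"] S[OF that] that by auto
  \<comment> \<open>The factor 1 / \<open>scale2 v\<close> written out; this quotient is regular
    because Z1 does not vanish where \<open>scale2\<close> does not.\<close>
  have "regular_map ?S UNIV (\<lambda>v. eta v $ 2 * eta v $ 4 / v $ Z1)"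
  proof (intro regular_map_complexI regular_fun_divide regular_fun_mult regular_fun_vec
      regular_map_vecD[OF regular_eta_dom_sigma])
    show "v $ Z1 \<noteq> 0" if "v \<in> ?S" for v
      using k(1)[OF that] by (auto simp: scale2_def)
  qed simp
  then have "partial_map V1 UNIV a"
    by (rule partial_mapI[OF open_dom_sigma]) (simp add: a_def scale2_def eta_def)
  moreover have "a (v1 one6) \<noteq> None"
    using good_xi_one6 by (simp add: a_def)
  then have "dom a \<noteq> {}"
    by blast
  moreover have "\<not> rat_eq V1 a (\<lambda>_. Some 0)"
  proof
    assume "rat_eq V1 a (\<lambda>_. Some 0)"
    then have "\<forall>\<^sub>F v in generic V1. v \<in> dom a \<and> a v = Some 0"
      by (simp add: rat_eq_iff[OF irreducible_V1])
    then obtain v where "v \<in> ?S" "v \<in> dom a \<and> a v = Some 0"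
      by (rule eventually_generic_meets_open[OF irreducible_V1 _ open_dom_sigma]) (use good_xi_one6 in blast)+
    then show False
      using k(1)[of v] by (simp add: a_def)
  qed
  moreover have "rat_eq V1 sigma (\<lambda>v. map_option (\<lambda>t. t *s v) (a v))"
    unfolding rat_eq_iff[OF irreducible_V1]
    by (rule eventually_genericI[OF irreducible_V1 open_dom_sigma good_xi_one6]) (auto simp: a_def k)
  ultimately show ?thesis
    unfolding is_sigma_bar_def using birational_sigma
    by (auto simp: rational_map_iff[OF irreducible_V1])
qed

text \<open>A value of \<open>\<sigma>\<close> is both a multiple of \<open>v1 x\<close> and a point
  \<open>v2 y\<close>. The multiple is nonzero since Emp does not vanish on \<open>V2\<close>, and
  \<open>eta\<close> ignores scaling, so y has to be \<open>eta (v1 x)\<close>.\<close>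

lemma sigma_bar_generic:
  assumes "is_sigma_bar \<sigma>"
  shows "\<forall>\<^sub>F x in generic torus. \<sigma> (v1 x) = Some (v2 (eta (v1 x)))"
proof -
  obtain a where "rational_map V1 V2 \<sigma>" and a: "rat_eq V1 \<sigma> (\<lambda>v. map_option (\<lambda>t. t *s v) (a v))"
    using assms by (auto simp: is_sigma_bar_def birational_pair_def)
  then have V2: "the (\<sigma> v) \<in> V2" if "v \<in> dom \<sigma>" for v
    using that by (auto simp: rational_map_def dest: regular_map_image)
  from a have "\<forall>\<^sub>F v in generic V1. v \<in> dom \<sigma> \<and> \<sigma> v = map_option (\<lambda>t. t *s v) (a v)"
    by (simp add: rat_eq_iff[OF irreducible_V1])
  then have "\<forall>\<^sub>F x in generic torus. v1 x \<in> dom \<sigma> \<and> \<sigma> (v1 x) = map_option (\<lambda>t. t *s v1 x) (a (v1 x))"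
    by (rule eventually_V1D)
  then show ?thesis
  proof eventually_elim
    case (elim x)
    then obtain t where t: "\<sigma> (v1 x) = Some (t *s v1 x)"
      by (cases "a (v1 x)") auto
    then obtain y where y: "y \<in> torus" "t *s v1 x = v2 y"
      using V2[of "v1 x"] elim by (auto simp: V2_def)
    have "t \<noteq> 0"
    proof
      assume "t = 0"
      then have "v2 y = 0"
        using y(2) by simp
      moreover have "v2 y $ Emp \<noteq> 0"
        using y(1) by (elim torus6E) (simp add: v2_nth)
      ultimately show False
        by simp
    qed
    then have "v1 x = (1 / t) *s v2 y"
      using y(2) by (metis nonzero_eq_divide_eq vector_smult_assoc vector_smult_lid)
    then have "eta (v1 x) = y"
      using eta_v2(1)[OF y(1), of "1 / t"] \<open>t \<noteq> 0\<close> by simp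
    then show ?case
      using t y(2) by simp
  qed
qed

section \<open>The action of 0 on the second variety, and its transport to the first\<close>

lemma regular_e0_V2:
  "regular_map (Cstar \<times> V2) V2 (\<lambda>p. v2 (tup6 (fst p * eta (snd p) $ 0) (eta (snd p) $ 1) (eta (snd p) $ 2)
     (eta (snd p) $ 3) (eta (snd p) $ 4) (eta (snd p) $ 5)))"
proof (rule regular_map_compose[OF regular_v2], rule regular_map_vecI)
  have "regular_map (Cstar \<times> V2) torus (\<lambda>p. eta (snd p))"
    by (rule regular_map_compose[OF regular_eta regular_map_snd[of _ Cstar]]) simp
  note e = regular_map_vecD[OF this]
  have "\<forall>i. regular_fun (Cstar \<times> V2) (\<lambda>p. tup6 (fst p * eta (snd p) $ 0) (eta (snd p) $ 1) (eta (snd p) $ 2)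
     (eta (snd p) $ 3) (eta (snd p) $ 4) (eta (snd p) $ 5) $ i)"
    unfolding forall_6 tup6_nth by (intro conjI regular_fun_mult regular_fun_fst e)
  then show "regular_fun (Cstar \<times> V2) (\<lambda>p. tup6 (fst p * eta (snd p) $ 0) (eta (snd p) $ 1) (eta (snd p) $ 2)
     (eta (snd p) $ 3) (eta (snd p) $ 4) (eta (snd p) $ 5) $ i)" for i
    by blast
qed (use V2_eta(1)[unfolded mem_torus_vec] in auto)

lemma e0_V2_v2:
  "y \<in> torus \<Longrightarrow> e0_V2 c (v2 y) =
     (if c = 0 then None else Some (v2 (tup6 (c * y $ 0) (y $ 1) (y $ 2) (y $ 3) (y $ 4) (y $ 5))))"
  by (simp add: e0_V2_def map_in_coords_v2 app6_def mem_torus_vec[of y])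

lemma partial_e0_V2: "partial_map (Cstar \<times> V2) V2 (\<lambda>(c, w). e0_V2 c w)"
proof (rule partial_map_total[OF regular_e0_V2])
  show "(case p of (c, w) \<Rightarrow> e0_V2 c w) = Some (v2 (tup6 (fst p * eta (snd p) $ 0) (eta (snd p) $ 1) (eta (snd p) $ 2)
     (eta (snd p) $ 3) (eta (snd p) $ 4) (eta (snd p) $ 5)))" if "p \<in> Cstar \<times> V2" for p
  proof -
    from that obtain c y where "p = (c, v2 y)" "c \<noteq> 0" "y \<in> torus"
      by (auto simp: V2_def)
    then show ?thesis
      by (simp add: e0_V2_v2)
  qed
  show "dom (\<lambda>(c, w). e0_V2 c w) \<subseteq> Cstar \<times> V2"
  proof
    fix p assume "p \<in> dom (\<lambda>(c, w). e0_V2 c w)"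
    then have p: "e0_V2 (fst p) (snd p) \<noteq> None"
      by (auto simp: domIff split: prod.splits)
    then have "snd p \<in> v2 ` torus"
      unfolding e0_V2_def using map_in_coords_outside by metis
    with p show "p \<in> Cstar \<times> V2"
      by (auto simp: V2_def mem_Times_iff e0_V2_v2)
  qed
qed

locale sigma_bar =
  fixes \<sigma> \<tau> :: "wmod \<rightharpoonup> wmod"
  assumes sigma_bar: "is_sigma_bar \<sigma>" and birational: "birational_pair V1 V2 \<sigma> \<tau>"
begin

lemma partial_maps: "partial_map V1 V2 \<sigma>" "partial_map V2 V1 \<tau>"
  using birational by (simp_all add: birational_pair_def rational_map_iff[OF irreducible_V1] rational_map_iff[OF irreducible_V2])

lemma sigma_generic: "\<forall>\<^sub>F x in generic torus. \<sigma> (v1 x) = Some (v2 (eta (v1 x)))"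
  by (rule sigma_bar_generic[OF sigma_bar])

lemma tau_generic: "\<forall>\<^sub>F x in generic torus. \<tau> (v2 (eta (v1 x))) = Some (v1 x)"
proof -
  have "\<forall>\<^sub>F v in generic V1. v \<in> dom (\<tau> \<circ>\<^sub>m \<sigma>) \<and> (\<tau> \<circ>\<^sub>m \<sigma>) v = Some v"
    using birational by (simp add: birational_pair_def rat_eq_iff[OF irreducible_V1])
  then have "\<forall>\<^sub>F x in generic torus. v1 x \<in> dom (\<tau> \<circ>\<^sub>m \<sigma>) \<and> (\<tau> \<circ>\<^sub>m \<sigma>) (v1 x) = Some (v1 x)"
    by (rule eventually_V1D)
  with sigma_generic show ?thesis
    by eventually_elim simp
qed

text \<open>\<open>\<tau>\<close> is evaluated at the moved point, so its generic value can be used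
  only because \<open>act0\<close> is dominant.\<close>

lemma e0_generic:
  "\<forall>\<^sub>F q in generic torus. (\<tau> \<circ>\<^sub>m e0_V2 (fst q) \<circ>\<^sub>m \<sigma>) (v1 (snd q)) = Some (v1 (act0 (fst q) (snd q)))"
proof -
  have act0: "\<forall>\<^sub>F q in generic torus. act0 (fst q) (snd q) \<in> torus"
    "filterlim (\<lambda>q. act0 (fst q) (snd q)) (generic torus) (generic torus)"
    using act_dominant_T2[of 0] by simp_all
  have "\<forall>\<^sub>F q in generic torus. \<tau> (v2 (eta (v1 (act0 (fst q) (snd q))))) = Some (v1 (act0 (fst q) (snd q)))"
    using act0(2) tau_generic unfolding filterlim_iff by blast
  with act0(1) eventually_snd[OF sigma_generic] eventually_snd[OF eventually_good]
    eventually_in_generic[OF irreducible_T2]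
  show ?thesis
  proof eventually_elim
    case (elim q)
    then have "eta (v1 (snd q)) \<in> torus" "fst q \<noteq> 0"
      by (auto simp: good_def mem_torus_prod)
    with elim act0_good(2)[of "snd q" "fst q"] show ?case
      by (simp add: e0_V2_v2)
  qed
qed

lemma partial_e0: "partial_map (Cstar \<times> V1) V1 (\<lambda>(c, v). (\<tau> \<circ>\<^sub>m e0_V2 c \<circ>\<^sub>m \<sigma>) v)"
proof -
  let ?lift = "\<lambda>(c, v). if c = 0 then None else map_option (Pair c) (\<sigma> v)"
  have zero: "e0_V2 0 w = None" for w
    using e0_V2_v2[of _ 0] map_in_coords_outside[of w v2] by (cases "w \<in> v2 ` torus") (auto simp: e0_V2_def)
  have "(\<lambda>(c, v). (\<tau> \<circ>\<^sub>m e0_V2 c \<circ>\<^sub>m \<sigma>) v) = \<tau> \<circ>\<^sub>m (\<lambda>(c, w). e0_V2 c w) \<circ>\<^sub>m ?lift"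
    by (auto simp: fun_eq_iff map_comp_def zero split: option.splits)
  then show ?thesis
    using partial_map_compose[OF partial_map_Pair[OF partial_maps(1)]
        partial_map_compose[OF partial_e0_V2 partial_maps(2)]]
    by (simp only:)
qed

lemma regular_gam_eps_V2:
  "regular_fun torus (app6 (\<lambda>y0 y1 y2 y3 y4 y5. y0^2 / (y1 * y3 * y5)))"
  "regular_fun torus (app6 (\<lambda>y0 y1 y2 y3 y4 y5. y1 * y3 / y0))"
  unfolding app6_def[abs_def] by (intro regular_intros; simp add: mem_torus_vec)+

lemma partial_gamma0: "partial_map V1 UNIV (gamma0_V2 \<circ>\<^sub>m \<sigma>)" and partial_eps0: "partial_map V1 UNIV (eps0_V2 \<circ>\<^sub>m \<sigma>)"
  unfolding gamma0_V2_def eps0_V2_def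
  by (intro partial_map_compose[OF partial_maps(1)] partial_map_fun_in_coords_v2 regular_gam_eps_V2)+

lemma gamma0_generic: "\<forall>\<^sub>F x in generic torus. (gamma0_V2 \<circ>\<^sub>m \<sigma>) (v1 x) = Some (gam 0 x)"
  and eps0_generic: "\<forall>\<^sub>F x in generic torus. (eps0_V2 \<circ>\<^sub>m \<sigma>) (v1 x) = Some (eps 0 x)"
  using sigma_generic eventually_good unfolding gamma0_V2_def eps0_V2_def
  by (eventually_elim; simp add: good_def fun_in_coords_v2 gam0_eta eps0_eta)+

lemma chi_simps:
  "e_chi \<sigma> \<tau> 0 c = \<tau> \<circ>\<^sub>m e0_V2 c \<circ>\<^sub>m \<sigma>" "e_chi \<sigma> \<tau> 1 c = ee 1 c" "e_chi \<sigma> \<tau> 2 c = ee 2 c"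
  "gamma_chi \<sigma> 0 = gamma0_V2 \<circ>\<^sub>m \<sigma>" "gamma_chi \<sigma> 1 = fun_in_coords v1 (gam 1)"
  "gamma_chi \<sigma> 2 = fun_in_coords v1 (gam 2)"
  "eps_chi \<sigma> 0 = eps0_V2 \<circ>\<^sub>m \<sigma>" "eps_chi \<sigma> 1 = fun_in_coords v1 (eps 1)"
  "eps_chi \<sigma> 2 = fun_in_coords v1 (eps 2)"
  by (simp_all add: e_chi_def gamma_chi_def eps_chi_def e1_V1_eq e2_V1_eq fun_V1_eq)

lemma ee_generic:
  assumes "i \<in> {0, 1, 2}"
  shows "\<forall>\<^sub>F q in generic torus. ee i (fst q) (v1 (snd q)) = Some (v1 (act i (fst q) (snd q)))"
  using act_dominant_T2(1)[OF assms] eventually_in_generic[OF irreducible_T2]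
  by eventually_elim (simp add: ee_def map_in_coords_v1 mem_torus_prod)

lemma fun_in_coords_generic: "\<forall>\<^sub>F x in generic torus. fun_in_coords v1 g (v1 x) = Some (g x)"
  using eventually_in_generic[OF irreducible_T1] by eventually_elim (rule fun_in_coords_v1)

sublocale coordinate_crystal "e_chi \<sigma> \<tau>" "gamma_chi \<sigma>" "eps_chi \<sigma>"
proof
  fix i :: nat assume i: "i \<in> {0, 1, 2}"
  then consider "i = 0" | "i = 1" | "i = 2"
    by auto
  note cases = this
  show "partial_map (Cstar \<times> V1) V1 (\<lambda>(c, v). e_chi \<sigma> \<tau> i c v)"
    using cases partial_e0 partial_map_ee[of 1] partial_map_ee[of 2] by cases (simp_all only: chi_simps insert_iff simp_thms)
  show "partial_map V1 UNIV (gamma_chi \<sigma> i)"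
    using cases partial_gamma0 regular_gam_eps(1)[OF i]
    by cases (simp_all only: chi_simps partial_map_fun_in_coords_v1)
  show "partial_map V1 UNIV (eps_chi \<sigma> i)"
    using cases partial_eps0 regular_gam_eps(2)[OF i]
    by cases (simp_all only: chi_simps partial_map_fun_in_coords_v1)
  show "\<forall>\<^sub>F x in generic torus. gamma_chi \<sigma> i (v1 x) = Some (gam i x)"
    using cases gamma0_generic fun_in_coords_generic by cases (simp_all only: chi_simps)
  show "\<forall>\<^sub>F x in generic torus. eps_chi \<sigma> i (v1 x) = Some (eps i x)"
    using cases eps0_generic fun_in_coords_generic by cases (simp_all only: chi_simps)
next
  have "\<forall>\<^sub>F q in generic torus. e_chi \<sigma> \<tau> i (fst q) (v1 (snd q)) = Some (v1 (act i (fst q) (snd q)))"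
    if "i = 0 \<or> i = 1 \<or> i = 2" for i
    using that e0_generic ee_generic[of 1] ee_generic[of 2]
    by (elim disjE) (simp_all only: chi_simps act_simps insert_iff simp_thms)
  then show "agrees (e_chi \<sigma> \<tau>)"
    by (simp add: agrees_def del: One_nat_def)
qed

lemma explicit_fun:
  assumes "\<forall>\<^sub>F x in generic torus. f (v1 x) = Some (g x)"
  shows "rat_eq V1 f (fun_in_coords v1 g)"
  unfolding rat_eq_iff[OF irreducible_V1]
proof (rule eventually_V1I)
  show "\<forall>\<^sub>F x in generic torus. v1 x \<in> dom f \<and> f (v1 x) = fun_in_coords v1 g (v1 x)"
    using assms fun_in_coords_generic[of g] by eventually_elim auto
qed

end

text \<open>The claims are made for every representative \<open>\<sigma>\<close> and every inverse
  \<open>\<tau>\<close>. The first conjunct shows that such pairs exist, since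
  \<open>is_sigma_bar\<close> includes a birational inverse.\<close>

theorem theorem5p3:
  shows "(\<exists>\<sigma>. is_sigma_bar \<sigma>) \<and>
    (\<forall>\<sigma> \<tau>. is_sigma_bar \<sigma> \<and> birational_pair V1 V2 \<sigma> \<tau> \<longrightarrow>
       geometric_crystal {0, 1, 2} cartan V1 (e_chi \<sigma> \<tau>) (gamma_chi \<sigma>) (eps_chi \<sigma>) \<and>
       positive_structure {0, 1, 2} V1 (e_chi \<sigma> \<tau>) (gamma_chi \<sigma>) (eps_chi \<sigma>) param1 \<and>
       rat_eq (Cstar \<times> V1) (\<lambda>(c, v). e_chi \<sigma> \<tau> 0 c v) (\<lambda>(c, v). e0_explicit c v) \<and>
       rat_eq V1 (eps_chi \<sigma> 0) eps0_explicit \<and>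
       rat_eq V1 (gamma_chi \<sigma> 0) gamma0_explicit)"
proof (intro conjI allI impI)
  show "\<exists>\<sigma>. is_sigma_bar \<sigma>"
    using is_sigma_bar_sigma by blast
  fix \<sigma> \<tau> assume "is_sigma_bar \<sigma> \<and> birational_pair V1 V2 \<sigma> \<tau>"
  then interpret sigma_bar \<sigma> \<tau>
    by unfold_locales simp_all
  show "geometric_crystal {0, 1, 2} cartan V1 (e_chi \<sigma> \<tau>) (gamma_chi \<sigma>) (eps_chi \<sigma>)"
    by (rule crystal)
  show "positive_structure {0, 1, 2} V1 (e_chi \<sigma> \<tau>) (gamma_chi \<sigma>) (eps_chi \<sigma>) param1"
    by (rule positive)
  show "rat_eq (Cstar \<times> V1) (\<lambda>(c, v). e_chi \<sigma> \<tau> 0 c v) (\<lambda>(c, v). e0_explicit c v)"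
    using rat_eq_ee(1)[of 0] by (simp add: e0_explicit_eq)
  show "rat_eq V1 (eps_chi \<sigma> 0) eps0_explicit" "rat_eq V1 (gamma_chi \<sigma> 0) gamma0_explicit"
    unfolding fun_V1_eq using agrees_\<epsilon>[of 0] agrees_\<gamma>[of 0] by (simp_all add: explicit_fun)
qed

end
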